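(* Let $n\ge 1$ be an integer, $\sigma\ge 1$ and $0\le \sigma_1<\sigma/2<\sigma_2\le\sigma$ be real numbers. Assume that the real number $m$ satisfies $$m>\max\left\{1,\frac{\sqrt{(n+4\sigma_1)^2+16n(\sigma-\sigma_1)}-n-4\sigma_1}{4(\sigma-\sigma_1)}\right\}$$ together with $m\le 2$ if $\sigma_1=0$, and $m<\frac{2n}{n+4\sigma_1}$ if $\sigma_1>0$. Assume moreover that the exponent $p$ satisfies one of the following: (i) $n\le 2\sigma$ and $1+\frac{2m\sigma}{n-2m\sigma_1}\le p<\infty$; or (ii) $2\sigma<n<\frac{4\sigma}{2-m}$ and $1+\frac{2m\sigma}{n-2m\sigma_1}\le p\le \frac{n}{n-2\sigma}$. Let $(u_0,u_1)\in\mathcal{D}_\sigma^m$. Then there exists a constant $\varepsilon_0>0$ such that for any $\varepsilon\in(0,\varepsilon_0]$ the Cauchy problem $$\begin{cases} u_{tt}+(-\Delta)^\sigma u+(-\Delta)^{\sigma_1}u_t+(-\Delta)^{\sigma_2}u_t=|u|^p, & x\in\mathbb{R}^n,\ t>0,\\ u(0,x)=\varepsilon u_0(x),\quad u_t(0,x)=\varepsilon u_1(x), & x\in\mathbb{R}^n,\end{cases}$$ admits a unique global (in time) solution $u\in\mathcal{C}([0,\infty),H^\sigma)$. Furthermore, the following estimates hold for all $t\ge 0$: $$\|u(t,\cdot)\|_{L^2}\lesssim (1+t)^{-\frac{n}{2(\sigma-\sigma_1)}\left(\frac1m-\frac12\right)+\frac{\sigma_1}{\sigma-\sigma_1}}\|(u_0,u_1)\|_{\mathcal{D}_\sigma^m},$$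 $$\||D|^\sigma u(t,\cdot)\|_{L^2}\lesssim (1+t)^{-\frac{n}{2(\sigma-\sigma_1)}\left(\frac1m-\frac12\right)-\frac{\sigma-2\sigma_1}{2(\sigma-\sigma_1)}}\|(u_0,u_1)\|_{\mathcal{D}_\sigma^m}.$$
   Context: All functions are on $\mathbb{R}^n$; $H^a$ ($a\ge0$) is the $L^2$-based Bessel potential space on $\mathbb{R}^n$. The fractional Laplacian is $(-\Delta)^{a}\psi=\mathfrak{F}^{-1}(|\xi|^{2a}\mathfrak{F}(\psi)(\xi))$, with $\mathfrak{F}$ the Fourier transform in $x$, and $|D|^a$ is the operator with symbol $|\xi|^a$. If $m=2$, the quantity $\frac{4\sigma}{2-m}$ is read as $+\infty$. The notation $f\lesssim g$ means $f\le Cg$ for some constant $C>0$ (independent of $t$, $\varepsilon$ and the data). The data space is $\mathcal{D}_\sigma^m=(H^\sigma\cap L^m)\times(L^2\cap L^m)$ with norm $\|(\phi_0,\phi_1)\|_{\mathcal{D}_\sigma^m}=\|\phi_0\|_{H^\sigma}+\|\phi_0\|_{L^m}+\|\phi_1\|_{L^2}+\|\phi_1\|_{L^m}$. Solutions are understood via Duhamel's formula: $$u(t,x)=\varepsilon K_0(t,x)*_x u_0(x)+\varepsilon K_1(t,x)*_x u_1(x)+\int_0^t K_1(t-\tau,x)*_x|u(\tau,x)|^p\,d\tau,$$ where the kernels are defined by their Fourier transforms in $x$, $$\widehat{K_0}(t,\xi)=\frac{\lambda_1e^{\lambda_2t}-\lambda_2e^{\lambda_1t}}{\lambda_1-\lambda_2},\qquad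 \widehat{K_1}(t,\xi)=\frac{e^{\lambda_1t}-e^{\lambda_2t}}{\lambda_1-\lambda_2},$$ and $\lambda_{1,2}=\lambda_{1,2}(|\xi|)$ are the two (real or complex conjugate) roots $\lambda_{1,2}=\frac12\big(-|\xi|^{2\sigma_1}-|\xi|^{2\sigma_2}\pm\sqrt{(|\xi|^{2\sigma_1}+|\xi|^{2\sigma_2})^2-4|\xi|^{2\sigma}}\big)$ (the quotients being understood as limits where $\lambda_1=\lambda_2$). *)

theory Defs
  imports "HOL-Analysis.Analysis"
begin

section \<open>The Hilbert space of square-integrable functions\<close>

definition square_integrable :: "('a::euclidean_space \<Rightarrow> complex) \<Rightarrow> bool" where
  "square_integrable f \<longleftrightarrow>
     f \<in> borel_measurable lborel \<and> integrable lborel (\<lambda>x. (cmod (f x))\<^sup>2)"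

lemma square_integrable_0: "square_integrable (\<lambda>_. 0)"
  by (simp add: square_integrable_def)

lemma square_integrable_add:
  assumes "square_integrable f" "square_integrable g"
  shows "square_integrable (\<lambda>x. f x + g x)"
proof -
  have [measurable]: "f \<in> borel_measurable borel" "g \<in> borel_measurable borel"
    using assms by (auto simp: square_integrable_def)
  have "integrable lborel (\<lambda>x. 2 * (cmod (f x))\<^sup>2 + 2 * (cmod (g x))\<^sup>2)"
    using assms by (auto simp: square_integrable_def)
  then have "integrable lborel (\<lambda>x. (cmod (f x + g x))\<^sup>2)"
  proof (rule Bochner_Integration.integrable_bound, measurable, intro AE_I2)
    fix x
    have "(cmod (f x + g x))\<^sup>2 \<le> (cmod (f x) + cmod (g x))\<^sup>2"
      by (intro power_mono norm_triangle_ineq) auto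
    also have "\<dots> \<le> 2 * (cmod (f x))\<^sup>2 + 2 * (cmod (g x))\<^sup>2"
      using sum_squares_bound[of "cmod (f x)" "cmod (g x)"] by (simp add: power2_sum)
    finally show "norm ((cmod (f x + g x))\<^sup>2) \<le> norm (2 * (cmod (f x))\<^sup>2 + 2 * (cmod (g x))\<^sup>2)"
      by simp
  qed
  then show ?thesis by (simp add: square_integrable_def)
qed

lemma square_integrable_scaleR:
  "square_integrable f \<Longrightarrow> square_integrable (\<lambda>x. c *\<^sub>R f x)"
  by (auto simp: square_integrable_def power_mult_distrib
      intro!: borel_measurable_scaleR borel_measurable_const)

lemma square_integrable_uminus:
  "square_integrable f \<Longrightarrow> square_integrable (\<lambda>x. - f x)"
  by (simp add: square_integrable_def)

lemma square_integrable_diff: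
  "square_integrable f \<Longrightarrow> square_integrable g \<Longrightarrow> square_integrable (\<lambda>x. f x - g x)"
  using square_integrable_add[of f "\<lambda>x. - g x"] square_integrable_uminus[of g] by simp

lemma square_integrable_inner:
  assumes "square_integrable f" "square_integrable g"
  shows "integrable lborel (\<lambda>x. f x \<bullet> g x)"
proof -
  have [measurable]: "f \<in> borel_measurable borel" "g \<in> borel_measurable borel"
    using assms by (auto simp: square_integrable_def)
  have "integrable lborel (\<lambda>x. (cmod (f x))\<^sup>2 + (cmod (g x))\<^sup>2)"
    using assms by (auto simp: square_integrable_def)
  then show ?thesis
  proof (rule Bochner_Integration.integrable_bound, measurable, intro AE_I2)
    fix x
    have "\<bar>f x \<bullet> g x\<bar> \<le> cmod (f x) * cmod (g x)" by (rule Cauchy_Schwarz_ineq2)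
    also have "\<dots> \<le> (cmod (f x))\<^sup>2 + (cmod (g x))\<^sup>2"
      using sum_squares_bound[of "cmod (f x)" "cmod (g x)"]
        mult_nonneg_nonneg[OF norm_ge_zero[of "f x"] norm_ge_zero[of "g x"]] by linarith
    finally show "norm (f x \<bullet> g x) \<le> norm ((cmod (f x))\<^sup>2 + (cmod (g x))\<^sup>2)" by simp
  qed
qed

definition L2_rel :: "('a::euclidean_space \<Rightarrow> complex) \<Rightarrow> ('a \<Rightarrow> complex) \<Rightarrow> bool" where
  "L2_rel f g \<longleftrightarrow>
     square_integrable f \<and> square_integrable g \<and> (AE x in lborel. f x = g x)"

lemma L2_rel_part_equivp: "part_equivp L2_rel"
proof (rule part_equivpI)
  show "\<exists>f. L2_rel f f"
    using square_integrable_0 by (auto simp: L2_rel_def)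
  show "symp L2_rel" by (auto simp: symp_def L2_rel_def)
  show "transp L2_rel" unfolding transp_def L2_rel_def by (auto elim: AE_mp)
qed

text \<open>Elements of the type \<open>'a L2\<close> are classes of square-integrable functions modulo equality
  almost everywhere; \<open>rep_L2\<close> picks some representative. Everything below that is defined
  through \<open>rep_L2\<close> is independent of this choice.\<close>

quotient_type (overloaded) 'a L2 = "'a::euclidean_space \<Rightarrow> complex" / partial: L2_rel
  morphisms rep_L2 abs_L2
  by (rule L2_rel_part_equivp)

instantiation L2 :: (euclidean_space) real_inner
begin

lift_definition zero_L2 :: "'a L2" is "\<lambda>_. 0"
  using square_integrable_0 by (auto simp: L2_rel_def)

lift_definition plus_L2 :: "'a L2 \<Rightarrow> 'a L2 \<Rightarrow> 'a L2" is "\<lambda>f g x. f x + g x"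
  by (auto simp: L2_rel_def square_integrable_add)

lift_definition minus_L2 :: "'a L2 \<Rightarrow> 'a L2 \<Rightarrow> 'a L2" is "\<lambda>f g x. f x - g x"
  by (auto simp: L2_rel_def square_integrable_diff)

lift_definition uminus_L2 :: "'a L2 \<Rightarrow> 'a L2" is "\<lambda>f x. - f x"
  by (auto simp: L2_rel_def square_integrable_uminus)

lift_definition scaleR_L2 :: "real \<Rightarrow> 'a L2 \<Rightarrow> 'a L2" is "\<lambda>c f x. c *\<^sub>R f x"
  by (auto simp: L2_rel_def square_integrable_scaleR)

lift_definition inner_L2 :: "'a L2 \<Rightarrow> 'a L2 \<Rightarrow> real" is
  "\<lambda>f g. \<integral>x. f x \<bullet> g x \<partial>lborel"
  apply (rule integral_cong_AE)
  by (auto simp: L2_rel_def square_integrable_def)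

lift_definition norm_L2 :: "'a L2 \<Rightarrow> real" is
  "\<lambda>f. sqrt (\<integral>x. (cmod (f x))\<^sup>2 \<partial>lborel)"
  apply (subst real_sqrt_eq_iff, rule integral_cong_AE)
  by (auto simp: L2_rel_def square_integrable_def)

definition dist_L2 :: "'a L2 \<Rightarrow> 'a L2 \<Rightarrow> real" where
  "dist_L2 u v = norm (u - v)"

definition sgn_L2 :: "'a L2 \<Rightarrow> 'a L2" where
  "sgn_L2 u = scaleR (inverse (norm u)) u"

definition uniformity_L2 :: "('a L2 \<times> 'a L2) filter" where
  "uniformity_L2 = (INF e\<in>{0<..}. principal {(u, v). dist u v < e})"

definition open_L2 :: "'a L2 set \<Rightarrow> bool" where
  "open_L2 U = (\<forall>u\<in>U. \<forall>\<^sub>F (u', v) in uniformity. u' = u \<longrightarrow> v \<in> U)"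

instance
proof
  fix u v w :: "'a L2" and a b :: real
  show "u + v + w = u + (v + w)"
    by transfer (auto simp: L2_rel_def add.assoc intro!: square_integrable_add)
  show "u + v = v + u"
    by transfer (auto simp: L2_rel_def add.commute intro!: square_integrable_add)
  show "0 + u = u"
    by transfer (auto simp: L2_rel_def)
  show "- u + u = 0"
    by transfer (auto simp: L2_rel_def square_integrable_0)
  show "u - v = u + - v"
    by transfer (auto simp: L2_rel_def square_integrable_diff)
  show "a *\<^sub>R (u + v) = a *\<^sub>R u + a *\<^sub>R v"
    by transfer (auto simp: L2_rel_def scaleR_add_right
        intro!: square_integrable_add square_integrable_scaleR)
  show "(a + b) *\<^sub>R u = a *\<^sub>R u + b *\<^sub>R u"
    by transfer (auto simp: L2_rel_def scaleR_add_left
        intro!: square_integrable_add square_integrable_scaleR)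
  show "a *\<^sub>R b *\<^sub>R u = (a * b) *\<^sub>R u"
    by transfer (auto simp: L2_rel_def intro!: square_integrable_scaleR simp flip: scaleR_scaleR)
  show "1 *\<^sub>R u = u"
    by transfer (auto simp: L2_rel_def)
  show "dist u v = norm (u - v)" by (rule dist_L2_def)
  show "sgn u = scaleR (inverse (norm u)) u" by (rule sgn_L2_def)
  show "uniformity = (INF e\<in>{0<..}. principal {(u :: 'a L2, v). dist u v < e})"
    by (rule uniformity_L2_def)
  show "open U = (\<forall>u\<in>U. \<forall>\<^sub>F (u', v) in uniformity. u' = u \<longrightarrow> v \<in> U)" for U :: "'a L2 set"
    by (rule open_L2_def)
  show "u \<bullet> v = v \<bullet> u"
    by transfer (simp add: inner_commute)
  show "(u + v) \<bullet> w = u \<bullet> w + v \<bullet> w"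
    by transfer (auto simp: L2_rel_def inner_add_left square_integrable_inner)
  show "a *\<^sub>R u \<bullet> v = a * (u \<bullet> v)"
    by transfer simp
  show "0 \<le> u \<bullet> u"
    by transfer simp
  show "u \<bullet> u = 0 \<longleftrightarrow> u = 0"
  proof (transfer)
    fix f :: "'a \<Rightarrow> complex" assume "L2_rel f f"
    then have f: "square_integrable f" by (simp add: L2_rel_def)
    have "(\<integral>x. f x \<bullet> f x \<partial>lborel) = 0 \<longleftrightarrow> (AE x in lborel. f x \<bullet> f x = 0)"
      by (rule integral_nonneg_eq_0_iff_AE) (auto simp: square_integrable_inner[OF f f])
    then show "((\<integral>x. f x \<bullet> f x \<partial>lborel) = 0) = L2_rel f (\<lambda>_. 0)"
      using f by (simp add: L2_rel_def square_integrable_0)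
  qed
  show "norm u = sqrt (u \<bullet> u)"
    by transfer (simp add: power2_norm_eq_inner)
qed

end


definition to_L2 :: "('a::euclidean_space \<Rightarrow> complex) \<Rightarrow> 'a L2" where
  "to_L2 f = (if square_integrable f then abs_L2 f else 0)"


section \<open>Fourier transform and function spaces\<close>

text \<open>The limits are taken in the norm of \<open>L\<^sup>2\<close>; they exist by Plancherel's theorem. The
  normalisation of the Fourier transform \<open>F\<close> is the one for which \<open>F(K * f) = F(K) F(f)\<close> holds
  without a constant.\<close>

definition fourier :: "'a::euclidean_space L2 \<Rightarrow> 'a L2" where
  "fourier u = Lim at_top (\<lambda>R::real. to_L2 (\<lambda>\<xi>.
     LINT x:cball 0 R|lborel. exp (- (\<i> * complex_of_real (x \<bullet> \<xi>))) * rep_L2 u x))"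

definition inv_fourier :: "'a::euclidean_space L2 \<Rightarrow> 'a L2" where
  "inv_fourier v = Lim at_top (\<lambda>R::real. to_L2 (\<lambda>x. complex_of_real (1 / (2 * pi) ^ DIM('a)) *
     (LINT \<xi>:cball 0 R|lborel. exp (\<i> * complex_of_real (x \<bullet> \<xi>)) * rep_L2 v \<xi>)))"

definition in_multiplier_domain ::
  "('a::euclidean_space \<Rightarrow> complex) \<Rightarrow> 'a L2 \<Rightarrow> bool" where
  "in_multiplier_domain a u \<longleftrightarrow> square_integrable (\<lambda>\<xi>. a \<xi> * rep_L2 (fourier u) \<xi>)"

text \<open>The operator with symbol \<open>a\<close>, that is \<open>u \<mapsto> F\<^sup>-\<^sup>1 (a F u)\<close>, meaningful on its domain. The
  convolution with a kernel \<open>K\<close> given by its Fourier transform is the operator with symbol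
  \<open>F K\<close>.\<close>

definition fourier_multiplier ::
  "('a::euclidean_space \<Rightarrow> complex) \<Rightarrow> 'a L2 \<Rightarrow> 'a L2" where
  "fourier_multiplier a u = inv_fourier (to_L2 (\<lambda>\<xi>. a \<xi> * rep_L2 (fourier u) \<xi>))"

definition bessel_symbol :: "real \<Rightarrow> 'a::euclidean_space \<Rightarrow> complex" where
  "bessel_symbol s \<xi> = complex_of_real ((1 + (norm \<xi>)\<^sup>2) powr (s / 2))"

definition sobolev_space :: "real \<Rightarrow> 'a::euclidean_space L2 set" where
  "sobolev_space s = {u. in_multiplier_domain (bessel_symbol s) u}"

definition sobolev_norm :: "real \<Rightarrow> 'a::euclidean_space L2 \<Rightarrow> real" where
  "sobolev_norm s u = norm (fourier_multiplier (bessel_symbol s) u)"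

definition abs_D :: "real \<Rightarrow> 'a::euclidean_space L2 \<Rightarrow> 'a L2" where
  "abs_D a = fourier_multiplier (\<lambda>\<xi>. complex_of_real (norm \<xi> powr a))"

text \<open>\<open>L\<^sup>m\<close>, for a real exponent \<open>m\<close>, intersected with \<open>L\<^sup>2\<close>.\<close>

definition lebesgue_space :: "real \<Rightarrow> 'a::euclidean_space L2 set" where
  "lebesgue_space m = {u. integrable lborel (\<lambda>x. cmod (rep_L2 u x) powr m)}"

definition lebesgue_norm :: "real \<Rightarrow> 'a::euclidean_space L2 \<Rightarrow> real" where
  "lebesgue_norm m u = (\<integral>x. cmod (rep_L2 u x) powr m \<partial>lborel) powr (1 / m)"

definition data_space :: "real \<Rightarrow> real \<Rightarrow> ('a::euclidean_space L2 \<times> 'a L2) set" where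
  "data_space \<sigma> m = (sobolev_space \<sigma> \<inter> lebesgue_space m) \<times> lebesgue_space m"

definition data_norm :: "real \<Rightarrow> real \<Rightarrow> 'a::euclidean_space L2 \<times> 'a L2 \<Rightarrow> real" where
  "data_norm \<sigma> m = (\<lambda>(\<phi>\<^sub>0, \<phi>\<^sub>1).
     sobolev_norm \<sigma> \<phi>\<^sub>0 + lebesgue_norm m \<phi>\<^sub>0 + norm \<phi>\<^sub>1 + lebesgue_norm m \<phi>\<^sub>1)"

text \<open>\<open>u \<in> C([0,\<infinity>), H\<^sup>s)\<close>; values at negative times are irrelevant.\<close>

definition continuous_into_sobolev :: "real \<Rightarrow> (real \<Rightarrow> 'a::euclidean_space L2) \<Rightarrow> bool" where
  "continuous_into_sobolev s u \<longleftrightarrow>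
     (\<forall>t\<ge>0. u t \<in> sobolev_space s \<and>
       ((\<lambda>\<tau>. sobolev_norm s (u \<tau> - u t)) \<longlongrightarrow> 0) (at t within {0..}))"


section \<open>The Cauchy problem\<close>

context
  fixes \<sigma> \<sigma>\<^sub>1 \<sigma>\<^sub>2 :: real
begin

text \<open>Since \<open>0 powr 0 = 0\<close>, the symbol \<open>|\<xi>|\<^sup>0\<close> takes the value \<open>0\<close> instead of \<open>1\<close> at \<open>\<xi> = 0\<close>.
  This is a null set and does not affect the operators.\<close>

definition damping_symbol :: "'a::euclidean_space \<Rightarrow> real" where
  "damping_symbol \<xi> = norm \<xi> powr (2 * \<sigma>\<^sub>1) + norm \<xi> powr (2 * \<sigma>\<^sub>2)"

definition root\<^sub>1 :: "'a::euclidean_space \<Rightarrow> complex" where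
  "root\<^sub>1 \<xi> = (- complex_of_real (damping_symbol \<xi>)
     + csqrt (complex_of_real ((damping_symbol \<xi>)\<^sup>2 - 4 * norm \<xi> powr (2 * \<sigma>)))) / 2"

definition root\<^sub>2 :: "'a::euclidean_space \<Rightarrow> complex" where
  "root\<^sub>2 \<xi> = (- complex_of_real (damping_symbol \<xi>)
     - csqrt (complex_of_real ((damping_symbol \<xi>)\<^sup>2 - 4 * norm \<xi> powr (2 * \<sigma>)))) / 2"

text \<open>Where the two roots coincide, the quotients are replaced by their limits.\<close>

definition K0_hat :: "real \<Rightarrow> 'a::euclidean_space \<Rightarrow> complex" where
  "K0_hat t \<xi> = (let l\<^sub>1 = root\<^sub>1 \<xi>; l\<^sub>2 = root\<^sub>2 \<xi>; s = complex_of_real t in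
     if l\<^sub>1 = l\<^sub>2 then (1 - l\<^sub>1 * s) * exp (l\<^sub>1 * s)
     else (l\<^sub>1 * exp (l\<^sub>2 * s) - l\<^sub>2 * exp (l\<^sub>1 * s)) / (l\<^sub>1 - l\<^sub>2))"

definition K1_hat :: "real \<Rightarrow> 'a::euclidean_space \<Rightarrow> complex" where
  "K1_hat t \<xi> = (let l\<^sub>1 = root\<^sub>1 \<xi>; l\<^sub>2 = root\<^sub>2 \<xi>; s = complex_of_real t in
     if l\<^sub>1 = l\<^sub>2 then s * exp (l\<^sub>1 * s)
     else (exp (l\<^sub>1 * s) - exp (l\<^sub>2 * s)) / (l\<^sub>1 - l\<^sub>2))"

definition abs_power :: "real \<Rightarrow> ('a::euclidean_space \<Rightarrow> complex) \<Rightarrow> 'a \<Rightarrow> complex" where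
  "abs_power p f x = complex_of_real (cmod (f x) powr p)"

text \<open>Duhamel's formula in \<open>C([0,\<infinity>), H\<^sup>\<sigma>)\<close>. The time integral is the integral of a function with
  values in \<open>L\<^sup>2\<close>. That \<open>|u(t)|\<^sup>p\<close> is square-integrable, which the formula presupposes, is no
  extra restriction when \<open>H\<^sup>\<sigma>\<close> embeds into \<open>L\<^sup>2\<^sup>p\<close>.\<close>

definition global_solution ::
  "real \<Rightarrow> real \<Rightarrow> 'a::euclidean_space L2 \<Rightarrow> 'a L2 \<Rightarrow> (real \<Rightarrow> 'a L2) \<Rightarrow> bool" where
  "global_solution p \<epsilon> u\<^sub>0 u\<^sub>1 u \<longleftrightarrow>
     continuous_into_sobolev \<sigma> u \<and>
     (\<forall>t\<ge>0. square_integrable (abs_power p (rep_L2 (u t)))) \<and>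
     (\<forall>t\<ge>0. \<exists>I.
        ((\<lambda>\<tau>. fourier_multiplier (K1_hat (t - \<tau>)) (to_L2 (abs_power p (rep_L2 (u \<tau>)))))
           has_integral I) {0..t} \<and>
        u t = \<epsilon> *\<^sub>R fourier_multiplier (K0_hat t) u\<^sub>0
              + \<epsilon> *\<^sub>R fourier_multiplier (K1_hat t) u\<^sub>1 + I)"

end

end

theory Submission
  imports Defs "HOL-Probability.Characteristic_Functions"
begin

text \<open>With \<open>W = \<langle>\<xi>\<rangle>\<^sup>\<sigma> F u\<close> as the unknown, Duhamel's formula becomes a fixed-point equation in \<open>L\<^sup>2\<close>
  which is solved by contraction among functions for which \<open>\<parallel>u\<parallel>\<close> and \<open>\<parallel>|D|\<^sup>\<sigma> u\<parallel>\<close> decay at the rates of the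
  linear problem; uniqueness among all continuous solutions is a local Lipschitz argument. The kernels
  decay like \<open>exp (- c |\<xi>|\<^bsup>2(\<sigma>-\<sigma>1)\<^esup> t)\<close> at low frequencies and like \<open>exp (- c t)\<close>, up to powers, at high ones.
  Polynomial decay then comes from the smallness of \<open>F f\<close> in \<open>L\<^sup>2\<close> of small balls for \<open>f\<close> in \<open>L\<^sup>m\<close>, by summing
  over dyadic balls; this takes the place of the Hausdorff--Young inequality. The power \<open>|u|\<^sup>p\<close> is
  estimated in \<open>L\<^sup>2\<close> and \<open>L\<^sup>m\<close> by a Gagliardo--Nirenberg inequality, deduced from the Sobolev embedding by
  splitting at a frequency.\<close>

section \<open>The space L2\<close>

text \<open>One scaling governs the estimates. A solution with the linear decay rates behaves as if
  it lived at frequencies of size \<open>(1 + t) powr (- 1 / \<alpha>)\<close> with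
  \<open>\<alpha> = 2 * (\<sigma> - \<sigma>\<^sub>1)\<close>. Put into the Gagliardo--Nirenberg
  inequality, this gives the decay of \<open>|u|^p\<close>, and the lower bound on p says that in
  L^m this decay is at least \<open>(1 + t) powr - 1\<close>. At equality the estimate in L^m alone
  would lose a logarithm, so a second exponent \<mu> < m is brought in, and \<mu> p \<ge> 2 must
  still hold for Gagliardo--Nirenberg. The lower bound on m, the root of a quadratic polynomial,
  says exactly that m p > 2 at the critical p; this is the room in which \<mu> is chosen. The upper
  bound on m has another origin: at low frequencies the kernel is singular like
  \<open>|\<xi>| powr - (2 * \<sigma>\<^sub>1)\<close>, and transforms of functions in L^m must be
  small enough near the origin to absorb this. Since the Fourier transform is given as a limit in L2
  that has to be shown to exist, Plancherel's theorem is derived from the start, by Gaussian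
  regularisation.\<close>

lemma square_integrable_rep [simp, intro]: "square_integrable (rep_L2 u)"
  using Quotient_rep_reflp[OF Quotient_L2, of u] by (simp add: L2_rel_def)

lemma rep_L2_measurable [measurable]: "rep_L2 u \<in> borel_measurable borel"
  using square_integrable_rep[of u] unfolding square_integrable_def by simp

lemma integrable_rep_L2_sq: "integrable lborel (\<lambda>x. (cmod (rep_L2 u x))\<^sup>2)"
  using square_integrable_rep[of u] unfolding square_integrable_def by simp

lemma abs_rep_L2 [simp]: "abs_L2 (rep_L2 u) = u"
  by (rule Quotient_abs_rep[OF Quotient_L2])

lemma to_L2_rep [simp]: "to_L2 (rep_L2 u) = u"
  by (simp add: to_L2_def)

lemma rep_to_L2: "square_integrable f \<Longrightarrow> AE x in lborel. rep_L2 (to_L2 f) x = f x"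
  using Quotient_rep_abs[OF Quotient_L2, of f] by (simp add: to_L2_def L2_rel_def)

lemma to_L2_eqI:
  assumes "square_integrable f" "square_integrable g" "AE x in lborel. f x = g x"
  shows "to_L2 f = to_L2 g"
  using assms Quotient_rel_abs[OF Quotient_L2, of f g] by (simp add: to_L2_def L2_rel_def)

lemma square_integrable_cong_AE:
  assumes "square_integrable f" "g \<in> borel_measurable borel" "AE x in lborel. f x = g x"
  shows "square_integrable g"
proof -
  have "f \<in> borel_measurable borel" "integrable lborel (\<lambda>x. (cmod (f x))\<^sup>2)"
    using assms(1) by (auto simp: square_integrable_def)
  then have "integrable lborel (\<lambda>x. (cmod (g x))\<^sup>2)"
    using assms(2,3) by (subst integrable_cong_AE[where g="\<lambda>x. (cmod (f x))\<^sup>2"]) auto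
  then show ?thesis using assms(2) by (simp add: square_integrable_def)
qed

lemma rep_L2_0: "AE x in lborel. rep_L2 0 x = 0"
  using rep_to_L2[OF square_integrable_0] by (simp add: to_L2_def zero_L2_def square_integrable_0)

lemma to_L2_0: "to_L2 (\<lambda>_. 0) = 0"
  by (simp add: to_L2_def zero_L2_def square_integrable_0)

lemma to_L2_add:
  assumes "square_integrable f" "square_integrable g"
  shows "to_L2 (\<lambda>x. f x + g x) = to_L2 f + to_L2 g"
  using assms square_integrable_add[OF assms]
  by (simp add: to_L2_def plus_L2.abs_eq L2_rel_def)

lemma to_L2_diff:
  assumes "square_integrable f" "square_integrable g"
  shows "to_L2 (\<lambda>x. f x - g x) = to_L2 f - to_L2 g"
  using assms square_integrable_diff[OF assms]
  by (simp add: to_L2_def minus_L2.abs_eq L2_rel_def)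

lemma to_L2_scaleR:
  assumes "square_integrable f"
  shows "to_L2 (\<lambda>x. c *\<^sub>R f x) = c *\<^sub>R to_L2 f"
  using assms square_integrable_scaleR[OF assms]
  by (simp add: to_L2_def scaleR_L2.abs_eq L2_rel_def)

lemma rep_L2_add: "AE x in lborel. rep_L2 (u + v) x = rep_L2 u x + rep_L2 v x"
  using rep_to_L2[OF square_integrable_add[OF square_integrable_rep[of u] square_integrable_rep[of v]]]
  by (subst (asm) to_L2_add) auto

lemma rep_L2_diff: "AE x in lborel. rep_L2 (u - v) x = rep_L2 u x - rep_L2 v x"
  using rep_to_L2[OF square_integrable_diff[OF square_integrable_rep[of u] square_integrable_rep[of v]]]
  by (subst (asm) to_L2_diff) auto

lemma rep_L2_scaleR: "AE x in lborel. rep_L2 (c *\<^sub>R u) x = c *\<^sub>R rep_L2 u x"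
  using rep_to_L2[OF square_integrable_scaleR[OF square_integrable_rep[of u]]]
  by (subst (asm) to_L2_scaleR) auto

lemma norm_L2_sq: "(norm u)\<^sup>2 = (\<integral>x. (cmod (rep_L2 u x))\<^sup>2 \<partial>lborel)"
proof -
  have "norm u = sqrt (\<integral>x. (cmod (rep_L2 u x))\<^sup>2 \<partial>lborel)"
    using norm_L2.abs_eq[of "rep_L2 u"] by (simp add: L2_rel_def)
  then show ?thesis by simp
qed

lemma norm_to_L2_sq: "square_integrable f \<Longrightarrow> (norm (to_L2 f))\<^sup>2 = (\<integral>x. (cmod (f x))\<^sup>2 \<partial>lborel)"
  using norm_L2.abs_eq[of f] by (simp add: L2_rel_def to_L2_def)

lemma inner_to_L2_eq:
  assumes "square_integrable f" "square_integrable g"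
  shows "to_L2 f \<bullet> to_L2 g = (\<integral>x. f x \<bullet> g x \<partial>lborel)"
  using inner_L2.abs_eq[of f g] assms by (simp add: L2_rel_def to_L2_def)

section \<open>Norms as nonnegative integrals\<close>

lemma square_integrable_iff_nn:
  "square_integrable f \<longleftrightarrow>
     f \<in> borel_measurable borel \<and> (\<integral>\<^sup>+x. ennreal ((cmod (f x))\<^sup>2) \<partial>lborel) < \<infinity>"
  by (auto simp: square_integrable_def integrable_iff_bounded)

lemma nn_norm_L2: "(\<integral>\<^sup>+x. ennreal ((cmod (rep_L2 u x))\<^sup>2) \<partial>lborel) = ennreal ((norm u)\<^sup>2)"
  using nn_integral_eq_integral[OF integrable_rep_L2_sq[of u]] by (simp add: norm_L2_sq)

lemma nn_norm_to_L2:
  "square_integrable f \<Longrightarrow> (\<integral>\<^sup>+x. ennreal ((cmod (f x))\<^sup>2) \<partial>lborel) = ennreal ((norm (to_L2 f))\<^sup>2)"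
  by (subst norm_to_L2_sq, assumption, subst nn_integral_eq_integral) (auto simp: square_integrable_def)

lemma square_integrableI_nn:
  assumes "f \<in> borel_measurable borel"
    and "(\<integral>\<^sup>+x. ennreal ((cmod (f x))\<^sup>2) \<partial>lborel) \<le> ennreal C"
  shows "square_integrable f"
  unfolding square_integrable_iff_nn infinity_ennreal_def
  using assms(1) le_less_trans[OF assms(2) ennreal_less_top] by blast

lemma norm_to_L2_le_nn:
  assumes "f \<in> borel_measurable borel" "0 \<le> C"
    and "(\<integral>\<^sup>+x. ennreal ((cmod (f x))\<^sup>2) \<partial>lborel) \<le> ennreal (C\<^sup>2)"
  shows "norm (to_L2 f) \<le> C"
proof -
  have "(norm (to_L2 f))\<^sup>2 \<le> C\<^sup>2"
    using assms(3) nn_norm_to_L2[OF square_integrableI_nn[OF assms(1,3)]] by (simp add: ennreal_le_iff)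
  then show ?thesis using assms(2) by (rule power2_le_imp_le)
qed

lemma square_integrable_bound:
  assumes "square_integrable f" "g \<in> borel_measurable borel"
    and "AE x in lborel. cmod (g x) \<le> C * cmod (f x)"
  shows "square_integrable g"
proof -
  have f: "f \<in> borel_measurable borel" "integrable lborel (\<lambda>x. C\<^sup>2 * (cmod (f x))\<^sup>2)"
    using assms(1) by (auto simp: square_integrable_def)
  have "integrable lborel (\<lambda>x. (cmod (g x))\<^sup>2)"
  proof (rule Bochner_Integration.integrable_bound[OF f(2)])
    show "(\<lambda>x. (cmod (g x))\<^sup>2) \<in> borel_measurable lborel" using assms(2) by measurable
    show "AE x in lborel. norm ((cmod (g x))\<^sup>2) \<le> norm (C\<^sup>2 * (cmod (f x))\<^sup>2)"
      using assms(3)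
    proof (eventually_elim)
      case (elim x)
      then show ?case using power_mono[OF elim, of 2] by (simp add: power_mult_distrib)
    qed
  qed
  then show ?thesis using assms(2) by (simp add: square_integrable_def)
qed

lemma norm_to_L2_mono:
  assumes "square_integrable f" "g \<in> borel_measurable borel" "0 \<le> C"
    and "AE x in lborel. cmod (g x) \<le> C * cmod (f x)"
  shows "norm (to_L2 g) \<le> C * norm (to_L2 f)"
proof -
  have f: "f \<in> borel_measurable borel" using assms(1) by (auto simp: square_integrable_def)
  have "(\<integral>\<^sup>+x. ennreal ((cmod (g x))\<^sup>2) \<partial>lborel) \<le> (\<integral>\<^sup>+x. ennreal (C\<^sup>2) * ennreal ((cmod (f x))\<^sup>2) \<partial>lborel)"
  proof (rule nn_integral_mono_AE, use assms(4) in eventually_elim)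
    fix x assume "cmod (g x) \<le> C * cmod (f x)"
    then show "ennreal ((cmod (g x))\<^sup>2) \<le> ennreal (C\<^sup>2) * ennreal ((cmod (f x))\<^sup>2)"
      using power_mono[of "cmod (g x)" "C * cmod (f x)" 2]
      by (simp add: power_mult_distrib flip: ennreal_mult)
  qed
  also have "\<dots> = ennreal (C\<^sup>2) * ennreal ((norm (to_L2 f))\<^sup>2)"
    using f by (subst nn_integral_cmult) (auto simp: nn_norm_to_L2[OF assms(1)])
  also have "\<dots> = ennreal ((C * norm (to_L2 f))\<^sup>2)"
    by (simp add: power_mult_distrib ennreal_mult)
  finally show ?thesis using assms by (intro norm_to_L2_le_nn) auto
qed

lemma norm_L2_mono:
  assumes "0 \<le> C" and "AE x in lborel. cmod (rep_L2 u x) \<le> C * cmod (rep_L2 v x)"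
  shows "norm u \<le> C * norm v"
  using norm_to_L2_mono[OF square_integrable_rep[of v] rep_L2_measurable[of u] assms]
  by (simp only: to_L2_rep)

subsection \<open>Completeness\<close>

text \<open>Riesz--Fischer for fast Cauchy sequences. The partial sums \<open>G\<close> of the
  absolute increments are bounded by 2 in norm, so by monotone convergence their limit is finite
  almost everywhere and the sequence converges pointwise; Fatou's lemma turns this into convergence
  in norm.\<close>

lemma L2_tendsto_subseq:
  fixes X :: "nat \<Rightarrow> 'a::euclidean_space L2"
  assumes X: "\<And>n. norm (X (Suc n) - X n) \<le> (1/2)^n"
  shows "\<exists>u. X \<longlonglongrightarrow> u \<and> (AE x in lborel. (\<lambda>n. rep_L2 (X n) x) \<longlonglongrightarrow> rep_L2 u x)"
proof -
  \<comment> \<open>The moduli of the increments are made into elements of the type, so that the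
    triangle inequality of its norm plays the part of Minkowski's inequality for
    \<open>G\<close>.\<close>
  define D where "D n = to_L2 (\<lambda>x. complex_of_real (cmod (rep_L2 (X (Suc n) - X n) x)))" for n
  have sqD: "square_integrable (\<lambda>x. complex_of_real (cmod (rep_L2 (X (Suc n) - X n) x)))" for n
    by (rule square_integrable_bound[where f="rep_L2 (X (Suc n) - X n)" and C=1]) auto
  have nD: "norm (D n) \<le> (1/2)^n" for n
  proof -
    have "norm (D n) \<le> 1 * norm (to_L2 (rep_L2 (X (Suc n) - X n)))"
      unfolding D_def by (rule norm_to_L2_mono) auto
    then show ?thesis using X[of n] by simp
  qed
  define G where "G N x = (\<Sum>n<N. cmod (rep_L2 (X (Suc n) - X n) x))" for N :: nat and x
  have Gm[measurable]: "G N \<in> borel_measurable borel" for N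
    unfolding G_def by measurable
  have G: "square_integrable (\<lambda>x. complex_of_real (G N x)) \<and> to_L2 (\<lambda>x. complex_of_real (G N x)) = (\<Sum>n<N. D n)" for N
  proof (induction N)
    case 0 then show ?case by (simp add: G_def square_integrable_0 to_L2_0)
  next
    case (Suc N)
    have "(\<lambda>x. complex_of_real (G (Suc N) x)) = (\<lambda>x. complex_of_real (G N x) + complex_of_real (cmod (rep_L2 (X (Suc N) - X N) x)))"
      by (auto simp: G_def)
    then show ?case using Suc sqD[of N] by (auto simp: to_L2_add square_integrable_add D_def)
  qed
  have nG: "norm (to_L2 (\<lambda>x. complex_of_real (G N x))) \<le> 2" for N
  proof -
    have "norm (\<Sum>n<N. D n) \<le> (\<Sum>n<N. (1/2)^n)" using nD by (intro sum_norm_le) auto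
    also have "\<dots> \<le> (\<Sum>n. (1/2)^n)" by (rule sum_le_suminf) (auto simp: summable_geometric)
    also have "\<dots> = 2" by (subst suminf_geometric) auto
    finally show ?thesis using G by simp
  qed
  have Gmono: "G N x \<le> G (Suc N) x" for N x by (simp add: G_def)
  have G0: "0 \<le> G N x" for N x by (auto simp: G_def intro!: sum_nonneg)
  have "(\<integral>\<^sup>+x. (SUP N. ennreal ((G N x)\<^sup>2)) \<partial>lborel) = (SUP N. \<integral>\<^sup>+x. ennreal ((G N x)\<^sup>2) \<partial>lborel)"
    by (intro nn_integral_monotone_convergence_SUP)
       (auto simp: incseq_Suc_iff le_fun_def Gmono G0 intro!: ennreal_leI power_mono)
  also have "\<dots> \<le> 4"
  proof (rule SUP_least)
    fix N
    have "(\<integral>\<^sup>+x. ennreal ((G N x)\<^sup>2) \<partial>lborel) = ennreal ((norm (to_L2 (\<lambda>x. complex_of_real (G N x))))\<^sup>2)"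
      using nn_norm_to_L2[of "\<lambda>x. complex_of_real (G N x)"] G by simp
    also have "\<dots> \<le> ennreal (2\<^sup>2)" using nG[of N] by (intro ennreal_leI power_mono) auto
    finally show "(\<integral>\<^sup>+x. ennreal ((G N x)\<^sup>2) \<partial>lborel) \<le> 4" by simp
  qed
  finally have "(\<integral>\<^sup>+x. (SUP N. ennreal ((G N x)\<^sup>2)) \<partial>lborel) \<noteq> \<infinity>"
    by (auto simp: top_unique)
  then have "AE x in lborel. (SUP N. ennreal ((G N x)\<^sup>2)) \<noteq> \<infinity>"
    by (intro nn_integral_noteq_infinite) auto
  moreover have "AE x in lborel. \<forall>n. rep_L2 (X (Suc n) - X n) x = rep_L2 (X (Suc n)) x - rep_L2 (X n) x"
    by (subst AE_all_countable) (auto intro: rep_L2_diff)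
  ultimately have conv: "AE x in lborel. convergent (\<lambda>n. rep_L2 (X n) x)"
  proof eventually_elim
    case (elim x)
    then obtain M where M: "(SUP N. ennreal ((G N x)\<^sup>2)) = ennreal M" "0 \<le> M"
      by (metis ennreal_cases infinity_ennreal_def)
    have "(G N x)\<^sup>2 \<le> M" for N
      using SUP_upper[of N UNIV "\<lambda>N. ennreal ((G N x)\<^sup>2)"] M by (simp add: ennreal_le_iff)
    then have "G N x \<le> sqrt M" for N using real_le_rsqrt by blast
    then have "summable (\<lambda>n. cmod (rep_L2 (X (Suc n) - X n) x))"
      by (intro bounded_imp_summable[where B="sqrt M"])
         (simp_all only: G_def norm_ge_zero flip: lessThan_Suc_atMost)
    then have "summable (\<lambda>n. rep_L2 (X (Suc n)) x - rep_L2 (X n) x)"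
      using elim by (auto dest: summable_norm_cancel)
    then have "convergent (\<lambda>n. \<Sum>i<n. rep_L2 (X (Suc i)) x - rep_L2 (X i) x)"
      by (simp add: summable_iff_convergent)
    then have "convergent (\<lambda>n. rep_L2 (X n) x - rep_L2 (X 0) x)"
      unfolding sum_lessThan_telescope[of "\<lambda>i. rep_L2 (X i) x"] .
    then show ?case by (subst (asm) convergent_diff_const_right_iff)
  qed
  \<comment> \<open>Where the sequence diverges, \<open>lim\<close> is an unspecified value; these
    points form a null set.\<close>
  define f where "f x = lim (\<lambda>n. rep_L2 (X n) x)" for x
  have fm[measurable]: "f \<in> borel_measurable borel" unfolding f_def by measurable
  have lim: "AE x in lborel. (\<lambda>n. rep_L2 (X n) x) \<longlonglongrightarrow> f x"
    using conv by eventually_elim (simp add: f_def convergent_LIMSEQ_iff)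
  \<comment> \<open>Fatou in the second index: for fixed \<open>n\<close>, the tail bound of the
    sequence passes to the pointwise limit.\<close>
  have est: "(\<integral>\<^sup>+x. ennreal ((cmod (f x - rep_L2 (X n) x))\<^sup>2) \<partial>lborel) \<le> ennreal ((2 * (1/2)^n)\<^sup>2)" for n
  proof -
    have dist: "norm (X (n+k) - X n) \<le> 2 * (1/2)^n" for k
    proof -
      have "norm (X (n+k) - X n) \<le> (\<Sum>i<k. (1/2)^(n+i))"
      proof (induction k)
        case (Suc k)
        have "norm (X (n + Suc k) - X n) \<le> norm (X (Suc (n + k)) - X (n+k)) + norm (X (n+k) - X n)"
          by (metis add_Suc_right norm_triangle_ineq diff_add_cancel add_diff_eq)
        then show ?case using Suc X[of "n+k"] by simp
      qed simp
      also have "\<dots> = (1/2)^n * (\<Sum>i<k. (1/2)^i)" by (simp add: power_add sum_distrib_left)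
      also have "(\<Sum>i<k. (1/2::real)^i) \<le> (\<Sum>i. (1/2)^i)" by (rule sum_le_suminf) (auto simp: summable_geometric)
      also have "(\<Sum>i. (1/2::real)^i) = 2" by (subst suminf_geometric) auto
      finally show ?thesis by (simp add: mult_ac)
    qed
    have "(\<integral>\<^sup>+x. ennreal ((cmod (f x - rep_L2 (X n) x))\<^sup>2) \<partial>lborel)
       \<le> (\<integral>\<^sup>+x. liminf (\<lambda>k. ennreal ((cmod (rep_L2 (X k) x - rep_L2 (X n) x))\<^sup>2)) \<partial>lborel)"
    proof (rule nn_integral_mono_AE, use lim in eventually_elim)
      fix x assume "(\<lambda>n. rep_L2 (X n) x) \<longlonglongrightarrow> f x"
      then have "(\<lambda>k. ennreal ((cmod (rep_L2 (X k) x - rep_L2 (X n) x))\<^sup>2)) \<longlonglongrightarrow> ennreal ((cmod (f x - rep_L2 (X n) x))\<^sup>2)"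
        by (intro tendsto_intros tendsto_ennrealI)
      then show "ennreal ((cmod (f x - rep_L2 (X n) x))\<^sup>2) \<le> liminf (\<lambda>k. ennreal ((cmod (rep_L2 (X k) x - rep_L2 (X n) x))\<^sup>2))"
        using lim_imp_Liminf[OF sequentially_bot] by (metis order_refl)
    qed
    also have "\<dots> \<le> liminf (\<lambda>k. \<integral>\<^sup>+x. ennreal ((cmod (rep_L2 (X k) x - rep_L2 (X n) x))\<^sup>2) \<partial>lborel)"
      by (rule nn_integral_liminf) auto
    also have "\<dots> \<le> ennreal ((2 * (1/2)^n)\<^sup>2)"
    proof -
      have "(\<integral>\<^sup>+x. ennreal ((cmod (rep_L2 (X k) x - rep_L2 (X n) x))\<^sup>2) \<partial>lborel) \<le> ennreal ((2 * (1/2)^n)\<^sup>2)" if "k \<ge> n" for k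
      proof -
        have "(\<integral>\<^sup>+x. ennreal ((cmod (rep_L2 (X k) x - rep_L2 (X n) x))\<^sup>2) \<partial>lborel) = (\<integral>\<^sup>+x. ennreal ((cmod (rep_L2 (X k - X n) x))\<^sup>2) \<partial>lborel)"
          by (rule nn_integral_cong_AE) (use rep_L2_diff[of "X k" "X n"] in eventually_elim, simp)
        also have "\<dots> = ennreal ((norm (X k - X n))\<^sup>2)" by (rule nn_norm_L2)
        also have "\<dots> \<le> ennreal ((2 * (1/2)^n)\<^sup>2)"
          using dist[of "k - n"] that by (intro ennreal_leI power_mono) auto
        finally show ?thesis .
      qed
      then have "eventually (\<lambda>k. (\<integral>\<^sup>+x. ennreal ((cmod (rep_L2 (X k) x - rep_L2 (X n) x))\<^sup>2) \<partial>lborel) \<le> ennreal ((2 * (1/2)^n)\<^sup>2)) sequentially"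
        using eventually_sequentially by blast
      then have "limsup (\<lambda>k. \<integral>\<^sup>+x. ennreal ((cmod (rep_L2 (X k) x - rep_L2 (X n) x))\<^sup>2) \<partial>lborel) \<le> ennreal ((2 * (1/2)^n)\<^sup>2)"
        by (rule Limsup_bounded)
      then show ?thesis using Liminf_le_Limsup[OF sequentially_bot] order_trans by blast
    qed
    finally show ?thesis .
  qed
  have "square_integrable (\<lambda>x. f x - rep_L2 (X 0) x)"
    by (rule square_integrableI_nn[OF _ est[of 0]]) auto
  then have sf: "square_integrable f"
    using square_integrable_add[OF _ square_integrable_rep[of "X 0"], of "\<lambda>x. f x - rep_L2 (X 0) x"] by simp
  have "norm (to_L2 f - X n) \<le> 2 * (1/2)^n" for n
    using norm_to_L2_le_nn[OF _ _ est[of n]] to_L2_diff[OF sf square_integrable_rep[of "X n"]] by simp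
  then have n2: "norm (X n - to_L2 f) \<le> 2 * (1/2)^n" for n by (simp add: norm_minus_commute)
  have "X \<longlonglongrightarrow> to_L2 f"
  proof (rule LIM_zero_cancel, rule Lim_null_comparison)
    show "\<forall>\<^sub>F n in sequentially. norm (X n - to_L2 f) \<le> 2 * (1/2)^n" using n2 by auto
    show "(\<lambda>n. 2 * (1/2::real)^n) \<longlonglongrightarrow> 0" by (intro tendsto_mult_right_zero LIMSEQ_power_zero) auto
  qed
  moreover have "AE x in lborel. (\<lambda>n. rep_L2 (X n) x) \<longlonglongrightarrow> rep_L2 (to_L2 f) x"
    using lim rep_to_L2[OF sf] by eventually_elim auto
  ultimately show ?thesis by blast
qed

lemma Cauchy_fast_subseq:
  fixes X :: "nat \<Rightarrow> 'b::real_normed_vector"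
  assumes "Cauchy X"
  obtains r where "strict_mono r" "\<And>n. norm (X (r (Suc n)) - X (r n)) \<le> (1/2)^n"
proof -
  have "\<exists>M. \<forall>i\<ge>M. \<forall>j\<ge>M. norm (X i - X j) < (1/2)^k" for k :: nat
    using assms by (simp add: Cauchy_iff)
  then obtain M where M: "\<And>k i j. i \<ge> M k \<Longrightarrow> j \<ge> M k \<Longrightarrow> norm (X i - X j) < (1/2::real)^k"
    by metis
  define r where "r = rec_nat (M 0) (\<lambda>k rk. max (Suc rk) (M (Suc k)))"
  have r_Suc: "r (Suc k) = max (Suc (r k)) (M (Suc k))" for k by (simp add: r_def)
  have rM: "r k \<ge> M k" for k by (cases k) (simp_all add: r_def)
  have "strict_mono r" by (rule strict_monoI_Suc) (simp add: r_Suc)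
  moreover have "norm (X (r (Suc n)) - X (r n)) \<le> (1/2)^n" for n
  proof -
    have "r (Suc n) \<ge> M n" using rM[of n] r_Suc[of n] by simp
    then show ?thesis using M[of n "r (Suc n)" "r n"] rM[of n] by simp
  qed
  ultimately show ?thesis using that by blast
qed

instance L2 :: (euclidean_space) complete_space
proof
  fix X :: "nat \<Rightarrow> 'a L2" assume X: "Cauchy X"
  obtain r where r: "strict_mono r" "\<And>n. norm (X (r (Suc n)) - X (r n)) \<le> (1/2)^n"
    using Cauchy_fast_subseq[OF X] by blast
  obtain u where "(X \<circ> r) \<longlonglongrightarrow> u" using L2_tendsto_subseq[of "X \<circ> r"] r(2) by auto
  then have "X \<longlonglongrightarrow> u" using Cauchy_converges_subseq[OF X r(1)] by simp
  then show "convergent X" by (rule convergentI)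
qed

instance L2 :: (euclidean_space) banach ..

subsection \<open>Multiplication operators\<close>

text \<open>Total by the convention of \<open>to_L2\<close>: the value is \<open>0\<close> where the
  product is not square-integrable.\<close>

definition mul :: "('a::euclidean_space \<Rightarrow> complex) \<Rightarrow> 'a L2 \<Rightarrow> 'a L2" where
  "mul a u = to_L2 (\<lambda>x. a x * rep_L2 u x)"

lemma square_integrable_mul:
  assumes "a \<in> borel_measurable borel" "AE x in lborel. cmod (a x) \<le> C"
  shows "square_integrable (\<lambda>x. a x * rep_L2 u x)"
proof (rule square_integrable_bound[where f="rep_L2 u" and C=C])
  show "(\<lambda>x. a x * rep_L2 u x) \<in> borel_measurable borel"
    using assms(1) by measurable
  show "AE x in lborel. cmod (a x * rep_L2 u x) \<le> C * cmod (rep_L2 u x)"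
    using assms(2) by eventually_elim (simp add: norm_mult mult_right_mono)
qed simp

lemma rep_mul:
  assumes "square_integrable (\<lambda>x. a x * rep_L2 u x)"
  shows "AE x in lborel. rep_L2 (mul a u) x = a x * rep_L2 u x"
  using rep_to_L2[OF assms] by (simp add: mul_def)

lemma norm_mul_le:
  assumes "a \<in> borel_measurable borel" "AE x in lborel. cmod (a x) \<le> C" "0 \<le> C"
  shows "norm (mul a u) \<le> C * norm u"
proof -
  have "norm (mul a u) \<le> C * norm (to_L2 (rep_L2 u))"
    unfolding mul_def
  proof (rule norm_to_L2_mono[OF square_integrable_rep _ assms(3)])
    show "(\<lambda>x. a x * rep_L2 u x) \<in> borel_measurable borel"
      using assms(1) by measurable
    show "AE x in lborel. cmod (a x * rep_L2 u x) \<le> C * cmod (rep_L2 u x)"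
      using assms(2) by eventually_elim (simp add: norm_mult mult_right_mono)
  qed
  then show ?thesis by simp
qed

lemma bounded_linear_mul:
  assumes "a \<in> borel_measurable borel" "AE x in lborel. cmod (a x) \<le> C"
  shows "bounded_linear (mul a)"
proof -
  have sq: "square_integrable (\<lambda>x. a x * rep_L2 u x)" for u using square_integrable_mul[OF assms] .
  have [measurable]: "a \<in> borel_measurable borel" using assms(1) .
  show ?thesis
  proof (rule bounded_linear_intro[where K="\<bar>C\<bar>"])
    fix u v :: "'a L2" and r :: real
    show "mul a (u + v) = mul a u + mul a v"
      unfolding mul_def
      apply (subst to_L2_add[symmetric, OF sq sq])
      apply (rule to_L2_eqI[OF sq square_integrable_add[OF sq sq]])
      using rep_L2_add[of u v] by eventually_elim (simp add: algebra_simps)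
    show "mul a (r *\<^sub>R u) = r *\<^sub>R mul a u"
      unfolding mul_def
      apply (subst to_L2_scaleR[symmetric, OF sq])
      apply (rule to_L2_eqI[OF sq square_integrable_scaleR[OF sq]])
      using rep_L2_scaleR[of r u] by eventually_elim (simp add: algebra_simps)
    show "norm (mul a u) \<le> norm u * \<bar>C\<bar>"
    proof -
      have "AE x in lborel. cmod (a x) \<le> \<bar>C\<bar>"
        using assms(2) by eventually_elim linarith
      then show ?thesis using norm_mul_le[OF assms(1), of "\<bar>C\<bar>" u] by (simp add: mult.commute)
    qed
  qed
qed

text \<open>If the outer product leaves L2, so does the one with \<open>a x * b x\<close>, because
  they agree almost everywhere; both sides are then \<open>0\<close>. Unbounded outer symbols such
  as \<open>bessel_symbol \<sigma>\<close> can thus be composed freely.\<close>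

lemma mul_mul:
  assumes "square_integrable (\<lambda>x. b x * rep_L2 u x)" "a \<in> borel_measurable borel" "b \<in> borel_measurable borel"
  shows "mul a (mul b u) = mul (\<lambda>x. a x * b x) u"
proof -
  have [measurable]: "a \<in> borel_measurable borel" "b \<in> borel_measurable borel" using assms by auto
  have ae: "AE x in lborel. a x * rep_L2 (mul b u) x = a x * b x * rep_L2 u x"
    using rep_mul[OF assms(1)] by eventually_elim simp
  show ?thesis
  proof (cases "square_integrable (\<lambda>x. a x * rep_L2 (mul b u) x)")
    case True
    then have "square_integrable (\<lambda>x. a x * b x * rep_L2 u x)"
      by (rule square_integrable_cong_AE) (use ae in auto)
    then show ?thesis unfolding mul_def[of a] mul_def[of "\<lambda>x. a x * b x"] using True ae
      by (intro to_L2_eqI) auto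
  next
    case False
    moreover have "\<not> square_integrable (\<lambda>x. a x * b x * rep_L2 u x)"
    proof
      assume "square_integrable (\<lambda>x. a x * b x * rep_L2 u x)"
      then have "square_integrable (\<lambda>x. a x * rep_L2 (mul b u) x)"
        by (rule square_integrable_cong_AE) (use ae in auto)
      with False show False by simp
    qed
    ultimately show ?thesis by (simp add: mul_def to_L2_def)
  qed
qed

lemma mul_1: "mul (\<lambda>_. 1) u = u"
  by (simp add: mul_def)

text \<open>The symbols converge only pointwise, so what results is strong continuity: for a fixed
  \<open>u\<close>, dominated convergence with the majorant
  \<open>(2*C)\<^sup>2 * (cmod (rep_L2 u x))\<^sup>2\<close>.\<close>

lemma mul_dominated_tendsto:
  fixes a :: "real \<Rightarrow> 'a::euclidean_space \<Rightarrow> complex"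
  assumes [measurable]: "\<And>t. t \<in> T \<Longrightarrow> a t \<in> borel_measurable borel"
    and t0: "t0 \<in> T"
    and bd: "\<And>t. t \<in> T \<Longrightarrow> AE x in lborel. cmod (a t x) \<le> C"
    and cont: "AE x in lborel. ((\<lambda>t. a t x) \<longlongrightarrow> a t0 x) (at t0 within T)"
  shows "((\<lambda>t. mul (a t) u) \<longlongrightarrow> mul (a t0) u) (at t0 within T)"
proof (rule Lim_within_LIMSEQ, safe)
  fix X :: "nat \<Rightarrow> real" assume X: "\<forall>n. X n \<noteq> t0 \<and> X n \<in> T" and Xl: "X \<longlonglongrightarrow> t0"
  have [measurable]: "a (X n) \<in> borel_measurable borel" "a t0 \<in> borel_measurable borel" for n
    using X t0 assms(1) by auto
  have sq: "square_integrable (\<lambda>x. a t x * rep_L2 u x)" if "t \<in> T" for t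
    using square_integrable_mul[OF assms(1)[OF that] bd[OF that]] .
  have eq: "(norm (mul (a (X n)) u - mul (a t0) u))\<^sup>2 = (\<integral>x. (cmod ((a (X n) x - a t0 x) * rep_L2 u x))\<^sup>2 \<partial>lborel)" for n
  proof -
    have s: "square_integrable (\<lambda>x. a (X n) x * rep_L2 u x)" "square_integrable (\<lambda>x. a t0 x * rep_L2 u x)"
      using sq X t0 by auto
    have "mul (a (X n)) u - mul (a t0) u = to_L2 (\<lambda>x. a (X n) x * rep_L2 u x - a t0 x * rep_L2 u x)"
      using s by (simp add: mul_def to_L2_diff)
    then show ?thesis using norm_to_L2_sq[OF square_integrable_diff[OF s]] by (simp add: left_diff_distrib)
  qed
  have "(\<lambda>n. \<integral>x. (cmod ((a (X n) x - a t0 x) * rep_L2 u x))\<^sup>2 \<partial>lborel) \<longlonglongrightarrow> (\<integral>x. 0 \<partial>(lborel :: 'a measure))"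
  proof (rule integral_dominated_convergence[where w="\<lambda>x. (2*C)\<^sup>2 * (cmod (rep_L2 u x))\<^sup>2"])
    show "integrable lborel (\<lambda>x. (2 * C)\<^sup>2 * (cmod (rep_L2 u x))\<^sup>2)" using integrable_rep_L2_sq by auto
    show "AE x in lborel. (\<lambda>n. (cmod ((a (X n) x - a t0 x) * rep_L2 u x))\<^sup>2) \<longlonglongrightarrow> 0"
      using cont
    proof eventually_elim
      case (elim x)
      have "(\<lambda>n. a (X n) x) \<longlonglongrightarrow> a t0 x"
        using X Xl elim by (auto simp: tendsto_at_iff_sequentially o_def)
      then have "(\<lambda>n. (cmod ((a (X n) x - a t0 x) * rep_L2 u x))\<^sup>2) \<longlonglongrightarrow> (cmod ((a t0 x - a t0 x) * rep_L2 u x))\<^sup>2"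
        by (intro tendsto_intros)
      then show ?case by simp
    qed
    fix n
    show "AE x in lborel. norm ((cmod ((a (X n) x - a t0 x) * rep_L2 u x))\<^sup>2) \<le> (2 * C)\<^sup>2 * (cmod (rep_L2 u x))\<^sup>2"
      using bd[OF t0] bd[of "X n", OF X[rule_format, THEN conjunct2]]
    proof eventually_elim
      case (elim x)
      have "cmod (a (X n) x - a t0 x) \<le> 2 * C" using elim norm_triangle_ineq4[of "a (X n) x" "a t0 x"] by linarith
      then have "(cmod (a (X n) x - a t0 x))\<^sup>2 \<le> (2 * C)\<^sup>2" by (rule power_mono) auto
      then show ?case by (simp add: norm_mult power_mult_distrib mult_right_mono)
    qed
  qed auto
  then have "(\<lambda>n. (norm (mul (a (X n)) u - mul (a t0) u))\<^sup>2) \<longlonglongrightarrow> 0" by (simp add: eq)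
  then have "(\<lambda>n. sqrt ((norm (mul (a (X n)) u - mul (a t0) u))\<^sup>2)) \<longlonglongrightarrow> sqrt 0" by (rule tendsto_real_sqrt)
  then have "(\<lambda>n. norm (mul (a (X n)) u - mul (a t0) u)) \<longlonglongrightarrow> 0" by simp
  then show "(\<lambda>n. mul (a (X n)) u) \<longlonglongrightarrow> mul (a t0) u" by (simp add: tendsto_norm_zero_iff LIM_zero_iff)
qed

section \<open>Dominated convergence and a dense class of functions\<close>

lemma L2_dominated_convergence:
  fixes s :: "nat \<Rightarrow> 'a::euclidean_space \<Rightarrow> complex"
  assumes w: "square_integrable w"
    and [measurable]: "\<And>i. s i \<in> borel_measurable borel" "f \<in> borel_measurable borel"
    and bd: "\<And>i. AE x in lborel. cmod (s i x) \<le> cmod (w x)"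
    and lim: "AE x in lborel. (\<lambda>i. s i x) \<longlonglongrightarrow> f x"
  shows "square_integrable f" "(\<lambda>i. to_L2 (s i)) \<longlonglongrightarrow> to_L2 f"
proof -
  have bda: "AE x in lborel. \<forall>i. cmod (s i x) \<le> cmod (w x)"
    using bd by (simp add: AE_all_countable)
  have fb: "AE x in lborel. cmod (f x) \<le> cmod (w x)"
    using bda lim
  proof eventually_elim
    case (elim x)
    then show ?case by (intro LIMSEQ_le_const2[OF tendsto_norm[OF elim(2)]]) auto
  qed
  have ss: "square_integrable (s i)" for i
    by (rule square_integrable_bound[OF w, where C=1]) (use bd[of i] in auto)
  show sf: "square_integrable f"
    by (rule square_integrable_bound[OF w, where C=1]) (use fb in auto)
  have wi: "integrable lborel (\<lambda>x. (2 * cmod (w x))\<^sup>2)"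
    using w by (simp add: square_integrable_def power_mult_distrib)
  have "(\<lambda>i. \<integral>x. (cmod (s i x - f x))\<^sup>2 \<partial>lborel) \<longlonglongrightarrow> (\<integral>x. 0 \<partial>(lborel :: 'a measure))"
  proof (rule integral_dominated_convergence[OF _ _ wi])
    show "AE x in lborel. (\<lambda>i. (cmod (s i x - f x))\<^sup>2) \<longlonglongrightarrow> 0"
      using lim
    proof eventually_elim
      case (elim x)
      have "(\<lambda>i. (cmod (s i x - f x))\<^sup>2) \<longlonglongrightarrow> (cmod (f x - f x))\<^sup>2"
        by (intro tendsto_intros elim)
      then show ?case by simp
    qed
    show "AE x in lborel. norm ((cmod (s i x - f x))\<^sup>2) \<le> (2 * cmod (w x))\<^sup>2" for i
      using bd[of i] fb
    proof eventually_elim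
      case (elim x)
      have "cmod (s i x - f x) \<le> 2 * cmod (w x)"
        using elim norm_triangle_ineq4[of "s i x" "f x"] by linarith
      then have "(cmod (s i x - f x))\<^sup>2 \<le> (2 * cmod (w x))\<^sup>2" by (rule power_mono) simp
      then show ?case by simp
    qed
  qed auto
  then have "(\<lambda>i. (norm (to_L2 (s i) - to_L2 f))\<^sup>2) \<longlonglongrightarrow> 0"
    using norm_to_L2_sq[OF square_integrable_diff[OF ss sf]] by (simp add: to_L2_diff[OF ss sf])
  then have "(\<lambda>i. sqrt ((norm (to_L2 (s i) - to_L2 f))\<^sup>2)) \<longlonglongrightarrow> sqrt 0" by (rule tendsto_real_sqrt)
  then show "(\<lambda>i. to_L2 (s i)) \<longlonglongrightarrow> to_L2 f" by (simp add: tendsto_norm_zero_iff LIM_zero_iff)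
qed

lemma square_integrable_indicator:
  fixes A :: "'a::euclidean_space set"
  assumes "A \<in> sets borel" "A \<subseteq> ball 0 R"
  shows "square_integrable (\<lambda>x. c * indicator A x)"
proof -
  have "emeasure lborel A \<le> emeasure lborel (ball (0::'a) R)" using emeasure_mono[of A "ball 0 R" lborel] assms(2) by simp
  then have fin: "emeasure lborel A < \<infinity>"
    using emeasure_lborel_ball_finite[of "0::'a" R] by (auto simp: less_top[symmetric] top_unique)
  have "(cmod (c * indicator A x))\<^sup>2 = (cmod c)\<^sup>2 * indicator A x" for x
    by (auto simp: indicator_def)
  then show ?thesis
    unfolding square_integrable_def using assms(1) fin
    by (auto simp: integrable_indicator_iff)
qed

text \<open>Indicators of open sets are the functions on which the continuity of translations can be
  read off directly, so density is reduced to them. A Dynkin system argument reaches bounded Borel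
  sets; closedness of \<open>D\<close> serves for countable unions and again for limits of simple
  functions.\<close>

lemma L2_dense_open_indicators:
  fixes D :: "'a::euclidean_space L2 set"
  assumes sub: "subspace D" and cl: "closed D"
    and op: "\<And>U c R. open U \<Longrightarrow> U \<subseteq> ball 0 R \<Longrightarrow> to_L2 (\<lambda>x. c * indicator U x) \<in> D"
  shows "u \<in> D"
proof -
  \<comment> \<open>Intersecting with a ball keeps all measures finite, so that complements can be
    formed by subtraction from the indicator of the ball.\<close>
  have ind: "to_L2 (\<lambda>x. c * indicator (A \<inter> ball 0 R) x) \<in> D" if "A \<in> sets borel" for A c R
  proof -
    have "Int_stable {S :: 'a set. open S}" "{S :: 'a set. open S} \<subseteq> Pow UNIV"
      by (auto simp: Int_stable_def)
    moreover have "A \<in> sigma_sets UNIV {S. open S}" using that by (simp add: borel_def)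
    ultimately show ?thesis
    proof (induction rule: sigma_sets_induct_disjoint)
      case (basic A)
      then show ?case by (intro op[of _ R]) auto
    next
      case empty
      then show ?case using subspace_0[OF sub] by (simp add: to_L2_0)
    next
      case (compl A)
      have A: "A \<in> sets borel" using compl.hyps by (simp add: borel_def)
      have "(\<lambda>x. c * indicator ((UNIV - A) \<inter> ball 0 R) x) =
          (\<lambda>x. c * indicator (ball 0 R) x - c * indicator (A \<inter> ball 0 R) x)"
        by (auto simp: indicator_def)
      then have "to_L2 (\<lambda>x. c * indicator ((UNIV - A) \<inter> ball 0 R) x) =
          to_L2 (\<lambda>x. c * indicator (ball 0 R) x) - to_L2 (\<lambda>x. c * indicator (A \<inter> ball 0 R) x)"
        using to_L2_diff[OF square_integrable_indicator[of "ball 0 R" R c] square_integrable_indicator[of "A \<inter> ball 0 R" R c]] A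
        by (simp only:) auto
      then show ?case using compl.IH op[of "ball 0 R" R c] subspace_diff[OF sub] by simp
    next
      case (union F)
      have F: "F i \<in> sets borel" for i using union.hyps by (simp add: borel_def image_subset_iff)
      define s where "s n x = c * indicator ((\<Union>i<n. F i) \<inter> ball 0 R) x" for n :: nat and x :: 'a
      have sq: "square_integrable (s n)" for n unfolding s_def
        by (rule square_integrable_indicator) (use F in auto)
      have sD: "to_L2 (s n) \<in> D" for n
      proof (induction n)
        case 0 then show ?case using subspace_0[OF sub] by (simp add: to_L2_0 s_def)
      next
        case (Suc n)
        have "s (Suc n) = (\<lambda>x. s n x + c * indicator (F n \<inter> ball 0 R) x)"
        proof
          fix x
          have "x \<notin> F i" if "x \<in> F n" "i < n" for i
            using disjoint_family_onD[OF union.hyps(1), of n i] that by blast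
          then show "s (Suc n) x = s n x + c * indicator (F n \<inter> ball 0 R) x"
            by (cases "x \<in> F n") (auto simp: s_def indicator_def less_Suc_eq)
        qed
        then have "to_L2 (s (Suc n)) = to_L2 (s n) + to_L2 (\<lambda>x. c * indicator (F n \<inter> ball 0 R) x)"
          using sq[of n] square_integrable_indicator[of "F n \<inter> ball 0 R" R c] F by (simp add: to_L2_add)
        then show ?case using Suc union.IH subspace_add[OF sub] by simp
      qed
      have "(\<lambda>n. to_L2 (s n)) \<longlonglongrightarrow> to_L2 (\<lambda>x. c * indicator ((\<Union>i. F i) \<inter> ball 0 R) x)"
      proof (rule L2_dominated_convergence(2)[OF square_integrable_indicator[of "ball 0 R" R c]])
        show "s n \<in> borel_measurable borel" for n using sq[of n] by (simp add: square_integrable_def)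
        show "(\<lambda>x. c * indicator ((\<Union>i. F i) \<inter> ball 0 R) x) \<in> borel_measurable borel"
          using F by (auto intro!: borel_measurable_times borel_measurable_indicator)
        show "AE x in lborel. cmod (s n x) \<le> cmod (c * indicator (ball 0 R) x)" for n
          by (auto simp: s_def indicator_def)
        show "AE x in lborel. (\<lambda>n. s n x) \<longlonglongrightarrow> c * indicator ((\<Union>i. F i) \<inter> ball 0 R) x"
        proof (rule AE_I2)
          fix x
          show "(\<lambda>n. s n x) \<longlonglongrightarrow> c * indicator ((\<Union>i. F i) \<inter> ball 0 R) x"
          proof (cases "\<exists>i. x \<in> F i")
            case True
            then obtain i where "x \<in> F i" by blast
            have "s n x = c * indicator ((\<Union>i. F i) \<inter> ball 0 R) x" if "n \<ge> Suc i" for n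
            proof -
              have "x \<in> (\<Union>i<n. F i)" "x \<in> (\<Union>i. F i)" using \<open>x \<in> F i\<close> that by auto
              then show ?thesis by (simp only: s_def indicator_def Int_iff)
            qed
            then show ?thesis
              by (intro tendsto_eventually) (unfold eventually_sequentially, blast)
          next
            case False then show ?thesis by (simp add: s_def)
          qed
        qed
      qed auto
      then show ?case by (rule closed_sequentially[OF cl sD])
    qed
  qed
  obtain F where F: "\<And>i. simple_function lborel (F i)" "\<And>x. (\<lambda>i. F i x) \<longlonglongrightarrow> rep_L2 u x"
      "\<And>i x. dist (F i x) 0 \<le> 2 * dist (rep_L2 u x) 0"
    using borel_measurable_implies_sequence_metric[of "rep_L2 u" lborel 0] by auto
  have Fm[measurable]: "F i \<in> borel_measurable borel" for i
    using borel_measurable_simple_function[OF F(1)[of i]] by simp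
  \<comment> \<open>The cut-off gives every level set bounded support, the form in which
    \<open>ind\<close> applies. It disappears in the limit because each point lies in all large
    balls.\<close>
  define s where "s i x = F i x * indicator (ball 0 (real i)) x" for i x
  have "s i \<in> borel_measurable borel" for i unfolding s_def[abs_def]
    by (intro borel_measurable_times borel_measurable_indicator) auto
  then have sq: "square_integrable (s i)" for i
    by (rule square_integrable_bound[OF square_integrable_rep[of u], where C=2])
       (use F(3)[of i] in \<open>auto simp: s_def indicator_def\<close>)
  have sD: "to_L2 (s i) \<in> D" for i
  proof -
    have fin: "finite (range (F i))" using F(1)[of i] by (simp add: simple_function_def)
    have pre: "F i -` {c} \<in> sets borel" if "c \<in> range (F i)" for c
      using F(1)[of i] that by (auto simp: simple_function_def)
    define I where "I c x = c * indicator (F i -` {c} \<inter> ball 0 (real i)) x" for c x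
    have I: "square_integrable (I c)" "to_L2 (I c) \<in> D" if "c \<in> range (F i)" for c
      unfolding I_def[abs_def]
      using square_integrable_indicator[of "F i -` {c} \<inter> ball 0 (real i)" "real i" c]
        ind[of "F i -` {c}" c "real i"] pre[OF that] by auto
    have key: "square_integrable (\<lambda>x. \<Sum>c\<in>C. I c x) \<and> to_L2 (\<lambda>x. \<Sum>c\<in>C. I c x) \<in> D"
      if "finite C" "C \<subseteq> range (F i)" for C
      using that
    proof (induction rule: finite_induct)
      case empty
      then show ?case using subspace_0[OF sub] by (simp add: to_L2_0 square_integrable_0)
    next
      case (insert c C)
      then show ?case using I[of c] subspace_add[OF sub]
        by (simp add: to_L2_add square_integrable_add)
    qed
    have "(\<Sum>c\<in>range (F i). I c x) = s i x" for x
    proof -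
      have "(\<Sum>c\<in>range (F i). I c x)
          = (\<Sum>c\<in>range (F i). if c = F i x then F i x * indicator (ball 0 (real i)) x else 0)"
        by (intro sum.cong) (auto simp: I_def indicator_def)
      then show ?thesis using fin by (simp add: s_def)
    qed
    then show ?thesis using key[OF fin order_refl] by simp
  qed
  have sq2: "square_integrable (\<lambda>x. 2 * rep_L2 u x)"
    using square_integrable_mul[of "\<lambda>_. 2" 2 u] by simp
  have "(\<lambda>i. to_L2 (s i)) \<longlonglongrightarrow> to_L2 (rep_L2 u)"
  proof (rule L2_dominated_convergence(2)[OF sq2])
    show "s i \<in> borel_measurable borel" for i using sq[of i] by (simp add: square_integrable_def)
    show "AE x in lborel. cmod (s i x) \<le> cmod (2 * rep_L2 u x)" for i
      using F(3)[of i] by (auto simp: s_def indicator_def norm_mult)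
    show "AE x in lborel. (\<lambda>n. s n x) \<longlonglongrightarrow> rep_L2 u x"
    proof (rule AE_I2)
      fix x :: 'a
      obtain N :: nat where N: "norm x < real N" using reals_Archimedean2 by blast
      have "\<forall>\<^sub>F n in sequentially. s n x = F n x"
        using eventually_ge_at_top[of N] by eventually_elim (use N in \<open>auto simp: s_def indicator_def\<close>)
      then show "(\<lambda>n. s n x) \<longlonglongrightarrow> rep_L2 u x" using F(2)[of x] by (simp add: tendsto_cong)
    qed
  qed auto
  then show ?thesis using closed_sequentially[OF cl sD] by simp
qed

subsection \<open>Translations\<close>

definition transl :: "'a::euclidean_space \<Rightarrow> 'a L2 \<Rightarrow> 'a L2" where
  "transl y u = to_L2 (\<lambda>x. rep_L2 u (x - y))"

lemma AE_lborel_translate: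
  fixes y :: "'a::euclidean_space"
  assumes "AE x in lborel. P x"
  shows "AE x in lborel. P (x - y)"
proof -
  obtain N where N: "{x. \<not> P x} \<subseteq> N" "N \<in> sets lborel" "emeasure lborel N = 0"
    using assms by (auto simp: eventually_ae_filter null_sets_def)
  have N': "AE x in lborel. x \<notin> N" using N by (auto intro!: AE_not_in simp: null_sets_def)
  have "AE x in distr lborel borel ((+) (- y)). x \<notin> N"
    using N' by (subst lborel_distr_plus) simp
  then have "AE x in lborel. x - y \<notin> N"
    using N(2) by (subst (asm) AE_distr_iff) auto
  then show ?thesis
    by (rule eventually_mono) (use N(1) in blast)
qed

lemma integral_lborel_translate:
  fixes f :: "'a::euclidean_space \<Rightarrow> 'b::{banach, second_countable_topology}"
  assumes [measurable]: "f \<in> borel_measurable borel"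
  shows "(\<integral>x. f (x - y) \<partial>lborel) = (\<integral>x. f x \<partial>lborel)"
proof -
  have "(\<integral>x. f x \<partial>lborel) = (\<integral>x. f x \<partial>distr lborel borel ((+) (- y)))"
    by (subst lborel_distr_plus) simp
  then show ?thesis by (subst (asm) integral_distr) auto
qed

lemma nn_integral_lborel_translate:
  fixes f :: "'a::euclidean_space \<Rightarrow> ennreal"
  assumes [measurable]: "f \<in> borel_measurable borel"
  shows "(\<integral>\<^sup>+x. f (x - y) \<partial>lborel) = (\<integral>\<^sup>+x. f x \<partial>lborel)"
proof -
  have "(\<integral>\<^sup>+x. f x \<partial>lborel) = (\<integral>\<^sup>+x. f x \<partial>distr lborel borel ((+) (- y)))"
    by (subst lborel_distr_plus) simp
  then show ?thesis by (subst (asm) nn_integral_distr) auto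
qed

lemma square_integrable_translate:
  assumes "square_integrable f"
  shows "square_integrable (\<lambda>x. f (x - y))"
proof -
  have [measurable]: "f \<in> borel_measurable borel" using assms by (simp add: square_integrable_def)
  show ?thesis using assms nn_integral_lborel_translate[of "\<lambda>x. ennreal ((cmod (f x))\<^sup>2)" y]
    by (simp add: square_integrable_iff_nn)
qed

lemma transl_to_L2:
  assumes "square_integrable f"
  shows "transl y (to_L2 f) = to_L2 (\<lambda>x. f (x - y))"
  unfolding transl_def
  by (rule to_L2_eqI[OF square_integrable_translate[OF square_integrable_rep] square_integrable_translate[OF assms]
      AE_lborel_translate[OF rep_to_L2[OF assms]]])

lemma norm_transl: "norm (transl y u) = norm u"
proof -
  have "(norm (transl y u))\<^sup>2 = (norm u)\<^sup>2"
    unfolding transl_def norm_to_L2_sq[OF square_integrable_translate[OF square_integrable_rep]]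
    by (subst integral_lborel_translate[where f="\<lambda>x. (cmod (rep_L2 u x))\<^sup>2"]) (auto simp: norm_L2_sq)
  then show ?thesis by simp
qed

lemma transl_add: "transl y (u + v) = transl y u + transl y v"
proof -
  note sq = square_integrable_translate[OF square_integrable_rep]
  show ?thesis unfolding transl_def to_L2_add[OF sq sq, symmetric]
    by (rule to_L2_eqI[OF sq square_integrable_add[OF sq sq] AE_lborel_translate[OF rep_L2_add]])
qed

lemma transl_scaleR: "transl y (c *\<^sub>R u) = c *\<^sub>R transl y u"
proof -
  note sq = square_integrable_translate[OF square_integrable_rep]
  show ?thesis unfolding transl_def to_L2_scaleR[OF sq, symmetric]
    by (rule to_L2_eqI[OF sq square_integrable_scaleR[OF sq] AE_lborel_translate[OF rep_L2_scaleR]])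
qed

lemma transl_diff: "transl y (u - v) = transl y u - transl y v"
  using transl_add[of y u "(-1) *\<^sub>R v"] transl_scaleR[of y "-1" v] by simp

text \<open>Translations are linear isometries, so the vectors for which the claim holds form a
  closed subspace, and indicators of open sets suffice. For these, norm convergence follows from
  that of the inner products \<open>transl (Y k) u \<bullet> u\<close>.\<close>

lemma transl_tendsto:
  fixes Y :: "nat \<Rightarrow> 'a::euclidean_space" and u :: "'a L2"
  assumes Y: "Y \<longlonglongrightarrow> 0"
  shows "(\<lambda>k. transl (Y k) u) \<longlonglongrightarrow> u"
proof -
  define D where "D = {u :: 'a L2. (\<lambda>k. transl (Y k) u) \<longlonglongrightarrow> u}"
  have "u \<in> D"
  proof (rule L2_dense_open_indicators)
    show "subspace D" unfolding D_def subspace_def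
    proof (safe)
      have "transl y (0::'a L2) = 0" for y using transl_scaleR[of y 0 0] by simp
      then show "(\<lambda>k. transl (Y k) (0::'a L2)) \<longlonglongrightarrow> 0" by simp
    qed (auto simp: transl_add transl_scaleR intro!: tendsto_add tendsto_scaleR)
    show "closed D" unfolding closed_sequential_limits
    proof (safe)
      fix X :: "nat \<Rightarrow> 'a L2" and l assume X: "\<forall>n. X n \<in> D" and Xl: "X \<longlonglongrightarrow> l"
      show "l \<in> D" unfolding D_def
      proof (safe, rule LIMSEQ_I)
        fix r :: real assume r: "0 < r"
        obtain n where n: "norm (X n - l) < r/3" using LIMSEQ_D[OF Xl, of "r/3"] r by auto
        have "(\<lambda>k. transl (Y k) (X n)) \<longlonglongrightarrow> X n" using X by (simp add: D_def)
        then obtain N where N: "\<And>k. k \<ge> N \<Longrightarrow> norm (transl (Y k) (X n) - X n) < r/3"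
          using LIMSEQ_D[of _ "X n" "r/3"] r by force
        have "norm (transl (Y k) l - l) < r" if "k \<ge> N" for k
        proof -
          have "transl (Y k) l - l = - transl (Y k) (X n - l) + (transl (Y k) (X n) - X n) + (X n - l)"
            by (simp add: transl_diff)
          also have "norm \<dots> \<le> norm (transl (Y k) (X n - l)) + norm (transl (Y k) (X n) - X n) + norm (X n - l)"
            by (metis norm_triangle_le norm_minus_cancel norm_triangle_ineq add_right_mono)
          also have "\<dots> < r" using N[OF that] n norm_transl[of "Y k" "X n - l"] by linarith
          finally show ?thesis .
        qed
        then show "\<exists>no. \<forall>n\<ge>no. norm (transl (Y n) l - l) < r" by blast
      qed
    qed
    fix U :: "'a set" and c R assume U: "open U" "U \<subseteq> ball 0 R"
    define f where "f x = c * (indicator U x :: complex)" for x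
    have sq: "square_integrable f" unfolding f_def using U by (intro square_integrable_indicator) auto
    have [measurable]: "U \<in> sets borel" using U by auto
    have fm[measurable]: "f \<in> borel_measurable borel" unfolding f_def by measurable
    \<comment> \<open>For \<open>x \<in> U\<close> openness puts \<open>x - Y k\<close> into
      \<open>U\<close> eventually, and off \<open>U\<close> the second factor vanishes. Boundary
      points of \<open>U\<close>, where \<open>f (x - Y k)\<close> itself may fail to converge to
      \<open>f x\<close>, thus do no harm.\<close>
    have "(\<lambda>k. \<integral>x. f (x - Y k) \<bullet> f x \<partial>lborel) \<longlonglongrightarrow> (\<integral>x. f x \<bullet> f x \<partial>lborel)"
    proof (rule integral_dominated_convergence[where w="\<lambda>x. (cmod (f x))\<^sup>2"])
      show "integrable lborel (\<lambda>x. (cmod (f x))\<^sup>2)" using sq by (simp add: square_integrable_def)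
      show "AE x in lborel. (\<lambda>k. f (x - Y k) \<bullet> f x) \<longlonglongrightarrow> f x \<bullet> f x"
      proof (rule AE_I2)
        fix x
        show "(\<lambda>k. f (x - Y k) \<bullet> f x) \<longlonglongrightarrow> f x \<bullet> f x"
        proof (cases "x \<in> U")
          case True
          have "(\<lambda>k. x - Y k) \<longlonglongrightarrow> x - 0" by (intro tendsto_intros Y)
          then have "\<forall>\<^sub>F k in sequentially. x - Y k \<in> U"
            using topological_tendstoD U(1) True by fastforce
          then have "\<forall>\<^sub>F k in sequentially. f (x - Y k) \<bullet> f x = f x \<bullet> f x"
            by eventually_elim (use True in \<open>simp add: f_def\<close>)
          then show ?thesis by (rule tendsto_eventually)
        qed (simp add: f_def)
      qed
      show "AE x in lborel. norm (f (x - Y k) \<bullet> f x) \<le> (cmod (f x))\<^sup>2" for k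
        by (auto simp: f_def indicator_def power2_norm_eq_inner)
    qed auto
    then have inn: "(\<lambda>k. transl (Y k) (to_L2 f) \<bullet> to_L2 f) \<longlonglongrightarrow> to_L2 f \<bullet> to_L2 f"
      using sq square_integrable_translate[OF sq] by (simp add: transl_to_L2 inner_to_L2_eq)
    have eq: "(norm (transl y (to_L2 f) - to_L2 f))\<^sup>2 = 2 * (norm (to_L2 f))\<^sup>2 - 2 * (transl y (to_L2 f) \<bullet> to_L2 f)" for y
    proof -
      have "(norm (transl y (to_L2 f) - to_L2 f))\<^sup>2 = (norm (transl y (to_L2 f)))\<^sup>2 + (norm (to_L2 f))\<^sup>2 - 2 * (transl y (to_L2 f) \<bullet> to_L2 f)"
        by (simp add: power2_norm_eq_inner inner_diff_left inner_diff_right inner_commute)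
      then show ?thesis by (simp add: norm_transl)
    qed
    have "(\<lambda>k. (norm (transl (Y k) (to_L2 f) - to_L2 f))\<^sup>2) \<longlonglongrightarrow> 2 * (norm (to_L2 f))\<^sup>2 - 2 * (to_L2 f \<bullet> to_L2 f)"
      unfolding eq by (intro tendsto_intros inn)
    then have "(\<lambda>k. (norm (transl (Y k) (to_L2 f) - to_L2 f))\<^sup>2) \<longlonglongrightarrow> 0"
      by (simp add: power2_norm_eq_inner)
    then have "(\<lambda>k. sqrt ((norm (transl (Y k) (to_L2 f) - to_L2 f))\<^sup>2)) \<longlonglongrightarrow> sqrt 0" by (rule tendsto_real_sqrt)
    then have "(\<lambda>k. transl (Y k) (to_L2 f)) \<longlonglongrightarrow> to_L2 f" by (simp add: tendsto_norm_zero_iff LIM_zero_iff)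
    then show "to_L2 (\<lambda>x. c * indicator U x) \<in> D" by (simp add: D_def f_def[abs_def])
  qed
  then show ?thesis by (simp add: D_def)
qed

subsection \<open>Gaussians\<close>

text \<open>The case \<open>k = 1\<close> is the characteristic function of the standard normal
  distribution; the rest is the substitution \<open>x = k * y\<close>.\<close>

lemma gaussian_fourier_1d:
  assumes k: "0 < k"
  shows "integrable lborel (\<lambda>x::real. iexp (a * x) * complex_of_real (exp (- x\<^sup>2 / (2 * k\<^sup>2))))"
    and "(\<integral>x. iexp (a * x) * complex_of_real (exp (- x\<^sup>2 / (2 * k\<^sup>2))) \<partial>lborel)
      = complex_of_real (k * sqrt (2 * pi) * exp (- (k * a)\<^sup>2 / 2))"
proof -
  have int: "integrable lborel (\<lambda>x::real. exp (- x\<^sup>2 / 2))"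
    using integrable_mult_right[OF integrable_normal_density[of 1 0], of "sqrt (2 * pi)"]
    by (simp add: std_normal_density_def)
  then have int1: "integrable lborel (\<lambda>x. iexp (b * x) * complex_of_real (exp (- x\<^sup>2 / 2)))" for b
    by (rule Bochner_Integration.integrable_bound) (auto simp: norm_mult)
  have E: "(\<integral>x. iexp (t * x) * complex_of_real (exp (- x\<^sup>2 / 2)) \<partial>lborel) = complex_of_real (sqrt (2 * pi) * exp (- (t^2) / 2))" for t
  proof -
    have "complex_of_real (exp (- (t^2) / 2)) = char std_normal_distribution t"
      by (simp add: char_std_normal_distribution)
    also have "\<dots> = (\<integral>x. std_normal_density x *\<^sub>R iexp (t * x) \<partial>lborel)"
      unfolding char_def by (subst integral_density) (auto simp: normal_density_nonneg)
    also have "\<dots> = (\<integral>x. (1 / sqrt (2 * pi)) *\<^sub>R (iexp (t * x) * complex_of_real (exp (- x\<^sup>2 / 2))) \<partial>lborel)"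
      by (intro Bochner_Integration.integral_cong)
         (auto simp: std_normal_density_def scaleR_conv_of_real mult_ac)
    also have "\<dots> = (1 / sqrt (2 * pi)) *\<^sub>R (\<integral>x. iexp (t * x) * complex_of_real (exp (- x\<^sup>2 / 2)) \<partial>lborel)"
      by (rule integral_scaleR_right)
    finally have "sqrt (2 * pi) *\<^sub>R complex_of_real (exp (- (t^2) / 2)) =
        sqrt (2 * pi) *\<^sub>R (1 / sqrt (2 * pi)) *\<^sub>R (\<integral>x. iexp (t * x) * complex_of_real (exp (- x\<^sup>2 / 2)) \<partial>lborel)"
      by simp
    then show ?thesis by (simp add: scaleR_conv_of_real)
  qed
  have eq: "iexp (a * (0 + k * x)) * complex_of_real (exp (- (0 + k * x)\<^sup>2 / (2 * k\<^sup>2))) = iexp ((k * a) * x) * complex_of_real (exp (- x\<^sup>2 / 2))" for x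
    using k by (simp add: power_mult_distrib mult_ac)
  show "integrable lborel (\<lambda>x::real. iexp (a * x) * complex_of_real (exp (- x\<^sup>2 / (2 * k\<^sup>2))))"
    using lborel_integrable_real_affine_iff[of k "\<lambda>x. iexp (a * x) * complex_of_real (exp (- x\<^sup>2 / (2 * k\<^sup>2)))" 0] k int1[of "k * a"]
    unfolding eq by auto
  show "(\<integral>x. iexp (a * x) * complex_of_real (exp (- x\<^sup>2 / (2 * k\<^sup>2))) \<partial>lborel)
      = complex_of_real (k * sqrt (2 * pi) * exp (- (k * a)\<^sup>2 / 2))"
    using lborel_integral_real_affine[of k "\<lambda>x. iexp (a * x) * complex_of_real (exp (- x\<^sup>2 / (2 * k\<^sup>2)))" 0] k
    unfolding eq E by (simp add: scaleR_conv_of_real mult_ac)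
qed

text \<open>Both the phase and the Gaussian split over the coordinates, and integrals of products
  over a product measure reduce to dimension one.\<close>

lemma gaussian_fourier:
  fixes z :: "'a::euclidean_space"
  assumes k: "0 < k"
  shows "integrable lborel (\<lambda>\<xi>. iexp (z \<bullet> \<xi>) * complex_of_real (exp (- (norm \<xi>)\<^sup>2 / (2 * k\<^sup>2))))" (is "integrable lborel ?f")
    and "(\<integral>\<xi>. iexp (z \<bullet> \<xi>) * complex_of_real (exp (- (norm \<xi>)\<^sup>2 / (2 * k\<^sup>2))) \<partial>lborel)
      = complex_of_real ((k * sqrt (2 * pi)) ^ DIM('a) * exp (- k\<^sup>2 * (norm z)\<^sup>2 / 2))"
proof -
  interpret product_sigma_finite "\<lambda>b::'a. lborel :: real measure" ..
  define g where "g b = (\<lambda>x::real. iexp ((z \<bullet> b) * x) * complex_of_real (exp (- x\<^sup>2 / (2 * k\<^sup>2))))" for b :: 'a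
  have int: "integrable lborel (g b)" for b unfolding g_def by (rule gaussian_fourier_1d(1)[OF k])
  let ?T = "\<lambda>f. \<Sum>b\<in>Basis. f b *\<^sub>R (b :: 'a)"
  have prod: "?f (?T f) = (\<Prod>b\<in>Basis. g b (f b))" for f
  proof -
    have ip: "z \<bullet> ?T f = (\<Sum>b\<in>Basis. (z \<bullet> b) * f b)"
      by (simp add: inner_sum_right mult.commute)
    have nn: "(norm (?T f))\<^sup>2 = (\<Sum>b\<in>Basis. (f b)\<^sup>2)"
      by (simp only: power2_norm_eq_inner euclidean_inner[of "?T f" "?T f"])
         (simp add: inner_sum_left_Basis power2_eq_square)
    have "iexp (z \<bullet> ?T f) = (\<Prod>b\<in>Basis. iexp ((z \<bullet> b) * f b))"
      unfolding ip by (simp add: exp_sum sum_distrib_left)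
    moreover have "complex_of_real (exp (- (norm (?T f))\<^sup>2 / (2 * k\<^sup>2))) = (\<Prod>b\<in>Basis. complex_of_real (exp (- (f b)\<^sup>2 / (2 * k\<^sup>2))))"
      unfolding nn by (simp add: exp_sum sum_negf sum_divide_distrib flip: of_real_prod)
         (simp add: exp_sum sum_negf[symmetric] sum_divide_distrib)
    ultimately show ?thesis by (simp add: g_def prod.distrib)
  qed
  have Tm: "?T \<in> (\<Pi>\<^sub>M b\<in>Basis. lborel) \<rightarrow>\<^sub>M borel" by measurable
  have fm[measurable]: "?f \<in> borel_measurable borel" by measurable
  have pint: "integrable (\<Pi>\<^sub>M b\<in>(Basis::'a set). lborel) (\<lambda>f. \<Prod>b\<in>Basis. g b (f b))"
    by (rule product_integrable_prod[OF finite_Basis int])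
  show "integrable lborel ?f"
    by (subst lborel_eq, subst integrable_distr_eq[OF Tm fm]) (use pint prod in simp)
  have "(\<integral>\<xi>. ?f \<xi> \<partial>lborel) = (\<integral>f. (\<Prod>b\<in>Basis. g b (f b)) \<partial>(\<Pi>\<^sub>M b\<in>(Basis::'a set). lborel))"
    by (subst lborel_eq, subst integral_distr[OF Tm fm]) (simp only: prod)
  also have "\<dots> = (\<Prod>b\<in>Basis. integral\<^sup>L lborel (g b))"
    by (rule product_integral_prod[OF finite_Basis int])
  also have "\<dots> = (\<Prod>b\<in>(Basis::'a set). complex_of_real (k * sqrt (2 * pi) * exp (- (k * (z \<bullet> b))\<^sup>2 / 2)))"
    unfolding g_def by (subst gaussian_fourier_1d(2)[OF k]) simp
  also have "\<dots> = complex_of_real ((k * sqrt (2 * pi)) ^ DIM('a) * exp (\<Sum>b\<in>(Basis::'a set). - (k * (z \<bullet> b))\<^sup>2 / 2))"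
    by (simp only: of_real_prod[symmetric] prod.distrib prod_constant exp_sum[OF finite_Basis] power_mult_distrib)
  also have "(\<Sum>b\<in>(Basis::'a set). - (k * (z \<bullet> b))\<^sup>2 / 2) = - k\<^sup>2 * (norm z)\<^sup>2 / 2"
  proof -
    have "(norm z)\<^sup>2 = (\<Sum>b\<in>Basis. (z \<bullet> b)\<^sup>2)"
      unfolding power2_norm_eq_inner euclidean_inner[of z z] by (simp only: power2_eq_square)
    then show ?thesis
      by (simp add: sum_distrib_left sum_divide_distrib power_mult_distrib sum_negf)
  qed
  finally show "(\<integral>\<xi>. ?f \<xi> \<partial>lborel) = complex_of_real ((k * sqrt (2 * pi)) ^ DIM('a) * exp (- k\<^sup>2 * (norm z)\<^sup>2 / 2))" .
qed

section \<open>Plancherel's theorem\<close>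

text \<open>The sign \<open>s\<close> stays a parameter so that the transform and its inverse share
  every proof; the adjoint for \<open>s\<close> is the transform for \<open>- s\<close>.\<close>

definition ftrans :: "real \<Rightarrow> ('a::euclidean_space \<Rightarrow> complex) \<Rightarrow> 'a \<Rightarrow> complex" where
  "ftrans s f \<xi> = (\<integral>x. iexp (s * (x \<bullet> \<xi>)) * f x \<partial>lborel)"

lemma integrable_iexp_mult:
  assumes "integrable lborel f"
  shows "integrable lborel (\<lambda>x::'a::euclidean_space. iexp (s * (x \<bullet> \<xi>)) * f x)"
proof -
  have [measurable]: "f \<in> borel_measurable borel" using assms by auto
  show ?thesis using assms
    by (rule Bochner_Integration.integrable_bound) (auto simp: norm_mult)
qed

lemma ftrans_measurable [measurable]:
  assumes [measurable]: "f \<in> borel_measurable borel"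
  shows "ftrans s f \<in> borel_measurable borel"
proof -
  have "(\<lambda>\<xi>. \<integral>x. iexp (s * (x \<bullet> \<xi>)) * f x \<partial>lborel) \<in> borel_measurable borel"
    by (rule lborel.borel_measurable_lebesgue_integral) measurable
  then show ?thesis by (simp add: ftrans_def[abs_def])
qed

lemma norm_ftrans_le:
  assumes "integrable lborel f"
  shows "cmod (ftrans s f \<xi>) \<le> (\<integral>x. cmod (f x) \<partial>lborel)"
proof -
  have "cmod (ftrans s f \<xi>) \<le> (\<integral>x. cmod (iexp (s * (x \<bullet> \<xi>)) * f x) \<partial>lborel)"
    unfolding ftrans_def by (rule integral_norm_bound)
  then show ?thesis by (simp add: norm_mult)
qed

lemma ftrans_diff:
  "integrable lborel f \<Longrightarrow> integrable lborel g \<Longrightarrow> ftrans s (\<lambda>x. f x - g x) \<xi> = ftrans s f \<xi> - ftrans s g \<xi>"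
  unfolding ftrans_def right_diff_distrib
  by (rule Bochner_Integration.integral_diff) (rule integrable_iexp_mult, assumption)+

lemma borel_measurable_cnj [measurable (raw)]:
  assumes "f \<in> borel_measurable M"
  shows "(\<lambda>x. cnj (f x)) \<in> borel_measurable M"
  by (rule borel_measurable_continuous_on[OF _ assms]) (intro continuous_intros)

lemma ftrans_cnj: "ftrans s (\<lambda>x. cnj (f x)) \<xi> = cnj (ftrans (- s) f \<xi>)"
proof -
  have "cnj (ftrans (- s) f \<xi>) = (\<integral>x. cnj (iexp ((- s) * (x \<bullet> \<xi>)) * f x) \<partial>lborel)"
    unfolding ftrans_def by (rule Bochner_Integration.integral_cnj[symmetric])
  then show ?thesis by (simp add: ftrans_def exp_cnj)
qed

lemma ftrans_multiplication:
  fixes f g :: "'a::euclidean_space \<Rightarrow> complex"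
  assumes f: "integrable lborel f" and g: "integrable lborel g"
  shows "(\<integral>\<xi>. ftrans s f \<xi> * g \<xi> \<partial>lborel) = (\<integral>x. f x * ftrans s g x \<partial>lborel)"
proof -
  have [measurable]: "f \<in> borel_measurable borel" "g \<in> borel_measurable borel" using f g by auto
  let ?h = "\<lambda>x \<xi>. iexp (s * (x \<bullet> \<xi>)) * f x * g \<xi>"
  have int: "integrable (lborel \<Otimes>\<^sub>M lborel) (case_prod ?h)"
  proof (rule lborel_pair.Fubini_integrable)
    show "case_prod ?h \<in> borel_measurable (lborel \<Otimes>\<^sub>M lborel)" by measurable
    have "(\<lambda>x. \<integral>\<xi>. norm (case_prod ?h (x, \<xi>)) \<partial>lborel) = (\<lambda>x. cmod (f x) * (\<integral>\<xi>. cmod (g \<xi>) \<partial>lborel))"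
      by (simp add: norm_mult)
    then show "integrable lborel (\<lambda>x. \<integral>\<xi>. norm (case_prod ?h (x, \<xi>)) \<partial>lborel)"
      using f by (simp only:) (intro integrable_mult_left integrable_norm)
    show "AE x in lborel. integrable lborel (\<lambda>\<xi>. case_prod ?h (x, \<xi>))"
    proof (rule AE_I2)
      fix x
      have "integrable lborel (\<lambda>\<xi>. f x * (iexp (s * (\<xi> \<bullet> x)) * g \<xi>))"
        by (intro integrable_mult_right integrable_iexp_mult g)
      then show "integrable lborel (\<lambda>\<xi>. case_prod ?h (x, \<xi>))" by (simp add: mult_ac inner_commute)
    qed
  qed
  have "(\<integral>\<xi>. ftrans s f \<xi> * g \<xi> \<partial>lborel) = (\<integral>\<xi>. (\<integral>x. ?h x \<xi> \<partial>lborel) \<partial>lborel)"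
    unfolding ftrans_def by (intro Bochner_Integration.integral_cong refl integral_mult_left_zero[symmetric])
  also have "\<dots> = (\<integral>x. (\<integral>\<xi>. ?h x \<xi> \<partial>lborel) \<partial>lborel)"
    by (rule lborel_pair.Fubini_integral[OF int])
  also have "\<dots> = (\<integral>x. f x * ftrans s g x \<partial>lborel)"
  proof (intro Bochner_Integration.integral_cong refl)
    fix x
    have "(\<integral>\<xi>. ?h x \<xi> \<partial>lborel) = (\<integral>\<xi>. f x * (iexp (s * (\<xi> \<bullet> x)) * g \<xi>) \<partial>lborel)"
      by (simp add: mult_ac inner_commute)
    then show "(\<integral>\<xi>. ?h x \<xi> \<partial>lborel) = f x * ftrans s g x" by (simp add: ftrans_def)
  qed
  finally show ?thesis .
qed

abbreviation gss :: "real \<Rightarrow> 'a::euclidean_space \<Rightarrow> real" where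
  "gss k \<xi> \<equiv> exp (- (norm \<xi>)\<^sup>2 / (2 * k\<^sup>2))"

lemma integral_lborel_scale:
  fixes f :: "'a::euclidean_space \<Rightarrow> complex"
  assumes "f \<in> borel_measurable borel" "c \<noteq> 0"
  shows "(\<integral>y. f y \<partial>lborel) = \<bar>c\<bar> ^ DIM('a) *\<^sub>R (\<integral>w. f (t + c *\<^sub>R w) \<partial>lborel)"
proof -
  have [measurable]: "f \<in> borel_measurable borel" using assms by simp
  have "(\<integral>y. f y \<partial>lborel) = (\<integral>y. f y \<partial>density (distr lborel borel (\<lambda>x. t + c *\<^sub>R x)) (\<lambda>_. ennreal (\<bar>c\<bar>^DIM('a))))"
    by (subst lborel_affine[OF assms(2), of t]) (simp add: ennreal_power)
  also have "\<dots> = (\<integral>y. (\<bar>c\<bar>^DIM('a)) *\<^sub>R f y \<partial>distr lborel borel (\<lambda>x. t + c *\<^sub>R x))"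
    by (subst integral_density) auto
  also have "\<dots> = (\<integral>w. (\<bar>c\<bar>^DIM('a)) *\<^sub>R f (t + c *\<^sub>R w) \<partial>lborel)"
    by (subst integral_distr) auto
  finally show ?thesis by simp
qed

text \<open>A regularised Plancherel identity. The Gaussian weight makes all double integrals
  absolutely convergent; moved to the other side it becomes a Gaussian average of the correlations
  of \<open>f\<close> with its translates. After the substitution \<open>w = k * (x - y)\<close> the
  parameter \<open>k\<close> sits only in the translation, which tends to \<open>0\<close> as
  \<open>k\<close> grows.\<close>

lemma ftrans_gauss_identity:
  fixes f :: "'a::euclidean_space \<Rightarrow> complex"
  assumes f: "integrable lborel f" "square_integrable f" and s: "s = 1 \<or> s = -1" and k: "0 < k"
  shows "(\<integral>\<xi>. (cmod (ftrans s f \<xi>))\<^sup>2 * gss k \<xi> \<partial>lborel)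
    = (\<integral>w. sqrt (2 * pi) ^ DIM('a) * exp (- (norm w)\<^sup>2 / 2) * (to_L2 f \<bullet> transl ((1/k) *\<^sub>R w) (to_L2 f)) \<partial>lborel)"
    and "integrable lborel (\<lambda>\<xi>. (cmod (ftrans s f \<xi>))\<^sup>2 * gss k \<xi>)"
proof -
  have fm[measurable]: "f \<in> borel_measurable borel" using f by auto
  define B where "B = (\<integral>x. cmod (f x) \<partial>lborel)"
  have Fb: "cmod (ftrans s f \<xi>) \<le> B" for s \<xi> unfolding B_def by (rule norm_ftrans_le[OF f(1)])
  have gint: "integrable lborel (\<lambda>\<xi>::'a. complex_of_real (gss k \<xi>))"
    using gaussian_fourier(1)[OF k, of "0::'a"] by simp
  have gintr: "integrable lborel (\<lambda>\<xi>::'a. gss k \<xi>)"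
    using integrable_Re[OF gint] by simp
  \<comment> \<open>Chosen so that \<open>ftrans s f \<xi> * ?g \<xi>\<close> is the weighted
    square; the multiplication formula then transfers one transform onto \<open>?g\<close>.\<close>
  let ?g = "\<lambda>\<xi>. cnj (ftrans s f \<xi>) * complex_of_real (gss k \<xi>)"
  have g: "integrable lborel ?g"
  proof (rule Bochner_Integration.integrable_bound[OF integrable_mult_right[OF gintr, of B]])
    show "AE x in lborel. norm (?g x) \<le> norm (B * gss k x)"
      using order_trans[OF norm_ge_zero Fb] Fb
      by (intro AE_I2) (auto simp: norm_mult abs_mult intro!: mult_right_mono)
  qed measurable
  define C where "C = sqrt (2 * pi) ^ DIM('a)"
  define G where "G z = complex_of_real (C * exp (- (norm z)\<^sup>2 / 2))" for z :: 'a
  have Gm[measurable]: "G \<in> borel_measurable borel" unfolding G_def[abs_def] by measurable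
  have Gk: "(\<integral>\<xi>. iexp (z \<bullet> \<xi>) * complex_of_real (gss k \<xi>) \<partial>lborel) = complex_of_real (k ^ DIM('a)) * G (k *\<^sub>R z)" for z
    using gaussian_fourier(2)[OF k, of z] k by (simp add: G_def C_def power_mult_distrib)
  \<comment> \<open>The transform of \<open>?g\<close> is a convolution of \<open>cnj f\<close> with
    a Gaussian. It comes from a second use of the multiplication formula, now with the sign
    \<open>- s\<close> because \<open>?g\<close> contains a conjugated transform.\<close>
  have Fg: "ftrans s ?g x = (\<integral>w. cnj (f (x - (1/k) *\<^sub>R w)) * G w \<partial>lborel)" for x
  proof -
    let ?h = "\<lambda>\<xi>. iexp (s * (x \<bullet> \<xi>)) * complex_of_real (gss k \<xi>)"
    have h: "integrable lborel ?h" using integrable_iexp_mult[OF gint, of s x] by (simp add: inner_commute)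
    have "ftrans s ?g x = (\<integral>\<xi>. ftrans (-s) (\<lambda>x. cnj (f x)) \<xi> * ?h \<xi> \<partial>lborel)"
      unfolding ftrans_def[of s ?g] by (simp add: ftrans_cnj mult_ac inner_commute)
    also have "\<dots> = (\<integral>y. cnj (f y) * ftrans (-s) ?h y \<partial>lborel)"
      by (rule ftrans_multiplication) (use f(1) h in auto)
    also have "\<dots> = (\<integral>y. cnj (f y) * (complex_of_real (k ^ DIM('a)) * G (k *\<^sub>R (x - y))) \<partial>lborel)"
    proof (intro Bochner_Integration.integral_cong refl arg_cong2[where f="(*)"])
      fix y
      have "ftrans (-s) ?h y = (\<integral>\<xi>. iexp ((s *\<^sub>R (x - y)) \<bullet> \<xi>) * complex_of_real (gss k \<xi>) \<partial>lborel)"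
        unfolding ftrans_def
      proof (intro Bochner_Integration.integral_cong refl)
        fix \<xi>
        have e: "(s *\<^sub>R (x - y)) \<bullet> \<xi> = (- s) * (\<xi> \<bullet> y) + s * (x \<bullet> \<xi>)"
          by (simp add: inner_diff_left inner_diff_right inner_commute right_diff_distrib)
        have "iexp ((s *\<^sub>R (x - y)) \<bullet> \<xi>) = iexp ((- s) * (\<xi> \<bullet> y)) * iexp (s * (x \<bullet> \<xi>))"
          unfolding e by (simp only: of_real_add distrib_left exp_add)
        then show "iexp ((- s) * (\<xi> \<bullet> y)) * ?h \<xi> = iexp ((s *\<^sub>R (x - y)) \<bullet> \<xi>) * complex_of_real (gss k \<xi>)"
          by (simp only: mult.assoc)
      qed
      also have "\<dots> = complex_of_real (k ^ DIM('a)) * G (k *\<^sub>R (x - y))"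
        unfolding Gk using s by (auto simp: G_def norm_minus_commute simp flip: scaleR_minus_right)
      finally show "ftrans (-s) ?h y = complex_of_real (k ^ DIM('a)) * G (k *\<^sub>R (x - y))" .
    qed
    \<comment> \<open>Substitution \<open>y = x - w / k\<close>; its Jacobian cancels the factor
      \<open>k ^ DIM('a)\<close> from the transform of the Gaussian.\<close>
    also have "\<dots> = \<bar>-1/k\<bar> ^ DIM('a) *\<^sub>R (\<integral>w. cnj (f (x + (-1/k) *\<^sub>R w)) * (complex_of_real (k ^ DIM('a)) * G (k *\<^sub>R (x - (x + (-1/k) *\<^sub>R w)))) \<partial>lborel)"
      by (rule integral_lborel_scale) (use k in auto)
    also have "\<dots> = \<bar>-1/k\<bar> ^ DIM('a) *\<^sub>R (\<integral>w. complex_of_real (k ^ DIM('a)) * (cnj (f (x - (1/k) *\<^sub>R w)) * G w) \<partial>lborel)"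
      using k by (simp add: mult_ac)
    also have "\<dots> = (\<integral>w. cnj (f (x - (1/k) *\<^sub>R w)) * G w \<partial>lborel)"
      using k by (simp add: scaleR_conv_of_real power_divide)
    finally show ?thesis .
  qed
  let ?H = "\<lambda>w x. f x * (cnj (f (x - (1/k) *\<^sub>R w)) * G w)"
  have u: "square_integrable (\<lambda>x. f (x - y))" for y by (rule square_integrable_translate[OF f(2)])
  have sqc: "integrable lborel (\<lambda>x. f x * cnj (f (x - y)))" for y
  proof (rule Bochner_Integration.integrable_bound)
    show "integrable lborel (\<lambda>x. (cmod (f x))\<^sup>2 + (cmod (f (x - y)))\<^sup>2)"
      using f(2) u[of y] by (auto simp: square_integrable_def)
    show "AE x in lborel. norm (f x * cnj (f (x - y))) \<le> norm ((cmod (f x))\<^sup>2 + (cmod (f (x - y)))\<^sup>2)"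
    proof (rule AE_I2)
      fix x
      show "norm (f x * cnj (f (x - y))) \<le> norm ((cmod (f x))\<^sup>2 + (cmod (f (x - y)))\<^sup>2)"
      proof -
        have "cmod (f x) * cmod (f (x - y)) \<le> (cmod (f x))\<^sup>2 + (cmod (f (x - y)))\<^sup>2"
          using sum_squares_bound[of "cmod (f x)" "cmod (f (x - y))"]
            mult_nonneg_nonneg[OF norm_ge_zero[of "f x"] norm_ge_zero[of "f (x - y)"]] by linarith
        then show ?thesis by (simp add: norm_mult)
      qed
    qed
  qed measurable
  have nu: "(norm (to_L2 f))\<^sup>2 = (\<integral>x. (cmod (f x))\<^sup>2 \<partial>lborel)" by (rule norm_to_L2_sq[OF f(2)])
  have G1: "integrable lborel (\<lambda>w. cmod (G w))"
  proof -
    have "integrable lborel (\<lambda>w::'a. complex_of_real (gss 1 w))" using gaussian_fourier(1)[of 1 "0::'a"] by simp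
    then have "integrable lborel (\<lambda>w::'a. complex_of_real C * complex_of_real (gss 1 w))" by (rule integrable_mult_right)
    then have "integrable lborel G" by (simp add: G_def[abs_def])
    then show ?thesis by (rule integrable_norm)
  qed
  \<comment> \<open>Uniform in \<open>y\<close>, since by translation invariance both halves of the
    arithmetic-geometric mean bound integrate to the same value. This is the bound behind Fubini's
    theorem below.\<close>
  have abs_bd: "(\<integral>x. cmod (f x * cnj (f (x - y))) \<partial>lborel) \<le> (norm (to_L2 f))\<^sup>2" for y
  proof -
    have i1: "integrable lborel (\<lambda>x. (cmod (f x))\<^sup>2)" "integrable lborel (\<lambda>x. (cmod (f (x - y)))\<^sup>2)"
      using f(2) u[of y] by (auto simp: square_integrable_def)
    have "(\<integral>x. cmod (f x * cnj (f (x - y))) \<partial>lborel) \<le> (\<integral>x. ((cmod (f x))\<^sup>2 + (cmod (f (x - y)))\<^sup>2) / 2 \<partial>lborel)"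
    proof (rule integral_mono)
      show "integrable lborel (\<lambda>x. cmod (f x * cnj (f (x - y))))" by (rule integrable_norm[OF sqc])
      show "integrable lborel (\<lambda>x. ((cmod (f x))\<^sup>2 + (cmod (f (x - y)))\<^sup>2) / 2)" using i1 by auto
      show "cmod (f x * cnj (f (x - y))) \<le> ((cmod (f x))\<^sup>2 + (cmod (f (x - y)))\<^sup>2) / 2" for x
        using sum_squares_bound[of "cmod (f x)" "cmod (f (x - y))"] by (simp add: norm_mult)
    qed
    also have "\<dots> = ((\<integral>x. (cmod (f x))\<^sup>2 \<partial>lborel) + (\<integral>x. (cmod (f (x - y)))\<^sup>2 \<partial>lborel)) / 2"
      using i1 by simp
    also have "(\<integral>x. (cmod (f (x - y)))\<^sup>2 \<partial>lborel) = (\<integral>x. (cmod (f x))\<^sup>2 \<partial>lborel)"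
      by (rule integral_lborel_translate[where f="\<lambda>x. (cmod (f x))\<^sup>2"]) simp
    finally show ?thesis by (simp add: nu)
  qed
  have Hint: "integrable (lborel \<Otimes>\<^sub>M lborel) (case_prod ?H)"
  proof (rule lborel_pair.Fubini_integrable)
    show Hm: "case_prod ?H \<in> borel_measurable (lborel \<Otimes>\<^sub>M lborel)" by measurable
    show "integrable lborel (\<lambda>w. \<integral>x. norm (case_prod ?H (w, x)) \<partial>lborel)"
    proof (rule Bochner_Integration.integrable_bound[OF integrable_mult_right[OF G1, of "(norm (to_L2 f))\<^sup>2"]])
      show "(\<lambda>w. \<integral>x. norm (case_prod ?H (w, x)) \<partial>lborel) \<in> borel_measurable lborel"
        by (rule lborel.borel_measurable_lebesgue_integral) (use Hm in measurable)
      show "AE w in lborel. norm (\<integral>x. norm (case_prod ?H (w, x)) \<partial>lborel) \<le> norm ((norm (to_L2 f))\<^sup>2 * cmod (G w))"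
      proof (rule AE_I2)
        fix w
        have "(\<integral>x. norm (case_prod ?H (w, x)) \<partial>lborel) = (\<integral>x. cmod (f x * cnj (f (x - (1/k) *\<^sub>R w))) \<partial>lborel) * cmod (G w)"
          by (simp add: norm_mult mult.assoc[symmetric])
        then show "norm (\<integral>x. norm (case_prod ?H (w, x)) \<partial>lborel) \<le> norm ((norm (to_L2 f))\<^sup>2 * cmod (G w))"
          using abs_bd[of "(1/k) *\<^sub>R w"] by (simp add: abs_mult mult_right_mono)
      qed
    qed
    show "AE w in lborel. integrable lborel (\<lambda>x. case_prod ?H (w, x))"
      using integrable_mult_left[OF sqc] by (intro AE_I2) (simp add: mult.assoc[symmetric])
  qed
  have Hin: "(\<integral>x. ?H w x \<partial>lborel) = (\<integral>x. f x * cnj (f (x - (1/k) *\<^sub>R w)) \<partial>lborel) * G w" for w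
    by (simp add: mult.assoc[symmetric])
  have "(\<integral>\<xi>. ftrans s f \<xi> * ?g \<xi> \<partial>lborel) = (\<integral>x. f x * ftrans s ?g x \<partial>lborel)"
    by (rule ftrans_multiplication[OF f(1) g])
  also have "\<dots> = (\<integral>x. (\<integral>w. ?H w x \<partial>lborel) \<partial>lborel)"
    unfolding Fg by simp
  also have "\<dots> = (\<integral>w. (\<integral>x. ?H w x \<partial>lborel) \<partial>lborel)"
    by (rule lborel_pair.Fubini_integral[OF Hint])
  finally have main: "(\<integral>\<xi>. ftrans s f \<xi> * ?g \<xi> \<partial>lborel) = (\<integral>w. (\<integral>x. f x * cnj (f (x - (1/k) *\<^sub>R w)) \<partial>lborel) * G w \<partial>lborel)"
    unfolding Hin .
  have lhs: "ftrans s f \<xi> * ?g \<xi> = complex_of_real ((cmod (ftrans s f \<xi>))\<^sup>2 * gss k \<xi>)" for \<xi>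
    by (simp only: of_real_mult complex_norm_square mult.assoc)
  have li: "integrable lborel (\<lambda>\<xi>. ftrans s f \<xi> * ?g \<xi>)"
  proof (rule Bochner_Integration.integrable_bound[OF integrable_mult_right[OF integrable_norm[OF g], of B]])
    show "AE x in lborel. norm (ftrans s f x * ?g x) \<le> norm (B * norm (?g x))"
      using order_trans[OF norm_ge_zero Fb] Fb
      by (intro AE_I2) (auto simp: norm_mult abs_mult intro!: mult_right_mono)
  qed measurable
  show int1: "integrable lborel (\<lambda>\<xi>. (cmod (ftrans s f \<xi>))\<^sup>2 * gss k \<xi>)"
    using integrable_Re[OF li] unfolding lhs Re_complex_of_real .
  have ri: "integrable lborel (\<lambda>w. (\<integral>x. f x * cnj (f (x - (1/k) *\<^sub>R w)) \<partial>lborel) * G w)"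
    using lborel_pair.integrable_fst[OF Hint] unfolding Hin .
  have re: "Re ((\<integral>x. f x * cnj (f (x - (1/k) *\<^sub>R w)) \<partial>lborel) * G w) = C * exp (- (norm w)\<^sup>2 / 2) * (to_L2 f \<bullet> transl ((1/k) *\<^sub>R w) (to_L2 f))" for w
  proof -
    have "Re (\<integral>x. f x * cnj (f (x - (1/k) *\<^sub>R w)) \<partial>lborel) = (\<integral>x. f x \<bullet> f (x - (1/k) *\<^sub>R w) \<partial>lborel)"
      by (subst integral_Re[OF sqc, symmetric]) (simp add: inner_complex_def)
    also have "\<dots> = to_L2 f \<bullet> transl ((1/k) *\<^sub>R w) (to_L2 f)"
      by (simp add: transl_to_L2[OF f(2)] inner_to_L2_eq[OF f(2) u])
    finally show ?thesis by (simp add: G_def del: of_real_mult of_real_exp)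
  qed
  have "(\<integral>\<xi>. (cmod (ftrans s f \<xi>))\<^sup>2 * gss k \<xi> \<partial>lborel) = Re (\<integral>\<xi>. ftrans s f \<xi> * ?g \<xi> \<partial>lborel)"
    using integral_Re[OF li] by (simp only: lhs Re_complex_of_real)
  also have "\<dots> = (\<integral>w. C * exp (- (norm w)\<^sup>2 / 2) * (to_L2 f \<bullet> transl ((1/k) *\<^sub>R w) (to_L2 f)) \<partial>lborel)"
    unfolding main using integral_Re[OF ri] by (simp only: re)
  finally show "(\<integral>\<xi>. (cmod (ftrans s f \<xi>))\<^sup>2 * gss k \<xi> \<partial>lborel)
    = (\<integral>w. sqrt (2 * pi) ^ DIM('a) * exp (- (norm w)\<^sup>2 / 2) * (to_L2 f \<bullet> transl ((1/k) *\<^sub>R w) (to_L2 f)) \<partial>lborel)"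
    by (simp only: C_def)
qed

text \<open>Let \<open>k\<close> tend to infinity in the regularised identity: monotone convergence
  on the frequency side, dominated convergence and continuity of translations on the other. The
  constant \<open>(2 * pi) ^ DIM('a)\<close> is \<open>C * C\<close>, one factor standing in the
  identity and one being the integral of the Gaussian. The nonnegative integral is used because
  finiteness of the left side is part of the claim.\<close>

lemma nn_ftrans_plancherel:
  fixes f :: "'a::euclidean_space \<Rightarrow> complex"
  assumes f: "integrable lborel f" "square_integrable f" and s: "s = 1 \<or> s = -1"
  shows "(\<integral>\<^sup>+\<xi>. ennreal ((cmod (ftrans s f \<xi>))\<^sup>2) \<partial>lborel) = ennreal ((2 * pi) ^ DIM('a) * (norm (to_L2 f))\<^sup>2)"
proof -
  have fm[measurable]: "f \<in> borel_measurable borel" using f by auto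
  define C where "C = sqrt (2 * pi) ^ DIM('a)"
  have C0: "0 \<le> C" by (simp add: C_def)
  define u where "u = to_L2 f"
  define k where "k i = real (Suc i)" for i
  have gint: "integrable lborel (\<lambda>w::'a. exp (- (norm w)\<^sup>2 / 2))"
    using integrable_Re[OF gaussian_fourier(1)[of 1 "0::'a"]] by simp
  have g1: "(\<integral>w. exp (- (norm (w::'a))\<^sup>2 / 2) \<partial>lborel) = C"
    using arg_cong[OF gaussian_fourier(2)[of 1 "0::'a"], of Re] integral_Re[OF gaussian_fourier(1)[of 1 "0::'a"]]
    by (simp add: C_def)
  have k0: "0 < k i" for i by (simp add: k_def)
  have lim: "(\<lambda>i. \<integral>w. C * exp (- (norm w)\<^sup>2 / 2) * (u \<bullet> transl ((1/k i) *\<^sub>R w) u) \<partial>lborel)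
      \<longlonglongrightarrow> (\<integral>w. C * exp (- (norm (w::'a))\<^sup>2 / 2) * (norm u)\<^sup>2 \<partial>lborel)"
  proof (rule integral_dominated_convergence[where w="\<lambda>w. C * exp (- (norm w)\<^sup>2 / 2) * (norm u)\<^sup>2"])
    show "integrable lborel (\<lambda>w::'a. C * exp (- (norm w)\<^sup>2 / 2) * (norm u)\<^sup>2)"
      using gint by auto
    show "(\<lambda>w. C * exp (- (norm w)\<^sup>2 / 2) * (u \<bullet> transl ((1/k i) *\<^sub>R w) u)) \<in> borel_measurable lborel" for i
    proof -
      have "(\<lambda>w. \<integral>x. f x \<bullet> f (x - (1/k i) *\<^sub>R w) \<partial>lborel) \<in> borel_measurable borel"
        by (rule lborel.borel_measurable_lebesgue_integral) measurable
      then have [measurable]: "(\<lambda>w. u \<bullet> transl ((1/k i) *\<^sub>R w) u) \<in> borel_measurable borel"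
        by (simp add: u_def transl_to_L2[OF f(2)] inner_to_L2_eq[OF f(2) square_integrable_translate[OF f(2)]])
      show ?thesis by measurable
    qed
    show "AE w in lborel. (\<lambda>i. C * exp (- (norm (w::'a))\<^sup>2 / 2) * (u \<bullet> transl ((1/k i) *\<^sub>R w) u)) \<longlonglongrightarrow> C * exp (- (norm w)\<^sup>2 / 2) * (norm u)\<^sup>2"
    proof (rule AE_I2)
      fix w :: 'a
      have "(\<lambda>i. 1 / k i) \<longlonglongrightarrow> 0" unfolding k_def using LIMSEQ_inverse_real_of_nat by (simp add: inverse_eq_divide)
      then have "(\<lambda>i. (1 / k i) *\<^sub>R w) \<longlonglongrightarrow> 0 *\<^sub>R w" by (intro tendsto_intros)
      then have "(\<lambda>i. transl ((1/k i) *\<^sub>R w) u) \<longlonglongrightarrow> u" by (intro transl_tendsto) simp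
      then show "(\<lambda>i. C * exp (- (norm w)\<^sup>2 / 2) * (u \<bullet> transl ((1/k i) *\<^sub>R w) u)) \<longlonglongrightarrow> C * exp (- (norm w)\<^sup>2 / 2) * (norm u)\<^sup>2"
        unfolding power2_norm_eq_inner[of u] by (intro tendsto_intros)
    qed
    show "AE w in lborel. norm (C * exp (- (norm (w::'a))\<^sup>2 / 2) * (u \<bullet> transl ((1/k i) *\<^sub>R w) u)) \<le> C * exp (- (norm w)\<^sup>2 / 2) * (norm u)\<^sup>2" for i
    proof (rule AE_I2)
      fix w :: 'a
      have "\<bar>u \<bullet> transl ((1/k i) *\<^sub>R w) u\<bar> \<le> (norm u)\<^sup>2"
        using Cauchy_Schwarz_ineq2[of u "transl ((1/k i) *\<^sub>R w) u"] by (simp add: norm_transl power2_eq_square)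
      then show "norm (C * exp (- (norm w)\<^sup>2 / 2) * (u \<bullet> transl ((1/k i) *\<^sub>R w) u)) \<le> C * exp (- (norm w)\<^sup>2 / 2) * (norm u)\<^sup>2"
        using C0 by (simp add: abs_mult mult_left_mono)
    qed
  qed auto
  have rhs: "(\<integral>w. C * exp (- (norm (w::'a))\<^sup>2 / 2) * (norm u)\<^sup>2 \<partial>lborel) = (2 * pi) ^ DIM('a) * (norm u)\<^sup>2"
  proof -
    have "C * C = (2 * pi) ^ DIM('a)"
      unfolding C_def power_mult_distrib[symmetric] by simp
    then show ?thesis using g1 by simp
  qed
  have eq: "(\<integral>\<^sup>+\<xi>. ennreal ((cmod (ftrans s f \<xi>))\<^sup>2 * gss (k i) \<xi>) \<partial>lborel) =
      ennreal (\<integral>w. C * exp (- (norm w)\<^sup>2 / 2) * (u \<bullet> transl ((1/k i) *\<^sub>R w) u) \<partial>lborel)" for i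
    using ftrans_gauss_identity[OF f s k0[of i]]
    by (subst nn_integral_eq_integral) (auto simp: C_def u_def)
  have kk: "(\<lambda>i. gss (k i) \<xi>) \<longlonglongrightarrow> 1" for \<xi> :: 'a
  proof -
    have "(\<lambda>i. 1 / k i) \<longlonglongrightarrow> 0" unfolding k_def using LIMSEQ_inverse_real_of_nat by (simp add: inverse_eq_divide)
    then have "(\<lambda>i. exp (- (norm \<xi>)\<^sup>2 / 2 * (1 / k i)\<^sup>2)) \<longlonglongrightarrow> exp (- (norm \<xi>)\<^sup>2 / 2 * 0\<^sup>2)"
      by (intro tendsto_intros)
    then show ?thesis by (simp add: power_divide)
  qed
  have inc: "incseq (\<lambda>i \<xi>. ennreal ((cmod (ftrans s f \<xi>))\<^sup>2 * gss (k i) \<xi>))"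
  proof (rule incseq_SucI, rule le_funI, rule ennreal_leI, rule mult_left_mono)
    fix i and \<xi> :: 'a
    have "(k i)\<^sup>2 \<le> (k (Suc i))\<^sup>2" by (rule power_mono) (auto simp: k_def)
    then have "(norm \<xi>)\<^sup>2 / (2 * (k (Suc i))\<^sup>2) \<le> (norm \<xi>)\<^sup>2 / (2 * (k i)\<^sup>2)"
      using k0[of i] k0[of "Suc i"] by (intro divide_left_mono) auto
    then show "gss (k i) \<xi> \<le> gss (k (Suc i)) \<xi>" by simp
  qed simp
  have "(\<lambda>i. \<integral>\<^sup>+\<xi>. ennreal ((cmod (ftrans s f \<xi>))\<^sup>2 * gss (k i) \<xi>) \<partial>lborel) \<longlonglongrightarrow> (\<integral>\<^sup>+\<xi>. ennreal ((cmod (ftrans s f \<xi>))\<^sup>2) \<partial>lborel)"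
  proof (rule nn_integral_LIMSEQ[OF inc])
    show "(\<lambda>i. ennreal ((cmod (ftrans s f \<xi>))\<^sup>2 * gss (k i) \<xi>)) \<longlonglongrightarrow> ennreal ((cmod (ftrans s f \<xi>))\<^sup>2)" for \<xi>
    proof -
      have "(\<lambda>i. (cmod (ftrans s f \<xi>))\<^sup>2 * gss (k i) \<xi>) \<longlonglongrightarrow> (cmod (ftrans s f \<xi>))\<^sup>2 * 1"
        by (intro tendsto_mult tendsto_const kk)
      then show ?thesis by (intro tendsto_ennrealI) simp
    qed
  qed measurable
  moreover have "(\<lambda>i. \<integral>\<^sup>+\<xi>. ennreal ((cmod (ftrans s f \<xi>))\<^sup>2 * gss (k i) \<xi>) \<partial>lborel) \<longlonglongrightarrow> ennreal ((2 * pi) ^ DIM('a) * (norm u)\<^sup>2)"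
    unfolding eq by (rule tendsto_ennrealI[OF lim[unfolded rhs]])
  ultimately show ?thesis unfolding u_def by (rule LIMSEQ_unique)
qed

lemma square_integrable_ftrans:
  assumes "integrable lborel f" "square_integrable f" "s = 1 \<or> s = -1"
  shows "square_integrable (ftrans s f)"
proof -
  have "f \<in> borel_measurable borel" using assms(2) by (simp add: square_integrable_def)
  then show ?thesis
    using nn_ftrans_plancherel[OF assms] ftrans_measurable[of f s] by (simp add: square_integrable_iff_nn)
qed

lemma norm_ftrans:
  fixes f :: "'a::euclidean_space \<Rightarrow> complex"
  assumes "integrable lborel f" "square_integrable f" "s = 1 \<or> s = -1"
  shows "norm (to_L2 (ftrans s f)) = sqrt ((2 * pi) ^ DIM('a)) * norm (to_L2 f)"
proof -
  have "(norm (to_L2 (ftrans s f)))\<^sup>2 = (2 * pi) ^ DIM('a) * (norm (to_L2 f))\<^sup>2"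
    using nn_ftrans_plancherel[OF assms] nn_norm_to_L2[OF square_integrable_ftrans[OF assms]] by simp
  then have "sqrt ((norm (to_L2 (ftrans s f)))\<^sup>2) = sqrt ((2 * pi) ^ DIM('a) * (norm (to_L2 f))\<^sup>2)" by simp
  then show ?thesis by (simp add: real_sqrt_mult)
qed

section \<open>Extension of the transform from truncations to L2, and inversion\<close>

definition trunc :: "real \<Rightarrow> 'a::euclidean_space L2 \<Rightarrow> 'a \<Rightarrow> complex" where
  "trunc R u x = indicator (cball 0 R) x *\<^sub>R rep_L2 u x"

lemma trunc_measurable [measurable]: "trunc R u \<in> borel_measurable borel"
  unfolding trunc_def[abs_def] by (intro borel_measurable_scaleR borel_measurable_indicator) auto

lemma square_integrable_trunc: "square_integrable (trunc R u)"
  by (rule square_integrable_bound[OF square_integrable_rep[of u], where C=1])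
     (auto simp: trunc_def indicator_def)

text \<open>On the ball \<open>|f| \<le> 1 + |f|^2\<close>, and the ball has finite measure.\<close>

lemma integrable_bounded_support:
  fixes f :: "'a::euclidean_space \<Rightarrow> complex"
  assumes "square_integrable f" "\<And>x. R < norm x \<Longrightarrow> f x = 0"
  shows "integrable lborel f"
proof (rule Bochner_Integration.integrable_bound)
  have "integrable lborel (indicator (cball (0::'a) R) :: 'a \<Rightarrow> real)"
    using emeasure_lborel_cball_finite[of "0::'a" R] by (auto simp: integrable_indicator_iff)
  then show "integrable lborel (\<lambda>x. indicator (cball (0::'a) R) x + (cmod (f x))\<^sup>2)"
    using assms(1) by (auto simp: square_integrable_def)
  show "f \<in> borel_measurable lborel" using assms(1) by (simp add: square_integrable_def)
  show "AE x in lborel. norm (f x) \<le> norm (indicator (cball (0::'a) R) x + (cmod (f x))\<^sup>2)"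
  proof (rule AE_I2)
    fix x
    have "0 \<le> (cmod (f x) - 1)\<^sup>2" by simp
    then have "cmod (f x) \<le> 1 + (cmod (f x))\<^sup>2"
      using norm_ge_zero[of "f x"] unfolding power2_diff one_power2 mult_1_right by linarith
    then show "norm (f x) \<le> norm (indicator (cball (0::'a) R) x + (cmod (f x))\<^sup>2)"
      using assms(2)[of x] by (cases "norm x \<le> R") (auto simp: indicator_def)
  qed
qed

lemma integrable_trunc: "integrable lborel (trunc R u)"
  by (rule integrable_bounded_support[OF square_integrable_trunc, where R=R]) (auto simp: trunc_def indicator_def)

lemma trunc_tendsto: "((\<lambda>R. to_L2 (trunc R u)) \<longlongrightarrow> u) at_top"
proof (rule tendsto_at_topI_sequentially)
  fix X :: "nat \<Rightarrow> real" assume X: "filterlim X at_top sequentially"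
  have "(\<lambda>n. to_L2 (trunc (X n) u)) \<longlonglongrightarrow> to_L2 (rep_L2 u)"
  proof (rule L2_dominated_convergence(2)[OF square_integrable_rep[of u]])
    show "AE x in lborel. (\<lambda>i. trunc (X i) u x) \<longlonglongrightarrow> rep_L2 u x"
    proof (rule AE_I2)
      fix x :: 'a
      have "\<forall>\<^sub>F n in sequentially. norm x \<le> X n" using X by (simp add: filterlim_at_top)
      then have "\<forall>\<^sub>F n in sequentially. trunc (X n) u x = rep_L2 u x"
        by eventually_elim (simp add: trunc_def)
      then show "(\<lambda>i. trunc (X i) u x) \<longlonglongrightarrow> rep_L2 u x" by (rule tendsto_eventually)
    qed
  qed (auto simp: trunc_def indicator_def)
  then show "(\<lambda>n. to_L2 (trunc (X n) u)) \<longlonglongrightarrow> u" by simp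
qed

definition sqrt_pi_const :: "'a::euclidean_space itself \<Rightarrow> real" where
  "sqrt_pi_const _ = sqrt ((2 * pi) ^ DIM('a))"

lemma sqrt_pi_const_pos: "0 < sqrt_pi_const TYPE('a::euclidean_space)"
  by (simp add: sqrt_pi_const_def)

lemma sqrt_pi_const_sq: "(sqrt_pi_const TYPE('a::euclidean_space))\<^sup>2 = (2 * pi) ^ DIM('a)"
  by (simp add: sqrt_pi_const_def)

text \<open>The Fourier transform with phase \<open>exp (i s x \<xi>)\<close>; \<open>s = -1\<close> is the transform and \<open>s = 1\<close> a
  multiple of its inverse.\<close>

definition FT :: "real \<Rightarrow> 'a::euclidean_space L2 \<Rightarrow> 'a L2" where
  "FT s u = Lim at_top (\<lambda>R. to_L2 (ftrans s (trunc R u)))"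

lemma ftrans_dist:
  fixes f g :: "'a::euclidean_space \<Rightarrow> complex"
  assumes "integrable lborel f" "square_integrable f" "integrable lborel g" "square_integrable g" "s = 1 \<or> s = -1"
  shows "norm (to_L2 (ftrans s f) - to_L2 (ftrans s g)) = sqrt_pi_const TYPE('a) * norm (to_L2 f - to_L2 g)"
proof -
  have "ftrans s (\<lambda>x. f x - g x) = (\<lambda>\<xi>. ftrans s f \<xi> - ftrans s g \<xi>)"
    using ftrans_diff[OF assms(1,3)] by auto
  then have "to_L2 (ftrans s f) - to_L2 (ftrans s g) = to_L2 (ftrans s (\<lambda>x. f x - g x))"
    using square_integrable_ftrans[OF assms(1,2,5)] square_integrable_ftrans[OF assms(3,4,5)] by (simp add: to_L2_diff)
  also have "norm \<dots> = sqrt_pi_const TYPE('a) * norm (to_L2 (\<lambda>x. f x - g x))"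
    unfolding sqrt_pi_const_def using assms by (intro norm_ftrans square_integrable_diff) auto
  finally show ?thesis using assms by (simp add: to_L2_diff)
qed

text \<open>\<open>Lim\<close> says nothing unless the limit exists. On truncations the transform
  multiplies distances by a constant, so the Cauchy property carries over; completeness gives a
  limit along the integers, and the distance identity \<open>dL\<close> then gives it along all real
  radii.\<close>

lemma FT_tendsto:
  assumes s: "s = 1 \<or> s = -1"
  shows "((\<lambda>R. to_L2 (ftrans s (trunc R u))) \<longlongrightarrow> FT s (u :: 'a::euclidean_space L2)) at_top"
proof -
  let ?C = "sqrt_pi_const TYPE('a)"
  define X where "X R = to_L2 (ftrans s (trunc R u))" for R
  define T where "T R = to_L2 (trunc R u)" for R
  have d: "norm (X R - X S) = ?C * norm (T R - T S)" for R S
    unfolding X_def T_def by (rule ftrans_dist[OF integrable_trunc square_integrable_trunc integrable_trunc square_integrable_trunc s])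
  have T: "(T \<longlongrightarrow> u) at_top" unfolding T_def by (rule trunc_tendsto)
  have Tn: "(\<lambda>n. T (real n)) \<longlonglongrightarrow> u" by (rule filterlim_compose[OF T filterlim_real_sequentially])
  have "Cauchy (\<lambda>n. X (real n))"
  proof (rule CauchyI)
    fix e :: real assume e: "0 < e"
    then have "0 < e / ?C" using sqrt_pi_const_pos[where 'a='a] by simp
    then obtain M where M: "\<And>m n. m \<ge> M \<Longrightarrow> n \<ge> M \<Longrightarrow> norm (T (real m) - T (real n)) < e / ?C"
      using LIMSEQ_imp_Cauchy[OF Tn] unfolding Cauchy_iff by blast
    have "norm (X (real m) - X (real n)) < e" if "m \<ge> M" "n \<ge> M" for m n
      unfolding d using M[OF that] sqrt_pi_const_pos[where 'a='a] by (simp add: pos_less_divide_eq mult.commute)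
    then show "\<exists>M. \<forall>m\<ge>M. \<forall>n\<ge>M. norm (X (real m) - X (real n)) < e" by blast
  qed
  then obtain L where L: "(\<lambda>n. X (real n)) \<longlonglongrightarrow> L" using Cauchy_convergent convergent_def by blast
  have dL: "norm (X R - L) = ?C * norm (T R - u)" for R
  proof (rule LIMSEQ_unique)
    show "(\<lambda>n. norm (X R - X (real n))) \<longlonglongrightarrow> norm (X R - L)" by (intro tendsto_intros L)
    show "(\<lambda>n. norm (X R - X (real n))) \<longlonglongrightarrow> ?C * norm (T R - u)" unfolding d by (intro tendsto_intros Tn)
  qed
  have "((\<lambda>R. ?C * norm (T R - u)) \<longlongrightarrow> ?C * norm (u - u)) at_top" by (intro tendsto_intros T)
  then have "((\<lambda>R. norm (X R - L)) \<longlongrightarrow> 0) at_top" unfolding dL by simp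
  then have "(X \<longlongrightarrow> L) at_top" by (simp add: tendsto_norm_zero_iff LIM_zero_iff)
  moreover from this have "FT s u = L" unfolding FT_def X_def[symmetric] by (intro tendsto_Lim) auto
  ultimately show ?thesis by (simp add: X_def[abs_def])
qed

lemma norm_FT:
  assumes s: "s = 1 \<or> s = -1"
  shows "norm (FT s (u :: 'a::euclidean_space L2)) = sqrt_pi_const TYPE('a) * norm u"
proof (rule tendsto_unique)
  show "((\<lambda>R. norm (to_L2 (ftrans s (trunc R u)))) \<longlongrightarrow> norm (FT s u)) at_top"
    by (intro tendsto_intros FT_tendsto s)
  have "norm (to_L2 (ftrans s (trunc R u))) = sqrt_pi_const TYPE('a) * norm (to_L2 (trunc R u))" for R
    unfolding sqrt_pi_const_def by (rule norm_ftrans[OF integrable_trunc square_integrable_trunc s])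
  then show "((\<lambda>R. norm (to_L2 (ftrans s (trunc R u)))) \<longlongrightarrow> sqrt_pi_const TYPE('a) * norm u) at_top"
    by (simp only:) (intro tendsto_intros trunc_tendsto)
qed simp

text \<open>The real inner product is the real part of the hermitian one, and for the latter the
  adjoint is read off the multiplication formula with the second function conjugated.\<close>

lemma inner_ftrans:
  fixes f g :: "'a::euclidean_space \<Rightarrow> complex"
  assumes f: "integrable lborel f" "square_integrable f" and g: "integrable lborel g" "square_integrable g" and s: "s = 1 \<or> s = -1"
  shows "to_L2 (ftrans s f) \<bullet> to_L2 g = to_L2 f \<bullet> to_L2 (ftrans (-s) g)"
proof -
  have [measurable]: "f \<in> borel_measurable borel" "g \<in> borel_measurable borel" using f g by auto
  have s': "- s = 1 \<or> - s = -1" using s by auto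
  have bd: "integrable lborel (\<lambda>x. F x * cnj (h x))" if F: "square_integrable F" and h: "square_integrable h" for F h :: "'a \<Rightarrow> complex"
  proof (rule Bochner_Integration.integrable_bound)
    show "integrable lborel (\<lambda>x. (cmod (F x))\<^sup>2 + (cmod (h x))\<^sup>2)"
      using F h by (auto simp: square_integrable_def)
    show "(\<lambda>x. F x * cnj (h x)) \<in> borel_measurable lborel" using F h by (auto simp: square_integrable_def)
    show "AE x in lborel. norm (F x * cnj (h x)) \<le> norm ((cmod (F x))\<^sup>2 + (cmod (h x))\<^sup>2)"
    proof (rule AE_I2)
      fix x
      have "cmod (F x) * cmod (h x) \<le> (cmod (F x))\<^sup>2 + (cmod (h x))\<^sup>2"
        using sum_squares_bound[of "cmod (F x)" "cmod (h x)"]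
          mult_nonneg_nonneg[OF norm_ge_zero[of "F x"] norm_ge_zero[of "h x"]] by linarith
      then show "norm (F x * cnj (h x)) \<le> norm ((cmod (F x))\<^sup>2 + (cmod (h x))\<^sup>2)" by (simp add: norm_mult)
    qed
  qed
  have in_eq: "to_L2 F \<bullet> to_L2 h = Re (\<integral>x. F x * cnj (h x) \<partial>lborel)" if F: "square_integrable F" and h: "square_integrable h" for F h :: "'a \<Rightarrow> complex"
    unfolding inner_to_L2_eq[OF F h] integral_Re[OF bd[OF F h], symmetric]
    by (simp add: inner_complex_def)
  have "(\<integral>\<xi>. ftrans s f \<xi> * cnj (g \<xi>) \<partial>lborel) = (\<integral>x. f x * cnj (ftrans (-s) g x) \<partial>lborel)"
    unfolding ftrans_cnj[symmetric] minus_minus by (rule ftrans_multiplication) (use f g in auto)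
  then show ?thesis
    unfolding in_eq[OF square_integrable_ftrans[OF f s] g(2)] in_eq[OF f(2) square_integrable_ftrans[OF g s']]
    by (simp add: ftrans_cnj)
qed

lemma FT_adjoint:
  assumes s: "s = 1 \<or> s = -1"
  shows "FT s u \<bullet> v = u \<bullet> FT (- s) v"
proof -
  have s': "- s = 1 \<or> - s = -1" using s by auto
  have eq: "to_L2 (ftrans s (trunc R u)) \<bullet> to_L2 (trunc R v) = to_L2 (trunc R u) \<bullet> to_L2 (ftrans (-s) (trunc R v))" for R
    by (rule inner_ftrans[OF integrable_trunc square_integrable_trunc integrable_trunc square_integrable_trunc s])
  show ?thesis
  proof (rule tendsto_unique)
    show "((\<lambda>R. to_L2 (ftrans s (trunc R u)) \<bullet> to_L2 (trunc R v)) \<longlongrightarrow> FT s u \<bullet> v) at_top"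
      by (intro tendsto_intros FT_tendsto[OF s] trunc_tendsto)
    show "((\<lambda>R. to_L2 (ftrans s (trunc R u)) \<bullet> to_L2 (trunc R v)) \<longlongrightarrow> u \<bullet> FT (-s) v) at_top"
      unfolding eq by (intro tendsto_intros FT_tendsto[OF s'] trunc_tendsto)
  qed simp
qed

lemma inner_eq_all_imp_eq: "(\<And>w. (u::'b::real_inner) \<bullet> w = v \<bullet> w) \<Longrightarrow> u = v"
  by (metis inner_eq_zero_iff inner_diff_left right_minus_eq)

text \<open>An operator with an adjoint is linear. Going through \<open>FT_adjoint\<close> avoids
  comparing representatives of \<open>u + v\<close> with sums of representatives.\<close>

lemma FT_add: "s = 1 \<or> s = -1 \<Longrightarrow> FT s (u + v) = FT s u + FT s v"
  by (rule inner_eq_all_imp_eq) (simp add: FT_adjoint inner_add_left)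

lemma FT_scaleR: "s = 1 \<or> s = -1 \<Longrightarrow> FT s (c *\<^sub>R u) = c *\<^sub>R FT s u"
  by (rule inner_eq_all_imp_eq) (simp add: FT_adjoint)

lemma bounded_linear_FT: "s = 1 \<or> s = -1 \<Longrightarrow> bounded_linear (FT s :: 'a::euclidean_space L2 \<Rightarrow> 'a L2)"
  by (rule bounded_linear_intro[where K="sqrt_pi_const TYPE('a)"]) (auto simp: FT_add FT_scaleR norm_FT)

text \<open>A multiple of an isometry preserves inner products up to the square of the factor, by
  polarisation; as the adjoint is the transform with the opposite sign, this is the inversion
  formula.\<close>

lemma FT_FT:
  assumes s: "s = 1 \<or> s = -1"
  shows "FT (- s) (FT s u) = (2 * pi) ^ DIM('a) *\<^sub>R (u :: 'a::euclidean_space L2)"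
proof (rule inner_eq_all_imp_eq)
  fix v :: "'a L2"
  let ?C = "sqrt_pi_const TYPE('a)"
  have s': "- s = 1 \<or> - s = -1" using s by auto
  have pol: "x \<bullet> y = ((norm (x + y))\<^sup>2 - (norm x)\<^sup>2 - (norm y)\<^sup>2) / 2" for x y :: "'a L2"
    by (rule dot_norm)
  have "FT (- s) (FT s u) \<bullet> v = FT s u \<bullet> FT s v" using FT_adjoint[OF s', of "FT s u" v] by simp
  also have "\<dots> = ((norm (FT s (u + v)))\<^sup>2 - (norm (FT s u))\<^sup>2 - (norm (FT s v))\<^sup>2) / 2"
    unfolding pol[of "FT s u"] FT_add[OF s] ..
  also have "\<dots> = ?C\<^sup>2 * (((norm (u + v))\<^sup>2 - (norm u)\<^sup>2 - (norm v)\<^sup>2) / 2)"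
    unfolding norm_FT[OF s] power_mult_distrib by (simp add: right_diff_distrib)
  also have "\<dots> = (?C\<^sup>2 *\<^sub>R u) \<bullet> v" unfolding pol[of u v, symmetric] by simp
  finally show "FT (- s) (FT s u) \<bullet> v = ((2 * pi) ^ DIM('a) *\<^sub>R u) \<bullet> v"
    by (simp add: sqrt_pi_const_sq)
qed

lemma fourier_eq: "fourier u = FT (-1) u"
proof -
  have "(LINT x:cball 0 R|lborel. exp (- (\<i> * complex_of_real (x \<bullet> \<xi>))) * rep_L2 u x) = ftrans (-1) (trunc R u) \<xi>" for R \<xi>
    unfolding ftrans_def set_lebesgue_integral_def trunc_def
    by (intro Bochner_Integration.integral_cong refl) simp
  then show ?thesis by (simp add: fourier_def FT_def)
qed

lemma inv_fourier_eq: "inv_fourier v = (1 / (2 * pi) ^ DIM('a)) *\<^sub>R FT 1 (v :: 'a::euclidean_space L2)"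
proof -
  let ?c = "1 / (2 * pi) ^ DIM('a)"
  have i: "(LINT x:cball 0 R|lborel. exp (\<i> * complex_of_real (\<xi> \<bullet> x)) * rep_L2 v x) = ftrans 1 (trunc R v) \<xi>" for R \<xi>
    unfolding ftrans_def set_lebesgue_integral_def trunc_def
    by (intro Bochner_Integration.integral_cong refl) (simp add: inner_commute)
  have "to_L2 (\<lambda>x. complex_of_real ?c * (LINT \<xi>:cball 0 R|lborel. exp (\<i> * complex_of_real (x \<bullet> \<xi>)) * rep_L2 v \<xi>))
    = ?c *\<^sub>R to_L2 (ftrans 1 (trunc R v))" for R
    unfolding i to_L2_scaleR[OF square_integrable_ftrans[OF integrable_trunc square_integrable_trunc disjI1[OF refl]], symmetric]
    by (simp only: scaleR_conv_of_real)
  then have "inv_fourier v = Lim at_top (\<lambda>R. ?c *\<^sub>R to_L2 (ftrans 1 (trunc R v)))"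
    by (simp only: inv_fourier_def)
  also have "\<dots> = ?c *\<^sub>R FT 1 v" by (intro tendsto_Lim tendsto_intros FT_tendsto) auto
  finally show ?thesis .
qed

lemma inv_fourier_fourier [simp]: "inv_fourier (fourier u) = (u :: 'a::euclidean_space L2)"
  using FT_FT[of "-1" u] by (simp add: inv_fourier_eq fourier_eq)

lemma fourier_inv_fourier [simp]: "fourier (inv_fourier u) = (u :: 'a::euclidean_space L2)"
  using FT_FT[of 1 u] by (simp add: inv_fourier_eq fourier_eq FT_scaleR)

lemma bounded_linear_fourier: "bounded_linear fourier"
  unfolding fourier_eq[abs_def] by (rule bounded_linear_FT) simp

lemma bounded_linear_inv_fourier: "bounded_linear inv_fourier"
  unfolding inv_fourier_eq[abs_def] by (intro bounded_linear_const_scaleR bounded_linear_FT) simp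

lemma norm_fourier: "norm (fourier (u :: 'a::euclidean_space L2)) = sqrt_pi_const TYPE('a) * norm u"
  by (simp add: fourier_eq norm_FT)

lemma norm_inv_fourier: "norm (inv_fourier (u :: 'a::euclidean_space L2)) = norm u / sqrt_pi_const TYPE('a)"
  using norm_fourier[of "inv_fourier u"] sqrt_pi_const_pos[where 'a='a] by (simp add: field_simps)

text \<open>Once the radius exceeds \<open>R\<close> the truncations change only on null sets, so
  the limit in the definition is attained and the inverse transform is a single integral, to which
  sup bounds apply.\<close>

lemma inv_fourier_bounded_support:
  fixes v :: "'a::euclidean_space L2"
  assumes "AE \<xi> in lborel. R < norm \<xi> \<longrightarrow> rep_L2 v \<xi> = 0"
  shows "inv_fourier v = (1 / (2 * pi) ^ DIM('a)) *\<^sub>R to_L2 (ftrans 1 (rep_L2 v))"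
proof -
  have e: "AE x in lborel. trunc S v x = rep_L2 v x" if "S \<ge> R" for S
    using assms by eventually_elim (use that in \<open>auto simp: trunc_def indicator_def\<close>)
  have eq: "ftrans 1 (trunc S v) = ftrans 1 (rep_L2 v)" if "S \<ge> R" for S
  proof
    fix \<xi>
    show "ftrans 1 (trunc S v) \<xi> = ftrans 1 (rep_L2 v) \<xi>" unfolding ftrans_def
    proof (rule integral_cong_AE)
      show "AE x in lborel. iexp (1 * (x \<bullet> \<xi>)) * trunc S v x = iexp (1 * (x \<bullet> \<xi>)) * rep_L2 v x"
        using e[OF that] by eventually_elim simp
    qed measurable
  qed
  have "FT 1 v = to_L2 (ftrans 1 (rep_L2 v))" unfolding FT_def
  proof (intro tendsto_Lim tendsto_eventually)
    show "\<forall>\<^sub>F S in at_top. to_L2 (ftrans 1 (trunc S v)) = to_L2 (ftrans 1 (rep_L2 v))"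
      using eventually_ge_at_top[of R] by eventually_elim (simp add: eq)
  qed simp
  then show ?thesis by (simp add: inv_fourier_eq)
qed

text \<open>The transform is only a limit in L2. The pointwise bound by the L1 norm is therefore
  used on the truncations, where it is uniform, and the norm over the ball passes to the
  limit.\<close>

lemma norm_fourier_ball_L1:
  fixes u :: "'a::euclidean_space L2"
  assumes u: "integrable lborel (rep_L2 u)"
  shows "norm (mul (indicator (cball 0 r)) (fourier u)) \<le> sqrt (measure lborel (cball (0::'a) r)) * (\<integral>x. cmod (rep_L2 u x) \<partial>lborel)"
proof -
  have bl: "bounded_linear (mul (indicator (cball (0::'a) r)))"
    by (rule bounded_linear_mul[where C=1]) (auto simp: indicator_def intro!: borel_measurable_indicator)
  have lim: "((\<lambda>R. mul (indicator (cball 0 r)) (to_L2 (ftrans (-1) (trunc R u)))) \<longlongrightarrow> mul (indicator (cball 0 r)) (fourier u)) at_top"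
    unfolding fourier_eq by (rule bounded_linear.tendsto[OF bl FT_tendsto]) simp
  define B where "B = (\<integral>x. cmod (rep_L2 u x) \<partial>lborel)"
  have B0: "0 \<le> B" by (simp add: B_def)
  have fin: "emeasure lborel (cball (0::'a) r) < \<infinity>"
    using emeasure_lborel_cball_finite[of "0::'a" r] by simp
  have "norm (mul (indicator (cball 0 r)) (to_L2 (ftrans (-1) (trunc R u)))) \<le> sqrt (measure lborel (cball (0::'a) r)) * B" for R
  proof -
    let ?F = "ftrans (-1) (trunc R u)"
    have sF: "square_integrable ?F" by (rule square_integrable_ftrans[OF integrable_trunc square_integrable_trunc]) simp
    have bF: "cmod (?F \<xi>) \<le> B" for \<xi>
    proof -
      have "cmod (?F \<xi>) \<le> (\<integral>x. cmod (trunc R u x) \<partial>lborel)" by (rule norm_ftrans_le[OF integrable_trunc])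
      also have "\<dots> \<le> B" unfolding B_def
        by (intro integral_mono integrable_norm integrable_trunc u) (auto simp: trunc_def indicator_def)
      finally show ?thesis .
    qed
    show ?thesis unfolding mul_def
    proof (rule norm_to_L2_le_nn)
      show "(\<lambda>x. indicator (cball 0 r) x * rep_L2 (to_L2 ?F) x) \<in> borel_measurable borel"
        by (intro borel_measurable_times borel_measurable_indicator) auto
      show "0 \<le> sqrt (measure lborel (cball (0::'a) r)) * B" using B0 by simp
      have "(\<integral>\<^sup>+x. ennreal ((cmod (indicator (cball 0 r) x * rep_L2 (to_L2 ?F) x))\<^sup>2) \<partial>lborel)
         \<le> (\<integral>\<^sup>+x. ennreal (B\<^sup>2) * indicator (cball (0::'a) r) x \<partial>lborel)"
      proof (rule nn_integral_mono_AE, use rep_to_L2[OF sF] in eventually_elim)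
        fix x assume "rep_L2 (to_L2 ?F) x = ?F x"
        then show "ennreal ((cmod (indicator (cball 0 r) x * rep_L2 (to_L2 ?F) x))\<^sup>2) \<le> ennreal (B\<^sup>2) * indicator (cball 0 r) x"
          using bF[of x] by (auto simp: indicator_def intro!: ennreal_leI power_mono)
      qed
      also have "\<dots> = ennreal (B\<^sup>2) * emeasure lborel (cball (0::'a) r)" by (rule nn_integral_cmult_indicator) simp
      also have "\<dots> = ennreal (B\<^sup>2) * ennreal (measure lborel (cball (0::'a) r))"
        using fin by (simp add: emeasure_eq_ennreal_measure less_top[symmetric])
      also have "\<dots> = ennreal ((sqrt (measure lborel (cball (0::'a) r)) * B)\<^sup>2)"
        by (simp add: power_mult_distrib ennreal_mult[symmetric] mult.commute)
      finally show "(\<integral>\<^sup>+x. ennreal ((cmod (indicator (cball 0 r) x * rep_L2 (to_L2 ?F) x))\<^sup>2) \<partial>lborel)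
         \<le> ennreal ((sqrt (measure lborel (cball (0::'a) r)) * B)\<^sup>2)" .
    qed
  qed
  then show ?thesis unfolding B_def[symmetric]
    by (intro tendsto_upperbound[OF tendsto_norm[OF lim]]) auto
qed

section \<open>Function space inequalities\<close>

text \<open>The values of \<open>u\<close> above the level \<open>r\<^bsup>n/m\<^esup> M\<close> are treated in \<open>L\<^sup>1\<close>, those below it in \<open>L\<^sup>2\<close>; at this
  level both contributions have the same size.\<close>

lemma fourier_ball_Lm:
  fixes u :: "'a::euclidean_space L2"
  assumes m: "1 \<le> m" "m \<le> 2" and r: "0 < r" and M: "0 < M"
    and u: "(\<integral>\<^sup>+x. ennreal (cmod (rep_L2 u x) powr m) \<partial>lborel) \<le> ennreal (M powr m)"
  shows "norm (mul (indicator (cball 0 r)) (fourier u))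
    \<le> (sqrt (unit_ball_vol (real DIM('a))) + sqrt_pi_const TYPE('a)) * (r powr (real DIM('a) * (1/m - 1/2)) * M)"
proof -
  let ?n = "real DIM('a)"
  define l where "l = r powr (?n / m) * M"
  have l: "0 < l" using r M by (simp add: l_def)
  define g where "g x = (if cmod (rep_L2 u x) > l then rep_L2 u x else 0)" for x
  define h where "h x = (if cmod (rep_L2 u x) > l then 0 else rep_L2 u x)" for x
  have gm[measurable]: "g \<in> borel_measurable borel" unfolding g_def[abs_def] by measurable
  have hm[measurable]: "h \<in> borel_measurable borel" unfolding h_def[abs_def] by measurable
  have sg: "square_integrable g"
    by (rule square_integrable_bound[OF square_integrable_rep[of u], where C=1]) (auto simp: g_def)
  have sh: "square_integrable h"
    by (rule square_integrable_bound[OF square_integrable_rep[of u], where C=1]) (auto simp: h_def)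
  have gh: "u = to_L2 g + to_L2 h"
  proof -
    have "(\<lambda>x. g x + h x) = rep_L2 u" by (auto simp: g_def h_def)
    then show ?thesis using to_L2_add[OF sg sh] by simp
  qed
  \<comment> \<open>Above the level, \<open>1 - m \<le> 0\<close> lets a power of \<open>|u|\<close>
    be traded for \<open>l powr (1 - m)\<close>, a pointwise form of Chebyshev's inequality. Below
    it, in \<open>h2\<close>, \<open>2 - m \<ge> 0\<close> does the same for the square.\<close>
  have g1: "cmod (g x) \<le> l powr (1 - m) * cmod (rep_L2 u x) powr m" for x
  proof (cases "cmod (rep_L2 u x) > l")
    case True
    have "cmod (rep_L2 u x) powr (1 - m) \<le> l powr (1 - m)"
      using True l m by (intro powr_mono2') auto
    then have "cmod (rep_L2 u x) powr (1 - m) * cmod (rep_L2 u x) powr m \<le> l powr (1 - m) * cmod (rep_L2 u x) powr m"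
      by (intro mult_right_mono) auto
    moreover have "cmod (rep_L2 u x) powr (1 - m) * cmod (rep_L2 u x) powr m = cmod (rep_L2 u x)"
      using True l by (simp add: powr_add[symmetric])
    ultimately show ?thesis using True by (simp add: g_def)
  qed (simp add: g_def)
  have h2: "(cmod (h x))\<^sup>2 \<le> l powr (2 - m) * cmod (rep_L2 u x) powr m" for x
  proof (cases "cmod (rep_L2 u x) > l \<or> rep_L2 u x = 0")
    case False
    then have p: "0 < cmod (rep_L2 u x)" "cmod (rep_L2 u x) \<le> l" by auto
    have "cmod (rep_L2 u x) powr (2 - m) \<le> l powr (2 - m)"
      using p m by (intro powr_mono2) auto
    then have "cmod (rep_L2 u x) powr (2 - m) * cmod (rep_L2 u x) powr m \<le> l powr (2 - m) * cmod (rep_L2 u x) powr m"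
      by (intro mult_right_mono) auto
    moreover have "cmod (rep_L2 u x) powr (2 - m) * cmod (rep_L2 u x) powr m = (cmod (rep_L2 u x))\<^sup>2"
      using p by (simp add: powr_add[symmetric] powr_numeral)
    ultimately show ?thesis using False by (simp add: h_def)
  qed (auto simp: h_def)
  have scale: "(\<integral>\<^sup>+x. ennreal (c * cmod (rep_L2 u x) powr m) \<partial>lborel) \<le> ennreal (c * M powr m)" if "0 \<le> c" for c
  proof -
    have "(\<integral>\<^sup>+x. ennreal (c * cmod (rep_L2 u x) powr m) \<partial>lborel) = ennreal c * (\<integral>\<^sup>+x. ennreal (cmod (rep_L2 u x) powr m) \<partial>lborel)"
      using that by (subst nn_integral_cmult[symmetric]) (auto simp: ennreal_mult)
    also have "\<dots> \<le> ennreal c * ennreal (M powr m)" by (intro mult_left_mono u) simp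
    finally show ?thesis using that by (simp add: ennreal_mult)
  qed
  have gi: "(\<integral>\<^sup>+x. ennreal (cmod (g x)) \<partial>lborel) \<le> ennreal (l powr (1 - m) * M powr m)"
    by (rule order_trans[OF nn_integral_mono scale]) (auto intro: ennreal_leI g1)
  have hi: "(\<integral>\<^sup>+x. ennreal ((cmod (h x))\<^sup>2) \<partial>lborel) \<le> ennreal (l powr (2 - m) * M powr m)"
    by (rule order_trans[OF nn_integral_mono scale]) (auto intro: ennreal_leI h2)
  have gint: "integrable lborel g"
    using le_less_trans[OF gi ennreal_less_top] by (simp add: integrable_iff_bounded)
  have gle: "(\<integral>x. cmod (g x) \<partial>lborel) \<le> l powr (1 - m) * M powr m"
    using gi nn_integral_eq_integral[OF integrable_norm[OF gint]] by (simp add: ennreal_le_iff)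
  have rg: "AE x in lborel. g x = rep_L2 (to_L2 g) x" using rep_to_L2[OF sg] by eventually_elim simp
  have gint': "integrable lborel (rep_L2 (to_L2 g))"
    using gint by (rule integrable_cong_AE_imp) (use rg in auto)
  have gle': "(\<integral>x. cmod (rep_L2 (to_L2 g) x) \<partial>lborel) \<le> l powr (1 - m) * M powr m"
  proof -
    have "(\<integral>x. cmod (rep_L2 (to_L2 g) x) \<partial>lborel) = (\<integral>x. cmod (g x) \<partial>lborel)"
      by (rule integral_cong_AE) (use rg in auto)
    then show ?thesis using gle by simp
  qed
  have e1: "sqrt (measure lborel (cball (0::'a) r)) * (l powr (1 - m) * M powr m) = sqrt (unit_ball_vol ?n) * (r powr (?n * (1/m - 1/2)) * M)"
  proof -
    have "sqrt (measure lborel (cball (0::'a) r)) = sqrt (unit_ball_vol ?n) * r powr (?n / 2)"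
      using r by (simp add: content_cball real_sqrt_mult powr_half_sqrt[symmetric] powr_realpow[symmetric] powr_powr)
    moreover have "l powr (1 - m) * M powr m = r powr (?n / m * (1 - m)) * M"
    proof -
      have "M powr (1 - m) * M powr m = M" using M by (simp add: powr_add[symmetric])
      then show ?thesis using r M by (simp add: l_def powr_mult powr_powr)
    qed
    moreover have "r powr (?n / 2) * r powr (?n / m * (1 - m)) = r powr (?n * (1/m - 1/2))"
      using m unfolding powr_add[symmetric] by (simp add: field_simps)
    ultimately show ?thesis by (metis (no_types, lifting) mult.assoc)
  qed
  have e2: "sqrt (l powr (2 - m) * M powr m) = r powr (?n * (1/m - 1/2)) * M"
  proof -
    have "M powr (2 - m) * M powr m = M\<^sup>2" using M by (simp add: powr_add[symmetric] powr_numeral)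
    then have "l powr (2 - m) * M powr m = r powr (?n / m * (2 - m)) * M\<^sup>2"
      using r M by (simp add: l_def powr_mult powr_powr)
    moreover have "r powr (?n / m * (2 - m)) = (r powr (?n * (1/m - 1/2)))\<^sup>2"
    proof -
      have "?n / m * (2 - m) = ?n * (1/m - 1/2) + ?n * (1/m - 1/2)" using m by (simp add: field_simps)
      then show ?thesis by (simp only: power2_eq_square powr_add)
    qed
    ultimately show ?thesis using M by (simp add: real_sqrt_mult)
  qed
  have bl: "bounded_linear (mul (indicator (cball (0::'a) r)))"
    by (rule bounded_linear_mul[where C=1]) (auto simp: indicator_def intro!: borel_measurable_indicator)
  have n1: "norm (mul (indicator (cball 0 r)) (fourier (to_L2 g))) \<le> sqrt (unit_ball_vol ?n) * (r powr (?n * (1/m - 1/2)) * M)"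
    unfolding e1[symmetric]
    by (rule order_trans[OF norm_fourier_ball_L1[OF gint']]) (intro mult_left_mono gle', simp)
  have n2: "norm (mul (indicator (cball 0 r)) (fourier (to_L2 h))) \<le> sqrt_pi_const TYPE('a) * (r powr (?n * (1/m - 1/2)) * M)"
  proof -
    have "norm (mul (indicator (cball 0 r)) (fourier (to_L2 h))) \<le> 1 * norm (fourier (to_L2 h))"
      by (rule norm_mul_le) (auto simp: indicator_def intro!: borel_measurable_indicator)
    also have "\<dots> = sqrt_pi_const TYPE('a) * norm (to_L2 h)" by (simp add: norm_fourier)
    also have "norm (to_L2 h) \<le> sqrt (l powr (2 - m) * M powr m)"
      by (rule norm_to_L2_le_nn) (use hi l M in auto)
    finally show ?thesis unfolding e2 using sqrt_pi_const_pos[where 'a='a] by simp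
  qed
  have "mul (indicator (cball 0 r)) (fourier u) = mul (indicator (cball 0 r)) (fourier (to_L2 g)) + mul (indicator (cball 0 r)) (fourier (to_L2 h))"
    by (subst gh) (simp add: linear_add[OF bounded_linear.linear[OF bounded_linear_fourier]] linear_add[OF bounded_linear.linear[OF bl]])
  then have "norm (mul (indicator (cball 0 r)) (fourier u)) \<le> norm (mul (indicator (cball 0 r)) (fourier (to_L2 g))) + norm (mul (indicator (cball 0 r)) (fourier (to_L2 h)))"
    by (simp add: norm_triangle_ineq)
  then show ?thesis using n1 n2 unfolding distrib_right by linarith
qed

section \<open>Dyadic summation over balls\<close>

definition dyadic_const :: "real \<Rightarrow> real \<Rightarrow> real \<Rightarrow> real" where
  "dyadic_const \<beta> \<gamma>\<^sub>1 \<gamma>\<^sub>2 = 2 powr \<gamma>\<^sub>1 / (1 - 2 powr (\<gamma>\<^sub>1 - \<beta>)) + 2 powr \<beta> / (1 - 2 powr (\<beta> - \<gamma>\<^sub>2))"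

lemma dyadic_const_pos:
  assumes "\<gamma>\<^sub>1 < \<beta>" "\<beta> < \<gamma>\<^sub>2"
  shows "0 < dyadic_const \<beta> \<gamma>\<^sub>1 \<gamma>\<^sub>2"
proof -
  have "2 powr (\<gamma>\<^sub>1 - \<beta>) < 1" "2 powr (\<beta> - \<gamma>\<^sub>2) < (1::real)"
    using assms by (auto simp: powr_less_one)
  then show ?thesis by (simp add: dyadic_const_def add_pos_pos)
qed

lemma suminf_ennreal_geometric:
  assumes "0 \<le> c" "0 \<le> q" "q < 1"
  shows "(\<Sum>k. ennreal (c * q ^ k)) = ennreal (c / (1 - q))"
  using assms by (subst suminf_ennreal2) (auto simp: suminf_mult suminf_geometric summable_geometric)

text \<open>A positive \<open>y\<close> lies in some dyadic shell, and the term of the sum with the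
  index of that shell already bounds the left side. The first family of intervals shrinks and serves
  \<open>y \<le> 1\<close>, the second grows and serves \<open>y > 1\<close>.\<close>

lemma min_powr_le_dyadic:
  fixes y :: real
  assumes y: "0 \<le> y" and g: "0 \<le> \<gamma>\<^sub>1" "0 \<le> \<gamma>\<^sub>2"
  shows "ennreal (min (y powr - \<gamma>\<^sub>1) (y powr - \<gamma>\<^sub>2)) \<le>
    (\<Sum>k. ennreal (2 powr \<gamma>\<^sub>1 * (2 powr \<gamma>\<^sub>1) ^ k) * indicator {.. 1 / 2 ^ k} y
        + ennreal ((2 powr - \<gamma>\<^sub>2) ^ k) * indicator {.. 2 * 2 ^ k} y)" (is "_ \<le> (\<Sum>k. ?f k)")
proof (cases "y = 0")
  \<comment> \<open>At \<open>y = 0\<close> the left side vanishes because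
    \<open>0 powr x = 0\<close>.\<close>
  case False
  then have y: "0 < y" using y by simp
  have le_sum: "?f k \<le> (\<Sum>k. ?f k)" for k
    using sum_le_suminf[OF summableI, of "{k}" ?f] by simp
  show ?thesis
  proof (cases "y \<le> 1")
    case True
    \<comment> \<open>The largest \<open>k\<close> with \<open>y \<le> 1 / 2 ^ k\<close>. Rounding
      loses at most a factor 2 in \<open>y\<close>, which is the constant
      \<open>2 powr \<gamma>\<^sub>1\<close> in front.\<close>
    define k where "k = nat \<lfloor>- log 2 y\<rfloor>"
    have lg: "0 \<le> - log 2 y" using True y by simp
    then have k: "real k \<le> - log 2 y" "- log 2 y < real k + 1" by (auto simp: k_def)
    have "y = 2 powr (log 2 y)" using y by simp
    also have "\<dots> \<le> 2 powr (- real k)" using k by (intro powr_mono) auto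
    finally have yk: "y \<le> 1 / 2 ^ k" by (simp add: powr_minus powr_realpow field_simps)
    have "y powr - \<gamma>\<^sub>1 = 2 powr (- log 2 y * \<gamma>\<^sub>1)"
      using y by (simp add: powr_def log_def)
    also have "\<dots> \<le> 2 powr ((real k + 1) * \<gamma>\<^sub>1)" using k g by (intro powr_mono mult_right_mono) auto
    also have "\<dots> = 2 powr \<gamma>\<^sub>1 * (2 powr \<gamma>\<^sub>1) ^ k"
      by (simp add: powr_realpow[symmetric] powr_powr powr_add[symmetric] algebra_simps)
    finally have "ennreal (min (y powr - \<gamma>\<^sub>1) (y powr - \<gamma>\<^sub>2)) \<le> ennreal (2 powr \<gamma>\<^sub>1 * (2 powr \<gamma>\<^sub>1) ^ k)"
      by (intro ennreal_leI) simp
    also have "\<dots> \<le> ?f k" using yk by simp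
    finally show ?thesis using le_sum[of k] by (rule order_trans)
  next
    case False
    define k where "k = nat \<lfloor>log 2 y\<rfloor>"
    have lg: "0 \<le> log 2 y" using False y by simp
    then have k: "real k \<le> log 2 y" "log 2 y < real k + 1" by (auto simp: k_def)
    have "y = 2 powr (log 2 y)" using y by simp
    also have "\<dots> \<le> 2 powr (real k + 1)" using k by (intro powr_mono) auto
    finally have yk: "y \<le> 2 * 2 ^ k" by (simp add: powr_add powr_realpow)
    have "y powr - \<gamma>\<^sub>2 = 2 powr (log 2 y * - \<gamma>\<^sub>2)"
      using y by (simp add: powr_def log_def)
    also have "\<dots> \<le> 2 powr (real k * - \<gamma>\<^sub>2)" using k g by (intro powr_mono) (auto intro: mult_right_mono)
    also have "\<dots> = (2 powr - \<gamma>\<^sub>2) ^ k"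
      by (simp add: powr_realpow[symmetric] powr_powr mult.commute)
    finally have "ennreal (min (y powr - \<gamma>\<^sub>1) (y powr - \<gamma>\<^sub>2)) \<le> ennreal ((2 powr - \<gamma>\<^sub>2) ^ k)"
      by (intro ennreal_leI) simp
    also have "\<dots> \<le> ?f k" using yk by simp
    finally show ?thesis using le_sum[of k] by (rule order_trans)
  qed
qed simp

text \<open>The mass of \<open>h\<close> on centred balls is enough to integrate it against a weight
  that is less singular than \<open>\<beta>\<close> at the origin and decays faster than
  \<open>\<beta>\<close> at infinity. On the dyadic layers the mass bound yields two geometric
  series with ratios \<open>2 powr (\<gamma>\<^sub>1 - \<beta>)\<close> and
  \<open>2 powr (\<beta> - \<gamma>\<^sub>2)\<close>, whose sums make up
  \<open>dyadic_const\<close>; \<open>T\<close> is a change of scale.\<close>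

lemma dyadic_integral:
  fixes h :: "'a::euclidean_space \<Rightarrow> ennreal"
  assumes hm[measurable]: "h \<in> borel_measurable borel"
    and K: "0 \<le> K" and h: "\<And>r. 0 < r \<Longrightarrow> (\<integral>\<^sup>+x. h x * indicator (cball 0 r) x \<partial>lborel) \<le> ennreal (K * r powr \<beta>)"
    and g: "0 \<le> \<gamma>\<^sub>1" "\<gamma>\<^sub>1 < \<beta>" "\<beta> < \<gamma>\<^sub>2" and T: "0 < T"
  shows "(\<integral>\<^sup>+x. h x * ennreal (min ((T * norm x) powr - \<gamma>\<^sub>1) ((T * norm x) powr - \<gamma>\<^sub>2)) \<partial>lborel)
    \<le> ennreal (dyadic_const \<beta> \<gamma>\<^sub>1 \<gamma>\<^sub>2 * (K * T powr - \<beta>))"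
proof -
  let ?a = "\<lambda>k. ennreal (2 powr \<gamma>\<^sub>1 * (2 powr \<gamma>\<^sub>1) ^ k)"
  let ?b = "\<lambda>k. ennreal ((2 powr - \<gamma>\<^sub>2) ^ k)"
  let ?A = "\<lambda>k. cball (0::'a) (1 / 2 ^ k / T)" and ?B = "\<lambda>k. cball (0::'a) (2 * 2 ^ k / T)"
  let ?KT = "K * T powr - \<beta>"
  have KT: "0 \<le> ?KT" using K by simp
  have pw: "(2 ^ k) powr b = ((2::real) powr b) ^ k" for k b
    by (simp add: powr_realpow[symmetric] powr_powr mult.commute)
  have AB[measurable]: "?A k \<in> sets borel" "?B k \<in> sets borel" for k by auto
  have pt: "h x * ennreal (min ((T * norm x) powr - \<gamma>\<^sub>1) ((T * norm x) powr - \<gamma>\<^sub>2))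
     \<le> (\<Sum>k. ?a k * (h x * indicator (?A k) x) + ?b k * (h x * indicator (?B k) x))" for x
  proof -
    have i1: "indicator {.. 1 / 2 ^ k} (T * norm x) = (indicator (?A k) x :: ennreal)" for k
      using T by (auto simp: indicator_def field_simps)
    have i2: "indicator {.. 2 * 2 ^ k} (T * norm x) = (indicator (?B k) x :: ennreal)" for k
      using T by (auto simp: indicator_def field_simps)
    have "h x * ennreal (min ((T * norm x) powr - \<gamma>\<^sub>1) ((T * norm x) powr - \<gamma>\<^sub>2))
      \<le> h x * (\<Sum>k. ?a k * indicator (?A k) x + ?b k * indicator (?B k) x)"
      unfolding i1[symmetric] i2[symmetric]
      by (intro mult_left_mono min_powr_le_dyadic) (use T g in auto)
    also have "\<dots> = (\<Sum>k. h x * (?a k * indicator (?A k) x + ?b k * indicator (?B k) x))"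
      by (rule ennreal_suminf_cmult[symmetric])
    finally show ?thesis by (simp add: distrib_left mult_ac)
  qed
  have "(\<integral>\<^sup>+x. h x * ennreal (min ((T * norm x) powr - \<gamma>\<^sub>1) ((T * norm x) powr - \<gamma>\<^sub>2)) \<partial>lborel)
    \<le> (\<integral>\<^sup>+x. (\<Sum>k. ?a k * (h x * indicator (?A k) x) + ?b k * (h x * indicator (?B k) x)) \<partial>lborel)"
    by (intro nn_integral_mono pt)
  also have "\<dots> = (\<Sum>k. \<integral>\<^sup>+x. ?a k * (h x * indicator (?A k) x) + ?b k * (h x * indicator (?B k) x) \<partial>lborel)"
    by (intro nn_integral_suminf borel_measurable_add borel_measurable_times_ennreal borel_measurable_const
        borel_measurable_indicator) (use hm AB in simp_all)
  also have "\<dots> = (\<Sum>k. ?a k * (\<integral>\<^sup>+x. h x * indicator (?A k) x \<partial>lborel) + ?b k * (\<integral>\<^sup>+x. h x * indicator (?B k) x \<partial>lborel))"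
  proof (intro suminf_cong)
    fix k
    have mA: "(\<lambda>x. h x * indicator (?A k) x) \<in> borel_measurable lborel"
      and mB: "(\<lambda>x. h x * indicator (?B k) x) \<in> borel_measurable lborel"
      by (intro borel_measurable_times_ennreal borel_measurable_indicator; use hm AB in simp)+
    show "(\<integral>\<^sup>+x. ?a k * (h x * indicator (?A k) x) + ?b k * (h x * indicator (?B k) x) \<partial>lborel)
      = ?a k * (\<integral>\<^sup>+x. h x * indicator (?A k) x \<partial>lborel) + ?b k * (\<integral>\<^sup>+x. h x * indicator (?B k) x \<partial>lborel)"
      unfolding nn_integral_cmult[OF mA, symmetric] nn_integral_cmult[OF mB, symmetric]
      by (intro nn_integral_add borel_measurable_times_ennreal borel_measurable_const mA mB)
  qed
  also have "\<dots> \<le> (\<Sum>k. ennreal (2 powr \<gamma>\<^sub>1 * ?KT * (2 powr (\<gamma>\<^sub>1 - \<beta>)) ^ k) + ennreal (2 powr \<beta> * ?KT * (2 powr (\<beta> - \<gamma>\<^sub>2)) ^ k))"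
  proof (intro suminf_le summableI add_mono)
    fix k
    have "?a k * (\<integral>\<^sup>+x. h x * indicator (?A k) x \<partial>lborel) \<le> ?a k * ennreal (K * (1 / 2 ^ k / T) powr \<beta>)"
      using T by (intro mult_left_mono h) auto
    also have "\<dots> = ennreal (2 powr \<gamma>\<^sub>1 * (2 powr \<gamma>\<^sub>1) ^ k * (K * (1 / 2 ^ k / T) powr \<beta>))"
      using K by (simp add: ennreal_mult)
    also have "2 powr \<gamma>\<^sub>1 * (2 powr \<gamma>\<^sub>1) ^ k * (K * (1 / 2 ^ k / T) powr \<beta>) = 2 powr \<gamma>\<^sub>1 * ?KT * (2 powr (\<gamma>\<^sub>1 - \<beta>)) ^ k"
    proof -
      have "(1 / 2 ^ k / T) powr \<beta> = (2 powr - \<beta>) ^ k * T powr - \<beta>"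
        using T by (simp add: powr_divide powr_mult powr_minus pw power_inverse field_simps)
      moreover have "(2 powr (\<gamma>\<^sub>1 - \<beta>)) ^ k = (2 powr \<gamma>\<^sub>1) ^ k * (2 powr - \<beta>) ^ k"
        by (simp add: power_mult_distrib[symmetric] powr_add[symmetric])
      ultimately show ?thesis by (simp only: mult_ac)
    qed
    finally show "?a k * (\<integral>\<^sup>+x. h x * indicator (?A k) x \<partial>lborel) \<le> ennreal (2 powr \<gamma>\<^sub>1 * ?KT * (2 powr (\<gamma>\<^sub>1 - \<beta>)) ^ k)" .
    have "?b k * (\<integral>\<^sup>+x. h x * indicator (?B k) x \<partial>lborel) \<le> ?b k * ennreal (K * (2 * 2 ^ k / T) powr \<beta>)"
      using T by (intro mult_left_mono h) auto
    also have "\<dots> = ennreal ((2 powr - \<gamma>\<^sub>2) ^ k * (K * (2 * 2 ^ k / T) powr \<beta>))"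
      using K by (simp add: ennreal_mult)
    also have "(2 powr - \<gamma>\<^sub>2) ^ k * (K * (2 * 2 ^ k / T) powr \<beta>) = 2 powr \<beta> * ?KT * (2 powr (\<beta> - \<gamma>\<^sub>2)) ^ k"
    proof -
      have "(2 * 2 ^ k / T) powr \<beta> = 2 powr \<beta> * (2 powr \<beta>) ^ k * T powr - \<beta>"
        using T by (simp add: powr_divide powr_mult powr_minus pw field_simps)
      moreover have "(2 powr (\<beta> - \<gamma>\<^sub>2)) ^ k = (2 powr \<beta>) ^ k * (2 powr - \<gamma>\<^sub>2) ^ k"
        by (simp add: power_mult_distrib[symmetric] powr_add[symmetric])
      ultimately show ?thesis by (simp only: mult_ac)
    qed
    finally show "?b k * (\<integral>\<^sup>+x. h x * indicator (?B k) x \<partial>lborel) \<le> ennreal (2 powr \<beta> * ?KT * (2 powr (\<beta> - \<gamma>\<^sub>2)) ^ k)" .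
  qed
  also have "\<dots> = (\<Sum>k. ennreal (2 powr \<gamma>\<^sub>1 * ?KT * (2 powr (\<gamma>\<^sub>1 - \<beta>)) ^ k)) + (\<Sum>k. ennreal (2 powr \<beta> * ?KT * (2 powr (\<beta> - \<gamma>\<^sub>2)) ^ k))"
    by (rule suminf_add[symmetric]) auto
  also have "\<dots> = ennreal (2 powr \<gamma>\<^sub>1 * ?KT / (1 - 2 powr (\<gamma>\<^sub>1 - \<beta>))) + ennreal (2 powr \<beta> * ?KT / (1 - 2 powr (\<beta> - \<gamma>\<^sub>2)))"
    using KT g by (intro arg_cong2[where f="(+)"] suminf_ennreal_geometric) (auto simp: powr_less_one)
  also have "\<dots> = ennreal (dyadic_const \<beta> \<gamma>\<^sub>1 \<gamma>\<^sub>2 * ?KT)"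
  proof -
    have "2 powr (\<gamma>\<^sub>1 - \<beta>) < 1" "2 powr (\<beta> - \<gamma>\<^sub>2) < (1::real)" using g by (auto simp: powr_less_one)
    then show ?thesis using KT
      by (subst ennreal_plus[symmetric]) (auto simp: dyadic_const_def distrib_right)
  qed
  finally show ?thesis .
qed

text \<open>The case \<open>h = 1\<close> of \<open>dyadic_integral\<close>, where the mass exponent
  is the dimension. On the ball of radius \<open>A\<close> the scaled variable is at most 1, so the
  minimum is its first entry; the second exponent may be any number above the dimension.\<close>

lemma ball_powr_integral:
  fixes A :: real
  assumes s: "0 \<le> s" "2 * s < real DIM('a::euclidean_space)" and A: "0 < A"
  shows "(\<integral>\<^sup>+x. ennreal (norm (x::'a) powr - (2 * s)) * indicator (cball 0 A) x \<partial>lborel)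
    \<le> ennreal (dyadic_const (real DIM('a)) (2 * s) (real DIM('a) + 1) * unit_ball_vol (real DIM('a)) * A powr (real DIM('a) - 2 * s))"
proof -
  let ?n = "real DIM('a)" and ?V = "unit_ball_vol (real DIM('a))"
  let ?m = "\<lambda>x::'a. min ((1/A * norm x) powr - (2 * s)) ((1/A * norm x) powr - (?n + 1))"
  have pt: "ennreal (norm x powr - (2 * s)) * indicator (cball 0 A) x \<le> ennreal (A powr - (2 * s)) * (1 * ennreal (?m x))" for x :: 'a
  proof (cases "norm x \<le> A \<and> x \<noteq> 0")
    case True
    then have y: "0 < 1/A * norm x" "1/A * norm x \<le> 1" using A by auto
    then have "(1/A * norm x) powr - (2 * s) \<le> (1/A * norm x) powr - (?n + 1)"
      using s by (intro powr_mono') auto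
    then have "?m x = (1/A * norm x) powr - (2 * s)" by simp
    also have "\<dots> = A powr (2 * s) * norm x powr - (2 * s)"
      using A True by (simp add: powr_mult powr_divide powr_minus field_simps)
    finally have "A powr - (2 * s) * ?m x = norm x powr - (2 * s)"
      using A by (simp add: powr_minus field_simps)
    then show ?thesis using True by (simp add: ennreal_mult[symmetric])
  qed (auto simp: indicator_def)
  have "(\<integral>\<^sup>+x. ennreal (norm (x::'a) powr - (2 * s)) * indicator (cball 0 A) x \<partial>lborel)
     \<le> (\<integral>\<^sup>+x. ennreal (A powr - (2 * s)) * (1 * ennreal (?m x)) \<partial>lborel)"
    by (intro nn_integral_mono pt)
  also have "\<dots> = ennreal (A powr - (2 * s)) * (\<integral>\<^sup>+x. 1 * ennreal (?m x) \<partial>lborel)"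
    by (rule nn_integral_cmult) measurable
  also have "\<dots> \<le> ennreal (A powr - (2 * s)) * ennreal (dyadic_const ?n (2 * s) (?n + 1) * (?V * (1/A) powr - ?n))"
  proof (intro mult_left_mono dyadic_integral)
    fix r :: real assume r: "0 < r"
    show "(\<integral>\<^sup>+x. 1 * indicator (cball (0::'a) r) x \<partial>lborel) \<le> ennreal (?V * r powr ?n)"
      using r by (simp add: emeasure_cball powr_realpow)
  qed (use s A in auto)
  also have "\<dots> = ennreal (A powr - (2 * s) * (dyadic_const ?n (2 * s) (?n + 1) * (?V * (1/A) powr - ?n)))"
    using dyadic_const_pos[of "2 * s" ?n "?n + 1"] s by (simp add: ennreal_mult)
  also have "A powr - (2 * s) * (dyadic_const ?n (2 * s) (?n + 1) * (?V * (1/A) powr - ?n)) = dyadic_const ?n (2 * s) (?n + 1) * ?V * A powr (?n - 2 * s)"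
    using A by (simp add: powr_divide powr_minus powr_diff field_simps)
  finally show ?thesis .
qed

section \<open>Sobolev embedding and Gagliardo--Nirenberg inequality\<close>

lemma powr_squared: "(x powr a)\<^sup>2 = x powr (2 * a)" for x a :: real
  by (simp add: power2_eq_square powr_add[symmetric])

lemma nn_integral_powr_layer:
  fixes b e :: real
  assumes "0 < e" "0 \<le> b"
  shows "(\<integral>\<^sup>+t. (if 0 \<le> t \<and> t \<le> b then ennreal (t powr (e - 1)) else 0) \<partial>lborel) = ennreal (b powr e / e)"
proof -
  have "((\<lambda>t. t powr (e - 1)) has_integral (b powr (e - 1 + 1) / (e - 1 + 1))) {0..b}"
    by (rule has_integral_powr_from_0) (use assms in auto)
  then have "((\<lambda>t. t powr (e - 1)) has_integral (b powr e / e)) {0..b}" by simp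
  then have "(\<integral>\<^sup>+t. ennreal (t powr (e - 1)) * indicator {0..b} t \<partial>lborel) = ennreal (b powr e / e)"
    by (intro nn_integral_has_integral_lebesgue') auto
  moreover have "ennreal (t powr (e - 1)) * indicator {0..b} t = (if 0 \<le> t \<and> t \<le> b then ennreal (t powr (e - 1)) else 0)" for t
    by (auto simp: indicator_def)
  ultimately show ?thesis by simp
qed

text \<open>The supremum is bounded by the L1 norm of the transform. On the ball
  \<open>norm \<xi> powr - s\<close> is square-integrable because \<open>2 * s < n\<close>, so the
  transform is integrable there as a product of two square-integrable functions.\<close>

lemma low_frequency_sup:
  fixes u :: "'a::euclidean_space L2"
  defines "n \<equiv> real DIM('a)"
  assumes s: "0 \<le> s" "2 * s < n" and A: "0 < A" and D: "0 < D"
    and c: "c = dyadic_const n (2 * s) (n + 1) * unit_ball_vol n"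
    and u: "(\<integral>\<^sup>+\<xi>. ennreal (norm \<xi> powr (2 * s) * (cmod (rep_L2 (fourier u) \<xi>))\<^sup>2) \<partial>lborel) \<le> ennreal (D\<^sup>2)"
  shows "AE x in lborel. cmod (rep_L2 (inv_fourier (mul (indicator (cball 0 A)) (fourier u))) x)
    \<le> (c + 1) / (2 * (2 * pi) ^ DIM('a)) * D * A powr (n / 2 - s)"
proof -
  let ?v = "fourier u" and ?I = "indicator (cball 0 A) :: 'a \<Rightarrow> complex"
  let ?l = "mul ?I ?v"
  have c0: "0 \<le> c" unfolding c using dyadic_const_pos[of "2 * s" n "n + 1"] s n_def by simp
  \<comment> \<open>This weight in Young's inequality gives both terms the size
    \<open>D * A powr (n / 2 - s)\<close> up to constants.\<close>
  define \<eta> where "\<eta> = D * A powr (s - n / 2)"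
  have \<eta>: "0 < \<eta>" using D A by (simp add: \<eta>_def)
  have sq: "square_integrable (\<lambda>\<xi>. ?I \<xi> * rep_L2 ?v \<xi>)"
    by (rule square_integrable_mul[where C=1]) (auto simp: indicator_def intro!: borel_measurable_indicator)
  have rl: "AE \<xi> in lborel. rep_L2 ?l \<xi> = ?I \<xi> * rep_L2 ?v \<xi>" by (rule rep_mul[OF sq])
  have young: "a * b \<le> (\<eta> * a\<^sup>2 + b\<^sup>2 / \<eta>) / 2" for a b :: real
  proof -
    have "0 \<le> (\<eta> * a - b)\<^sup>2" by simp
    then have "2 * (a * b) * \<eta> \<le> \<eta> * (\<eta> * a\<^sup>2) + b\<^sup>2" by (simp add: power2_eq_square algebra_simps)
    then show ?thesis using \<eta> by (simp add: field_simps power2_eq_square)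
  qed
  have nz: "AE \<xi> in lborel. (\<xi>::'a) \<noteq> 0" by (rule AE_lborel_singleton)
  have nnl: "(\<integral>\<^sup>+\<xi>. ennreal (cmod (rep_L2 ?l \<xi>)) \<partial>lborel) \<le> ennreal ((c + 1) / 2 * D * A powr (n / 2 - s))"
  proof -
    have "(\<integral>\<^sup>+\<xi>. ennreal (cmod (rep_L2 ?l \<xi>)) \<partial>lborel) \<le>
      (\<integral>\<^sup>+\<xi>. ennreal (\<eta> / 2) * (ennreal (norm \<xi> powr - (2 * s)) * indicator (cball 0 A) \<xi>)
         + ennreal (1 / (2 * \<eta>)) * ennreal (norm \<xi> powr (2 * s) * (cmod (rep_L2 ?v \<xi>))\<^sup>2) \<partial>lborel)"
      using rl nz
    proof (intro nn_integral_mono_AE, eventually_elim)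
      case (elim \<xi>)
      show ?case
      proof (cases "norm \<xi> \<le> A")
        case True
        have p: "norm \<xi> powr - s * norm \<xi> powr s = 1" using elim by (simp add: powr_add[symmetric])
        have "cmod (rep_L2 ?v \<xi>) = norm \<xi> powr - s * (norm \<xi> powr s * cmod (rep_L2 ?v \<xi>))"
          using p by (simp add: mult.assoc[symmetric])
        also have "\<dots> \<le> (\<eta> * (norm \<xi> powr - s)\<^sup>2 + (norm \<xi> powr s * cmod (rep_L2 ?v \<xi>))\<^sup>2 / \<eta>) / 2"
          by (rule young)
        also have "\<dots> = \<eta> / 2 * norm \<xi> powr - (2 * s) + 1 / (2 * \<eta>) * (norm \<xi> powr (2 * s) * (cmod (rep_L2 ?v \<xi>))\<^sup>2)"
          by (simp add: power_mult_distrib powr_squared add_divide_distrib)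
        finally show ?thesis using True elim \<eta> by (simp add: ennreal_mult[symmetric] ennreal_plus[symmetric] del: ennreal_plus)
      qed (use elim in simp)
    qed
    also have "\<dots> = ennreal (\<eta> / 2) * (\<integral>\<^sup>+\<xi>. ennreal (norm (\<xi>::'a) powr - (2 * s)) * indicator (cball 0 A) \<xi> \<partial>lborel)
       + ennreal (1 / (2 * \<eta>)) * (\<integral>\<^sup>+\<xi>. ennreal (norm \<xi> powr (2 * s) * (cmod (rep_L2 ?v \<xi>))\<^sup>2) \<partial>lborel)"
    proof -
      have m1: "(\<lambda>\<xi>::'a. ennreal (norm \<xi> powr - (2 * s)) * indicator (cball 0 A) \<xi>) \<in> borel_measurable lborel"
        by (intro borel_measurable_times_ennreal borel_measurable_indicator; simp)
      have m2: "(\<lambda>\<xi>. ennreal (norm \<xi> powr (2 * s) * (cmod (rep_L2 ?v \<xi>))\<^sup>2)) \<in> borel_measurable lborel" by measurable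
      show ?thesis
        unfolding nn_integral_cmult[OF m1, symmetric] nn_integral_cmult[OF m2, symmetric]
        by (intro nn_integral_add borel_measurable_times_ennreal borel_measurable_const m1 m2)
    qed
    also have "\<dots> \<le> ennreal (\<eta> / 2) * ennreal (c * A powr (n - 2 * s)) + ennreal (1 / (2 * \<eta>)) * ennreal (D\<^sup>2)"
      unfolding c n_def by (intro add_mono mult_left_mono u ball_powr_integral) (use s A n_def in auto)
    also have "\<dots> = ennreal (\<eta> / 2 * (c * A powr (n - 2 * s)) + 1 / (2 * \<eta>) * D\<^sup>2)"
      using \<eta> c0 by (simp add: ennreal_mult[symmetric] ennreal_plus[symmetric] del: ennreal_plus)
    also have "\<eta> / 2 * (c * A powr (n - 2 * s)) + 1 / (2 * \<eta>) * D\<^sup>2 = (c + 1) / 2 * D * A powr (n / 2 - s)"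
    proof -
      define P where "P = A powr (s - n / 2)"
      define Q where "Q = A powr (n / 2 - s)"
      have P: "0 < P" using A by (simp add: P_def)
      have PQ: "P * Q = 1" using A by (simp add: P_def Q_def powr_add[symmetric])
      have "A powr (n - 2 * s) = Q * Q" by (simp add: Q_def powr_add[symmetric])
      then have "\<eta> / 2 * (c * A powr (n - 2 * s)) = c / 2 * D * ((P * Q) * Q)"
        by (simp add: \<eta>_def P_def[symmetric])
      then have e1: "\<eta> / 2 * (c * A powr (n - 2 * s)) = c / 2 * D * Q" by (simp add: PQ)
      have "1 / (2 * \<eta>) * D\<^sup>2 = 1 / 2 * D * (1 / P)"
        unfolding \<eta>_def P_def[symmetric] using D by (simp add: power2_eq_square)
      moreover have "1 / P = Q" using P PQ by (simp add: nonzero_divide_eq_eq mult.commute)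
      ultimately have e2: "1 / (2 * \<eta>) * D\<^sup>2 = 1 / 2 * D * Q" by simp
      show ?thesis unfolding e1 e2 Q_def[symmetric] by (simp add: distrib_right add_divide_distrib)
    qed
    finally show ?thesis .
  qed
  have intl: "integrable lborel (rep_L2 ?l)"
    using le_less_trans[OF nnl ennreal_less_top] by (simp add: integrable_iff_bounded)
  have li: "(\<integral>\<xi>. cmod (rep_L2 ?l \<xi>) \<partial>lborel) \<le> (c + 1) / 2 * D * A powr (n / 2 - s)"
  proof -
    have "ennreal (\<integral>\<xi>. cmod (rep_L2 ?l \<xi>) \<partial>lborel) \<le> ennreal ((c + 1) / 2 * D * A powr (n / 2 - s))"
      using nnl nn_integral_eq_integral[OF integrable_norm[OF intl]] by simp
    moreover have "0 \<le> (c + 1) / 2 * D * A powr (n / 2 - s)" using c0 D by simp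
    ultimately show ?thesis by (simp only: ennreal_le_iff)
  qed
  have inv: "inv_fourier ?l = (1 / (2 * pi) ^ DIM('a)) *\<^sub>R to_L2 (ftrans 1 (rep_L2 ?l))"
    by (rule inv_fourier_bounded_support[where R=A]) (use rl in \<open>eventually_elim, auto simp: indicator_def\<close>)
  have sF: "square_integrable (ftrans 1 (rep_L2 ?l))"
    by (rule square_integrable_ftrans[OF intl square_integrable_rep]) simp
  show ?thesis unfolding inv
    using rep_L2_scaleR[of "1 / (2 * pi) ^ DIM('a)" "to_L2 (ftrans 1 (rep_L2 ?l))"] rep_to_L2[OF sF]
  proof eventually_elim
    case (elim x)
    have "cmod (rep_L2 ((1 / (2 * pi) ^ DIM('a)) *\<^sub>R to_L2 (ftrans 1 (rep_L2 ?l))) x) = 1 / (2 * pi) ^ DIM('a) * cmod (ftrans 1 (rep_L2 ?l) x)"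
      using elim by simp
    also have "\<dots> \<le> 1 / (2 * pi) ^ DIM('a) * ((c + 1) / 2 * D * A powr (n / 2 - s))"
      by (intro mult_left_mono order_trans[OF norm_ftrans_le[OF intl] li]) simp
    finally show ?case by (simp add: field_simps)
  qed
qed

lemma nn_norm_diff_mul_indicator:
  fixes v :: "'a::euclidean_space L2"
  shows "ennreal ((norm (v - mul (indicator (cball 0 A)) v))\<^sup>2) = (\<integral>\<^sup>+\<xi>. (if A < norm \<xi> then ennreal ((cmod (rep_L2 v \<xi>))\<^sup>2) else 0) \<partial>lborel)"
proof -
  have sq: "square_integrable (\<lambda>\<xi>. indicator (cball 0 A) \<xi> * rep_L2 v \<xi>)"
    by (rule square_integrable_mul[where C=1]) (auto simp: indicator_def intro!: borel_measurable_indicator)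
  show ?thesis
    unfolding nn_norm_L2[symmetric]
  proof (rule nn_integral_cong_AE, use rep_mul[OF sq] rep_L2_diff[of v "mul (indicator (cball 0 A)) v"] in eventually_elim)
    fix \<xi> :: 'a
    assume "rep_L2 (mul (indicator (cball 0 A)) v) \<xi> = indicator (cball 0 A) \<xi> * rep_L2 v \<xi>"
      "rep_L2 (v - mul (indicator (cball 0 A)) v) \<xi> = rep_L2 v \<xi> - rep_L2 (mul (indicator (cball 0 A)) v) \<xi>"
    then show "ennreal ((cmod (rep_L2 (v - mul (indicator (cball 0 A)) v) \<xi>))\<^sup>2) = (if A < norm \<xi> then ennreal ((cmod (rep_L2 v \<xi>))\<^sup>2) else 0)"
      by (auto simp: indicator_def)
  qed
qed

text \<open>Splitting at a frequency that depends on the level, chosen so that the low frequencies account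
  for at most half of the level (Chemin and Xu); this covers the critical exponent.\<close>

lemma sobolev_embedding:
  fixes q s :: real
  defines "n \<equiv> real DIM('a::euclidean_space)"
  assumes q: "2 < q" and s: "s = n * (1/2 - 1/q)"
  shows "\<exists>C>0. \<forall>(u :: 'a L2) D. 0 < D \<longrightarrow>
    (\<integral>\<^sup>+\<xi>. ennreal (norm \<xi> powr (2 * s) * (cmod (rep_L2 (fourier u) \<xi>))\<^sup>2) \<partial>lborel) \<le> ennreal (D\<^sup>2) \<longrightarrow>
    (\<integral>\<^sup>+x. ennreal (cmod (rep_L2 u x) powr q) \<partial>lborel) \<le> ennreal (C * D powr q)"
proof -
  let ?pi = "(2 * pi) ^ DIM('a)"
  have n: "0 < n" by (simp add: n_def)
  have s2: "0 \<le> s" "2 * s < n"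
  proof -
    have "1 / q \<le> 1 / 2" using q by (simp add: field_simps)
    then show "0 \<le> s" using n by (simp add: s)
    have "n * (1 - 2 / q) < n * 1" using q n by (intro mult_strict_left_mono) auto
    moreover have "2 * s = n * (1 - 2 / q)" by (simp add: s algebra_simps)
    ultimately show "2 * s < n" by simp
  qed
  have ns: "n / 2 - s = n / q" by (simp add: s algebra_simps)
  define c where "c = dyadic_const n (2 * s) (n + 1) * unit_ball_vol n"
  have c0: "0 \<le> c" unfolding c_def using dyadic_const_pos[of "2 * s" n "n + 1"] s2 n_def by simp
  \<comment> \<open>With this constant \<open>low_frequency_sup\<close> bounds the part of
    \<open>u\<close> at frequencies up to \<open>A\<close> by
    \<open>k * D * A powr (n / q)\<close>.\<close>
  define k where "k = (c + 1) / (2 * ?pi)"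
  have k: "0 < k" using c0 by (simp add: k_def)
  define C where "C = 4 / ?pi * (2 * k) powr (q - 2)"
  have C: "0 < C" using k by (simp add: C_def)
  have "(\<integral>\<^sup>+x. ennreal (cmod (rep_L2 u x) powr q) \<partial>lborel) \<le> ennreal (C * D powr q)"
    if D: "0 < D" and u: "(\<integral>\<^sup>+\<xi>. ennreal (norm \<xi> powr (2 * s) * (cmod (rep_L2 (fourier u) \<xi>))\<^sup>2) \<partial>lborel) \<le> ennreal (D\<^sup>2)"
    for u :: "'a L2" and D
  proof -
    let ?v = "fourier u"
    \<comment> \<open>The level at which the splitting frequency reaches \<open>norm \<xi>\<close>:
      the frequencies above \<open>A\<close> at level \<open>t\<close> are among those with
      \<open>t \<le> b \<xi>\<close>.\<close>
    define b where "b \<xi> = 2 * k * D * norm \<xi> powr (n / q)" for \<xi> :: 'a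
    have b0: "0 \<le> b \<xi>" for \<xi> using k D by (simp add: b_def)
    have bm[measurable]: "b \<in> borel_measurable borel" unfolding b_def[abs_def] by measurable
    have level: "(\<integral>\<^sup>+x. (if 0 \<le> t \<and> t \<le> cmod (rep_L2 u x) then ennreal ((cmod (rep_L2 u x))\<^sup>2) else 0) \<partial>lborel)
        \<le> ennreal (4 / ?pi) * (\<integral>\<^sup>+\<xi>. (if 0 \<le> t \<and> t \<le> b \<xi> then ennreal ((cmod (rep_L2 ?v \<xi>))\<^sup>2) else 0) \<partial>lborel)"
      if t: "0 < t" for t
    proof -
      \<comment> \<open>Solves \<open>k * D * A powr (n / q) = t / 2\<close>.\<close>
      define A where "A = (t / (2 * k * D)) powr (q / n)"
      have A: "0 < A" using t k D by (simp add: A_def)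
      have An: "A powr (n / q) = t / (2 * k * D)" using q n t k D by (simp add: A_def powr_powr)
      let ?l = "mul (indicator (cball 0 A)) ?v"
      have low: "AE x in lborel. cmod (rep_L2 (inv_fourier ?l) x) \<le> t / 2"
        using low_frequency_sup[OF s2(1) s2(2)[unfolded n_def] A D c_def[unfolded n_def] u]
        unfolding n_def[symmetric] ns An k_def[symmetric]
        by eventually_elim (use k D in \<open>simp add: field_simps\<close>)
      have diff: "u - inv_fourier ?l = inv_fourier (?v - ?l)"
        by (simp add: linear_diff[OF bounded_linear.linear[OF bounded_linear_inv_fourier]])
      have "(\<integral>\<^sup>+x. (if 0 \<le> t \<and> t \<le> cmod (rep_L2 u x) then ennreal ((cmod (rep_L2 u x))\<^sup>2) else 0) \<partial>lborel)
        \<le> (\<integral>\<^sup>+x. ennreal 4 * ennreal ((cmod (rep_L2 (u - inv_fourier ?l) x))\<^sup>2) \<partial>lborel)"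
      proof (rule nn_integral_mono_AE, use low rep_L2_diff[of u "inv_fourier ?l"] in eventually_elim)
        fix x assume h: "cmod (rep_L2 (inv_fourier ?l) x) \<le> t / 2"
          "rep_L2 (u - inv_fourier ?l) x = rep_L2 u x - rep_L2 (inv_fourier ?l) x"
        show "(if 0 \<le> t \<and> t \<le> cmod (rep_L2 u x) then ennreal ((cmod (rep_L2 u x))\<^sup>2) else 0) \<le> ennreal 4 * ennreal ((cmod (rep_L2 (u - inv_fourier ?l) x))\<^sup>2)"
        proof (cases "t \<le> cmod (rep_L2 u x)")
          case True
          have "cmod (rep_L2 u x) \<le> 2 * cmod (rep_L2 (u - inv_fourier ?l) x)"
            using norm_triangle_ineq2[of "rep_L2 u x" "rep_L2 (inv_fourier ?l) x"] h True by simp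
          then have "(cmod (rep_L2 u x))\<^sup>2 \<le> (2 * cmod (rep_L2 (u - inv_fourier ?l) x))\<^sup>2" by (rule power_mono) simp
          then have "ennreal ((cmod (rep_L2 u x))\<^sup>2) \<le> ennreal (4 * (cmod (rep_L2 (u - inv_fourier ?l) x))\<^sup>2)"
            by (intro ennreal_leI) simp
          then show ?thesis by (simp add: ennreal_mult)
        qed simp
      qed
      also have "\<dots> = ennreal 4 * ennreal ((norm (u - inv_fourier ?l))\<^sup>2)"
        by (subst nn_integral_cmult) (auto simp: nn_norm_L2)
      also have "(norm (u - inv_fourier ?l))\<^sup>2 = (norm (?v - ?l))\<^sup>2 / ?pi"
        unfolding diff norm_inv_fourier power_divide sqrt_pi_const_sq ..
      also have "ennreal 4 * ennreal ((norm (?v - ?l))\<^sup>2 / ?pi) = ennreal (4 / ?pi) * ennreal ((norm (?v - ?l))\<^sup>2)"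
        by (subst (1 2) ennreal_mult[symmetric]) simp_all
      also have "\<dots> \<le> ennreal (4 / ?pi) * (\<integral>\<^sup>+\<xi>. (if 0 \<le> t \<and> t \<le> b \<xi> then ennreal ((cmod (rep_L2 ?v \<xi>))\<^sup>2) else 0) \<partial>lborel)"
        unfolding nn_norm_diff_mul_indicator
      proof (intro mult_left_mono nn_integral_mono)
        fix \<xi> :: 'a
        have "t \<le> b \<xi>" if "A < norm \<xi>"
        proof -
          have "A powr (n / q) \<le> norm \<xi> powr (n / q)" using that A n q by (intro powr_mono2) auto
          then show ?thesis unfolding An b_def using k D by (simp add: field_simps)
        qed
        then show "(if A < norm \<xi> then ennreal ((cmod (rep_L2 ?v \<xi>))\<^sup>2) else 0) \<le> (if 0 \<le> t \<and> t \<le> b \<xi> then ennreal ((cmod (rep_L2 ?v \<xi>))\<^sup>2) else 0)"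
          using t by auto
      qed simp
      finally show ?thesis .
    qed
    have q3: "q - 3 = (q - 2) - 1" by simp
    \<comment> \<open>Layer-cake formula with the square kept as a factor: only the power
      \<open>B powr (q - 2)\<close> is written as an integral over levels. The square is what
      Plancherel's theorem can handle at each level, and \<open>q > 2\<close> makes the integral
      converge at \<open>0\<close>.\<close>
    have ten: "ennreal (g\<^sup>2) * ennreal (B powr (q - 2) / (q - 2)) = (\<integral>\<^sup>+t. ennreal (t powr (q - 3)) * (if 0 \<le> t \<and> t \<le> B then ennreal (g\<^sup>2) else 0) \<partial>lborel)"
      if "0 \<le> B" for g B :: real
    proof -
      have "ennreal (g\<^sup>2) * ennreal (B powr (q - 2) / (q - 2)) = ennreal (g\<^sup>2) * (\<integral>\<^sup>+t. (if 0 \<le> t \<and> t \<le> B then ennreal (t powr (q - 3)) else 0) \<partial>lborel)"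
        unfolding q3 using q that by (subst nn_integral_powr_layer) auto
      also have "\<dots> = (\<integral>\<^sup>+t. ennreal (g\<^sup>2) * (if 0 \<le> t \<and> t \<le> B then ennreal (t powr (q - 3)) else 0) \<partial>lborel)"
        by (rule nn_integral_cmult[symmetric]) measurable
      also have "\<dots> = (\<integral>\<^sup>+t. ennreal (t powr (q - 3)) * (if 0 \<le> t \<and> t \<le> B then ennreal (g\<^sup>2) else 0) \<partial>lborel)"
        by (intro nn_integral_cong) (auto simp: mult.commute)
      finally show ?thesis .
    qed
    let ?U = "\<lambda>x t. ennreal (t powr (q - 3)) * (if 0 \<le> t \<and> t \<le> cmod (rep_L2 u x) then ennreal ((cmod (rep_L2 u x))\<^sup>2) else 0)"
    let ?V = "\<lambda>\<xi> t. ennreal (t powr (q - 3)) * (if 0 \<le> t \<and> t \<le> b \<xi> then ennreal ((cmod (rep_L2 ?v \<xi>))\<^sup>2) else 0)"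
    have Um: "case_prod ?U \<in> borel_measurable (lborel \<Otimes>\<^sub>M lborel)" by measurable
    have Vm: "case_prod ?V \<in> borel_measurable (lborel \<Otimes>\<^sub>M lborel)" by measurable
    have pq: "y\<^sup>2 * (y powr (q - 2) / (q - 2)) = y powr q / (q - 2)" if "0 \<le> y" for y :: real
    proof (cases "y = 0")
      case False
      then have "y\<^sup>2 = y powr 2" using that by (simp add: powr_numeral)
      then show ?thesis by (simp add: powr_add[symmetric])
    qed (use q in simp)
    have "(\<integral>\<^sup>+x. ennreal (cmod (rep_L2 u x) powr q / (q - 2)) \<partial>lborel) = (\<integral>\<^sup>+x. (\<integral>\<^sup>+t. ?U x t \<partial>lborel) \<partial>lborel)"
      unfolding ten[OF norm_ge_zero, symmetric] pq[OF norm_ge_zero, symmetric]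
      using q by (intro nn_integral_cong ennreal_mult) auto
    \<comment> \<open>Tonelli puts the levels outside, where \<open>level\<close> applies; a second
      use below brings the frequencies outside again.\<close>
    also have "\<dots> = (\<integral>\<^sup>+t. (\<integral>\<^sup>+x. ?U x t \<partial>lborel) \<partial>lborel)"
      by (rule lborel_pair.Fubini'[OF Um, symmetric])
    also have "\<dots> \<le> (\<integral>\<^sup>+t. ennreal (4 / ?pi) * (\<integral>\<^sup>+\<xi>. ?V \<xi> t \<partial>lborel) \<partial>lborel)"
    proof (intro nn_integral_mono)
      fix t :: real
      have mu: "(\<lambda>x. (if 0 \<le> t \<and> t \<le> cmod (rep_L2 u x) then ennreal ((cmod (rep_L2 u x))\<^sup>2) else 0)) \<in> borel_measurable lborel" by measurable
      have mv: "(\<lambda>\<xi>. (if 0 \<le> t \<and> t \<le> b \<xi> then ennreal ((cmod (rep_L2 ?v \<xi>))\<^sup>2) else 0)) \<in> borel_measurable lborel" by measurable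
      show "(\<integral>\<^sup>+x. ?U x t \<partial>lborel) \<le> ennreal (4 / ?pi) * (\<integral>\<^sup>+\<xi>. ?V \<xi> t \<partial>lborel)"
      proof (cases "0 < t")
        case True
        show ?thesis unfolding nn_integral_cmult[OF mu] nn_integral_cmult[OF mv]
          using mult_left_mono[OF level[OF True], of "ennreal (t powr (q - 3))"] by (simp add: mult_ac)
      next
        case False
        then have "?U x t = 0" for x by (cases "t = 0") auto
        then have "(\<integral>\<^sup>+x. ?U x t \<partial>lborel) = (\<integral>\<^sup>+x. 0 \<partial>(lborel :: 'a measure))" by (intro nn_integral_cong)
        then show ?thesis by (simp only: nn_integral_const mult_zero_left zero_le)
      qed
    qed
    also have "\<dots> = ennreal (4 / ?pi) * (\<integral>\<^sup>+t. (\<integral>\<^sup>+\<xi>. ?V \<xi> t \<partial>lborel) \<partial>lborel)"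
      by (rule nn_integral_cmult) (intro lborel.borel_measurable_nn_integral, use Vm in measurable)
    also have "(\<integral>\<^sup>+t. (\<integral>\<^sup>+\<xi>. ?V \<xi> t \<partial>lborel) \<partial>lborel) = (\<integral>\<^sup>+\<xi>. (\<integral>\<^sup>+t. ?V \<xi> t \<partial>lborel) \<partial>lborel)"
      by (rule lborel_pair.Fubini'[OF Vm])
    also have "\<dots> = (\<integral>\<^sup>+\<xi>. ennreal ((2 * k * D) powr (q - 2) / (q - 2)) * ennreal (norm \<xi> powr (2 * s) * (cmod (rep_L2 ?v \<xi>))\<^sup>2) \<partial>lborel)"
    proof (intro nn_integral_cong)
      fix \<xi> :: 'a
      have e: "n * (q - 2) / q = 2 * s" using q by (simp add: s field_simps)
      have "b \<xi> powr (q - 2) = (2 * k * D) powr (q - 2) * norm \<xi> powr (2 * s)"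
        using k D by (simp add: b_def powr_mult powr_powr e)
      then show "(\<integral>\<^sup>+t. ?V \<xi> t \<partial>lborel) = ennreal ((2 * k * D) powr (q - 2) / (q - 2)) * ennreal (norm \<xi> powr (2 * s) * (cmod (rep_L2 ?v \<xi>))\<^sup>2)"
        unfolding ten[OF b0, symmetric] using q by (subst (1 2) ennreal_mult[symmetric]) (simp_all add: mult_ac)
    qed
    also have "\<dots> = ennreal ((2 * k * D) powr (q - 2) / (q - 2)) * (\<integral>\<^sup>+\<xi>. ennreal (norm \<xi> powr (2 * s) * (cmod (rep_L2 ?v \<xi>))\<^sup>2) \<partial>lborel)"
      by (rule nn_integral_cmult) measurable
    finally have "(\<integral>\<^sup>+x. ennreal (cmod (rep_L2 u x) powr q / (q - 2)) \<partial>lborel)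
       \<le> ennreal (4 / ?pi) * (ennreal ((2 * k * D) powr (q - 2) / (q - 2)) * (\<integral>\<^sup>+\<xi>. ennreal (norm \<xi> powr (2 * s) * (cmod (rep_L2 ?v \<xi>))\<^sup>2) \<partial>lborel))" .
    also have "\<dots> \<le> ennreal (4 / ?pi) * (ennreal ((2 * k * D) powr (q - 2) / (q - 2)) * ennreal (D\<^sup>2))"
      by (intro mult_left_mono u) auto
    also have "\<dots> = ennreal (4 / ?pi * ((2 * k * D) powr (q - 2) / (q - 2) * D\<^sup>2))"
    proof -
      have nn: "0 \<le> (2 * k * D) powr (q - 2) / (q - 2)" "0 \<le> 4 / ?pi" "0 \<le> D\<^sup>2" using q by auto
      show ?thesis by (simp only: ennreal_mult[OF nn(1,3)] ennreal_mult[OF nn(2) mult_nonneg_nonneg[OF nn(1,3)]])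
    qed
    also have "4 / ?pi * ((2 * k * D) powr (q - 2) / (q - 2) * D\<^sup>2) = C * D powr q / (q - 2)"
    proof -
      have "(2 * k * D) powr (q - 2) / (q - 2) * D\<^sup>2 = (2 * k) powr (q - 2) * (D\<^sup>2 * (D powr (q - 2) / (q - 2)))"
        using k D by (simp add: powr_mult)
      also have "\<dots> = (2 * k) powr (q - 2) * (D powr q / (q - 2))"
        by (simp only: pq[OF less_imp_le[OF D]])
      finally show ?thesis by (simp add: C_def)
    qed
    finally have fin: "(\<integral>\<^sup>+x. ennreal (cmod (rep_L2 u x) powr q / (q - 2)) \<partial>lborel) \<le> ennreal (C * D powr q / (q - 2))" .
    have "(\<integral>\<^sup>+x. ennreal (cmod (rep_L2 u x) powr q) \<partial>lborel) = ennreal (q - 2) * (\<integral>\<^sup>+x. ennreal (cmod (rep_L2 u x) powr q / (q - 2)) \<partial>lborel)"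
      using q by (subst nn_integral_cmult[symmetric]) (auto simp: ennreal_mult[symmetric] intro!: nn_integral_cong)
    also have "\<dots> \<le> ennreal (q - 2) * ennreal (C * D powr q / (q - 2))"
      by (intro mult_left_mono fin) simp
    also have "\<dots> = ennreal ((q - 2) * (C * D powr q / (q - 2)))"
      using q C by (intro ennreal_mult[symmetric]) auto
    also have "(q - 2) * (C * D powr q / (q - 2)) = C * D powr q" using q by simp
    finally show ?thesis .
  qed
  then show ?thesis using C by blast
qed

text \<open>Written with a frequency scale \<open>\<rho>\<close> instead of a product of powers of
  norms: the hypotheses say that \<open>u\<close> has size \<open>X\<close> and behaves as if
  concentrated at frequencies of size \<open>\<rho>\<close>. Comparing \<open>norm \<xi>\<close>
  with \<open>\<rho>\<close> bounds the weight of order \<open>s\<close> by those of orders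
  \<open>0\<close> and \<open>\<sigma>\<close>, and the Sobolev embedding finishes. The case
  \<open>q = 2\<close> is apart because the embedding is proved for \<open>q > 2\<close>.\<close>

lemma gagliardo_nirenberg:
  fixes q s \<sigma> :: real
  defines "n \<equiv> real DIM('a::euclidean_space)"
  assumes q: "2 \<le> q" and s: "s = n * (1/2 - 1/q)" and \<sigma>: "s \<le> \<sigma>"
  shows "\<exists>C>0. \<forall>(u :: 'a L2) X \<rho>. 0 < X \<longrightarrow> 0 < \<rho> \<longrightarrow> norm u \<le> X \<longrightarrow>
    (\<integral>\<^sup>+\<xi>. ennreal (norm \<xi> powr (2 * \<sigma>) * (cmod (rep_L2 (fourier u) \<xi>))\<^sup>2) \<partial>lborel) \<le> ennreal ((\<rho> powr \<sigma> * X)\<^sup>2) \<longrightarrow>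
    (\<integral>\<^sup>+x. ennreal (cmod (rep_L2 u x) powr q) \<partial>lborel) \<le> ennreal (C * (\<rho> powr s * X) powr q)"
proof (cases "q = 2")
  case True
  have "(\<integral>\<^sup>+x. ennreal (cmod (rep_L2 u x) powr q) \<partial>lborel) \<le> ennreal (1 * (\<rho> powr s * X) powr q)"
    if "0 < X" "0 < \<rho>" "norm u \<le> X" for u :: "'a L2" and X \<rho>
  proof -
    have "(\<integral>\<^sup>+x. ennreal (cmod (rep_L2 u x) powr q) \<partial>lborel) = ennreal ((norm u)\<^sup>2)"
      using True by (simp add: nn_norm_L2[symmetric] powr_numeral)
    also have "\<dots> \<le> ennreal (X\<^sup>2)" using that by (intro ennreal_leI power_mono) auto
    finally show ?thesis using True s that by (simp add: powr_numeral)
  qed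
  then show ?thesis by (intro exI[of _ 1]) auto
next
  case False
  then have q2: "2 < q" using q by simp
  obtain C where C: "0 < C" "\<And>(u :: 'a L2) D. 0 < D \<Longrightarrow>
    (\<integral>\<^sup>+\<xi>. ennreal (norm \<xi> powr (2 * s) * (cmod (rep_L2 (fourier u) \<xi>))\<^sup>2) \<partial>lborel) \<le> ennreal (D\<^sup>2) \<Longrightarrow>
    (\<integral>\<^sup>+x. ennreal (cmod (rep_L2 u x) powr q) \<partial>lborel) \<le> ennreal (C * D powr q)"
    using sobolev_embedding[OF q2 s[unfolded n_def]] by blast
  let ?pi = "(2 * pi) ^ DIM('a)"
  have s0: "0 \<le> s" using q2 by (simp add: s n_def field_simps)
  define K where "K = sqrt (?pi + 1)"
  have K: "0 < K" "K\<^sup>2 = ?pi + 1" by (auto simp: K_def add_pos_pos)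
  have "(\<integral>\<^sup>+x. ennreal (cmod (rep_L2 u x) powr q) \<partial>lborel) \<le> ennreal (C * K powr q * (\<rho> powr s * X) powr q)"
    if X: "0 < X" and \<rho>: "0 < \<rho>" and u: "norm u \<le> X"
      "(\<integral>\<^sup>+\<xi>. ennreal (norm \<xi> powr (2 * \<sigma>) * (cmod (rep_L2 (fourier u) \<xi>))\<^sup>2) \<partial>lborel) \<le> ennreal ((\<rho> powr \<sigma> * X)\<^sup>2)"
    for u :: "'a L2" and X \<rho>
  proof -
    let ?v = "\<lambda>\<xi>. (cmod (rep_L2 (fourier u) \<xi>))\<^sup>2"
    have pt: "norm \<xi> powr (2 * s) \<le> \<rho> powr (2 * s) + \<rho> powr (2 * s - 2 * \<sigma>) * norm \<xi> powr (2 * \<sigma>)" for \<xi> :: 'a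
    proof (cases "norm \<xi> \<le> \<rho>")
      case True
      then have "norm \<xi> powr (2 * s) \<le> \<rho> powr (2 * s)" using s0 by (intro powr_mono2) auto
      then show ?thesis by (simp add: add_increasing2)
    next
      case False
      then have "norm \<xi> powr (2 * s - 2 * \<sigma>) \<le> \<rho> powr (2 * s - 2 * \<sigma>)"
        using \<rho> \<sigma> by (intro powr_mono2') auto
      then have "norm \<xi> powr (2 * s - 2 * \<sigma>) * norm \<xi> powr (2 * \<sigma>) \<le> \<rho> powr (2 * s - 2 * \<sigma>) * norm \<xi> powr (2 * \<sigma>)"
        by (intro mult_right_mono) auto
      then show ?thesis using False \<rho> by (simp add: powr_add[symmetric] add_increasing)
    qed
    have "(\<integral>\<^sup>+\<xi>. ennreal (norm \<xi> powr (2 * s) * ?v \<xi>) \<partial>lborel)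
      \<le> (\<integral>\<^sup>+\<xi>. ennreal (\<rho> powr (2 * s)) * ennreal (?v \<xi>) + ennreal (\<rho> powr (2 * s - 2 * \<sigma>)) * ennreal (norm \<xi> powr (2 * \<sigma>) * ?v \<xi>) \<partial>lborel)"
    proof (intro nn_integral_mono)
      fix \<xi> :: 'a
      have "norm \<xi> powr (2 * s) * ?v \<xi> \<le> (\<rho> powr (2 * s) + \<rho> powr (2 * s - 2 * \<sigma>) * norm \<xi> powr (2 * \<sigma>)) * ?v \<xi>"
        by (intro mult_right_mono pt) simp
      then show "ennreal (norm \<xi> powr (2 * s) * ?v \<xi>) \<le> ennreal (\<rho> powr (2 * s)) * ennreal (?v \<xi>) + ennreal (\<rho> powr (2 * s - 2 * \<sigma>)) * ennreal (norm \<xi> powr (2 * \<sigma>) * ?v \<xi>)"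
        by (simp add: ennreal_mult[symmetric] ennreal_plus[symmetric] distrib_right mult.assoc ennreal_leI del: ennreal_plus)
    qed
    also have "\<dots> = ennreal (\<rho> powr (2 * s)) * (\<integral>\<^sup>+\<xi>. ennreal (?v \<xi>) \<partial>lborel) + ennreal (\<rho> powr (2 * s - 2 * \<sigma>)) * (\<integral>\<^sup>+\<xi>. ennreal (norm \<xi> powr (2 * \<sigma>) * ?v \<xi>) \<partial>lborel)"
      by (subst nn_integral_add) (auto simp: nn_integral_cmult)
    also have "\<dots> \<le> ennreal (\<rho> powr (2 * s)) * ennreal (?pi * X\<^sup>2) + ennreal (\<rho> powr (2 * s - 2 * \<sigma>)) * ennreal ((\<rho> powr \<sigma> * X)\<^sup>2)"
    proof (intro add_mono mult_left_mono u)
      show "(\<integral>\<^sup>+\<xi>. ennreal (?v \<xi>) \<partial>lborel) \<le> ennreal (?pi * X\<^sup>2)"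
        unfolding nn_norm_L2 norm_fourier power_mult_distrib sqrt_pi_const_sq
        using u(1) by (intro ennreal_leI mult_left_mono power_mono) auto
    qed auto
    also have "\<dots> = ennreal (\<rho> powr (2 * s) * (?pi * X\<^sup>2) + \<rho> powr (2 * s - 2 * \<sigma>) * (\<rho> powr \<sigma> * X)\<^sup>2)"
      using \<rho> by (simp add: ennreal_mult[symmetric] ennreal_plus[symmetric] del: ennreal_plus)
    also have "\<rho> powr (2 * s) * (?pi * X\<^sup>2) + \<rho> powr (2 * s - 2 * \<sigma>) * (\<rho> powr \<sigma> * X)\<^sup>2 = (K * (\<rho> powr s * X))\<^sup>2"
    proof -
      have a: "(\<rho> powr \<sigma>)\<^sup>2 = \<rho> powr (2 * \<sigma>)" "(\<rho> powr s)\<^sup>2 = \<rho> powr (2 * s)"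
        by (rule powr_squared)+
      have b: "\<rho> powr (2 * s - 2 * \<sigma>) * \<rho> powr (2 * \<sigma>) = \<rho> powr (2 * s)" by (simp add: powr_add[symmetric])
      show ?thesis unfolding power_mult_distrib a K mult.assoc[symmetric] b by (simp add: algebra_simps)
    qed
    finally have "(\<integral>\<^sup>+\<xi>. ennreal (norm \<xi> powr (2 * s) * ?v \<xi>) \<partial>lborel) \<le> ennreal ((K * (\<rho> powr s * X))\<^sup>2)" .
    then have "(\<integral>\<^sup>+x. ennreal (cmod (rep_L2 u x) powr q) \<partial>lborel) \<le> ennreal (C * (K * (\<rho> powr s * X)) powr q)"
      using K X \<rho> by (intro C(2)) auto
    then show ?thesis using K X \<rho> by (simp add: powr_mult mult_ac)
  qed
  then show ?thesis using C(1) K(1) by (intro exI[of _ "C * K powr q"]) auto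
qed

section \<open>The kernels\<close>

lemma exp_minus_le_inverse: "x * exp (- x) \<le> (1::real)"
proof -
  have "x \<le> exp x" using exp_ge_add_one_self[of x] by linarith
  then show ?thesis by (simp add: exp_minus field_simps)
qed

text \<open>Mean value inequality on a half plane, which is convex and on which the derivative is at
  most \<open>exp (R * t)\<close>. Real and complex conjugate roots are thus treated alike.\<close>

lemma norm_exp_diff_le:
  fixes l\<^sub>1 l\<^sub>2 :: complex
  assumes "Re l\<^sub>1 \<le> R" "Re l\<^sub>2 \<le> R" "0 \<le> t"
  shows "cmod (exp (l\<^sub>1 * complex_of_real t) - exp (l\<^sub>2 * complex_of_real t)) \<le> exp (R * t) * (cmod (l\<^sub>1 - l\<^sub>2) * t)"
proof -
  let ?S = "{z. Re z \<le> R * t}"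
  have "cmod (exp (l\<^sub>1 * complex_of_real t) - exp (l\<^sub>2 * complex_of_real t)) \<le> exp (R * t) * cmod (l\<^sub>1 * complex_of_real t - l\<^sub>2 * complex_of_real t)"
  proof (rule field_differentiable_bound[of ?S exp exp])
    show "convex ?S" by (rule convex_halfspace_Re_le)
    show "(exp has_field_derivative exp z) (at z within ?S)" for z by (auto intro!: derivative_eq_intros)
    show "cmod (exp z) \<le> exp (R * t)" if "z \<in> ?S" for z using that by (simp add: norm_exp_eq_Re)
  qed (use assms in \<open>auto intro: mult_right_mono\<close>)
  also have "l\<^sub>1 * complex_of_real t - l\<^sub>2 * complex_of_real t = (l\<^sub>1 - l\<^sub>2) * complex_of_real t"
    by (simp add: left_diff_distrib)
  finally show ?thesis using assms by (simp add: norm_mult)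
qed

lemma csqrt_complex_of_real:
  "csqrt (complex_of_real d) = (if 0 \<le> d then complex_of_real (sqrt d) else \<i> * complex_of_real (sqrt (- d)))"
  by (simp add: csqrt_of_real_nonneg csqrt_of_real_nonpos)

text \<open>The divided difference of \<open>z \<mapsto> exp (z * t)\<close> at the two
  roots.\<close>

definition kern :: "complex \<Rightarrow> complex \<Rightarrow> real \<Rightarrow> complex" where
  "kern l\<^sub>1 l\<^sub>2 t = (if l\<^sub>1 = l\<^sub>2 then complex_of_real t * exp (l\<^sub>1 * complex_of_real t)
     else (exp (l\<^sub>1 * complex_of_real t) - exp (l\<^sub>2 * complex_of_real t)) / (l\<^sub>1 - l\<^sub>2))"

lemma kern_le:
  assumes "Re l\<^sub>2 \<le> Re l\<^sub>1" "0 \<le> t"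
  shows "cmod (kern l\<^sub>1 l\<^sub>2 t) \<le> t * exp (Re l\<^sub>1 * t)"
proof (cases "l\<^sub>1 = l\<^sub>2")
  case True
  then show ?thesis using assms by (simp add: kern_def norm_mult norm_exp_eq_Re)
next
  case False
  then have "cmod (l\<^sub>1 - l\<^sub>2) > 0" by simp
  then show ?thesis using norm_exp_diff_le[OF order_refl assms(1,2)] False
    by (simp add: kern_def norm_divide pos_divide_le_eq mult_ac)
qed

text \<open>For well separated roots: the factor \<open>t\<close> of \<open>kern_le\<close>, which
  is meant for roots that are close or equal, is exchanged for the inverse of the distance.\<close>

lemma kern_le2:
  assumes "Re l\<^sub>2 \<le> Re l\<^sub>1" "0 \<le> t" "0 < D" "D \<le> cmod (l\<^sub>1 - l\<^sub>2)"
  shows "cmod (kern l\<^sub>1 l\<^sub>2 t) \<le> 2 / D * exp (Re l\<^sub>1 * t)"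
proof -
  have "l\<^sub>1 \<noteq> l\<^sub>2" using assms by auto
  have "cmod (exp (l\<^sub>1 * complex_of_real t) - exp (l\<^sub>2 * complex_of_real t)) \<le> cmod (exp (l\<^sub>1 * complex_of_real t)) + cmod (exp (l\<^sub>2 * complex_of_real t))"
    by (rule norm_triangle_ineq4)
  also have "\<dots> \<le> 2 * exp (Re l\<^sub>1 * t)" using assms mult_right_mono[OF assms(1,2)] by (simp add: norm_exp_eq_Re)
  finally have "cmod (exp (l\<^sub>1 * complex_of_real t) - exp (l\<^sub>2 * complex_of_real t)) / cmod (l\<^sub>1 - l\<^sub>2) \<le> 2 * exp (Re l\<^sub>1 * t) / D"
    using assms by (intro frac_le) auto
  then show ?thesis using \<open>l\<^sub>1 \<noteq> l\<^sub>2\<close> by (simp add: kern_def norm_divide)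
qed

text \<open>With damping \<open>b\<close> and stiffness \<open>w\<close>, the decay rate \<open>w / b\<close> is right up to a constant in the
  overdamped regime, and dominated by \<open>b\<close> otherwise because \<open>w \<le> b\<^sup>2\<close>.\<close>

lemma kern_bounds:
  fixes b w t :: real
  assumes b: "0 < b" and w: "0 \<le> w" "w \<le> b\<^sup>2" and t: "0 \<le> t"
  defines "l\<^sub>1 \<equiv> (- complex_of_real b + csqrt (complex_of_real (b\<^sup>2 - 4 * w))) / 2"
    and "l\<^sub>2 \<equiv> (- complex_of_real b - csqrt (complex_of_real (b\<^sup>2 - 4 * w))) / 2"
  shows "cmod (kern l\<^sub>1 l\<^sub>2 t) \<le> t"
    and "cmod (kern l\<^sub>1 l\<^sub>2 t) \<le> 8 / b * exp (- (w / b * t / 8))"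
    and "cmod (exp (l\<^sub>1 * complex_of_real t) - l\<^sub>1 * kern l\<^sub>1 l\<^sub>2 t) \<le> 17 * exp (- (w / b * t / 8))"
proof -
  define d where "d = b\<^sup>2 - 4 * w"
  define c where "c = csqrt (complex_of_real d)"
  have l: "l\<^sub>1 = (- complex_of_real b + c) / 2" "l\<^sub>2 = (- complex_of_real b - c) / 2"
    by (auto simp: l\<^sub>1_def l\<^sub>2_def c_def d_def)
  have c0: "0 \<le> Re c" unfolding c_def by (rule Re_csqrt)
  have Re: "Re l\<^sub>1 = (Re c - b) / 2" "Re l\<^sub>2 = (- Re c - b) / 2" by (auto simp: l)
  have R21: "Re l\<^sub>2 \<le> Re l\<^sub>1" using c0 by (simp add: Re)
  have dif: "l\<^sub>1 - l\<^sub>2 = c" by (simp add: l field_simps)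
  have wb: "0 \<le> w / b" "w / b \<le> b" using b w by (auto simp: field_simps power2_eq_square)
  have wbt: "w / b * t / 8 \<le> b * t / 8" using mult_right_mono[OF wb(2) t] by simp
  have ncd: "cmod c \<le> 2 * b"
  proof -
    have "(cmod c)\<^sup>2 = \<bar>d\<bar>" by (simp add: c_def norm_power[symmetric])
    also have "\<dots> \<le> (2 * b)\<^sup>2" using w b by (auto simp: d_def power_mult_distrib abs_if)
    finally show ?thesis using b power2_le_imp_le[of "cmod c" "2 * b"] by simp
  qed
  have nl1: "cmod l\<^sub>1 \<le> 2 * b"
  proof -
    have "cmod (- complex_of_real b + c) \<le> b + cmod c" using norm_triangle_ineq[of "- complex_of_real b" c] b by simp
    then show ?thesis using ncd b by (simp add: l(1) norm_divide)
  qed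
  have key: "cmod (kern l\<^sub>1 l\<^sub>2 t) \<le> 8 / b * exp (- (w / b * t / 8)) \<and> Re l\<^sub>1 \<le> - (w / b) / 8"
  \<comment> \<open>The threshold separates the roots by at least \<open>b / 2\<close> in the first
    case and keeps both real parts at most \<open>- b / 4\<close> in the second.\<close>
  proof (cases "b\<^sup>2 / 4 < d")
    case True
    then have d0: "0 < d" using b by (smt (verit) zero_le_power2 divide_nonneg_nonneg)
    have c: "c = complex_of_real (sqrt d)" using d0 by (simp add: c_def csqrt_complex_of_real)
    have sd: "b / 2 < sqrt d" using True b by (intro real_less_rsqrt) (simp add: power_divide)
    have sd2: "sqrt d \<le> b" using w b by (intro real_le_lsqrt) (auto simp: d_def)
    \<comment> \<open>The roots have product \<open>w\<close> and the larger modulus is at most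
      \<open>b\<close>, so the smaller one is at least \<open>w / b\<close>.\<close>
    have "(b - sqrt d) * (b + sqrt d) = 4 * w" using d0 by (simp add: algebra_simps power2_eq_square[symmetric]) (simp add: d_def)
    then have "4 * w \<le> (b - sqrt d) * (2 * b)" using sd2 mult_left_mono[of "b + sqrt d" "2 * b" "b - sqrt d"] by simp
    then have rr: "w / b \<le> (b - sqrt d) / 2" using b by (simp add: field_simps)
    then have R: "Re l\<^sub>1 \<le> - (w / b)" by (simp add: Re c)
    have "cmod (kern l\<^sub>1 l\<^sub>2 t) \<le> 2 / (b / 2) * exp (Re l\<^sub>1 * t)"
      by (rule kern_le2[OF R21 t]) (use b sd d0 in \<open>auto simp: dif c\<close>)
    also have "\<dots> \<le> 8 / b * exp (- (w / b * t / 8))"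
    proof (intro mult_mono)
      have "Re l\<^sub>1 * t \<le> - (w / b) * t" using R t by (rule mult_right_mono)
      also have "\<dots> \<le> - (w / b * t / 8)"
      proof -
        have "x / 8 \<le> x" if "0 \<le> x" for x :: real using that by simp
        from this[OF mult_nonneg_nonneg[OF wb(1) t]] show ?thesis
          unfolding mult_minus_left by (rule le_imp_neg_le)
      qed
      finally show "exp (Re l\<^sub>1 * t) \<le> exp (- (w / b * t / 8))" by simp
    qed (use b in \<open>auto intro: divide_right_mono\<close>)
    finally show ?thesis using R wb(1) by simp
  next
    case False
    have rc: "Re c \<le> b / 2"
    proof (cases "0 \<le> d")
      case True
      moreover have "sqrt d \<le> b / 2"
        by (rule real_le_lsqrt) (use False b in \<open>auto simp: power_divide\<close>)
      ultimately show ?thesis by (simp add: c_def csqrt_complex_of_real)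
    next
      case False
      then show ?thesis using b by (simp add: c_def csqrt_complex_of_real)
    qed
    then have R: "Re l\<^sub>1 \<le> - b / 4" by (simp add: Re)
    have "cmod (kern l\<^sub>1 l\<^sub>2 t) \<le> t * exp (Re l\<^sub>1 * t)" by (rule kern_le[OF R21 t])
    also have "\<dots> \<le> t * exp (- b / 4 * t)" using mult_right_mono[OF R t] t by (intro mult_left_mono) auto
    \<comment> \<open>Half of the exponential is spent on absorbing the factor
      \<open>t\<close>.\<close>
    also have "\<dots> = 8 / b * ((b * t / 8) * exp (- (b * t / 8))) * exp (- (b * t / 8))"
      using b by (simp add: exp_add[symmetric] field_simps)
    also have "\<dots> \<le> 8 / b * 1 * exp (- (b * t / 8))"
      using b by (intro mult_right_mono mult_left_mono exp_minus_le_inverse) auto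
    also have "\<dots> \<le> 8 / b * exp (- (w / b * t / 8))"
      using wbt b by (simp add: divide_right_mono)
    finally show ?thesis using R wb b by simp
  qed
  then have R0: "Re l\<^sub>1 \<le> 0" using wb(1) by simp
  have eb: "exp (Re l\<^sub>1 * t) \<le> exp (- (w / b * t / 8))"
    using mult_right_mono[OF conjunct2[OF key] t] by simp
  show "cmod (kern l\<^sub>1 l\<^sub>2 t) \<le> 8 / b * exp (- (w / b * t / 8))" using key by simp
  have "exp (Re l\<^sub>1 * t) \<le> 1" using R0 t by (simp add: mult_nonpos_nonneg)
  then show "cmod (kern l\<^sub>1 l\<^sub>2 t) \<le> t"
    using kern_le[OF R21 t] mult_left_mono[of "exp (Re l\<^sub>1 * t)" 1 t] t by simp
  have "cmod (exp (l\<^sub>1 * complex_of_real t) - l\<^sub>1 * kern l\<^sub>1 l\<^sub>2 t) \<le> cmod (exp (l\<^sub>1 * complex_of_real t)) + cmod (l\<^sub>1 * kern l\<^sub>1 l\<^sub>2 t)"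
    by (rule norm_triangle_ineq4)
  \<comment> \<open>Here \<open>17 = 1 + 2 * 8\<close>, from
    \<open>cmod l\<^sub>1 \<le> 2 * b\<close> and the constant \<open>8 / b\<close> in the bound of
    \<open>kern\<close>.\<close>
  also have "\<dots> \<le> exp (- (w / b * t / 8)) + 2 * b * (8 / b * exp (- (w / b * t / 8)))"
    unfolding norm_mult using eb key b nl1 by (intro add_mono mult_mono) (auto simp: norm_exp_eq_Re)
  also have "\<dots> = 17 * exp (- (w / b * t / 8))" using b by simp
  finally show "cmod (exp (l\<^sub>1 * complex_of_real t) - l\<^sub>1 * kern l\<^sub>1 l\<^sub>2 t) \<le> 17 * exp (- (w / b * t / 8))" .
qed

section \<open>The kernels of the problem as functions of the frequency\<close>

lemma K1_hat_eq: "K1_hat \<sigma> \<sigma>\<^sub>1 \<sigma>\<^sub>2 t \<xi> = kern (root\<^sub>1 \<sigma> \<sigma>\<^sub>1 \<sigma>\<^sub>2 \<xi>) (root\<^sub>2 \<sigma> \<sigma>\<^sub>1 \<sigma>\<^sub>2 \<xi>) t"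
  by (simp add: K1_hat_def kern_def Let_def)

text \<open>In this form, which also covers the double root, bounds, measurability and continuity of
  the first kernel reduce to those of \<open>kern\<close>.\<close>

lemma K0_hat_eq: "K0_hat \<sigma> \<sigma>\<^sub>1 \<sigma>\<^sub>2 t \<xi> = exp (root\<^sub>1 \<sigma> \<sigma>\<^sub>1 \<sigma>\<^sub>2 \<xi> * complex_of_real t)
    - root\<^sub>1 \<sigma> \<sigma>\<^sub>1 \<sigma>\<^sub>2 \<xi> * kern (root\<^sub>1 \<sigma> \<sigma>\<^sub>1 \<sigma>\<^sub>2 \<xi>) (root\<^sub>2 \<sigma> \<sigma>\<^sub>1 \<sigma>\<^sub>2 \<xi>) t"
proof -
  have "(l * e' - l' * e) / (l - l') = e - l * ((e - e') / (l - l'))" if "l \<noteq> l'" for l l' e e' :: complex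
  proof -
    have "l - l' \<noteq> 0" using that by simp
    then have "e = e * (l - l') / (l - l')" by simp
    then have "e - l * ((e - e') / (l - l')) = (e * (l - l') - l * (e - e')) / (l - l')"
      by (metis (no_types, lifting) diff_divide_distrib times_divide_eq_right)
    then show ?thesis by (simp add: algebra_simps)
  qed
  then show ?thesis by (simp add: K0_hat_def kern_def Let_def left_diff_distrib)
qed

text \<open>\<open>csqrt\<close> jumps across the negative half-line, so measurability is taken from
  its explicit form on the reals.\<close>

lemma csqrt_of_real_measurable: "(\<lambda>d. csqrt (complex_of_real d)) \<in> borel_measurable borel"
  unfolding csqrt_complex_of_real by measurable

lemma roots_measurable [measurable]:
  "(root\<^sub>1 \<sigma> \<sigma>\<^sub>1 \<sigma>\<^sub>2 :: 'a::euclidean_space \<Rightarrow> complex) \<in> borel_measurable borel"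
  "(root\<^sub>2 \<sigma> \<sigma>\<^sub>1 \<sigma>\<^sub>2 :: 'a \<Rightarrow> complex) \<in> borel_measurable borel"
proof -
  have [measurable]: "(\<lambda>\<xi>::'a. csqrt (complex_of_real ((damping_symbol \<sigma>\<^sub>1 \<sigma>\<^sub>2 \<xi>)\<^sup>2 - 4 * norm \<xi> powr (2 * \<sigma>)))) \<in> borel_measurable borel"
    unfolding damping_symbol_def
    by (rule measurable_compose[OF _ csqrt_of_real_measurable]) measurable
  have [measurable]: "(\<lambda>\<xi>::'a. damping_symbol \<sigma>\<^sub>1 \<sigma>\<^sub>2 \<xi>) \<in> borel_measurable borel"
    unfolding damping_symbol_def by measurable
  show "(root\<^sub>1 \<sigma> \<sigma>\<^sub>1 \<sigma>\<^sub>2 :: 'a \<Rightarrow> _) \<in> borel_measurable borel" "(root\<^sub>2 \<sigma> \<sigma>\<^sub>1 \<sigma>\<^sub>2 :: 'a \<Rightarrow> _) \<in> borel_measurable borel"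
    unfolding root\<^sub>1_def[abs_def] root\<^sub>2_def[abs_def] by measurable
qed

lemma kern_measurable:
  assumes [measurable]: "f \<in> borel_measurable M" "g \<in> borel_measurable M"
  shows "(\<lambda>x. kern (f x) (g x) t) \<in> borel_measurable M"
  unfolding kern_def by measurable

lemma K_hat_measurable [measurable]:
  "(K1_hat \<sigma> \<sigma>\<^sub>1 \<sigma>\<^sub>2 t :: 'a::euclidean_space \<Rightarrow> complex) \<in> borel_measurable borel"
  "(K0_hat \<sigma> \<sigma>\<^sub>1 \<sigma>\<^sub>2 t :: 'a \<Rightarrow> complex) \<in> borel_measurable borel"
proof -
  note [measurable] = kern_measurable
  show "(K1_hat \<sigma> \<sigma>\<^sub>1 \<sigma>\<^sub>2 t :: 'a \<Rightarrow> _) \<in> borel_measurable borel"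
    unfolding K1_hat_eq[abs_def] by measurable
  show "(K0_hat \<sigma> \<sigma>\<^sub>1 \<sigma>\<^sub>2 t :: 'a \<Rightarrow> _) \<in> borel_measurable borel"
    unfolding K0_hat_eq[abs_def] by measurable
qed

lemma K_hat_continuous:
  "continuous_on UNIV (\<lambda>t. K1_hat \<sigma> \<sigma>\<^sub>1 \<sigma>\<^sub>2 t \<xi>)" "continuous_on UNIV (\<lambda>t. K0_hat \<sigma> \<sigma>\<^sub>1 \<sigma>\<^sub>2 t \<xi>)"
proof -
  have k: "continuous_on UNIV (kern l\<^sub>1 l\<^sub>2)" for l\<^sub>1 l\<^sub>2
    unfolding kern_def[abs_def] by (cases "l\<^sub>1 = l\<^sub>2") (auto intro!: continuous_intros)
  show "continuous_on UNIV (\<lambda>t. K1_hat \<sigma> \<sigma>\<^sub>1 \<sigma>\<^sub>2 t \<xi>)"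
    unfolding K1_hat_eq using k by simp
  show "continuous_on UNIV (\<lambda>t. K0_hat \<sigma> \<sigma>\<^sub>1 \<sigma>\<^sub>2 t \<xi>)"
    unfolding K0_hat_eq by (intro continuous_intros k)
qed

text \<open>Since \<open>\<sigma>\<^sub>1 < \<sigma> / 2 < \<sigma>\<^sub>2\<close>, the first
  damping term dominates \<open>norm \<xi> powr \<sigma>\<close> inside the unit ball and the second
  one outside. This is the condition \<open>w \<le> b\<^sup>2\<close> of
  \<open>kern_bounds\<close>.\<close>

lemma damping_lower:
  fixes \<xi> :: "'a::euclidean_space"
  assumes "\<sigma>\<^sub>1 < \<sigma> / 2" "\<sigma> / 2 < \<sigma>\<^sub>2" "\<xi> \<noteq> 0"
  shows "norm \<xi> powr (2 * \<sigma>) \<le> (damping_symbol \<sigma>\<^sub>1 \<sigma>\<^sub>2 \<xi>)\<^sup>2" "0 < damping_symbol \<sigma>\<^sub>1 \<sigma>\<^sub>2 \<xi>"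
proof -
  have "norm \<xi> powr \<sigma> \<le> damping_symbol \<sigma>\<^sub>1 \<sigma>\<^sub>2 \<xi>"
  proof (cases "norm \<xi> \<le> 1")
    case True
    then have "norm \<xi> powr \<sigma> \<le> norm \<xi> powr (2 * \<sigma>\<^sub>1)" using assms by (intro powr_mono') auto
    then show ?thesis by (simp add: damping_symbol_def add_increasing2)
  next
    case False
    then have "norm \<xi> powr \<sigma> \<le> norm \<xi> powr (2 * \<sigma>\<^sub>2)" using assms by (intro powr_mono) auto
    then show ?thesis by (simp add: damping_symbol_def add_increasing)
  qed
  then have "(norm \<xi> powr \<sigma>)\<^sup>2 \<le> (damping_symbol \<sigma>\<^sub>1 \<sigma>\<^sub>2 \<xi>)\<^sup>2" by (rule power_mono) simp
  then show "norm \<xi> powr (2 * \<sigma>) \<le> (damping_symbol \<sigma>\<^sub>1 \<sigma>\<^sub>2 \<xi>)\<^sup>2" by (simp only: powr_squared)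
  show "0 < damping_symbol \<sigma>\<^sub>1 \<sigma>\<^sub>2 \<xi>" using assms by (simp add: damping_symbol_def add_pos_pos)
qed

lemma K_hat_bounds:
  fixes \<xi> :: "'a::euclidean_space"
  assumes s: "\<sigma>\<^sub>1 < \<sigma> / 2" "\<sigma> / 2 < \<sigma>\<^sub>2" "\<xi> \<noteq> 0" and t: "0 \<le> t"
  defines "b \<equiv> damping_symbol \<sigma>\<^sub>1 \<sigma>\<^sub>2 \<xi>"
  shows "cmod (K1_hat \<sigma> \<sigma>\<^sub>1 \<sigma>\<^sub>2 t \<xi>) \<le> t"
    and "cmod (K1_hat \<sigma> \<sigma>\<^sub>1 \<sigma>\<^sub>2 t \<xi>) \<le> 8 / b * exp (- (norm \<xi> powr (2 * \<sigma>) / b * t / 8))"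
    and "cmod (K0_hat \<sigma> \<sigma>\<^sub>1 \<sigma>\<^sub>2 t \<xi>) \<le> 17 * exp (- (norm \<xi> powr (2 * \<sigma>) / b * t / 8))"
  unfolding K1_hat_eq K0_hat_eq root\<^sub>1_def root\<^sub>2_def b_def
  using damping_lower[OF s] t by (intro kern_bounds; simp)+

text \<open>Inside the unit ball the damping is comparable to
  \<open>norm \<xi> powr (2 * \<sigma>\<^sub>1)\<close>. This produces the diffusion of order
  \<open>2 * (\<sigma> - \<sigma>\<^sub>1)\<close> and, through the inverse of the damping, the
  singular factor of the kernel.\<close>

lemma damping_rate_low:
  fixes \<xi> :: "'a::euclidean_space"
  assumes "\<sigma>\<^sub>1 < \<sigma>\<^sub>2" "\<xi> \<noteq> 0" "norm \<xi> \<le> 1"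
  defines "b \<equiv> damping_symbol \<sigma>\<^sub>1 \<sigma>\<^sub>2 \<xi>"
  shows "1 / b \<le> norm \<xi> powr - (2 * \<sigma>\<^sub>1)" "norm \<xi> powr (2 * (\<sigma> - \<sigma>\<^sub>1)) / 2 \<le> norm \<xi> powr (2 * \<sigma>) / b"
proof -
  let ?r = "norm \<xi>"
  have p: "0 < ?r powr (2 * \<sigma>\<^sub>1)" using assms by simp
  have b1: "?r powr (2 * \<sigma>\<^sub>1) \<le> b" by (simp add: b_def damping_symbol_def)
  have b2: "b \<le> 2 * ?r powr (2 * \<sigma>\<^sub>1)"
    using powr_mono'[of "2 * \<sigma>\<^sub>1" "2 * \<sigma>\<^sub>2" ?r] assms by (simp add: b_def damping_symbol_def)
  show "1 / b \<le> ?r powr - (2 * \<sigma>\<^sub>1)"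
    using p b1 by (simp add: powr_minus inverse_eq_divide frac_le)
  have "?r powr (2 * (\<sigma> - \<sigma>\<^sub>1)) / 2 = ?r powr (2 * \<sigma>) / (2 * ?r powr (2 * \<sigma>\<^sub>1))"
    by (simp add: right_diff_distrib powr_diff)
  also have "\<dots> \<le> ?r powr (2 * \<sigma>) / b" using p b1 b2
    by (intro divide_left_mono mult_pos_pos) (linarith | simp)+
  finally show "?r powr (2 * (\<sigma> - \<sigma>\<^sub>1)) / 2 \<le> ?r powr (2 * \<sigma>) / b" .
qed

text \<open>Outside the unit ball the rate is comparable to
  \<open>norm \<xi> powr (2 * (\<sigma> - \<sigma>\<^sub>2))\<close>, which is bounded below because
  \<open>\<sigma>\<^sub>2 \<le> \<sigma>\<close>: the decay is exponential without loss of
  derivatives. The inverse of the damping is a smoothing of order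
  \<open>2 * \<sigma>\<^sub>2\<close>.\<close>

lemma damping_rate_high:
  fixes \<xi> :: "'a::euclidean_space"
  assumes "\<sigma>\<^sub>1 < \<sigma>\<^sub>2" "\<sigma>\<^sub>2 \<le> \<sigma>" "1 < norm \<xi>"
  defines "b \<equiv> damping_symbol \<sigma>\<^sub>1 \<sigma>\<^sub>2 \<xi>"
  shows "1 / b \<le> norm \<xi> powr - (2 * \<sigma>\<^sub>2)" "1 / 2 \<le> norm \<xi> powr (2 * \<sigma>) / b"
proof -
  let ?r = "norm \<xi>"
  have p: "0 < ?r powr (2 * \<sigma>\<^sub>2)" using assms by auto
  have b1: "?r powr (2 * \<sigma>\<^sub>2) \<le> b" by (simp add: b_def damping_symbol_def)
  have b2: "b \<le> 2 * ?r powr (2 * \<sigma>\<^sub>2)"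
    using powr_mono[of "2 * \<sigma>\<^sub>1" "2 * \<sigma>\<^sub>2" ?r] assms by (simp add: b_def damping_symbol_def)
  show "1 / b \<le> ?r powr - (2 * \<sigma>\<^sub>2)"
    using p b1 by (simp add: powr_minus inverse_eq_divide frac_le)
  have "b \<le> 2 * ?r powr (2 * \<sigma>)" using b2 powr_mono[of "2 * \<sigma>\<^sub>2" "2 * \<sigma>" ?r] assms(2,3) by linarith
  moreover have "0 < b" using p b1 by linarith
  ultimately show "1 / 2 \<le> ?r powr (2 * \<sigma>) / b" by (simp add: field_simps)
qed

section \<open>Multipliers with diffusive decay\<close>

lemma powr_exp_bounded:
  fixes M c :: real
  assumes "0 \<le> M" "0 < c"
  shows "\<exists>C>0. \<forall>z>0. z powr M * exp (- (z / c)) \<le> C"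
proof (cases "M = 0")
  case True
  then show ?thesis using assms by (intro exI[of _ 1]) auto
next
  case False
  then have M: "0 < M" using assms by simp
  have "z powr M * exp (- (z / c)) \<le> (c * M) powr M" if z: "0 < z" for z
  proof -
    have "z / (c * M) \<le> exp (z / (c * M))" using exp_ge_add_one_self[of "z / (c * M)"] by linarith
    then have "(z / (c * M)) powr M \<le> exp (z / (c * M)) powr M"
      using z M assms by (intro powr_mono2) auto
    also have "\<dots> = exp (z / c)" using M assms by (simp add: exp_powr_real)
    finally have "z powr M / (c * M) powr M \<le> exp (z / c)" using z M assms by (simp add: powr_divide)
    then show ?thesis using M assms by (simp add: exp_minus field_simps)
  qed
  then show ?thesis using M assms by (intro exI[of _ "(c * M) powr M"]) auto
qed

text \<open>\<open>\<kappa>\<close> is the order of the singularity at the origin and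
  \<open>\<alpha>\<close> that of the diffusion. Writing \<open>1 + t\<close> for \<open>t\<close>
  at low frequencies costs a constant factor, as \<open>norm \<xi> powr \<alpha> \<le> 1\<close>
  there for positive \<open>\<alpha>\<close>, and makes the estimates uniform down to
  \<open>t = 0\<close>.\<close>

definition decaying :: "real \<Rightarrow> real \<Rightarrow> real \<Rightarrow> real \<Rightarrow> ('a::euclidean_space \<Rightarrow> complex) \<Rightarrow> bool" where
  "decaying \<alpha> \<kappa> c t k \<longleftrightarrow> k \<in> borel_measurable borel \<and>
    (\<forall>\<xi>. \<xi> \<noteq> 0 \<longrightarrow> norm \<xi> \<le> 1 \<longrightarrow> cmod (k \<xi>) \<le> c * (norm \<xi> powr - \<kappa> * exp (- (norm \<xi> powr \<alpha> * (1 + t) / 16)))) \<and>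
    (\<forall>\<xi>. 1 < norm \<xi> \<longrightarrow> cmod (k \<xi>) \<le> c * exp (- (t / 16)))"

lemma nn_norm_mul_indicator:
  fixes v :: "'a::euclidean_space L2"
  shows "(\<integral>\<^sup>+\<xi>. ennreal ((cmod (rep_L2 v \<xi>))\<^sup>2) * indicator (cball 0 r) \<xi> \<partial>lborel) = ennreal ((norm (mul (indicator (cball 0 r)) v))\<^sup>2)"
proof -
  have sq: "square_integrable (\<lambda>\<xi>. indicator (cball 0 r) \<xi> * rep_L2 v \<xi>)"
    by (rule square_integrable_mul[where C=1]) (auto simp: indicator_def intro!: borel_measurable_indicator)
  show ?thesis
    unfolding nn_norm_L2[symmetric]
  proof (rule nn_integral_cong_AE, use rep_mul[OF sq] in eventually_elim)
    fix \<xi> :: 'a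
    assume "rep_L2 (mul (indicator (cball 0 r)) v) \<xi> = indicator (cball 0 r) \<xi> * rep_L2 v \<xi>"
    then show "ennreal ((cmod (rep_L2 v \<xi>))\<^sup>2) * indicator (cball 0 r) \<xi> = ennreal ((cmod (rep_L2 (mul (indicator (cball 0 r)) v) \<xi>))\<^sup>2)"
      by (auto simp: indicator_def)
  qed
qed

lemma exp_decay_powr:
  fixes E :: real
  assumes "E \<le> 0"
  shows "\<exists>C>0. \<forall>t\<ge>0. exp (- (t / 16)) \<le> C * (1 + t) powr E"
proof -
  obtain C where C: "0 < C" "\<And>z. 0 < z \<Longrightarrow> z powr (- E) * exp (- (z / 16)) \<le> C"
    using powr_exp_bounded[of "- E" 16] assms by auto
  have "exp (- (t / 16)) \<le> exp (1/16) * C * (1 + t) powr E" if "0 \<le> t" for t :: real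
  proof -
    have "exp (- (t / 16)) = exp (1/16) * exp (- ((1 + t) / 16))" by (simp add: exp_add[symmetric] field_simps)
    also have "exp (- ((1 + t) / 16)) = (1 + t) powr E * ((1 + t) powr (- E) * exp (- ((1 + t) / 16)))"
      using that by (simp add: mult.assoc[symmetric] powr_add[symmetric])
    also have "\<dots> \<le> (1 + t) powr E * C" using that by (intro mult_left_mono C) auto
    finally show ?thesis by (simp add: mult_ac)
  qed
  then show ?thesis using C(1) by (intro exI[of _ "exp (1/16) * C"]) auto
qed

text \<open>An estimate from L2 to L2 through the supremum of the symbol: with
  \<open>z = norm \<xi> powr \<alpha> * (1 + t)\<close>, the factor
  \<open>norm \<xi> powr - \<kappa>\<close> is \<open>(1 + t) powr (\<kappa> / \<alpha>)\<close>
  times a power of \<open>z\<close>, which the exponential keeps bounded.\<close>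

lemma decaying_mul_flat:
  fixes \<alpha> \<kappa> :: real
  assumes \<alpha>: "0 < \<alpha>" and \<kappa>: "\<kappa> \<le> 0"
  shows "\<exists>C>0. \<forall>(k :: 'a::euclidean_space \<Rightarrow> complex) c t v. 0 \<le> c \<longrightarrow> 0 \<le> t \<longrightarrow> decaying \<alpha> \<kappa> c t k \<longrightarrow>
    norm (mul k v) \<le> C * (c * ((1 + t) powr (\<kappa> / \<alpha>) * norm v))"
proof -
  have E: "\<kappa> / \<alpha> \<le> 0" using assms by (simp add: divide_nonpos_pos)
  obtain C1 where C1: "0 < C1" "\<And>t. 0 \<le> t \<Longrightarrow> exp (- (t / 16)) \<le> C1 * (1 + t) powr (\<kappa> / \<alpha>)"
    using exp_decay_powr[OF E] by blast
  obtain C2 where C2: "0 < C2" "\<And>z. 0 < z \<Longrightarrow> z powr (- (\<kappa> / \<alpha>)) * exp (- (z / 16)) \<le> C2"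
    using powr_exp_bounded[of "- (\<kappa> / \<alpha>)" 16] E by auto
  have "norm (mul k v) \<le> (C1 + C2) * (c * ((1 + t) powr (\<kappa> / \<alpha>) * norm v))"
    if c: "0 \<le> c" and t: "0 \<le> t" and k: "decaying \<alpha> \<kappa> c t k" for k :: "'a \<Rightarrow> complex" and c t v
  proof -
    let ?E = "(1 + t) powr (\<kappa> / \<alpha>)"
    have "norm (mul k v) \<le> ((C1 + C2) * (c * ?E)) * norm v"
    proof (rule norm_mul_le)
      show "k \<in> borel_measurable borel" using k by (simp add: decaying_def)
      have nz: "AE \<xi> in lborel. (\<xi>::'a) \<noteq> 0" by (rule AE_lborel_singleton)
      show "AE \<xi> in lborel. cmod (k \<xi>) \<le> (C1 + C2) * (c * ?E)"
        using nz
      proof eventually_elim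
        case (elim \<xi>)
        show ?case
        proof (cases "norm \<xi> \<le> 1")
          case True
          define z where "z = norm \<xi> powr \<alpha> * (1 + t)"
          have z: "0 < z" using elim t by (simp add: z_def)
          have "norm \<xi> powr - \<kappa> = ?E * z powr (- (\<kappa> / \<alpha>))"
          proof -
            have "z powr (- (\<kappa> / \<alpha>)) = norm \<xi> powr - \<kappa> * (1 + t) powr (- (\<kappa> / \<alpha>))"
              using elim t \<alpha> by (simp add: z_def powr_mult powr_powr)
            moreover have "?E * (1 + t) powr (- (\<kappa> / \<alpha>)) = 1" using t by (simp add: powr_add[symmetric])
            ultimately show ?thesis by (simp add: mult_ac)
          qed
          moreover have "cmod (k \<xi>) \<le> c * (norm \<xi> powr - \<kappa> * exp (- (z / 16)))"
            using k elim True by (simp add: decaying_def z_def)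
          ultimately have "cmod (k \<xi>) \<le> c * (?E * (z powr (- (\<kappa> / \<alpha>)) * exp (- (z / 16))))" by (simp only: mult.assoc)
          also have "\<dots> \<le> c * (?E * C2)" using c by (intro mult_left_mono C2 z) auto
          also have "\<dots> \<le> (C1 + C2) * (c * ?E)" using C1(1) c by (simp add: algebra_simps)
          finally show ?thesis .
        next
          case False
          then have "cmod (k \<xi>) \<le> c * exp (- (t / 16))" using k by (simp add: decaying_def)
          also have "\<dots> \<le> c * (C1 * ?E)" using c t by (intro mult_left_mono C1) auto
          also have "\<dots> \<le> (C1 + C2) * (c * ?E)" using C2(1) c by (simp add: algebra_simps)
          finally show ?thesis .
        qed
      qed
    qed (use C1 C2 c in auto)
    then show ?thesis by (simp add: mult_ac)
  qed
  then show ?thesis using C1(1) C2(1) by (intro exI[of _ "C1 + C2"]) auto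
qed

text \<open>The hypothesis on balls is what \<open>fourier_ball_Lm\<close> gives for transforms of
  functions in L^m. With \<open>T = (1 + t) powr (1 / \<alpha>)\<close>, at low frequencies the
  squared bound on the symbol is \<open>T powr (2 * \<kappa>)\<close> times a function of
  \<open>T * norm \<xi>\<close> alone, and the dyadic summation contributes
  \<open>T powr - \<beta>\<close>.\<close>

lemma decaying_mul_ball:
  fixes \<alpha> \<kappa> \<beta> :: real
  assumes \<alpha>: "0 < \<alpha>" and \<beta>: "0 < \<beta>" "2 * \<kappa> < \<beta>"
  shows "\<exists>C>0. \<forall>(k :: 'a::euclidean_space \<Rightarrow> complex) c t v M. 0 \<le> c \<longrightarrow> 0 \<le> t \<longrightarrow> 0 \<le> M \<longrightarrow> decaying \<alpha> \<kappa> c t k \<longrightarrow>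
    norm v \<le> M \<longrightarrow> (\<forall>r>0. norm (mul (indicator (cball 0 r)) v) \<le> M * r powr (\<beta> / 2)) \<longrightarrow>
    norm (mul k v) \<le> C * (c * ((1 + t) powr ((\<kappa> - \<beta> / 2) / \<alpha>) * M))"
proof -
  define E where "E = (\<kappa> - \<beta> / 2) / \<alpha>"
  have E: "E \<le> 0" using assms by (simp add: E_def divide_nonpos_pos)
  obtain C1 where C1: "0 < C1" "\<And>t. 0 \<le> t \<Longrightarrow> exp (- (t / 16)) \<le> C1 * (1 + t) powr E"
    using exp_decay_powr[OF E] by blast
  \<comment> \<open>\<open>g1\<close> has to reach \<open>2 * \<kappa>\<close> for the symbol to be
    bounded by that power and stay below \<open>\<beta>\<close> for the series to converge; it is
    cut at \<open>0\<close> because \<open>dyadic_integral\<close> takes nonnegative exponents. For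
    \<open>g2\<close> any exponent above \<open>\<beta>\<close> serves.\<close>
  define g1 where "g1 = max 0 (2 * \<kappa>)"
  define g2 where "g2 = \<beta> + 1"
  have g: "0 \<le> g1" "g1 < \<beta>" "\<beta> < g2" "2 * \<kappa> \<le> g1" "2 * \<kappa> \<le> g2" using \<beta> by (auto simp: g1_def g2_def)
  obtain C2 where C2: "0 < C2" "\<And>z. 0 < z \<Longrightarrow> z powr ((g1 - 2 * \<kappa>) / \<alpha>) * exp (- (z / 8)) \<le> C2"
    using powr_exp_bounded[of "(g1 - 2 * \<kappa>) / \<alpha>" 8] g \<alpha> by auto
  obtain C3 where C3: "0 < C3" "\<And>z. 0 < z \<Longrightarrow> z powr ((g2 - 2 * \<kappa>) / \<alpha>) * exp (- (z / 8)) \<le> C3"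
    using powr_exp_bounded[of "(g2 - 2 * \<kappa>) / \<alpha>" 8] g \<alpha> by auto
  define C4 where "C4 = max C2 C3"
  define d where "d = dyadic_const \<beta> g1 g2"
  have d: "0 < d" unfolding d_def by (rule dyadic_const_pos[OF g(2,3)])
  define C where "C = sqrt (C4 * d + C1\<^sup>2)"
  have C4: "0 < C4" using C2(1) by (simp add: C4_def)
  have C: "0 < C" using C4 d C1(1) by (simp add: C_def add_pos_pos)
  have "norm (mul k v) \<le> C * (c * ((1 + t) powr E * M))"
    if c: "0 \<le> c" and t: "0 \<le> t" and M: "0 \<le> M" and k: "decaying \<alpha> \<kappa> c t k" and v: "norm v \<le> M"
      and vb: "\<And>r. 0 < r \<Longrightarrow> norm (mul (indicator (cball 0 r)) v) \<le> M * r powr (\<beta> / 2)"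
    for k :: "'a \<Rightarrow> complex" and c t v M
  proof -
    have km[measurable]: "k \<in> borel_measurable borel" using k by (simp add: decaying_def)
    define T where "T = (1 + t) powr (1 / \<alpha>)"
    have T: "0 < T" using t by (simp add: T_def)
    let ?h = "\<lambda>\<xi>. ennreal ((cmod (rep_L2 v \<xi>))\<^sup>2)"
    let ?m = "\<lambda>\<xi>::'a. min ((T * norm \<xi>) powr - g1) ((T * norm \<xi>) powr - g2)"
    have nz: "AE \<xi> in lborel. (\<xi>::'a) \<noteq> 0" by (rule AE_lborel_singleton)
    have kb: "(cmod (k \<xi>))\<^sup>2 \<le> c\<^sup>2 * (T powr (2 * \<kappa>) * C4) * ?m \<xi> + c\<^sup>2 * (C1 * (1 + t) powr E)\<^sup>2" if \<xi>: "\<xi> \<noteq> 0" for \<xi>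
    proof (cases "norm \<xi> \<le> 1")
      case True
      define y where "y = T * norm \<xi>"
      have y: "0 < y" using T \<xi> by (simp add: y_def)
      have z: "norm \<xi> powr \<alpha> * (1 + t) = y powr \<alpha>" using \<alpha> t \<xi> by (simp add: y_def T_def powr_mult powr_powr)
      have e: "y powr - (2 * \<kappa>) * exp (- (y powr \<alpha> / 8)) \<le> C4 * y powr - G"
        if "(y powr \<alpha>) powr ((G - 2 * \<kappa>) / \<alpha>) * exp (- (y powr \<alpha> / 8)) \<le> C4" for G
      proof -
        have "(y powr \<alpha>) powr ((G - 2 * \<kappa>) / \<alpha>) = y powr (G - 2 * \<kappa>)" using \<alpha> by (simp add: powr_powr)
        then have "y powr - G * (y powr (G - 2 * \<kappa>) * exp (- (y powr \<alpha> / 8))) \<le> y powr - G * C4"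
          using that by (intro mult_left_mono) auto
        moreover have p: "y powr - G * y powr (G - 2 * \<kappa>) = y powr - (2 * \<kappa>)" by (simp add: powr_add[symmetric])
        ultimately show ?thesis unfolding mult.assoc[symmetric] p by (simp only: mult.commute[of C4])
      qed
      have "(y powr \<alpha>) powr ((g1 - 2 * \<kappa>) / \<alpha>) * exp (- (y powr \<alpha> / 8)) \<le> C4"
        unfolding C4_def by (rule max.coboundedI1, rule C2(2)) (use y in simp)
      note e1 = e[OF this]
      have "(y powr \<alpha>) powr ((g2 - 2 * \<kappa>) / \<alpha>) * exp (- (y powr \<alpha> / 8)) \<le> C4"
        unfolding C4_def by (rule max.coboundedI2, rule C3(2)) (use y in simp)
      note e2 = e[OF this]
      have em: "y powr - (2 * \<kappa>) * exp (- (y powr \<alpha> / 8)) \<le> C4 * ?m \<xi>"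
        unfolding min_def y_def[symmetric] using e1 e2 by (simp only: split: if_split) blast
      have "cmod (k \<xi>) \<le> c * (norm \<xi> powr - \<kappa> * exp (- (y powr \<alpha> / 16)))"
        using k \<xi> True unfolding decaying_def z[symmetric] by blast
      then have "(cmod (k \<xi>))\<^sup>2 \<le> (c * (norm \<xi> powr - \<kappa> * exp (- (y powr \<alpha> / 16))))\<^sup>2"
        by (rule power_mono) simp
      also have "\<dots> = c\<^sup>2 * (norm \<xi> powr - (2 * \<kappa>) * exp (- (y powr \<alpha> / 8)))"
        by (simp add: power_mult_distrib powr_squared exp_double[symmetric])
      also have "norm \<xi> powr - (2 * \<kappa>) = T powr (2 * \<kappa>) * y powr - (2 * \<kappa>)"
      proof -
        have "T powr (2 * \<kappa>) * T powr - (2 * \<kappa>) = 1" using T by (simp add: powr_add[symmetric])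
        then show ?thesis using T by (simp add: y_def powr_mult mult.assoc[symmetric])
      qed
      also have "c\<^sup>2 * (T powr (2 * \<kappa>) * y powr - (2 * \<kappa>) * exp (- (y powr \<alpha> / 8))) = c\<^sup>2 * (T powr (2 * \<kappa>) * (y powr - (2 * \<kappa>) * exp (- (y powr \<alpha> / 8))))"
        by (simp only: mult.assoc)
      also have "\<dots> \<le> c\<^sup>2 * (T powr (2 * \<kappa>) * (C4 * ?m \<xi>))"
        by (intro mult_left_mono em) auto
      finally show ?thesis by (simp only: mult.assoc) (rule add_increasing2, simp_all)
    next
      case False
      then have "cmod (k \<xi>) \<le> c * exp (- (t / 16))" using k by (simp add: decaying_def)
      also have "\<dots> \<le> c * (C1 * (1 + t) powr E)" using c t by (intro mult_left_mono C1) auto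
      finally have "(cmod (k \<xi>))\<^sup>2 \<le> (c * (C1 * (1 + t) powr E))\<^sup>2" by (rule power_mono) simp
      then show ?thesis using C4 by (simp only: power_mult_distrib) (rule add_increasing, auto)
    qed
    define a1 where "a1 = c\<^sup>2 * (T powr (2 * \<kappa>) * C4)"
    define a2 where "a2 = c\<^sup>2 * (C1 * (1 + t) powr E)\<^sup>2"
    have a0: "0 \<le> a1" "0 \<le> a2" using C4 by (auto simp: a1_def a2_def)
    have "(\<integral>\<^sup>+\<xi>. ennreal ((cmod (k \<xi> * rep_L2 v \<xi>))\<^sup>2) \<partial>lborel) \<le> (\<integral>\<^sup>+\<xi>. ennreal a1 * (?h \<xi> * ennreal (?m \<xi>)) + ennreal a2 * ?h \<xi> \<partial>lborel)"
    proof (rule nn_integral_mono_AE, use nz in eventually_elim)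
      fix \<xi> :: 'a assume "\<xi> \<noteq> 0"
      have "(cmod (k \<xi> * rep_L2 v \<xi>))\<^sup>2 = (cmod (k \<xi>))\<^sup>2 * (cmod (rep_L2 v \<xi>))\<^sup>2"
        by (simp add: norm_mult power_mult_distrib)
      also have "\<dots> \<le> (a1 * ?m \<xi> + a2) * (cmod (rep_L2 v \<xi>))\<^sup>2"
        unfolding a1_def a2_def by (intro mult_right_mono kb[OF \<open>\<xi> \<noteq> 0\<close>]) simp
      also have "\<dots> = a1 * ((cmod (rep_L2 v \<xi>))\<^sup>2 * ?m \<xi>) + a2 * (cmod (rep_L2 v \<xi>))\<^sup>2"
        by (simp add: algebra_simps)
      finally have "ennreal ((cmod (k \<xi> * rep_L2 v \<xi>))\<^sup>2) \<le> ennreal (a1 * ((cmod (rep_L2 v \<xi>))\<^sup>2 * ?m \<xi>) + a2 * (cmod (rep_L2 v \<xi>))\<^sup>2)"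
        by (rule ennreal_leI)
      also have "\<dots> = ennreal a1 * (?h \<xi> * ennreal (?m \<xi>)) + ennreal a2 * ?h \<xi>"
        using a0 by (subst ennreal_plus) (simp_all add: ennreal_mult)
      finally show "ennreal ((cmod (k \<xi> * rep_L2 v \<xi>))\<^sup>2) \<le> ennreal a1 * (?h \<xi> * ennreal (?m \<xi>)) + ennreal a2 * ?h \<xi>" .
    qed
    also have "\<dots> = ennreal a1 * (\<integral>\<^sup>+\<xi>. ?h \<xi> * ennreal (?m \<xi>) \<partial>lborel) + ennreal a2 * (\<integral>\<^sup>+\<xi>. ?h \<xi> \<partial>lborel)"
    proof -
      have m1: "(\<lambda>\<xi>. ?h \<xi> * ennreal (?m \<xi>)) \<in> borel_measurable lborel" by measurable
      have m2: "?h \<in> borel_measurable lborel" by measurable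
      show ?thesis
        unfolding nn_integral_cmult[OF m1, symmetric] nn_integral_cmult[OF m2, symmetric]
        by (intro nn_integral_add borel_measurable_times_ennreal borel_measurable_const m1 m2)
    qed
    also have "\<dots> \<le> ennreal a1 * ennreal (d * (M\<^sup>2 * T powr - \<beta>)) + ennreal a2 * ennreal (M\<^sup>2)"
    proof (intro add_mono mult_left_mono)
      show "(\<integral>\<^sup>+\<xi>. ?h \<xi> * ennreal (?m \<xi>) \<partial>lborel) \<le> ennreal (d * (M\<^sup>2 * T powr - \<beta>))"
        unfolding d_def
      proof (rule dyadic_integral[OF _ _ _ g(1,2,3) T])
        fix r :: real assume r: "0 < r"
        have "(norm (mul (indicator (cball 0 r)) v))\<^sup>2 \<le> (M * r powr (\<beta> / 2))\<^sup>2"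
          using vb[OF r] by (rule power_mono) simp
        then show "(\<integral>\<^sup>+\<xi>. ?h \<xi> * indicator (cball 0 r) \<xi> \<partial>lborel) \<le> ennreal (M\<^sup>2 * r powr \<beta>)"
          unfolding nn_norm_mul_indicator by (intro ennreal_leI) (simp add: power_mult_distrib powr_squared)
      qed auto
      show "(\<integral>\<^sup>+\<xi>. ?h \<xi> \<partial>lborel) \<le> ennreal (M\<^sup>2)"
        unfolding nn_norm_L2 using v by (intro ennreal_leI power_mono) auto
    qed auto
    also have "\<dots> = ennreal (a1 * (d * (M\<^sup>2 * T powr - \<beta>)) + a2 * M\<^sup>2)"
      using a0 d by (subst ennreal_plus) (auto simp: ennreal_mult)
    also have "a1 * (d * (M\<^sup>2 * T powr - \<beta>)) + a2 * M\<^sup>2 = (C * (c * ((1 + t) powr E * M)))\<^sup>2"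
    proof -
      have "1 / \<alpha> * (2 * \<kappa>) + 1 / \<alpha> * - \<beta> = 2 * E" using \<alpha> by (simp add: E_def field_simps)
      then have p: "T powr (2 * \<kappa>) * T powr - \<beta> = (1 + t) powr (2 * E)"
        unfolding T_def powr_powr powr_add[symmetric] by (simp only:)
      have "a1 * (d * (M\<^sup>2 * T powr - \<beta>)) = c\<^sup>2 * (C4 * d) * (1 + t) powr (2 * E) * M\<^sup>2"
        unfolding a1_def p[symmetric] by (simp only: mult_ac)
      moreover have "C\<^sup>2 = C4 * d + C1\<^sup>2" using C4 d by (simp add: C_def)
      ultimately show ?thesis unfolding a2_def by (simp add: power_mult_distrib powr_squared algebra_simps)
    qed
    finally have F: "(\<integral>\<^sup>+\<xi>. ennreal ((cmod (k \<xi> * rep_L2 v \<xi>))\<^sup>2) \<partial>lborel) \<le> ennreal ((C * (c * ((1 + t) powr E * M)))\<^sup>2)" .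
    show ?thesis unfolding mul_def
      by (rule norm_to_L2_le_nn[OF _ _ F]) (use C c M in auto)
  qed
  then show ?thesis using C unfolding E_def by blast
qed

section \<open>Duhamel's equation in a Banach space\<close>

lemma has_integral_powr_shift:
  fixes q u v s :: real
  assumes "q \<noteq> 0" "u \<le> v" "0 < s + u"
  shows "((\<lambda>x. (s + x) powr (q - 1)) has_integral ((s + v) powr q / q - (s + u) powr q / q)) {u..v}"
proof (rule fundamental_theorem_of_calculus[OF assms(2)])
  fix x assume "x \<in> {u..v}"
  then have "0 < s + x" using assms by auto
  then have "((\<lambda>x. (s + x) powr q / q) has_real_derivative (s + x) powr (q - 1)) (at x within {u..v})"
    using assms by (auto intro!: derivative_eq_intros)
  then show "((\<lambda>x. (s + x) powr q / q) has_vector_derivative (s + x) powr (q - 1)) (at x within {u..v})"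
    by (simp add: has_real_derivative_iff_has_vector_derivative)
qed

text \<open>For \<open>x \<le> t / 2\<close> the factor \<open>(1 + (t - x)) powr - e\<close> is
  comparable to \<open>(1 + t) powr - e\<close> and leaves the integral. As
  \<open>\<delta> > 0\<close>, what remains grows like \<open>(1 + t) powr \<delta>\<close>, without
  a logarithm.\<close>

lemma norm_integral_first_half:
  fixes f :: "real \<Rightarrow> 'h::banach"
  assumes t: "0 \<le> t" and e: "0 \<le> e" and \<delta>: "0 < \<delta>" and M: "0 \<le> M"
    and f: "continuous_on {0..t} f"
    and bd: "\<And>x. 0 \<le> x \<Longrightarrow> x \<le> t / 2 \<Longrightarrow> norm (f x) \<le> M * ((1 + (t - x)) powr - e * (1 + x) powr (\<delta> - 1))"
  shows "norm (integral {0..t/2} f) \<le> M * (2 powr e / \<delta>) * (1 + t) powr (\<delta> - e)"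
proof -
  let ?g = "\<lambda>x. M * (2 powr e * (1 + t) powr - e) * (1 + x) powr (\<delta> - 1)"
  have hi: "((\<lambda>x. (1 + x) powr (\<delta> - 1)) has_integral ((1 + t/2) powr \<delta> / \<delta> - (1 + 0) powr \<delta> / \<delta>)) {0..t/2}"
    by (rule has_integral_powr_shift) (use t \<delta> in auto)
  have gi: "(?g has_integral (M * (2 powr e * (1 + t) powr - e) * ((1 + t/2) powr \<delta> / \<delta> - (1 + 0) powr \<delta> / \<delta>))) {0..t/2}"
    by (rule has_integral_mult_right[OF hi])
  have "norm (integral {0..t/2} f) \<le> integral {0..t/2} ?g"
  proof (rule integral_norm_bound_integral)
    show "f integrable_on {0..t/2}"
      by (rule integrable_continuous_interval, rule continuous_on_subset[OF f]) (use t in auto)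
    show "?g integrable_on {0..t/2}" using gi by blast
    fix x assume x: "x \<in> {0..t/2}"
    have "(1 + (t - x)) powr - e \<le> ((1 + t) / 2) powr - e" using x t e by (intro powr_mono2') auto
    also have "\<dots> = 2 powr e * (1 + t) powr - e" using t by (simp add: powr_divide powr_minus field_simps)
    finally have "M * ((1 + (t - x)) powr - e * (1 + x) powr (\<delta> - 1)) \<le> M * ((2 powr e * (1 + t) powr - e) * (1 + x) powr (\<delta> - 1))"
      using M by (intro mult_left_mono mult_right_mono) auto
    then show "norm (f x) \<le> ?g x" using bd[of x] x by (simp add: mult.assoc)
  qed
  also have "\<dots> = M * (2 powr e * (1 + t) powr - e) * ((1 + t/2) powr \<delta> / \<delta> - (1 + 0) powr \<delta> / \<delta>)"
    using gi by (rule integral_unique)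
  also have "\<dots> \<le> M * (2 powr e * (1 + t) powr - e) * ((1 + t) powr \<delta> / \<delta>)"
  proof (intro mult_left_mono)
    have "(1 + t/2) powr \<delta> / \<delta> \<le> (1 + t) powr \<delta> / \<delta>" using t \<delta> by (intro divide_right_mono powr_mono2) auto
    then show "(1 + t/2) powr \<delta> / \<delta> - (1 + 0) powr \<delta> / \<delta> \<le> (1 + t) powr \<delta> / \<delta>"
      using \<delta> by (simp add: diff_le_eq add_increasing2)
  qed (use M in auto)
  also have "\<dots> = M * (2 powr e / \<delta>) * ((1 + t) powr - e * (1 + t) powr \<delta>)" by simp
  also have "(1 + t) powr - e * (1 + t) powr \<delta> = (1 + t) powr (\<delta> - e)" by (simp add: powr_add[symmetric])
  finally show ?thesis .
qed

text \<open>Now the other factor is frozen, at \<open>(1 + t) powr - \<kappa>\<close>, and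
  \<open>e < 1\<close> bounds the integral of the remaining one by a multiple of
  \<open>(1 + t) powr (1 - e)\<close>.\<close>

lemma norm_integral_second_half:
  fixes f :: "real \<Rightarrow> 'h::banach"
  assumes t: "0 \<le> t" and e: "e < 1" and \<kappa>: "0 \<le> \<kappa>" and M: "0 \<le> M"
    and f: "continuous_on {0..t} f"
    and bd: "\<And>x. t / 2 \<le> x \<Longrightarrow> x \<le> t \<Longrightarrow> norm (f x) \<le> M * ((1 + (t - x)) powr - e * (1 + x) powr - \<kappa>)"
  shows "norm (integral {t/2..t} f) \<le> M * (2 powr \<kappa> / (1 - e)) * (1 + t) powr (1 - e - \<kappa>)"
proof -
  let ?g = "\<lambda>x. M * (2 powr \<kappa> * (1 + t) powr - \<kappa>) * (1 + (t - x)) powr - e"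
  have hi: "((\<lambda>x. (1 + (t - x)) powr - e) has_integral ((1 + t/2) powr (1 - e) / (1 - e) - (1 + 0) powr (1 - e) / (1 - e))) {t/2..t}"
  proof -
    have "((\<lambda>x. (1 + (t - x)) powr - e) has_integral (- ((1 + (t - t)) powr (1 - e) / (1 - e)) - (- ((1 + (t - t/2)) powr (1 - e) / (1 - e))))) {t/2..t}"
    proof (rule fundamental_theorem_of_calculus)
      fix x assume "x \<in> {t/2..t}"
      then have "0 < 1 + (t - x)" by auto
      then have "((\<lambda>x. - ((1 + (t - x)) powr (1 - e) / (1 - e))) has_real_derivative (1 + (t - x)) powr - e) (at x within {t/2..t})"
        using e by (auto intro!: derivative_eq_intros)
      then show "((\<lambda>x. - ((1 + (t - x)) powr (1 - e) / (1 - e))) has_vector_derivative (1 + (t - x)) powr - e) (at x within {t/2..t})"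
        by (simp add: has_real_derivative_iff_has_vector_derivative)
    qed (use t in auto)
    then show ?thesis by simp
  qed
  have gi: "(?g has_integral (M * (2 powr \<kappa> * (1 + t) powr - \<kappa>) * ((1 + t/2) powr (1 - e) / (1 - e) - (1 + 0) powr (1 - e) / (1 - e)))) {t/2..t}"
    by (rule has_integral_mult_right[OF hi])
  have "norm (integral {t/2..t} f) \<le> integral {t/2..t} ?g"
  proof (rule integral_norm_bound_integral)
    show "f integrable_on {t/2..t}"
      by (rule integrable_continuous_interval, rule continuous_on_subset[OF f]) (use t in auto)
    show "?g integrable_on {t/2..t}" using gi by blast
    fix x assume x: "x \<in> {t/2..t}"
    have "(1 + x) powr - \<kappa> \<le> ((1 + t) / 2) powr - \<kappa>" using x t \<kappa> by (intro powr_mono2') auto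
    also have "\<dots> = 2 powr \<kappa> * (1 + t) powr - \<kappa>" using t by (simp add: powr_divide powr_minus field_simps)
    finally have "M * ((1 + (t - x)) powr - e * (1 + x) powr - \<kappa>) \<le> M * ((1 + (t - x)) powr - e * (2 powr \<kappa> * (1 + t) powr - \<kappa>))"
      using M by (intro mult_left_mono) auto
    then show "norm (f x) \<le> ?g x" using bd[of x] x by (simp add: mult_ac)
  qed
  also have "\<dots> = M * (2 powr \<kappa> * (1 + t) powr - \<kappa>) * ((1 + t/2) powr (1 - e) / (1 - e) - (1 + 0) powr (1 - e) / (1 - e))"
    using gi by (rule integral_unique)
  also have "\<dots> \<le> M * (2 powr \<kappa> * (1 + t) powr - \<kappa>) * ((1 + t) powr (1 - e) / (1 - e))"
  proof (intro mult_left_mono)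
    have "(1 + t/2) powr (1 - e) / (1 - e) \<le> (1 + t) powr (1 - e) / (1 - e)" using t e by (intro divide_right_mono powr_mono2) auto
    then show "(1 + t/2) powr (1 - e) / (1 - e) - (1 + 0) powr (1 - e) / (1 - e) \<le> (1 + t) powr (1 - e) / (1 - e)"
      using e by (simp add: diff_le_eq add_increasing2)
  qed (use M in auto)
  also have "\<dots> = M * (2 powr \<kappa> / (1 - e)) * ((1 + t) powr - \<kappa> * (1 + t) powr (1 - e))" by simp
  also have "(1 + t) powr - \<kappa> * (1 + t) powr (1 - e) = (1 + t) powr (1 - e - \<kappa>)" by (simp add: powr_add[symmetric])
  finally show ?thesis .
qed

text \<open>Of the last two bounds in \<open>decay\<close>, the first is used on \<open>[0, t/2]\<close> and the second on \<open>[t/2, t]\<close>: when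
  \<open>b \<ge> 1\<close>, the decay of \<open>B S\<close> is not integrable at the right end unless part of it is moved to \<open>N\<close>.\<close>

locale duhamel =
  fixes A B :: "'h::banach \<Rightarrow> 'h" and S :: "real \<Rightarrow> 'h \<Rightarrow> 'h" and N :: "'h \<Rightarrow> 'h"
    and a b c \<delta> \<eta> K p L :: real
  assumes A: "bounded_linear A" and B: "bounded_linear B"
    and AB: "\<And>W. norm W \<le> c * (norm (A W) + norm (B W))"
    and S: "\<And>t. 0 \<le> t \<Longrightarrow> bounded_linear (S t)"
    and S_cont: "\<And>x. continuous_on {0..} (\<lambda>t. S t x)"
    and S_bd: "\<And>t x. 0 \<le> t \<Longrightarrow> norm (S t x) \<le> L * (1 + t) * norm x"
    and S_0: "\<And>x. S 0 x = 0"
    and N_0: "N 0 = 0"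
    and N_lip: "\<And>R. 0 < R \<Longrightarrow> \<exists>l. \<forall>W W'. norm W \<le> R \<longrightarrow> norm W' \<le> R \<longrightarrow> norm (N W - N W') \<le> l * norm (W - W')"
    and params: "0 \<le> c" "1 < p" "0 < K" "0 \<le> a" "0 \<le> b" "0 < \<delta>" "a + \<delta> < 1" "0 \<le> \<eta>" "b - \<eta> < 1" "0 \<le> L"
    and decay: "\<And>W W' r d x s. \<lbrakk>0 < r; 0 < d; 0 \<le> x; 0 \<le> s;
      norm (A W) \<le> r * (1 + x) powr - a; norm (B W) \<le> r * (1 + x) powr - b;
      norm (A W') \<le> r * (1 + x) powr - a; norm (B W') \<le> r * (1 + x) powr - b;
      norm (A (W - W')) \<le> d * (1 + x) powr - a; norm (B (W - W')) \<le> d * (1 + x) powr - b\<rbrakk> \<Longrightarrow>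
      norm (A (S s (N W - N W'))) \<le> K * r powr (p - 1) * d * ((1 + s) powr - (a + \<delta>) * (1 + x) powr (\<delta> - 1)) \<and>
      norm (B (S s (N W - N W'))) \<le> K * r powr (p - 1) * d * ((1 + s) powr - (b + \<delta>) * (1 + x) powr (\<delta> - 1)) \<and>
      norm (B (S s (N W - N W'))) \<le> K * r powr (p - 1) * d * ((1 + s) powr - (b - \<eta>) * (1 + x) powr - (1 + \<eta>))"
begin

section \<open>Continuity and contraction of the Duhamel map\<close>

definition decays :: "real \<Rightarrow> (real \<Rightarrow> 'h) \<Rightarrow> bool" where
  "decays d V \<longleftrightarrow> (\<forall>t\<ge>0. norm (A (V t)) \<le> d * (1 + t) powr - a \<and> norm (B (V t)) \<le> d * (1 + t) powr - b)"

definition duh :: "(real \<Rightarrow> 'h) \<Rightarrow> real \<Rightarrow> 'h" where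
  "duh V t = integral {0..t} (\<lambda>x. S (t - x) (N (V x)))"

text \<open>Strong continuity of \<open>S\<close> in time together with its locally uniform bound
  gives joint continuity: freeze the vector, then estimate the difference.\<close>

lemma S_continuous:
  assumes g: "continuous_on X g" "\<And>x. x \<in> X \<Longrightarrow> 0 \<le> g x" and f: "continuous_on X f"
  shows "continuous_on X (\<lambda>x. S (g x) (f x))"
  unfolding continuous_on_def
proof
  fix y assume y: "y \<in> X"
  have gl: "(g \<longlongrightarrow> g y) (at y within X)" and fl: "(f \<longlongrightarrow> f y) (at y within X)"
    using g(1) f y by (auto simp: continuous_on_def)
  have "((\<lambda>x. S (g x) (f y)) \<longlongrightarrow> S (g y) (f y)) (at y within X)"
    using continuous_on_compose2[OF S_cont g(1), of "f y"] g(2) y by (auto simp: continuous_on_def)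
  moreover have "((\<lambda>x. S (g x) (f x - f y)) \<longlongrightarrow> 0) (at y within X)"
  proof (rule Lim_null_comparison)
    show "\<forall>\<^sub>F x in at y within X. norm (S (g x) (f x - f y)) \<le> L * (1 + g x) * norm (f x - f y)"
      using S_bd g(2) by (auto simp: eventually_at_filter)
    have "((\<lambda>x. L * (1 + g x) * norm (f x - f y)) \<longlongrightarrow> L * (1 + g y) * norm (f y - f y)) (at y within X)"
      by (intro tendsto_intros gl fl)
    then show "((\<lambda>x. L * (1 + g x) * norm (f x - f y)) \<longlongrightarrow> 0) (at y within X)" by simp
  qed
  ultimately have "((\<lambda>x. S (g x) (f y) + S (g x) (f x - f y)) \<longlongrightarrow> S (g y) (f y) + 0) (at y within X)"
    by (rule tendsto_add)
  then have "((\<lambda>x. S (g x) (f y) + S (g x) (f x - f y)) \<longlongrightarrow> S (g y) (f y)) (at y within X)" by simp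
  then show "((\<lambda>x. S (g x) (f x)) \<longlongrightarrow> S (g y) (f y)) (at y within X)"
  proof (rule Lim_transform_eventually)
    show "\<forall>\<^sub>F x in at y within X. S (g x) (f y) + S (g x) (f x - f y) = S (g x) (f x)"
      using linear_diff[OF bounded_linear.linear[OF S]] g(2) by (auto simp: eventually_at_filter)
  qed
qed

lemma N_continuous: "continuous_on X N"
  unfolding continuous_on_def
proof
  fix W assume "W \<in> X"
  obtain l where l: "\<And>U U'. norm U \<le> norm W + 1 \<Longrightarrow> norm U' \<le> norm W + 1 \<Longrightarrow> norm (N U - N U') \<le> l * norm (U - U')"
    using N_lip[of "norm W + 1"] norm_ge_zero[of W] by (metis add_nonneg_pos zero_less_one)
  have "((\<lambda>U. N U - N W) \<longlongrightarrow> 0) (at W within X)"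
  proof (rule Lim_null_comparison)
    have "\<forall>\<^sub>F U in at W within X. norm U < norm W + 1"
      by (rule order_tendstoD(2)[OF tendsto_norm[OF tendsto_ident_at]]) simp
    then show "\<forall>\<^sub>F U in at W within X. norm (N U - N W) \<le> l * norm (U - W)"
      by eventually_elim (rule l, auto)
    have "((\<lambda>U. l * norm (U - W)) \<longlongrightarrow> l * norm (W - W)) (at W within X)" by (intro tendsto_intros)
    then show "((\<lambda>U. l * norm (U - W)) \<longlongrightarrow> 0) (at W within X)" by simp
  qed
  then show "(N \<longlongrightarrow> N W) (at W within X)" by (rule LIM_zero_cancel)
qed

lemma integrand_continuous:
  assumes V: "continuous_on {0..} V"
  shows "continuous_on {0..t} (\<lambda>x. S (t - x) (N (V x)))"
proof (rule S_continuous)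
  show "continuous_on {0..t} (\<lambda>x. N (V x))"
    by (rule continuous_on_compose2[OF N_continuous[of UNIV]], rule continuous_on_subset[OF V]) auto
qed (auto intro!: continuous_intros)

lemma duh_integral:
  assumes "continuous_on {0..} V"
  shows "((\<lambda>x. S (t - x) (N (V x))) has_integral duh V t) {0..t}"
  unfolding duh_def by (intro integrable_integral integrable_continuous_interval integrand_continuous assms)

text \<open>The domain of integration moves with \<open>t\<close>. Extending the integrand to
  \<open>[0, T]\<close> by \<open>max 0 (t - x)\<close> fixes it, and the extension contributes
  nothing because \<open>S 0 = 0\<close>.\<close>

lemma duh_continuous:
  assumes V: "continuous_on {0..} V"
  shows "continuous_on {0..} (duh V)"
proof -
  have on: "continuous_on {0..T} (duh V)" if T: "0 \<le> T" for T
  proof -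
    have "continuous_on ({0..T} \<times> cbox 0 T) (\<lambda>(t, x). S (max 0 (t - x)) (N (V x)))"
      unfolding case_prod_beta
    proof (rule S_continuous)
      show "continuous_on ({0..T} \<times> cbox 0 T) (\<lambda>z. N (V (snd z)))"
        by (rule continuous_on_compose2[OF N_continuous[of UNIV]],
            rule continuous_on_compose2[OF V]) (auto intro!: continuous_intros)
    qed (auto intro!: continuous_intros)
    then have c: "continuous_on {0..T} (\<lambda>t. integral (cbox 0 T) (\<lambda>x. S (max 0 (t - x)) (N (V x))))"
      by (rule integral_continuous_on_param)
    have "integral (cbox 0 T) (\<lambda>x. S (max 0 (t - x)) (N (V x))) = duh V t" if t: "t \<in> {0..T}" for t
    proof -
      have i: "(\<lambda>x. S (max 0 (t - x)) (N (V x))) integrable_on {0..T}"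
      proof (rule integrable_continuous_interval, rule S_continuous)
        show "continuous_on {0..T} (\<lambda>x. N (V x))"
          by (rule continuous_on_compose2[OF N_continuous[of UNIV]], rule continuous_on_subset[OF V]) auto
      qed (auto intro!: continuous_intros)
      have "integral {0..T} (\<lambda>x. S (max 0 (t - x)) (N (V x))) = integral {0..t} (\<lambda>x. S (max 0 (t - x)) (N (V x))) + integral {t..T} (\<lambda>x. S (max 0 (t - x)) (N (V x)))"
        by (rule Henstock_Kurzweil_Integration.integral_combine[symmetric]) (use t i in auto)
      also have "integral {t..T} (\<lambda>x. S (max 0 (t - x)) (N (V x))) = integral {t..T} (\<lambda>x. 0)"
        by (rule integral_cong) (auto simp: S_0 max_def)
      also have "integral {0..t} (\<lambda>x. S (max 0 (t - x)) (N (V x))) = duh V t"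
        unfolding duh_def by (rule integral_cong) (auto simp: max_def)
      finally show ?thesis by simp
    qed
    then show ?thesis by (rule continuous_on_eq[OF c])
  qed
  show ?thesis unfolding continuous_on_def
  proof
    fix t :: real assume "t \<in> {0..}"
    then have t: "0 \<le> t" by simp
    have "(duh V \<longlongrightarrow> duh V t) (at t within {0..t+1})"
      using on[of "t + 1"] t by (auto simp: continuous_on_def)
    moreover have "at t within {0..} = at t within {0..t+1}"
      by (rule at_within_nhd[of _ "{..<t+1}"]) auto
    ultimately show "(duh V \<longlongrightarrow> duh V t) (at t within {0..})" by simp
  qed
qed

text \<open>The time integral is cut at \<open>t / 2\<close>. With the bounds of
  \<open>decay\<close>, each half reproduces exactly the rate \<open>- a\<close> for
  \<open>A\<close> and \<open>- b\<close> for \<open>B\<close>. The factor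
  \<open>r powr (p - 1)\<close> is the one that smallness of the data makes less than 1.\<close>

lemma duh_contraction:
  obtains KK where "0 < KK" "\<And>W W' r d. \<lbrakk>0 < r; 0 < d; continuous_on {0..} W; continuous_on {0..} W';
    decays r W; decays r W'; decays d (\<lambda>t. W t - W' t)\<rbrakk> \<Longrightarrow> decays (KK * r powr (p - 1) * d) (\<lambda>t. duh W t - duh W' t)"
proof -
  \<comment> \<open>The constants of the two time halves. For \<open>A\<close> one bound serves both
    halves since \<open>a + \<delta> < 1\<close>; for \<open>B\<close> the second half uses the
    bound with exponent \<open>b - \<eta> < 1\<close>.\<close>
  define KA where "KA = 2 powr (a + \<delta>) / \<delta> + 2 powr (1 - \<delta>) / (1 - (a + \<delta>))"
  define KB where "KB = 2 powr (b + \<delta>) / \<delta> + 2 powr (1 + \<eta>) / (1 - (b - \<eta>))"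
  have KA: "0 < KA" using params by (simp add: KA_def add_pos_pos)
  have KB: "0 < KB" using params by (simp add: KB_def add_pos_pos)
  have "decays (K * (KA + KB) * r powr (p - 1) * d) (\<lambda>t. duh W t - duh W' t)"
    if r: "0 < r" and d: "0 < d" and W: "continuous_on {0..} W" and W': "continuous_on {0..} W'"
      and Q: "decays r W" "decays r W'" "decays d (\<lambda>t. W t - W' t)" for W W' r d
    unfolding decays_def
  proof (intro allI impI)
    fix t :: real assume t: "0 \<le> t"
    define f where "f x = S (t - x) (N (W x) - N (W' x))" for x
    have feq: "f x = S (t - x) (N (W x)) - S (t - x) (N (W' x))" if "x \<in> {0..t}" for x
      using that linear_diff[OF bounded_linear.linear[OF S[of "t - x"]]] by (simp add: f_def)
    have fc: "continuous_on {0..t} f"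
    proof -
      have "continuous_on {0..t} (\<lambda>x. S (t - x) (N (W x)) - S (t - x) (N (W' x)))"
        by (intro continuous_intros integrand_continuous W W')
      then show ?thesis by (rule continuous_on_eq) (simp add: feq)
    qed
    have df: "duh W t - duh W' t = integral {0..t} f"
    proof -
      have "((\<lambda>x. S (t - x) (N (W x)) - S (t - x) (N (W' x))) has_integral (duh W t - duh W' t)) {0..t}"
        by (intro has_integral_diff duh_integral W W')
      then have "(f has_integral (duh W t - duh W' t)) {0..t}"
        by (rule has_integral_eq[rotated]) (simp add: feq)
      then show ?thesis by (simp add: integral_unique)
    qed
    define M where "M = K * r powr (p - 1) * d"
    have M: "0 \<le> M" using params r d by (simp add: M_def)
    have bd: "norm (A (f x)) \<le> M * ((1 + (t - x)) powr - (a + \<delta>) * (1 + x) powr (\<delta> - 1)) \<and>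
      norm (B (f x)) \<le> M * ((1 + (t - x)) powr - (b + \<delta>) * (1 + x) powr (\<delta> - 1)) \<and>
      norm (B (f x)) \<le> M * ((1 + (t - x)) powr - (b - \<eta>) * (1 + x) powr - (1 + \<eta>))" if "0 \<le> x" "x \<le> t" for x
      unfolding f_def M_def using Q that r d by (intro decay) (auto simp: decays_def)
    have split: "P (integral {0..t} f) = integral {0..t/2} (\<lambda>x. P (f x)) + integral {t/2..t} (\<lambda>x. P (f x))"
      and Pc: "continuous_on {0..t} (\<lambda>x. P (f x))" if P: "bounded_linear P" for P :: "'h \<Rightarrow> 'h"
    proof -
      show c: "continuous_on {0..t} (\<lambda>x. P (f x))" by (rule bounded_linear.continuous_on[OF P fc])
      have "P (integral {0..t} f) = integral {0..t} (P \<circ> f)"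
        by (rule integral_linear[symmetric, OF integrable_continuous_interval[OF fc] P])
      also have "\<dots> = integral {0..t/2} (P \<circ> f) + integral {t/2..t} (P \<circ> f)"
        by (rule Henstock_Kurzweil_Integration.integral_combine[symmetric]) (use t integrable_continuous_interval[OF c] in \<open>auto simp: o_def\<close>)
      finally show "P (integral {0..t} f) = integral {0..t/2} (\<lambda>x. P (f x)) + integral {t/2..t} (\<lambda>x. P (f x))"
        by (simp add: o_def)
    qed
    have "norm (A (integral {0..t} f)) \<le> M * (2 powr (a + \<delta>) / \<delta>) * (1 + t) powr (\<delta> - (a + \<delta>)) + M * (2 powr (1 - \<delta>) / (1 - (a + \<delta>))) * (1 + t) powr (1 - (a + \<delta>) - (1 - \<delta>))"
      unfolding split[OF A]
    proof (rule order_trans[OF norm_triangle_ineq], intro add_mono)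
      show "norm (integral {0..t/2} (\<lambda>x. A (f x))) \<le> M * (2 powr (a + \<delta>) / \<delta>) * (1 + t) powr (\<delta> - (a + \<delta>))"
        by (rule norm_integral_first_half[OF t _ _ M Pc[OF A]]) (use params bd t in auto)
      show "norm (integral {t/2..t} (\<lambda>x. A (f x))) \<le> M * (2 powr (1 - \<delta>) / (1 - (a + \<delta>))) * (1 + t) powr (1 - (a + \<delta>) - (1 - \<delta>))"
        by (rule norm_integral_second_half[OF t _ _ M Pc[OF A]]) (use params bd t in auto)
    qed
    also have "\<dots> = M * KA * (1 + t) powr - a" by (simp add: KA_def algebra_simps)
    also have "\<dots> \<le> K * (KA + KB) * r powr (p - 1) * d * (1 + t) powr - a"
    proof (rule mult_right_mono)
      have "M * KA \<le> M * (KA + KB)" using M KB by (intro mult_left_mono) auto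
      then show "M * KA \<le> K * (KA + KB) * r powr (p - 1) * d" by (simp add: M_def mult_ac)
    qed simp
    finally have 1: "norm (A (duh W t - duh W' t)) \<le> K * (KA + KB) * r powr (p - 1) * d * (1 + t) powr - a"
      unfolding df .
    have "norm (B (integral {0..t} f)) \<le> M * (2 powr (b + \<delta>) / \<delta>) * (1 + t) powr (\<delta> - (b + \<delta>)) + M * (2 powr (1 + \<eta>) / (1 - (b - \<eta>))) * (1 + t) powr (1 - (b - \<eta>) - (1 + \<eta>))"
      unfolding split[OF B]
    proof (rule order_trans[OF norm_triangle_ineq], intro add_mono)
      show "norm (integral {0..t/2} (\<lambda>x. B (f x))) \<le> M * (2 powr (b + \<delta>) / \<delta>) * (1 + t) powr (\<delta> - (b + \<delta>))"
        by (rule norm_integral_first_half[OF t _ _ M Pc[OF B]]) (use params bd t in auto)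
      show "norm (integral {t/2..t} (\<lambda>x. B (f x))) \<le> M * (2 powr (1 + \<eta>) / (1 - (b - \<eta>))) * (1 + t) powr (1 - (b - \<eta>) - (1 + \<eta>))"
        by (rule norm_integral_second_half[OF t _ _ M Pc[OF B]]) (use params bd t in auto)
    qed
    also have "\<dots> = M * KB * (1 + t) powr - b" by (simp add: KB_def algebra_simps)
    also have "\<dots> \<le> K * (KA + KB) * r powr (p - 1) * d * (1 + t) powr - b"
    proof (rule mult_right_mono)
      have "M * KB \<le> M * (KA + KB)" using M KA by (intro mult_left_mono) auto
      then show "M * KB \<le> K * (KA + KB) * r powr (p - 1) * d" by (simp add: M_def mult_ac)
    qed simp
    finally have 2: "norm (B (duh W t - duh W' t)) \<le> K * (KA + KB) * r powr (p - 1) * d * (1 + t) powr - b"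
      unfolding df .
    show "norm (A (duh W t - duh W' t)) \<le> K * (KA + KB) * r powr (p - 1) * d * (1 + t) powr - a \<and>
       norm (B (duh W t - duh W' t)) \<le> K * (KA + KB) * r powr (p - 1) * d * (1 + t) powr - b"
      using 1 2 by blast
  qed
  then show ?thesis using that[of "K * (KA + KB)"] KA KB params by simp
qed

section \<open>Existence by Picard iteration, and uniqueness\<close>

lemma decays_add:
  assumes "decays d V" "decays d' V'"
  shows "decays (d + d') (\<lambda>t. V t + V' t)"
  unfolding decays_def
proof (intro allI impI conjI)
  fix t :: real assume t: "0 \<le> t"
  show "norm (A (V t + V' t)) \<le> (d + d') * (1 + t) powr - a"
    unfolding linear_add[OF bounded_linear.linear[OF A]] distrib_right
    by (rule order_trans[OF norm_triangle_ineq], intro add_mono) (use assms t in \<open>auto simp: decays_def\<close>)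
  show "norm (B (V t + V' t)) \<le> (d + d') * (1 + t) powr - b"
    unfolding linear_add[OF bounded_linear.linear[OF B]] distrib_right
    by (rule order_trans[OF norm_triangle_ineq], intro add_mono) (use assms t in \<open>auto simp: decays_def\<close>)
qed

lemma decays_mono: "decays d V \<Longrightarrow> d \<le> d' \<Longrightarrow> decays d' V"
  unfolding decays_def by (meson mult_right_mono order_trans powr_ge_zero)

lemma decays_limit:
  assumes "\<And>k. decays d (X k)" "\<And>t. 0 \<le> t \<Longrightarrow> (\<lambda>k. X k t) \<longlonglongrightarrow> V t"
  shows "decays d V"
  unfolding decays_def
proof (intro allI impI conjI)
  fix t :: real assume t: "0 \<le> t"
  show "norm (A (V t)) \<le> d * (1 + t) powr - a"
    by (rule LIMSEQ_le_const2[OF tendsto_norm[OF bounded_linear.tendsto[OF A assms(2)[OF t]]]])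
       (use assms(1) t in \<open>auto simp: decays_def\<close>)
  show "norm (B (V t)) \<le> d * (1 + t) powr - b"
    by (rule LIMSEQ_le_const2[OF tendsto_norm[OF bounded_linear.tendsto[OF B assms(2)[OF t]]]])
       (use assms(1) t in \<open>auto simp: decays_def\<close>)
qed

text \<open>As \<open>a\<close> and \<open>b\<close> are nonnegative, the decay constants control
  the norm uniformly in time; this supplies the uniform convergence of the iteration.\<close>

lemma decays_norm:
  assumes "decays d V" "0 \<le> t" "0 \<le> d"
  shows "norm (V t) \<le> 2 * c * d"
proof -
  have "(1 + t) powr - a \<le> 1" "(1 + t) powr - b \<le> 1"
    using params assms by (auto simp: powr_minus intro!: ge_one_powr_ge_zero simp: inverse_le_1_iff)
  then have "d * (1 + t) powr - a \<le> d * 1" "d * (1 + t) powr - b \<le> d * 1"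
    unfolding mult_1_right using assms by (auto intro: mult_left_le)
  moreover have "norm (A (V t)) \<le> d * (1 + t) powr - a" "norm (B (V t)) \<le> d * (1 + t) powr - b"
    using assms by (auto simp: decays_def)
  ultimately have "norm (A (V t)) + norm (B (V t)) \<le> 2 * d" by linarith
  then have "c * (norm (A (V t)) + norm (B (V t))) \<le> c * (2 * d)" using params by (intro mult_left_mono)
  then show ?thesis using AB[of "V t"] by simp
qed

text \<open>The weighted supremum behind \<open>decays\<close> is not the norm of a type, so the
  contraction principle is carried out by hand: Picard iterates, uniform convergence by the
  Weierstrass test, passage to the limit in the equation.\<close>

theorem small_data_solution:
  obtains g\<^sub>0 where "0 < g\<^sub>0" "\<And>G g. \<lbrakk>continuous_on {0..} G; 0 < g; g \<le> g\<^sub>0; decays g G\<rbrakk> \<Longrightarrow>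
    \<exists>W. continuous_on {0..} W \<and> decays (2 * g) W \<and> (\<forall>t\<ge>0. W t = G t + duh W t)"
proof -
  obtain KK where KK: "0 < KK" "\<And>W W' r d. \<lbrakk>0 < r; 0 < d; continuous_on {0..} W; continuous_on {0..} W';
    decays r W; decays r W'; decays d (\<lambda>t. W t - W' t)\<rbrakk> \<Longrightarrow> decays (KK * r powr (p - 1) * d) (\<lambda>t. duh W t - duh W' t)"
    using duh_contraction by blast
  \<comment> \<open>Solves \<open>KK * (2 * g\<^sub>0) powr (p - 1) = 1 / 4\<close>, so that the
    Duhamel map contracts by \<open>1 / 4\<close> among functions decaying with constant
    \<open>2 * g\<close>.\<close>
  define g\<^sub>0 where "g\<^sub>0 = (1 / (4 * KK)) powr (1 / (p - 1)) / 2"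
  have g0: "0 < g\<^sub>0" using KK by (simp add: g\<^sub>0_def)
  have "\<exists>W. continuous_on {0..} W \<and> decays (2 * g) W \<and> (\<forall>t\<ge>0. W t = G t + duh W t)"
    if Gc: "continuous_on {0..} G" and g: "0 < g" "g \<le> g\<^sub>0" and G: "decays g G" for G g
  proof -
    have "(2 * g) powr (p - 1) \<le> ((1 / (4 * KK)) powr (1 / (p - 1))) powr (p - 1)"
      using g params by (intro powr_mono2) (auto simp: g\<^sub>0_def)
    also have "\<dots> = 1 / (4 * KK)" using params KK by (simp add: powr_powr)
    finally have kg: "KK * (2 * g) powr (p - 1) \<le> 1 / 4" using KK by (simp add: field_simps)
    have contr: "decays (1 / 4 * d) (\<lambda>t. duh W t - duh W' t)"
      if "0 < d" "continuous_on {0..} W" "continuous_on {0..} W'" "decays (2 * g) W" "decays (2 * g) W'" "decays d (\<lambda>t. W t - W' t)" for W W' d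
    proof (rule decays_mono)
      show "decays (KK * (2 * g) powr (p - 1) * d) (\<lambda>t. duh W t - duh W' t)"
        using KK(2)[of "2 * g" d W W'] that g by simp
      show "KK * (2 * g) powr (p - 1) * d \<le> 1 / 4 * d" using that(1) by (intro mult_right_mono kg) simp
    qed
    have zero: "decays d (\<lambda>t. 0)" if "0 \<le> d" for d
      using that linear_0[OF bounded_linear.linear[OF A]] linear_0[OF bounded_linear.linear[OF B]] by (simp add: decays_def)
    have duh0: "duh (\<lambda>t. 0) t = 0" if "0 \<le> t" for t
    proof -
      have "duh (\<lambda>t. 0) t = integral {0..t} (\<lambda>x. 0)" unfolding duh_def
        by (rule integral_cong) (use linear_0[OF bounded_linear.linear[OF S]] in \<open>auto simp: N_0\<close>)
      then show ?thesis by simp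
    qed
    have self: "decays (2 * g) (\<lambda>t. G t + duh W t)" if "continuous_on {0..} W" "decays (2 * g) W" for W
    proof -
      \<comment> \<open>Comparison with the zero function, whose Duhamel integral vanishes, gives
        the size of \<open>duh W\<close>; then \<open>g + g / 2 \<le> 2 * g\<close>.\<close>
      have "decays (1 / 4 * (2 * g)) (\<lambda>t. duh W t - duh (\<lambda>t. 0) t)"
        by (rule contr) (use that g zero in auto)
      then have "decays (1 / 4 * (2 * g)) (\<lambda>t. duh W t)" by (simp add: decays_def duh0)
      from decays_add[OF G this] show ?thesis by (rule decays_mono) (use g in simp)
    qed
    define X where "X = rec_nat G (\<lambda>k V t. G t + duh V t)"
    have X0: "X 0 = G" and XS: "X (Suc k) = (\<lambda>t. G t + duh (X k) t)" for k by (auto simp: X_def)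
    have Xc: "continuous_on {0..} (X k)" and Xd: "decays (2 * g) (X k)" for k
    proof (induction k)
      case 0
      { case 1 show ?case using Gc by (simp add: X0) }
      { case 2 show ?case unfolding X0 by (rule decays_mono[OF G]) (use g in simp) }
    next
      case (Suc k)
      { case 1 show ?case unfolding XS by (intro continuous_intros Gc duh_continuous Suc) }
      { case 2 show ?case unfolding XS by (intro self Suc) }
    qed
    have Xdiff: "decays (g * (1/4) ^ k) (\<lambda>t. X (Suc k) t - X k t)" for k
    proof (induction k)
      case 0
      have "decays (1 / 4 * (2 * g)) (\<lambda>t. duh G t - duh (\<lambda>t. 0) t)"
        by (rule contr) (use Gc g zero decays_mono[OF G, of "2 * g"] in auto)
      then have "decays (1 / 4 * (2 * g)) (\<lambda>t. X (Suc 0) t - X 0 t)" by (simp add: decays_def duh0 XS X0)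
      then show ?case by (rule decays_mono) (use g in simp)
    next
      case (Suc k)
      have "decays (1 / 4 * (g * (1/4) ^ k)) (\<lambda>t. duh (X (Suc k)) t - duh (X k) t)"
        by (rule contr[OF _ Xc Xc Xd Xd Suc]) (use g in simp)
      then show ?case by (simp add: XS mult_ac)
    qed
    have Xtail: "decays (g * (1/4) ^ k * (\<Sum>i<j. (1/4) ^ i)) (\<lambda>t. X (k + j) t - X k t)" for k j
    proof (induction j)
      case 0 then show ?case using zero[of 0] by simp
    next
      case (Suc j)
      have "decays (g * (1/4) ^ k * (\<Sum>i<j. (1/4) ^ i) + g * (1/4) ^ (k + j)) (\<lambda>t. (X (k + j) t - X k t) + (X (Suc (k + j)) t - X (k + j) t))"
        by (rule decays_add[OF Suc Xdiff])
      then show ?case by (simp add: algebra_simps power_add)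
    qed
    have geo: "(\<Sum>i<j. (1/4::real) ^ i) \<le> 2" for j
    proof -
      have "(\<Sum>i<j. (1/4::real) ^ i) \<le> (\<Sum>i. (1/4) ^ i)" by (rule sum_le_suminf) (auto simp: summable_geometric)
      also have "\<dots> = 4 / 3" by (subst suminf_geometric) auto
      finally show ?thesis by simp
    qed
    have Xtail2: "decays (2 * (g * (1/4) ^ k)) (\<lambda>t. X (k + j) t - X k t)" for k j
      by (rule decays_mono[OF Xtail]) (use mult_left_mono[OF geo[of j], of "g * (1/4) ^ k"] g in \<open>simp add: mult_ac\<close>)
    \<comment> \<open>The limit of the iterates, written as a telescoping series for the Weierstrass
      test.\<close>
    define W where "W t = G t + (\<Sum>k. X (Suc k) t - X k t)" for t
    have ul: "uniform_limit {0..} (\<lambda>n t. \<Sum>k<n. X (Suc k) t - X k t) (\<lambda>t. \<Sum>k. X (Suc k) t - X k t) sequentially"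
    proof (rule Weierstrass_m_test)
      show "norm (X (Suc n) t - X n t) \<le> 2 * c * g * (1/4) ^ n" if "t \<in> {0..}" for n t
        using decays_norm[OF Xdiff[of n], of t] that g by (simp add: mult_ac)
      show "summable (\<lambda>n. 2 * c * g * (1/4::real) ^ n)" by (intro summable_mult summable_geometric) simp
    qed
    have tel: "(\<Sum>k<n. X (Suc k) t - X k t) = X n t - G t" for n t
      using sum_lessThan_telescope[of "\<lambda>k. X k t" n] by (simp add: X0)
    have Wc: "continuous_on {0..} W"
    proof -
      have "continuous_on {0..} (\<lambda>t. \<Sum>k. X (Suc k) t - X k t)"
        by (rule uniform_limit_theorem[OF _ ul]) (auto intro!: always_eventually continuous_intros Xc)
      then show ?thesis unfolding W_def by (intro continuous_intros Gc)
    qed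
    have lim: "(\<lambda>n. X n t) \<longlonglongrightarrow> W t" if "0 \<le> t" for t
    proof -
      have "(\<lambda>n. X n t - G t) \<longlonglongrightarrow> (\<Sum>k. X (Suc k) t - X k t)"
        using tendsto_uniform_limitI[OF ul, of t] that by (simp add: tel)
      then have "(\<lambda>n. X n t - G t + G t) \<longlonglongrightarrow> (\<Sum>k. X (Suc k) t - X k t) + G t" by (intro tendsto_intros)
      then show ?thesis by (simp add: W_def add.commute)
    qed
    have Wd: "decays (2 * g) W" by (rule decays_limit[OF Xd lim])
    have WX: "decays (2 * (g * (1/4) ^ k)) (\<lambda>t. W t - X k t)" for k
    proof (rule decays_limit[of _ "\<lambda>j t. X (k + j) t - X k t"])
      show "(\<lambda>j. X (k + j) t - X k t) \<longlonglongrightarrow> W t - X k t" if "0 \<le> t" for t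
        using LIMSEQ_ignore_initial_segment[OF lim[OF that], of k] by (intro tendsto_intros) (simp add: add.commute)
    qed (rule Xtail2)
    have "W t = G t + duh W t" if t: "0 \<le> t" for t
    proof -
      have b: "norm (duh W t - (X (Suc k) t - G t)) \<le> c * g * (1/4) ^ k" for k
      proof -
        have "decays (1 / 4 * (2 * (g * (1/4) ^ k))) (\<lambda>t. duh W t - duh (X k) t)"
          by (rule contr[OF _ Wc Xc Wd Xd WX]) (use g in simp)
        from decays_norm[OF this t] show ?thesis using g by (simp add: XS mult_ac)
      qed
      have l1: "(\<lambda>k. norm (duh W t - (X (Suc k) t - G t))) \<longlonglongrightarrow> norm (duh W t - (W t - G t))"
        using LIMSEQ_Suc[OF lim[OF t]] by (intro tendsto_intros)
      have "(\<lambda>k. c * g * (1/4::real) ^ k) \<longlonglongrightarrow> 0" by (intro tendsto_mult_right_zero LIMSEQ_power_zero) simp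
      then have "norm (duh W t - (W t - G t)) \<le> 0" by (rule LIMSEQ_le[OF l1]) (use b in auto)
      then show ?thesis by (simp add: algebra_simps)
    qed
    then show ?thesis using Wc Wd by blast
  qed
  then show ?thesis using that g0 by blast
qed

text \<open>On \<open>[0, T]\<close> both solutions are bounded, so the nonlinearity is Lipschitz
  along them. Instead of Gronwall's inequality the difference is weighted by
  \<open>exp (- 2 * q * t)\<close>: at the maximum of the weighted difference the equation returns
  at most half of that maximum.\<close>

theorem solution_unique:
  assumes W: "continuous_on {0..} W" "\<And>t. 0 \<le> t \<Longrightarrow> W t = G t + duh W t"
    and W': "continuous_on {0..} W'" "\<And>t. 0 \<le> t \<Longrightarrow> W' t = G t + duh W' t"
    and T: "0 \<le> T"
  shows "W T = W' T"
proof -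
  have c: "continuous_on {0..T} W" "continuous_on {0..T} W'"
    using W(1) W'(1) by (auto intro: continuous_on_subset)
  obtain R1 where R1: "\<And>t. t \<in> {0..T} \<Longrightarrow> norm (W t) \<le> R1"
    using compact_continuous_image[OF c(1)] compact_imp_bounded bounded_iff by (metis compact_Icc imageI)
  obtain R2 where R2: "\<And>t. t \<in> {0..T} \<Longrightarrow> norm (W' t) \<le> R2"
    using compact_continuous_image[OF c(2)] compact_imp_bounded bounded_iff by (metis compact_Icc imageI)
  define R where "R = max 1 (max R1 R2)"
  obtain l where l: "\<And>U U'. norm U \<le> R \<Longrightarrow> norm U' \<le> R \<Longrightarrow> norm (N U - N U') \<le> l * norm (U - U')"
  proof -
    have "0 < R" by (simp add: R_def)
    from N_lip[OF this] show thesis using that by blast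
  qed
  \<comment> \<open>A Lipschitz constant of the integrand, made positive by the added
    \<open>1\<close>. The rate \<open>2 * q\<close> of the weight is what produces the factor one
    half after integration.\<close>
  define q where "q = L * (1 + T) * \<bar>l\<bar> + 1"
  have q: "0 < q" using params T by (simp add: q_def add_nonneg_pos)
  have Sq: "norm (S (t - x) (N (W x)) - S (t - x) (N (W' x))) \<le> q * norm (W x - W' x)" if "0 \<le> x" "x \<le> t" "t \<le> T" for x t
  proof -
    have "S (t - x) (N (W x)) - S (t - x) (N (W' x)) = S (t - x) (N (W x) - N (W' x))"
      using linear_diff[OF bounded_linear.linear[OF S[of "t - x"]]] that by simp
    also have "norm \<dots> \<le> L * (1 + (t - x)) * norm (N (W x) - N (W' x))" by (rule S_bd) (use that in simp)
    also have "\<dots> \<le> L * (1 + T) * (\<bar>l\<bar> * norm (W x - W' x))"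
    proof (intro mult_mono)
      have "norm (N (W x) - N (W' x)) \<le> l * norm (W x - W' x)"
        using R1[of x] R2[of x] that by (intro l) (auto simp: R_def)
      also have "\<dots> \<le> \<bar>l\<bar> * norm (W x - W' x)" by (intro mult_right_mono) auto
      finally show "norm (N (W x) - N (W' x)) \<le> \<bar>l\<bar> * norm (W x - W' x)" .
    qed (use params that T in auto)
    also have "\<dots> \<le> q * norm (W x - W' x)" by (simp add: q_def algebra_simps)
    finally show ?thesis .
  qed
  define E where "E t = exp (- 2 * q * t) * norm (W t - W' t)" for t
  have "continuous_on {0..T} E" unfolding E_def by (intro continuous_intros c)
  then obtain s where s: "s \<in> {0..T}" "\<And>t. t \<in> {0..T} \<Longrightarrow> E t \<le> E s"
    using continuous_attains_sup[of "{0..T}" E] T by auto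
  have E0: "0 \<le> E s" by (simp add: E_def)
  have n: "norm (W t - W' t) = exp (2 * q * t) * E t" for t by (simp add: E_def exp_minus field_simps)
  have "norm (W s - W' s) = norm (duh W s - duh W' s)" using W(2)[of s] W'(2)[of s] s(1) by simp
  also have "\<dots> = norm (integral {0..s} (\<lambda>x. S (s - x) (N (W x)) - S (s - x) (N (W' x))))"
    using integral_unique[OF has_integral_diff[OF duh_integral[OF W(1), of s] duh_integral[OF W'(1), of s]]] by simp
  also have "\<dots> \<le> integral {0..s} (\<lambda>x. q * E s * exp (2 * q * x))"
  proof (rule integral_norm_bound_integral)
    show "(\<lambda>x. S (s - x) (N (W x)) - S (s - x) (N (W' x))) integrable_on {0..s}"
      by (intro integrable_continuous_interval continuous_intros integrand_continuous W(1) W'(1))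
    show "(\<lambda>x. q * E s * exp (2 * q * x)) integrable_on {0..s}"
      by (intro integrable_continuous_interval continuous_intros)
    fix x assume x: "x \<in> {0..s}"
    have "norm (S (s - x) (N (W x)) - S (s - x) (N (W' x))) \<le> q * norm (W x - W' x)" using Sq x s(1) by auto
    also have "\<dots> \<le> q * (exp (2 * q * x) * E s)" unfolding n using q s x by (intro mult_left_mono) auto
    finally show "norm (S (s - x) (N (W x)) - S (s - x) (N (W' x))) \<le> q * E s * exp (2 * q * x)" by (simp add: mult_ac)
  qed
  also have "\<dots> = E s / 2 * exp (2 * q * s) - E s / 2 * exp (2 * q * 0)"
  proof (rule integral_unique, rule fundamental_theorem_of_calculus)
    show "((\<lambda>x. E s / 2 * exp (2 * q * x)) has_vector_derivative q * E s * exp (2 * q * x)) (at x within {0..s})" for x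
      unfolding has_real_derivative_iff_has_vector_derivative[symmetric] by (auto intro!: derivative_eq_intros)
  qed (use s in auto)
  also have "\<dots> \<le> E s / 2 * exp (2 * q * s)" using E0 by simp
  finally have "exp (2 * q * s) * E s \<le> exp (2 * q * s) * (E s / 2)" unfolding n by (simp add: mult_ac)
  then have "E s \<le> 0" by (simp add: mult_le_cancel_left_pos)
  then have "E T \<le> 0" using s(2)[of T] T by auto
  then have "norm (W T - W' T) \<le> 0" unfolding n by (simp add: mult_nonneg_nonpos)
  then show ?thesis by simp
qed

end

section \<open>The nonlinearity\<close>

lemma powr_diff_le:
  fixes x y p :: real
  assumes "0 \<le> x" "0 \<le> y" "1 < p"
  shows "\<bar>x powr p - y powr p\<bar> \<le> p * \<bar>x - y\<bar> * max x y powr (p - 1)"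
proof -
  have main: "x powr p - y powr p \<le> p * (x - y) * x powr (p - 1)" if "0 \<le> y" "y < x" for x y :: real
  \<comment> \<open>The mean value theorem is applied on an interval of positive numbers, where
    \<open>powr\<close> is differentiable; the left end \<open>0\<close> is treated
    directly.\<close>
  proof (cases "y = 0")
    case True
    have "x powr p = x * x powr (p - 1)" using that by (simp add: powr_mult_base)
    also have "\<dots> \<le> p * (x * x powr (p - 1))" using assms that mult_right_mono[of 1 p "x * x powr (p - 1)"] by simp
    finally show ?thesis using True by (simp add: mult_ac)
  next
    case False
    then have y: "0 < y" using that by simp
    have der: "((\<lambda>z. z powr p) has_real_derivative p * z powr (p - 1)) (at z)" if "y \<le> z" for z
      using that y by (auto intro!: derivative_eq_intros)
    obtain z where z: "y < z" "z < x" "x powr p - y powr p = (x - y) * (p * z powr (p - 1))"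
      using MVT2[OF \<open>y < x\<close>, of "\<lambda>z. z powr p" "\<lambda>z. p * z powr (p - 1)"] der by blast
    have "z powr (p - 1) \<le> x powr (p - 1)" using z y assms by (intro powr_mono2) auto
    then have "(x - y) * (p * z powr (p - 1)) \<le> (x - y) * (p * x powr (p - 1))"
      using that assms by (intro mult_left_mono) auto
    then show ?thesis unfolding z(3) by (simp add: mult_ac)
  qed
  have mono: "v powr p \<le> w powr p" if "0 \<le> v" "v \<le> w" for v w :: real using that assms by (intro powr_mono2) auto
  show ?thesis
  proof (cases "y < x")
    case True
    then show ?thesis using main[of y x] mono[of y x] assms by (simp add: max_def)
  next
    case False
    show ?thesis
    proof (cases "x < y")
      case True
      then show ?thesis using main[of x y] mono[of x y] assms by (simp add: max_def abs_if)
    qed (use False in simp)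
  qed
qed

lemma abs_power_measurable [measurable]:
  assumes [measurable]: "f \<in> borel_measurable borel"
  shows "abs_power p f \<in> borel_measurable borel"
  unfolding abs_power_def[abs_def] by measurable

text \<open>Hoelder's inequality in scaled form. Dividing \<open>|f - g|\<close> by \<open>d\<close>
  and the larger of \<open>|f|\<close>, \<open>|g|\<close> by \<open>R\<close> reduces it to
  \<open>s * m powr (p - 1) \<le> max s m powr p\<close>. Raised to the power \<open>\<mu>\<close>,
  the right side is at most a sum of three \<open>q\<close>-th powers, one for each hypothesis,
  whence the factor \<open>3\<close>.\<close>

lemma abs_power_diff_integral:
  fixes f g :: "'a::euclidean_space \<Rightarrow> complex"
  assumes [measurable]: "f \<in> borel_measurable borel" "g \<in> borel_measurable borel"
    and \<mu>: "0 < \<mu>" and p: "1 < p" and q: "q = \<mu> * p" and d: "0 < d" and R: "0 < R" and C: "0 \<le> C"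
    and fg: "(\<integral>\<^sup>+x. ennreal (cmod (f x - g x) powr q) \<partial>lborel) \<le> ennreal (C * d powr q)"
    and f: "(\<integral>\<^sup>+x. ennreal (cmod (f x) powr q) \<partial>lborel) \<le> ennreal (C * R powr q)"
    and g: "(\<integral>\<^sup>+x. ennreal (cmod (g x) powr q) \<partial>lborel) \<le> ennreal (C * R powr q)"
  shows "(\<integral>\<^sup>+x. ennreal (cmod (abs_power p f x - abs_power p g x) powr \<mu>) \<partial>lborel)
    \<le> ennreal (3 * C * (p * (d * R powr (p - 1))) powr \<mu>)"
proof -
  define Z where "Z = (p * (d * R powr (p - 1))) powr \<mu>"
  have Z: "0 \<le> Z" by (simp add: Z_def)
  have pt: "cmod (abs_power p f x - abs_power p g x) powr \<mu> \<le>
      Z * (d powr - q * cmod (f x - g x) powr q + (R powr - q * cmod (f x) powr q + R powr - q * cmod (g x) powr q))" for x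
  proof -
    define s where "s = cmod (f x - g x) / d"
    define m where "m = max (cmod (f x)) (cmod (g x)) / R"
    have s0: "0 \<le> s" and m0: "0 \<le> m" using d R by (auto simp: s_def m_def max_def)
    have "cmod (abs_power p f x - abs_power p g x) = \<bar>cmod (f x) powr p - cmod (g x) powr p\<bar>"
      unfolding abs_power_def by (metis norm_of_real of_real_diff)
    also have "\<dots> \<le> p * \<bar>cmod (f x) - cmod (g x)\<bar> * max (cmod (f x)) (cmod (g x)) powr (p - 1)"
      by (rule powr_diff_le) (use p in auto)
    also have "\<dots> \<le> p * cmod (f x - g x) * max (cmod (f x)) (cmod (g x)) powr (p - 1)"
      using p by (intro mult_right_mono mult_left_mono norm_triangle_ineq3) auto
    also have "\<dots> = p * (d * R powr (p - 1)) * (s * m powr (p - 1))"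
      using d R by (simp add: s_def m_def powr_divide)
    also have "\<dots> \<le> p * (d * R powr (p - 1)) * max s m powr p"
    proof (intro mult_left_mono)
      have "s * m powr (p - 1) \<le> max s m * max s m powr (p - 1)"
        using s0 m0 p by (intro mult_mono powr_mono2) auto
      then show "s * m powr (p - 1) \<le> max s m powr p" using s0 by (simp add: powr_mult_base max_def split: if_splits)
    qed (use p d in auto)
    finally have "cmod (abs_power p f x - abs_power p g x) powr \<mu> \<le> (p * (d * R powr (p - 1)) * max s m powr p) powr \<mu>"
      using \<mu> by (intro powr_mono2) auto
    also have "\<dots> = Z * max s m powr q"
      using p d by (simp add: Z_def powr_mult powr_powr q mult.commute[of \<mu>])
    also have "\<dots> \<le> Z * (s powr q + m powr q)"
      using Z by (intro mult_left_mono) (auto simp: max_def)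
    also have "\<dots> \<le> Z * (s powr q + ((cmod (f x) / R) powr q + (cmod (g x) / R) powr q))"
      using Z by (intro mult_left_mono add_left_mono) (auto simp: m_def max_def)
    also have "\<dots> = Z * (d powr - q * cmod (f x - g x) powr q + (R powr - q * cmod (f x) powr q + R powr - q * cmod (g x) powr q))"
      using d R by (simp add: s_def powr_divide powr_minus field_simps)
    finally show ?thesis .
  qed
  have "(\<integral>\<^sup>+x. ennreal (cmod (abs_power p f x - abs_power p g x) powr \<mu>) \<partial>lborel) \<le>
    (\<integral>\<^sup>+x. ennreal Z * (ennreal (d powr - q) * ennreal (cmod (f x - g x) powr q) +
       (ennreal (R powr - q) * ennreal (cmod (f x) powr q) + ennreal (R powr - q) * ennreal (cmod (g x) powr q))) \<partial>lborel)"
    using Z pt by (intro nn_integral_mono) (simp add: ennreal_mult[symmetric] ennreal_plus[symmetric] ennreal_leI del: ennreal_plus)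
  also have "\<dots> = ennreal Z * (ennreal (d powr - q) * (\<integral>\<^sup>+x. ennreal (cmod (f x - g x) powr q) \<partial>lborel) +
       (ennreal (R powr - q) * (\<integral>\<^sup>+x. ennreal (cmod (f x) powr q) \<partial>lborel) + ennreal (R powr - q) * (\<integral>\<^sup>+x. ennreal (cmod (g x) powr q) \<partial>lborel)))"
    by (simp add: nn_integral_cmult nn_integral_add)
  also have "\<dots> \<le> ennreal Z * (ennreal (d powr - q) * ennreal (C * d powr q) +
       (ennreal (R powr - q) * ennreal (C * R powr q) + ennreal (R powr - q) * ennreal (C * R powr q)))"
    by (intro mult_left_mono add_mono fg f g) auto
  also have "\<dots> = ennreal (Z * (d powr - q * (C * d powr q) + (R powr - q * (C * R powr q) + R powr - q * (C * R powr q))))"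
    using Z C by (simp add: ennreal_mult[symmetric] ennreal_plus[symmetric] del: ennreal_plus)
  also have "Z * (d powr - q * (C * d powr q) + (R powr - q * (C * R powr q) + R powr - q * (C * R powr q))) = 3 * C * Z"
    using d R by (simp add: powr_minus field_simps)
  finally show ?thesis by (simp only: Z_def)
qed

section \<open>The problem in frequency space\<close>

lemma bessel_measurable [measurable]: "bessel_symbol s \<in> borel_measurable borel"
  unfolding bessel_symbol_def[abs_def] by measurable

lemma bessel_inverse: "bessel_symbol s \<xi> * bessel_symbol (- s) \<xi> = 1"
proof -
  have "0 < 1 + (norm \<xi>)\<^sup>2" by (simp add: add_pos_nonneg)
  then show ?thesis by (simp add: bessel_symbol_def powr_add[symmetric] flip: of_real_mult)
qed

lemma norm_bessel: "cmod (bessel_symbol s \<xi>) = (1 + (norm \<xi>)\<^sup>2) powr (s / 2)"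
  by (simp add: bessel_symbol_def)

lemma bessel_neg_le:
  assumes "0 \<le> s"
  shows "cmod (bessel_symbol (- s) \<xi>) \<le> 1" "norm \<xi> powr s * cmod (bessel_symbol (- s) \<xi>) \<le> 1"
proof -
  have p: "0 < 1 + (norm \<xi>)\<^sup>2" by (simp add: add_pos_nonneg)
  have i: "cmod (bessel_symbol (- s) \<xi>) = 1 / (1 + (norm \<xi>)\<^sup>2) powr (s / 2)"
    by (simp add: norm_bessel powr_minus inverse_eq_divide)
  have "1 powr (s / 2) \<le> (1 + (norm \<xi>)\<^sup>2) powr (s / 2)" using assms by (intro powr_mono2) auto
  then show "cmod (bessel_symbol (- s) \<xi>) \<le> 1" using p unfolding i by (simp add: divide_le_eq_1)
  have "norm \<xi> powr s \<le> (1 + (norm \<xi>)\<^sup>2) powr (s / 2)"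
  proof (cases "\<xi> = 0")
    case False
    then have "norm \<xi> powr s = ((norm \<xi>)\<^sup>2) powr (s / 2)" by (simp add: powr_powr flip: powr_numeral)
    also have "\<dots> \<le> (1 + (norm \<xi>)\<^sup>2) powr (s / 2)" using assms by (intro powr_mono2) auto
    finally show ?thesis .
  qed simp
  then show "norm \<xi> powr s * cmod (bessel_symbol (- s) \<xi>) \<le> 1" using p unfolding i by (simp add: divide_le_eq_1)
qed

lemma bessel_pos_le:
  assumes "0 \<le> s"
  shows "norm \<xi> \<le> 1 \<Longrightarrow> cmod (bessel_symbol s \<xi>) \<le> 2 powr (s / 2)"
    and "1 < norm \<xi> \<Longrightarrow> cmod (bessel_symbol s \<xi>) \<le> 2 powr (s / 2) * norm \<xi> powr s"
proof -
  assume "norm \<xi> \<le> 1"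
  then have "(norm \<xi>)\<^sup>2 \<le> 1" by (simp add: power_le_one)
  then show "cmod (bessel_symbol s \<xi>) \<le> 2 powr (s / 2)"
    unfolding norm_bessel using assms by (intro powr_mono2) auto
next
  assume x: "1 < norm \<xi>"
  then have "1 \<le> (norm \<xi>)\<^sup>2" by (simp add: one_le_power)
  then have "(1 + (norm \<xi>)\<^sup>2) powr (s / 2) \<le> (2 * (norm \<xi>)\<^sup>2) powr (s / 2)"
    using assms by (intro powr_mono2) auto
  also have "\<dots> = 2 powr (s / 2) * ((norm \<xi>)\<^sup>2) powr (s / 2)" by (simp add: powr_mult)
  also have "((norm \<xi>)\<^sup>2) powr (s / 2) = norm \<xi> powr s" using x by (simp add: powr_powr flip: powr_numeral)
  finally show "cmod (bessel_symbol s \<xi>) \<le> 2 powr (s / 2) * norm \<xi> powr s" by (simp add: norm_bessel)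
qed

text \<open>The unknown is the square-integrable function \<open>W = \<langle>\<xi>\<rangle>\<^sup>\<sigma> F u\<close>; then \<open>opA W\<close> and \<open>opB W\<close> are the
  transforms of \<open>u\<close> and of \<open>|D|\<^sup>\<sigma> u\<close>.\<close>

definition opA :: "real \<Rightarrow> 'a::euclidean_space L2 \<Rightarrow> 'a L2" where
  "opA \<sigma> = mul (bessel_symbol (- \<sigma>))"

definition opB :: "real \<Rightarrow> 'a::euclidean_space L2 \<Rightarrow> 'a L2" where
  "opB \<sigma> = mul (\<lambda>\<xi>. complex_of_real (norm \<xi> powr \<sigma>) * bessel_symbol (- \<sigma>) \<xi>)"

definition nonlin :: "real \<Rightarrow> real \<Rightarrow> 'a::euclidean_space L2 \<Rightarrow> 'a L2" where
  "nonlin \<sigma> p W = fourier (to_L2 (abs_power p (rep_L2 (inv_fourier (opA \<sigma> W)))))"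

lemma square_integrable_opA: "0 \<le> \<sigma> \<Longrightarrow> square_integrable (\<lambda>\<xi>. bessel_symbol (- \<sigma>) \<xi> * rep_L2 W \<xi>)"
  by (rule square_integrable_mul[where C=1]) (auto simp: bessel_neg_le)

lemma square_integrable_opB:
  "0 \<le> \<sigma> \<Longrightarrow> square_integrable (\<lambda>\<xi>. (complex_of_real (norm \<xi> powr \<sigma>) * bessel_symbol (- \<sigma>) \<xi>) * rep_L2 W \<xi>)"
  by (rule square_integrable_mul[where C=1]) (auto simp: bessel_neg_le norm_mult)

lemma bounded_linear_opA: "0 \<le> \<sigma> \<Longrightarrow> bounded_linear (opA \<sigma>)"
  unfolding opA_def by (rule bounded_linear_mul[where C=1]) (auto simp: bessel_neg_le)

lemma bounded_linear_opB: "0 \<le> \<sigma> \<Longrightarrow> bounded_linear (opB \<sigma>)"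
  unfolding opB_def by (rule bounded_linear_mul[where C=1]) (auto simp: bessel_neg_le norm_mult)

lemma norm_opA_le: "0 \<le> \<sigma> \<Longrightarrow> norm (opA \<sigma> W) \<le> norm W"
  unfolding opA_def using norm_mul_le[of "bessel_symbol (- \<sigma>)" 1 W] by (simp add: bessel_neg_le)

lemma norm_opB_le: "0 \<le> \<sigma> \<Longrightarrow> norm (opB \<sigma> W) \<le> norm W"
  unfolding opB_def using norm_mul_le[of "\<lambda>\<xi>. complex_of_real (norm \<xi> powr \<sigma>) * bessel_symbol (- \<sigma>) \<xi>" 1 W]
  by (simp add: bessel_neg_le norm_mult)

lemma bessel_opA:
  assumes "0 \<le> \<sigma>"
  shows "mul (bessel_symbol \<sigma>) (opA \<sigma> W) = W"
  unfolding opA_def mul_mul[OF square_integrable_opA[OF assms] bessel_measurable bessel_measurable] bessel_inverse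
  by (rule mul_1)

lemma opA_bessel:
  assumes "square_integrable (\<lambda>\<xi>. bessel_symbol \<sigma> \<xi> * rep_L2 v \<xi>)"
  shows "opA \<sigma> (mul (bessel_symbol \<sigma>) v) = v"
proof -
  have "bessel_symbol (- \<sigma>) x * bessel_symbol \<sigma> x = 1" for x :: 'a
    using bessel_inverse[of \<sigma> x] by (simp only: mult.commute)
  then show ?thesis
    unfolding opA_def mul_mul[OF assms bessel_measurable bessel_measurable] by (simp add: mul_1)
qed

text \<open>The Bessel weight is bounded inside the unit ball and comparable to
  \<open>norm \<xi> powr \<sigma>\<close> outside, so the two norms with separate decay rates
  control the full norm of the unknown.\<close>

lemma norm_le_opA_opB:
  fixes W :: "'a::euclidean_space L2"
  assumes \<sigma>: "0 \<le> \<sigma>"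
  shows "norm W \<le> 2 powr (\<sigma> / 2) * (norm (opA \<sigma> W) + norm (opB \<sigma> W))"
proof -
  let ?c = "2 powr (\<sigma> / 2)"
  define f where "f \<xi> = complex_of_real (cmod (rep_L2 (opA \<sigma> W) \<xi>))" for \<xi>
  define g where "g \<xi> = complex_of_real (cmod (rep_L2 (opB \<sigma> W) \<xi>))" for \<xi>
  have sf: "square_integrable f"
    by (rule square_integrable_bound[OF square_integrable_rep[of "opA \<sigma> W"], where C=1]) (auto simp: f_def[abs_def])
  have sg: "square_integrable g"
    by (rule square_integrable_bound[OF square_integrable_rep[of "opB \<sigma> W"], where C=1]) (auto simp: g_def[abs_def])
  have nf: "norm (to_L2 f) \<le> 1 * norm (to_L2 (rep_L2 (opA \<sigma> W)))"
    by (rule norm_to_L2_mono) (auto simp: f_def[abs_def])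
  have ng: "norm (to_L2 g) \<le> 1 * norm (to_L2 (rep_L2 (opB \<sigma> W)))"
    by (rule norm_to_L2_mono) (auto simp: g_def[abs_def])
  have "norm (to_L2 (rep_L2 W)) \<le> ?c * norm (to_L2 (\<lambda>\<xi>. f \<xi> + g \<xi>))"
  proof (rule norm_to_L2_mono[OF square_integrable_add[OF sf sg]])
    show "AE \<xi> in lborel. cmod (rep_L2 W \<xi>) \<le> ?c * cmod (f \<xi> + g \<xi>)"
      using rep_mul[OF square_integrable_opA[OF \<sigma>], of W] rep_mul[OF square_integrable_opB[OF \<sigma>], of W]
      unfolding opA_def[symmetric] opB_def[symmetric]
    proof eventually_elim
      case (elim \<xi>)
      let ?b = "cmod (bessel_symbol (- \<sigma>) \<xi>)" and ?w = "cmod (rep_L2 W \<xi>)"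
      have fg: "cmod (f \<xi> + g \<xi>) = ?b * ?w + norm \<xi> powr \<sigma> * ?b * ?w"
        unfolding f_def g_def elim norm_mult of_real_add[symmetric] norm_of_real by simp
      have one: "cmod (bessel_symbol \<sigma> \<xi>) * ?b = 1" using bessel_inverse[of \<sigma> \<xi>] by (metis norm_mult norm_one)
      have "1 \<le> ?c * (?b + norm \<xi> powr \<sigma> * ?b)"
      proof (cases "norm \<xi> \<le> 1")
        case True
        have "1 \<le> ?c * ?b" using mult_right_mono[OF bessel_pos_le(1)[OF \<sigma> True], of ?b] one by simp
        then show ?thesis by (simp add: distrib_left add_increasing2)
      next
        case False
        then have "1 \<le> ?c * norm \<xi> powr \<sigma> * ?b" using mult_right_mono[OF bessel_pos_le(2)[OF \<sigma>, of \<xi>], of ?b] one by simp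
        then show ?thesis by (simp add: distrib_left add_increasing mult.assoc)
      qed
      then have "1 * ?w \<le> ?c * (?b + norm \<xi> powr \<sigma> * ?b) * ?w" by (rule mult_right_mono) simp
      then show ?case unfolding fg by (simp add: algebra_simps)
    qed
  qed auto
  also have "norm (to_L2 (\<lambda>\<xi>. f \<xi> + g \<xi>)) \<le> norm (to_L2 f) + norm (to_L2 g)"
    unfolding to_L2_add[OF sf sg] by (rule norm_triangle_ineq)
  finally show ?thesis using nf ng by (simp add: mult_left_mono order_trans[OF _ mult_left_mono])
qed

lemma nn_opB:
  fixes W :: "'a::euclidean_space L2"
  assumes \<sigma>: "0 \<le> \<sigma>"
  shows "(\<integral>\<^sup>+\<xi>. ennreal (norm \<xi> powr (2 * \<sigma>) * (cmod (rep_L2 (opA \<sigma> W) \<xi>))\<^sup>2) \<partial>lborel) = ennreal ((norm (opB \<sigma> W))\<^sup>2)"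
  unfolding nn_norm_L2[symmetric]
proof (rule nn_integral_cong_AE)
  show "AE \<xi> in lborel. ennreal (norm \<xi> powr (2 * \<sigma>) * (cmod (rep_L2 (opA \<sigma> W) \<xi>))\<^sup>2) = ennreal ((cmod (rep_L2 (opB \<sigma> W) \<xi>))\<^sup>2)"
    using rep_mul[OF square_integrable_opA[OF \<sigma>], of W] rep_mul[OF square_integrable_opB[OF \<sigma>], of W]
    unfolding opA_def[symmetric] opB_def[symmetric]
    by eventually_elim (simp add: norm_mult power_mult_distrib powr_squared mult.assoc)
qed

text \<open>One scale \<open>\<rho>\<close> serves both functions and their difference, so
  Gagliardo--Nirenberg gives all three the factor \<open>\<rho> powr s\<close>; the nonlinearity has
  degree \<open>p\<close>, whence \<open>\<rho> powr (s * p)\<close>.\<close>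

lemma nonlin_difference:
  fixes \<sigma> p \<mu> s :: real
  assumes \<sigma>: "0 \<le> \<sigma>" and p: "1 < p" and \<mu>: "0 < \<mu>" "2 \<le> \<mu> * p"
    and s: "s = real DIM('a::euclidean_space) * (1/2 - 1/(\<mu> * p))" "s \<le> \<sigma>"
  shows "\<exists>C>0. \<forall>(W :: 'a L2) W' r d \<rho>. 0 < r \<longrightarrow> 0 < d \<longrightarrow> 0 < \<rho> \<longrightarrow>
    norm (opA \<sigma> W) \<le> r \<longrightarrow> norm (opB \<sigma> W) \<le> \<rho> powr \<sigma> * r \<longrightarrow>
    norm (opA \<sigma> W') \<le> r \<longrightarrow> norm (opB \<sigma> W') \<le> \<rho> powr \<sigma> * r \<longrightarrow>
    norm (opA \<sigma> (W - W')) \<le> d \<longrightarrow> norm (opB \<sigma> (W - W')) \<le> \<rho> powr \<sigma> * d \<longrightarrow>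
    (\<integral>\<^sup>+x. ennreal (cmod (abs_power p (rep_L2 (inv_fourier (opA \<sigma> W))) x - abs_power p (rep_L2 (inv_fourier (opA \<sigma> W'))) x) powr \<mu>) \<partial>lborel)
      \<le> ennreal ((C * (d * r powr (p - 1) * \<rho> powr (s * p))) powr \<mu>)"
proof -
  let ?q = "\<mu> * p"
  \<comment> \<open>The inverse transform divides norms by \<open>sqrt_pi_const\<close>; the maximum
    with \<open>1\<close> lets one constant serve both hypotheses of Gagliardo--Nirenberg.\<close>
  let ?k = "max 1 (1 / sqrt_pi_const TYPE('a))"
  obtain C where C: "0 < C" "\<And>(u :: 'a L2) X \<rho>. 0 < X \<Longrightarrow> 0 < \<rho> \<Longrightarrow> norm u \<le> X \<Longrightarrow>
    (\<integral>\<^sup>+\<xi>. ennreal (norm \<xi> powr (2 * \<sigma>) * (cmod (rep_L2 (fourier u) \<xi>))\<^sup>2) \<partial>lborel) \<le> ennreal ((\<rho> powr \<sigma> * X)\<^sup>2) \<Longrightarrow>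
    (\<integral>\<^sup>+x. ennreal (cmod (rep_L2 u x) powr ?q) \<partial>lborel) \<le> ennreal (C * (\<rho> powr s * X) powr ?q)"
    using gagliardo_nirenberg[OF \<mu>(2) s] by blast
  have gn: "(\<integral>\<^sup>+x. ennreal (cmod (rep_L2 (inv_fourier (opA \<sigma> W)) x) powr ?q) \<partial>lborel) \<le> ennreal (C * (\<rho> powr s * (?k * X)) powr ?q)"
    if "0 < X" "0 < \<rho>" "norm (opA \<sigma> W) \<le> X" "norm (opB \<sigma> W) \<le> \<rho> powr \<sigma> * X" for W :: "'a L2" and X \<rho>
  proof (rule C(2))
    show "0 < ?k * X" using that by simp
    show "norm (inv_fourier (opA \<sigma> W)) \<le> ?k * X"
    proof -
      have "norm (inv_fourier (opA \<sigma> W)) = 1 / sqrt_pi_const TYPE('a) * norm (opA \<sigma> W)" by (simp add: norm_inv_fourier)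
      also have "\<dots> \<le> ?k * X" using that sqrt_pi_const_pos[where 'a='a] by (intro mult_mono) auto
      finally show ?thesis .
    qed
    have "\<rho> powr \<sigma> * X \<le> \<rho> powr \<sigma> * (?k * X)" using that by (intro mult_left_mono) (auto simp: max_def)
    then have "norm (opB \<sigma> W) \<le> \<rho> powr \<sigma> * (?k * X)" using that by linarith
    then show "(\<integral>\<^sup>+\<xi>. ennreal (norm \<xi> powr (2 * \<sigma>) * (cmod (rep_L2 (fourier (inv_fourier (opA \<sigma> W))) \<xi>))\<^sup>2) \<partial>lborel) \<le> ennreal ((\<rho> powr \<sigma> * (?k * X))\<^sup>2)"
      by (simp add: nn_opB[OF \<sigma>] power_mono ennreal_leI)
  qed (use that in auto)
  define C' where "C' = (3 * C) powr (1 / \<mu>) * (p * ?k powr p)"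
  have k: "0 < ?k" by simp
  have C': "0 < C'" using C(1) p k by (simp add: C'_def)
  have "(\<integral>\<^sup>+x. ennreal (cmod (abs_power p (rep_L2 (inv_fourier (opA \<sigma> W))) x - abs_power p (rep_L2 (inv_fourier (opA \<sigma> W'))) x) powr \<mu>) \<partial>lborel)
      \<le> ennreal ((C' * (d * r powr (p - 1) * \<rho> powr (s * p))) powr \<mu>)"
    if r: "0 < r" and d: "0 < d" and \<rho>: "0 < \<rho>"
      and W: "norm (opA \<sigma> W) \<le> r" "norm (opB \<sigma> W) \<le> \<rho> powr \<sigma> * r"
      and W': "norm (opA \<sigma> W') \<le> r" "norm (opB \<sigma> W') \<le> \<rho> powr \<sigma> * r"
      and D: "norm (opA \<sigma> (W - W')) \<le> d" "norm (opB \<sigma> (W - W')) \<le> \<rho> powr \<sigma> * d" for W W' :: "'a L2" and r d \<rho>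
  proof -
    let ?u = "rep_L2 (inv_fourier (opA \<sigma> W))" and ?u' = "rep_L2 (inv_fourier (opA \<sigma> W'))"
    have lin: "inv_fourier (opA \<sigma> (W - W')) = inv_fourier (opA \<sigma> W) - inv_fourier (opA \<sigma> W')"
      by (simp add: linear_diff[OF bounded_linear.linear[OF bounded_linear_opA[OF \<sigma>]]]
          linear_diff[OF bounded_linear.linear[OF bounded_linear_inv_fourier]])
    have "(\<integral>\<^sup>+x. ennreal (cmod (?u x - ?u' x) powr ?q) \<partial>lborel) = (\<integral>\<^sup>+x. ennreal (cmod (rep_L2 (inv_fourier (opA \<sigma> (W - W'))) x) powr ?q) \<partial>lborel)"
      unfolding lin by (rule nn_integral_cong_AE) (use rep_L2_diff[of "inv_fourier (opA \<sigma> W)" "inv_fourier (opA \<sigma> W')"] in \<open>eventually_elim, simp\<close>)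
    also have "\<dots> \<le> ennreal (C * (\<rho> powr s * (?k * d)) powr ?q)" by (rule gn[OF d \<rho> D])
    finally have i: "(\<integral>\<^sup>+x. ennreal (cmod (?u x - ?u' x) powr ?q) \<partial>lborel) \<le> ennreal (C * (\<rho> powr s * (?k * d)) powr ?q)" .
    have "(\<integral>\<^sup>+x. ennreal (cmod (abs_power p ?u x - abs_power p ?u' x) powr \<mu>) \<partial>lborel)
      \<le> ennreal (3 * C * (p * ((\<rho> powr s * (?k * d)) * (\<rho> powr s * (?k * r)) powr (p - 1))) powr \<mu>)"
      by (rule abs_power_diff_integral[OF _ _ \<mu>(1) p refl _ _ _ i gn[OF r \<rho> W] gn[OF r \<rho> W']])
         (use \<rho> d r C k in auto)
    also have "3 * C * (p * ((\<rho> powr s * (?k * d)) * (\<rho> powr s * (?k * r)) powr (p - 1))) powr \<mu> = (C' * (d * r powr (p - 1) * \<rho> powr (s * p))) powr \<mu>"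
    proof -
      have e1: "(\<rho> powr s * (?k * d)) * (\<rho> powr s * (?k * r)) powr (p - 1) = (\<rho> powr s * (\<rho> powr s) powr (p - 1)) * (?k * ?k powr (p - 1)) * (d * r powr (p - 1))"
        using k r by (simp add: powr_mult)
      have e2: "\<rho> powr s * (\<rho> powr s) powr (p - 1) = \<rho> powr (s * p)" unfolding powr_powr powr_add[symmetric] by (simp add: algebra_simps)
      have e3: "?k * ?k powr (p - 1) = ?k powr p" using k by (subst powr_mult_base) auto
      have e4: "3 * C = ((3 * C) powr (1 / \<mu>)) powr \<mu>" using C \<mu> by (simp add: powr_powr)
      have "3 * C * (p * (\<rho> powr (s * p) * ?k powr p * (d * r powr (p - 1)))) powr \<mu> = ((3 * C) powr (1 / \<mu>) * (p * (\<rho> powr (s * p) * ?k powr p * (d * r powr (p - 1))))) powr \<mu>"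
        unfolding powr_mult[of "(3 * C) powr (1 / \<mu>)"] by (subst e4) (rule refl)
      then show ?thesis unfolding e1 e2 e3 by (simp only: C'_def mult_ac)
    qed
    finally show ?thesis .
  qed
  then show ?thesis using C' by blast
qed

text \<open>The hypotheses of the theorem in the form in which the estimates use them:
  \<open>2 < m * p\<close> comes from the lower bounds on \<open>m\<close> and \<open>p\<close>,
  \<open>gap\<close> from the upper bound on \<open>m\<close>; \<open>slow\<close> makes the decay
  rate \<open>a\<close> smaller than \<open>1\<close>; the second part of \<open>p\<close> is the
  lower bound on the exponent multiplied out; \<open>embed\<close> is the embedding of
  \<open>H^\<sigma>\<close> into \<open>L^(2p)\<close>.\<close>

locale damped_wave =
  fixes \<sigma> \<sigma>\<^sub>1 \<sigma>\<^sub>2 m p n :: real and T :: "'a::euclidean_space itself"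
  assumes n_eq: "n = real DIM('a)"
    and sigma: "1 \<le> \<sigma>" "0 \<le> \<sigma>\<^sub>1" "\<sigma>\<^sub>1 < \<sigma> / 2" "\<sigma> / 2 < \<sigma>\<^sub>2" "\<sigma>\<^sub>2 \<le> \<sigma>"
    and m: "1 < m" "m \<le> 2" "2 < m * p"
    and gap: "m = 2 \<and> \<sigma>\<^sub>1 = 0 \<or> m < 2 \<and> 2 * \<sigma>\<^sub>1 < n * (1/m - 1/2)"
    and slow: "n * (1/m - 1/2) < 2 * \<sigma>"
    and p: "1 < p" "2 * \<sigma> \<le> (p - 1) * (n / m - 2 * \<sigma>\<^sub>1)"
    and embed: "n * (1/2 - 1/(2 * p)) \<le> \<sigma>"
begin

text \<open>\<open>- a\<close> and \<open>- b\<close> are the two decay exponents of the theorem.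
  They differ by \<open>\<sigma> / \<alpha>\<close>, the gain from \<open>\<sigma>\<close>
  derivatives at frequencies of size \<open>(1 + t) powr (- 1 / \<alpha>)\<close>.\<close>

definition \<alpha> :: real where "\<alpha> = 2 * (\<sigma> - \<sigma>\<^sub>1)"
definition a :: real where "a = (n * (1/m - 1/2) - 2 * \<sigma>\<^sub>1) / \<alpha>"
definition b :: real where "b = a + \<sigma> / \<alpha>"

abbreviation K\<^sub>0 :: "real \<Rightarrow> 'a \<Rightarrow> complex" where "K\<^sub>0 \<equiv> K0_hat \<sigma> \<sigma>\<^sub>1 \<sigma>\<^sub>2"
abbreviation K\<^sub>1 :: "real \<Rightarrow> 'a \<Rightarrow> complex" where "K\<^sub>1 \<equiv> K1_hat \<sigma> \<sigma>\<^sub>1 \<sigma>\<^sub>2"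

definition opS :: "real \<Rightarrow> 'a L2 \<Rightarrow> 'a L2" where
  "opS t = mul (\<lambda>\<xi>. bessel_symbol \<sigma> \<xi> * K\<^sub>1 t \<xi>)"

lemma alpha_pos: "0 < \<alpha>" using sigma by (simp add: \<alpha>_def)
lemma n_pos: "0 < n" by (simp add: n_eq)
lemma sigma_nonneg: "0 \<le> \<sigma>" using sigma by simp
lemma a_nonneg: "0 \<le> a" using gap alpha_pos by (auto simp: a_def intro!: divide_nonneg_pos)

subsection \<open>Symbol estimates\<close>

lemma K_low:
  assumes \<xi>: "\<xi> \<noteq> 0" "norm \<xi> \<le> 1" and t: "0 \<le> t"
  defines "e \<equiv> exp (- (norm \<xi> powr \<alpha> * (1 + t) / 16))"
  shows "cmod (K\<^sub>1 t \<xi>) \<le> 17 * exp (1/16) * (norm \<xi> powr - (2 * \<sigma>\<^sub>1) * e)"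
    and "cmod (K\<^sub>0 t \<xi>) \<le> 17 * exp (1/16) * (norm \<xi> powr - (2 * \<sigma>\<^sub>1) * e)"
proof -
  let ?b = "damping_symbol \<sigma>\<^sub>1 \<sigma>\<^sub>2 \<xi>"
  have s12: "\<sigma>\<^sub>1 < \<sigma>\<^sub>2" using sigma by simp
  have ex: "exp (- (norm \<xi> powr (2 * \<sigma>) / ?b * t / 8)) \<le> exp (1/16) * e"
  proof -
    have "norm \<xi> powr \<alpha> / 2 * (t / 8) \<le> norm \<xi> powr (2 * \<sigma>) / ?b * (t / 8)"
      using damping_rate_low(2)[OF s12 \<xi>, of \<sigma>] t unfolding \<alpha>_def by (intro mult_right_mono) auto
    moreover have "norm \<xi> powr \<alpha> \<le> 1" using \<xi> alpha_pos by (simp add: powr_le1)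
    \<comment> \<open>Passing from \<open>t\<close> to \<open>1 + t\<close> costs
      \<open>exp (1/16)\<close>, because \<open>norm \<xi> powr \<alpha> \<le> 1\<close>.\<close>
    moreover have "- (Q * t / 8) \<le> 1/16 - P * (1 + t) / 16" if "P / 2 * (t / 8) \<le> Q * (t / 8)" "P \<le> 1" for P Q :: real
      using that by (simp add: field_simps)
    ultimately have "- (norm \<xi> powr (2 * \<sigma>) / ?b * t / 8) \<le> 1/16 - norm \<xi> powr \<alpha> * (1 + t) / 16"
      by blast
    then have "exp (- (norm \<xi> powr (2 * \<sigma>) / ?b * t / 8)) \<le> exp (1/16 - norm \<xi> powr \<alpha> * (1 + t) / 16)" by simp
    also have "\<dots> = exp (1/16) * e" by (simp add: e_def exp_add[symmetric])
    finally show ?thesis .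
  qed
  have e0: "0 \<le> e" by (simp add: e_def)
  have "cmod (K\<^sub>1 t \<xi>) \<le> 8 * (1 / ?b) * exp (- (norm \<xi> powr (2 * \<sigma>) / ?b * t / 8))"
    using K_hat_bounds(2)[OF sigma(3,4) \<xi>(1) t] by simp
  also have "\<dots> \<le> 17 * norm \<xi> powr - (2 * \<sigma>\<^sub>1) * (exp (1/16) * e)"
    using damping_rate_low(1)[OF s12 \<xi>] damping_lower(2)[OF sigma(3,4) \<xi>(1)]
    by (intro mult_mono ex) auto
  finally show "cmod (K\<^sub>1 t \<xi>) \<le> 17 * exp (1/16) * (norm \<xi> powr - (2 * \<sigma>\<^sub>1) * e)" by (simp add: mult_ac)
  have "1 \<le> norm \<xi> powr - (2 * \<sigma>\<^sub>1)" using \<xi> sigma powr_mono'[of "- (2 * \<sigma>\<^sub>1)" 0 "norm \<xi>"] by simp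
  then have "1 * e \<le> norm \<xi> powr - (2 * \<sigma>\<^sub>1) * e" using e0 by (rule mult_right_mono)
  then have "17 * exp (1/16) * e \<le> 17 * exp (1/16) * (norm \<xi> powr - (2 * \<sigma>\<^sub>1) * e)" by (intro mult_left_mono) auto
  moreover have "cmod (K\<^sub>0 t \<xi>) \<le> 17 * (exp (1/16) * e)"
    using K_hat_bounds(3)[OF sigma(3,4) \<xi>(1) t] ex by linarith
  ultimately show "cmod (K\<^sub>0 t \<xi>) \<le> 17 * exp (1/16) * (norm \<xi> powr - (2 * \<sigma>\<^sub>1) * e)"
    unfolding mult.assoc by (rule order_trans[rotated])
qed

lemma K_high:
  assumes \<xi>: "1 < norm \<xi>" and t: "0 \<le> t"
  shows "norm \<xi> powr (2 * \<sigma>\<^sub>2) * cmod (K\<^sub>1 t \<xi>) \<le> 8 * exp (- (t / 16))"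
    and "cmod (K\<^sub>0 t \<xi>) \<le> 17 * exp (- (t / 16))"
proof -
  let ?b = "damping_symbol \<sigma>\<^sub>1 \<sigma>\<^sub>2 \<xi>"
  have s12: "\<sigma>\<^sub>1 < \<sigma>\<^sub>2" using sigma by simp
  have \<xi>0: "\<xi> \<noteq> 0" using \<xi> by auto
  note d = damping_rate_high[OF s12 sigma(5) \<xi>]
  have ex: "exp (- (norm \<xi> powr (2 * \<sigma>) / ?b * t / 8)) \<le> exp (- (t / 16))"
    using mult_right_mono[OF d(2), of "t / 8"] t by simp
  have "cmod (K\<^sub>1 t \<xi>) \<le> 8 * (1 / ?b) * exp (- (norm \<xi> powr (2 * \<sigma>) / ?b * t / 8))"
    using K_hat_bounds(2)[OF sigma(3,4) \<xi>0 t] by simp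
  also have "\<dots> \<le> 8 * norm \<xi> powr - (2 * \<sigma>\<^sub>2) * exp (- (t / 16))"
    using d(1) damping_lower(2)[OF sigma(3,4) \<xi>0] by (intro mult_mono ex) auto
  finally have "norm \<xi> powr (2 * \<sigma>\<^sub>2) * cmod (K\<^sub>1 t \<xi>) \<le> norm \<xi> powr (2 * \<sigma>\<^sub>2) * (8 * norm \<xi> powr - (2 * \<sigma>\<^sub>2) * exp (- (t / 16)))"
    by (intro mult_left_mono) auto
  also have "\<dots> = 8 * (norm \<xi> powr (2 * \<sigma>\<^sub>2) * norm \<xi> powr - (2 * \<sigma>\<^sub>2)) * exp (- (t / 16))" by (simp only: mult_ac)
  also have "norm \<xi> powr (2 * \<sigma>\<^sub>2) * norm \<xi> powr - (2 * \<sigma>\<^sub>2) = 1" using \<xi>0 by (simp add: powr_add[symmetric])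
  finally show "norm \<xi> powr (2 * \<sigma>\<^sub>2) * cmod (K\<^sub>1 t \<xi>) \<le> 8 * exp (- (t / 16))" by simp
  show "cmod (K\<^sub>0 t \<xi>) \<le> 17 * exp (- (t / 16))"
    using K_hat_bounds(3)[OF sigma(3,4) \<xi>0 t] ex by linarith
qed

definition ck :: real where "ck = 17 * exp (1/16)"

lemma ck: "0 < ck" "17 \<le> ck" by (simp_all add: ck_def)

lemma decaying_K1: "0 \<le> t \<Longrightarrow> decaying \<alpha> (2 * \<sigma>\<^sub>1) ck t (K\<^sub>1 t)"
  unfolding decaying_def ck_def
proof (intro conjI allI impI)
  fix \<xi> :: 'a assume t: "0 \<le> t" and \<xi>: "1 < norm \<xi>"
  have "1 \<le> norm \<xi> powr (2 * \<sigma>\<^sub>2)" using \<xi> sigma by (intro ge_one_powr_ge_zero) auto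
  then have "1 * cmod (K\<^sub>1 t \<xi>) \<le> norm \<xi> powr (2 * \<sigma>\<^sub>2) * cmod (K\<^sub>1 t \<xi>)" by (intro mult_right_mono) auto
  also have "\<dots> \<le> 8 * exp (- (t / 16))" by (rule K_high[OF \<xi> t])
  also have "\<dots> \<le> ck * exp (- (t / 16))" using ck(2) by (intro mult_right_mono) auto
  also have "\<dots> = 17 * exp (1 / 16) * exp (- (t / 16))" by (simp only: ck_def)
  finally show "cmod (K\<^sub>1 t \<xi>) \<le> 17 * exp (1 / 16) * exp (- (t / 16))" by simp
qed (use K_low in auto)

text \<open>A factor of order \<open>s\<close> lowers the singularity at the origin by
  \<open>s\<close>. Outside the unit ball the bound is asked of the product as a whole, since there
  growth of \<open>g\<close> may have to be compensated by smoothing of \<open>k\<close>.\<close>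

lemma decaying_powr_mult:
  fixes g k :: "'a \<Rightarrow> complex"
  assumes "decaying \<alpha> \<kappa> c t k" "g \<in> borel_measurable borel" "0 \<le> c"
    and low: "\<And>\<xi>. \<xi> \<noteq> 0 \<Longrightarrow> norm \<xi> \<le> 1 \<Longrightarrow> cmod (g \<xi>) \<le> norm \<xi> powr s"
    and high: "\<And>\<xi>. 1 < norm \<xi> \<Longrightarrow> cmod (g \<xi> * k \<xi>) \<le> c * exp (- (t / 16))"
  shows "decaying \<alpha> (\<kappa> - s) c t (\<lambda>\<xi>. g \<xi> * k \<xi>)"
  unfolding decaying_def
proof (intro conjI allI impI high)
  show "(\<lambda>\<xi>. g \<xi> * k \<xi>) \<in> borel_measurable borel" using assms(1,2) unfolding decaying_def by (intro borel_measurable_times) auto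
  fix \<xi> :: 'a assume \<xi>: "\<xi> \<noteq> 0" "norm \<xi> \<le> 1"
  let ?e = "exp (- (norm \<xi> powr \<alpha> * (1 + t) / 16))"
  have "cmod (g \<xi>) * cmod (k \<xi>) \<le> norm \<xi> powr s * (c * (norm \<xi> powr - \<kappa> * ?e))"
    using assms(1) \<xi> low[OF \<xi>] by (intro mult_mono) (auto simp: decaying_def)
  also have "\<dots> = c * ((norm \<xi> powr s * norm \<xi> powr - \<kappa>) * ?e)" by (simp only: mult_ac)
  also have "norm \<xi> powr s * norm \<xi> powr - \<kappa> = norm \<xi> powr - (\<kappa> - s)" by (simp add: powr_add[symmetric])
  finally show "cmod (g \<xi> * k \<xi>) \<le> c * (norm \<xi> powr - (\<kappa> - s) * ?e)" by (simp add: norm_mult)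
qed

lemma decaying_DK1:
  assumes t: "0 \<le> t"
  shows "decaying \<alpha> (2 * \<sigma>\<^sub>1 - \<sigma>) ck t (\<lambda>\<xi>. complex_of_real (norm \<xi> powr \<sigma>) * K\<^sub>1 t \<xi>)"
proof (rule decaying_powr_mult[OF decaying_K1[OF t]])
  fix \<xi> :: 'a assume \<xi>: "1 < norm \<xi>"
  have "norm \<xi> powr \<sigma> \<le> norm \<xi> powr (2 * \<sigma>\<^sub>2)" using \<xi> sigma by (intro powr_mono) auto
  then have "norm \<xi> powr \<sigma> * cmod (K\<^sub>1 t \<xi>) \<le> norm \<xi> powr (2 * \<sigma>\<^sub>2) * cmod (K\<^sub>1 t \<xi>)" by (intro mult_right_mono) auto
  also have "\<dots> \<le> 8 * exp (- (t / 16))" by (rule K_high[OF \<xi> t])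
  also have "\<dots> \<le> ck * exp (- (t / 16))" using ck(2) by (intro mult_right_mono) auto
  finally show "cmod (complex_of_real (norm \<xi> powr \<sigma>) * K\<^sub>1 t \<xi>) \<le> ck * exp (- (t / 16))" by (simp add: norm_mult)
qed (use ck in auto)

lemma decaying_K0: "0 \<le> t \<Longrightarrow> decaying \<alpha> (2 * \<sigma>\<^sub>1) ck t (K\<^sub>0 t)"
  unfolding decaying_def ck_def
proof (intro conjI allI impI)
  fix \<xi> :: 'a assume t: "0 \<le> t" and \<xi>: "1 < norm \<xi>"
  have "17 * exp (- (t / 16)) \<le> 17 * exp (1 / 16) * exp (- (t / 16))" using ck(2) by (intro mult_right_mono) (auto simp: ck_def)
  then show "cmod (K\<^sub>0 t \<xi>) \<le> 17 * exp (1 / 16) * exp (- (t / 16))" using K_high(2)[OF \<xi> t] by linarith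
qed (use K_low in auto)

lemma decaying_bounded_mult:
  assumes k: "decaying \<alpha> \<kappa> ck t (K\<^sub>0 t)" and t: "0 \<le> t"
    and g: "g \<in> borel_measurable borel" "\<And>\<xi>. cmod (g \<xi>) \<le> 1" and s: "\<And>\<xi>. cmod (g \<xi>) \<le> norm \<xi> powr s"
  shows "decaying \<alpha> (\<kappa> - s) ck t (\<lambda>\<xi>. g \<xi> * K\<^sub>0 t \<xi>)"
proof (rule decaying_powr_mult[OF k g(1)])
  fix \<xi> :: 'a assume \<xi>: "1 < norm \<xi>"
  have "cmod (g \<xi>) * cmod (K\<^sub>0 t \<xi>) \<le> 1 * (ck * exp (- (t / 16)))"
    using k \<xi> g(2)[of \<xi>] by (intro mult_mono) (auto simp: decaying_def)
  then show "cmod (g \<xi> * K\<^sub>0 t \<xi>) \<le> ck * exp (- (t / 16))" by (simp add: norm_mult)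
qed (use ck s in auto)

lemma decaying_AK0:
  assumes t: "0 \<le> t"
  shows "decaying \<alpha> (2 * \<sigma>\<^sub>1) ck t (\<lambda>\<xi>. bessel_symbol (- \<sigma>) \<xi> * K\<^sub>0 t \<xi>)"
proof -
  have "decaying \<alpha> (2 * \<sigma>\<^sub>1 - 0) ck t (\<lambda>\<xi>. bessel_symbol (- \<sigma>) \<xi> * K\<^sub>0 t \<xi>)"
  proof (rule decaying_powr_mult[OF decaying_K0[OF t]])
    fix \<xi> :: 'a
    show "cmod (bessel_symbol (- \<sigma>) \<xi>) \<le> norm \<xi> powr 0" if "\<xi> \<noteq> 0"
      using that bessel_neg_le(1)[OF sigma_nonneg] by simp
    assume \<xi>: "1 < norm \<xi>"
    have "cmod (bessel_symbol (- \<sigma>) \<xi>) * cmod (K\<^sub>0 t \<xi>) \<le> 1 * (ck * exp (- (t / 16)))"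
      using decaying_K0[OF t] \<xi> bessel_neg_le(1)[OF sigma_nonneg, of \<xi>] by (intro mult_mono) (auto simp: decaying_def)
    then show "cmod (bessel_symbol (- \<sigma>) \<xi> * K\<^sub>0 t \<xi>) \<le> ck * exp (- (t / 16))" by (simp add: norm_mult)
  qed (use ck in auto)
  then show ?thesis by simp
qed

lemma decaying_BK0:
  assumes t: "0 \<le> t"
  shows "decaying \<alpha> (2 * \<sigma>\<^sub>1 - \<sigma>) ck t (\<lambda>\<xi>. complex_of_real (norm \<xi> powr \<sigma>) * bessel_symbol (- \<sigma>) \<xi> * K\<^sub>0 t \<xi>)"
proof (rule decaying_bounded_mult[OF decaying_K0[OF t] t])
  show "cmod (complex_of_real (norm \<xi> powr \<sigma>) * bessel_symbol (- \<sigma>) \<xi>) \<le> 1" for \<xi> :: 'a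
    using bessel_neg_le(2)[OF sigma_nonneg, of \<xi>] by (simp add: norm_mult)
  show "cmod (complex_of_real (norm \<xi> powr \<sigma>) * bessel_symbol (- \<sigma>) \<xi>) \<le> norm \<xi> powr \<sigma>" for \<xi> :: 'a
    using mult_left_mono[OF bessel_neg_le(1)[OF sigma_nonneg, of \<xi>], of "norm \<xi> powr \<sigma>"] by (simp add: norm_mult)
qed measurable

text \<open>At high frequencies the weight of order \<open>\<sigma>\<close> is absorbed by the
  smoothing of order \<open>2 * \<sigma>\<^sub>2\<close>. At low frequencies the bound by
  \<open>t\<close> is used, as the damping may tend to \<open>0\<close> there; the growth in
  \<open>t\<close> is harmless for continuity and for uniqueness on bounded intervals.\<close>

lemma opS_symbol_le:
  assumes t: "0 \<le> t" and \<xi>: "\<xi> \<noteq> 0"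
  shows "cmod (bessel_symbol \<sigma> \<xi> * K\<^sub>1 t \<xi>) \<le> 8 * 2 powr (\<sigma> / 2) * (1 + t)"
proof (cases "norm \<xi> \<le> 1")
  case True
  have "cmod (bessel_symbol \<sigma> \<xi>) * cmod (K\<^sub>1 t \<xi>) \<le> 2 powr (\<sigma> / 2) * t"
    by (intro mult_mono bessel_pos_le(1)[OF sigma_nonneg True] K_hat_bounds(1)[OF sigma(3,4) \<xi> t]) auto
  also have "\<dots> \<le> 2 powr (\<sigma> / 2) * (8 * (1 + t))" using t by (intro mult_left_mono) auto
  finally show ?thesis by (simp only: norm_mult mult_ac)
next
  case False
  then have \<xi>1: "1 < norm \<xi>" by simp
  have "norm \<xi> powr \<sigma> \<le> norm \<xi> powr (2 * \<sigma>\<^sub>2)" using \<xi>1 sigma by (intro powr_mono) auto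
  then have "norm \<xi> powr \<sigma> * cmod (K\<^sub>1 t \<xi>) \<le> norm \<xi> powr (2 * \<sigma>\<^sub>2) * cmod (K\<^sub>1 t \<xi>)" by (intro mult_right_mono) auto
  also have "\<dots> \<le> 8 * exp (- (t / 16))" by (rule K_high[OF \<xi>1 t])
  also have "\<dots> \<le> 8 * (1 + t)"
  proof (intro mult_left_mono)
    have "exp (- (t / 16)) \<le> 1" using t by simp
    then show "exp (- (t / 16)) \<le> 1 + t" using t by linarith
  qed simp
  finally have h: "norm \<xi> powr \<sigma> * cmod (K\<^sub>1 t \<xi>) \<le> 8 * (1 + t)" .
  have "cmod (bessel_symbol \<sigma> \<xi>) * cmod (K\<^sub>1 t \<xi>) \<le> 2 powr (\<sigma> / 2) * norm \<xi> powr \<sigma> * cmod (K\<^sub>1 t \<xi>)"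
    by (intro mult_right_mono bessel_pos_le(2)[OF sigma_nonneg \<xi>1]) auto
  also have "\<dots> \<le> 2 powr (\<sigma> / 2) * (8 * (1 + t))" unfolding mult.assoc by (intro mult_left_mono h) auto
  finally show ?thesis by (simp only: norm_mult mult_ac)
qed

section \<open>The linear evolution acting on the weighted unknown\<close>

lemma AE_nonzero: "AE \<xi> in lborel. (\<xi> :: 'a) \<noteq> 0"
  by (rule AE_lborel_singleton)

lemma opS_symbol_AE: "0 \<le> t \<Longrightarrow> AE \<xi> in lborel. cmod (bessel_symbol \<sigma> \<xi> * K\<^sub>1 t \<xi>) \<le> 8 * 2 powr (\<sigma> / 2) * (1 + t)"
  using AE_nonzero by eventually_elim (rule opS_symbol_le)

lemma bounded_linear_opS: "0 \<le> t \<Longrightarrow> bounded_linear (opS t)"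
  unfolding opS_def by (rule bounded_linear_mul[OF _ opS_symbol_AE]) auto

lemma norm_opS_le: "0 \<le> t \<Longrightarrow> norm (opS t v) \<le> 8 * 2 powr (\<sigma> / 2) * (1 + t) * norm v"
  unfolding opS_def by (rule norm_mul_le[OF _ opS_symbol_AE]) auto

lemma square_integrable_opS: "0 \<le> t \<Longrightarrow> square_integrable (\<lambda>\<xi>. bessel_symbol \<sigma> \<xi> * K\<^sub>1 t \<xi> * rep_L2 v \<xi>)"
  by (rule square_integrable_mul[OF _ opS_symbol_AE]) auto

lemma opA_opS: "0 \<le> t \<Longrightarrow> opA \<sigma> (opS t v) = mul (K\<^sub>1 t) v"
  unfolding opA_def opS_def
proof (subst mul_mul[OF square_integrable_opS])
  have "bessel_symbol (- \<sigma>) x * (bessel_symbol \<sigma> x * K\<^sub>1 t x) = K\<^sub>1 t x" for x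
    using bessel_inverse[of \<sigma> x] by (metis mult.assoc mult.commute mult.right_neutral)
  then show "mul (\<lambda>x. bessel_symbol (- \<sigma>) x * (bessel_symbol \<sigma> x * K\<^sub>1 t x)) v = mul (K\<^sub>1 t) v" by (simp only:)
qed auto

lemma opB_opS: "0 \<le> t \<Longrightarrow> opB \<sigma> (opS t v) = mul (\<lambda>\<xi>. complex_of_real (norm \<xi> powr \<sigma>) * K\<^sub>1 t \<xi>) v"
  unfolding opB_def opS_def
proof (subst mul_mul[OF square_integrable_opS])
  have "complex_of_real (norm x powr \<sigma>) * bessel_symbol (- \<sigma>) x * (bessel_symbol \<sigma> x * K\<^sub>1 t x) = complex_of_real (norm x powr \<sigma>) * K\<^sub>1 t x" for x
    using bessel_inverse[of \<sigma> x] by (metis mult.assoc mult.commute mult.right_neutral)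
  then show "mul (\<lambda>x. complex_of_real (norm x powr \<sigma>) * bessel_symbol (- \<sigma>) x * (bessel_symbol \<sigma> x * K\<^sub>1 t x)) v = mul (\<lambda>\<xi>. complex_of_real (norm \<xi> powr \<sigma>) * K\<^sub>1 t \<xi>) v" by (simp only:)
qed auto

text \<open>Dominated convergence takes a bound uniform in time, so the limit is taken within
  \<open>[0, t + 1]\<close>, a neighbourhood of \<open>t\<close> in the half-line.\<close>

lemma mul_continuous_on:
  fixes k :: "real \<Rightarrow> 'a \<Rightarrow> complex"
  assumes [measurable]: "\<And>t. k t \<in> borel_measurable borel"
    and bd: "\<And>t \<xi>. 0 \<le> t \<Longrightarrow> \<xi> \<noteq> 0 \<Longrightarrow> cmod (k t \<xi>) \<le> C * (1 + t)" and C: "0 \<le> C"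
    and cont: "\<And>\<xi>. continuous_on UNIV (\<lambda>t. k t \<xi>)"
  shows "continuous_on {0..} (\<lambda>t. mul (k t) v)"
  unfolding continuous_on_def
proof
  fix t :: real assume "t \<in> {0..}"
  then have t: "0 \<le> t" by simp
  have "((\<lambda>s. mul (k s) v) \<longlongrightarrow> mul (k t) v) (at t within {0..t+1})"
  proof (rule mul_dominated_tendsto[where C="C * (2 + t)"])
    show "AE \<xi> in lborel. cmod (k s \<xi>) \<le> C * (2 + t)" if "s \<in> {0..t+1}" for s
      using AE_nonzero
    proof eventually_elim
      case (elim \<xi>)
      have "C * (1 + s) \<le> C * (2 + t)" using that C by (intro mult_left_mono) auto
      then show ?case using bd[of s \<xi>] elim that by auto
    qed
    show "AE \<xi> in lborel. ((\<lambda>s. k s \<xi>) \<longlongrightarrow> k t \<xi>) (at t within {0..t+1})"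
      using continuous_on_subset[OF cont] t by (intro AE_I2) (auto simp: continuous_on_def intro: tendsto_within_subset)
  qed (use t in auto)
  moreover have "at t within {0..} = at t within {0..t+1}"
    by (rule at_within_nhd[of _ "{..<t+1}"]) auto
  ultimately show "((\<lambda>s. mul (k s) v) \<longlongrightarrow> mul (k t) v) (at t within {0..})" by simp
qed

lemma opS_continuous: "continuous_on {0..} (\<lambda>t. opS t v)"
  unfolding opS_def
proof (rule mul_continuous_on)
  show "cmod (bessel_symbol \<sigma> \<xi> * K\<^sub>1 t \<xi>) \<le> 8 * 2 powr (\<sigma> / 2) * (1 + t)" if "0 \<le> t" "\<xi> \<noteq> 0" for t \<xi>
    by (rule opS_symbol_le[OF that])
qed (auto intro!: continuous_intros K_hat_continuous)

lemma K0_le: "0 \<le> t \<Longrightarrow> \<xi> \<noteq> 0 \<Longrightarrow> cmod (K\<^sub>0 t \<xi>) \<le> 17"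
proof -
  assume t: "0 \<le> t" and \<xi>: "\<xi> \<noteq> 0"
  have "0 \<le> norm \<xi> powr (2 * \<sigma>) / damping_symbol \<sigma>\<^sub>1 \<sigma>\<^sub>2 \<xi> * t / 8"
    using damping_lower(2)[OF sigma(3,4) \<xi>] t by simp
  then show "cmod (K\<^sub>0 t \<xi>) \<le> 17" using K_hat_bounds(3)[OF sigma(3,4) \<xi> t] by (simp add: order_trans)
qed

lemma mul_K0_continuous: "continuous_on {0..} (\<lambda>t. mul (K\<^sub>0 t) v)"
proof (rule mul_continuous_on)
  show "cmod (K\<^sub>0 t \<xi>) \<le> 17 * (1 + t)" if "0 \<le> t" "\<xi> \<noteq> 0" for t \<xi>
    using K0_le[OF that] that by simp
qed (auto intro!: K_hat_continuous)

lemma square_integrable_K0: "0 \<le> t \<Longrightarrow> square_integrable (\<lambda>\<xi>. K\<^sub>0 t \<xi> * rep_L2 v \<xi>)"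
proof (rule square_integrable_mul[where C=17])
  assume "0 \<le> t"
  then show "AE \<xi> in lborel. cmod (K\<^sub>0 t \<xi>) \<le> 17" using AE_nonzero by (auto elim!: eventually_mono intro: K0_le)
qed auto

lemma opS_0: "opS 0 v = 0"
proof -
  have "K\<^sub>1 0 \<xi> = 0" for \<xi> by (simp add: K1_hat_eq kern_def)
  then show ?thesis by (simp add: opS_def mul_def to_L2_0)
qed

section \<open>The nonlinearity as a map on the weighted space\<close>

lemma nonlin_0: "nonlin \<sigma> p (0 :: 'a L2) = 0"
proof -
  have z: "inv_fourier (opA \<sigma> (0 :: 'a L2)) = 0"
    using linear_0[OF bounded_linear.linear[OF bounded_linear_opA[OF sigma_nonneg]]]
      linear_0[OF bounded_linear.linear[OF bounded_linear_inv_fourier]] by metis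
  have ae: "AE x in lborel. 0 = abs_power p (rep_L2 (0 :: 'a L2)) x"
    using rep_L2_0 by eventually_elim (use p in \<open>simp add: abs_power_def\<close>)
  have sq: "square_integrable (abs_power p (rep_L2 (0 :: 'a L2)))"
    by (rule square_integrable_cong_AE[OF square_integrable_0 _ ae]) measurable
  have "to_L2 (abs_power p (rep_L2 (0 :: 'a L2))) = 0"
    using to_L2_eqI[OF square_integrable_0 sq ae] by (simp add: to_L2_0)
  then show ?thesis
    using linear_0[OF bounded_linear.linear[OF bounded_linear_fourier]] by (simp add: nonlin_def z)
qed

lemma exponent_embed:
  assumes "0 < \<mu>" "\<mu> \<le> 2"
  shows "n * (1/2 - 1/(\<mu> * p)) \<le> \<sigma>"
proof -
  have "1 / (2 * p) \<le> 1 / (\<mu> * p)" using assms p by (intro divide_left_mono) auto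
  then have "n * (1/2 - 1/(\<mu> * p)) \<le> n * (1/2 - 1/(2 * p))" using n_pos by (intro mult_left_mono) auto
  then show ?thesis using embed by simp
qed

lemma two_le_2p: "2 \<le> 2 * p" using p by simp

text \<open>Gagliardo--Nirenberg with \<open>q = 2 * p\<close> and scale \<open>1\<close>. It
  ensures that \<open>to_L2\<close> never falls back on \<open>0\<close> in
  \<open>nonlin\<close>.\<close>

lemma square_integrable_abs_power: "square_integrable (abs_power p (rep_L2 (inv_fourier (opA \<sigma> (W :: 'a L2)))))"
proof -
  obtain C where C: "0 < C" "\<And>(u :: 'a L2) X \<rho>. 0 < X \<Longrightarrow> 0 < \<rho> \<Longrightarrow> norm u \<le> X \<Longrightarrow>
    (\<integral>\<^sup>+\<xi>. ennreal (norm \<xi> powr (2 * \<sigma>) * (cmod (rep_L2 (fourier u) \<xi>))\<^sup>2) \<partial>lborel) \<le> ennreal ((\<rho> powr \<sigma> * X)\<^sup>2) \<Longrightarrow>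
    (\<integral>\<^sup>+x. ennreal (cmod (rep_L2 u x) powr (2 * p)) \<partial>lborel) \<le> ennreal (C * (\<rho> powr (n * (1/2 - 1/(2*p))) * X) powr (2 * p))"
    using gagliardo_nirenberg[OF two_le_2p refl embed[unfolded n_eq]] unfolding n_eq by blast
  let ?u = "inv_fourier (opA \<sigma> W)"
  define X where "X = norm ?u + norm (opB \<sigma> W) + 1"
  have "(\<integral>\<^sup>+x. ennreal (cmod (rep_L2 ?u x) powr (2 * p)) \<partial>lborel) \<le> ennreal (C * (1 powr (n * (1/2 - 1/(2*p))) * X) powr (2 * p))"
  proof (rule C(2))
    have "norm (opB \<sigma> W) \<le> X" by (simp add: X_def)
    then show "(\<integral>\<^sup>+\<xi>. ennreal (norm \<xi> powr (2 * \<sigma>) * (cmod (rep_L2 (fourier ?u) \<xi>))\<^sup>2) \<partial>lborel) \<le> ennreal ((1 powr \<sigma> * X)\<^sup>2)"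
      by (simp add: nn_opB[OF sigma_nonneg] power_mono ennreal_leI)
    show "0 < X" by (simp add: X_def add_nonneg_pos)
  qed (auto simp: X_def)
  moreover have "(cmod (abs_power p (rep_L2 ?u) x))\<^sup>2 = cmod (rep_L2 ?u x) powr (2 * p)" for x
    by (simp add: abs_power_def powr_squared)
  ultimately show ?thesis
    by (intro square_integrableI_nn) auto
qed

lemma nonlin_diff_eq:
  "nonlin \<sigma> p W - nonlin \<sigma> p W' = fourier (to_L2 (\<lambda>x. abs_power p (rep_L2 (inv_fourier (opA \<sigma> W))) x - abs_power p (rep_L2 (inv_fourier (opA \<sigma> (W' :: 'a L2)))) x))"
  unfolding nonlin_def to_L2_diff[OF square_integrable_abs_power square_integrable_abs_power]
  by (rule linear_diff[OF bounded_linear.linear[OF bounded_linear_fourier], symmetric])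

end

lemma norm_to_L2_le_powr:
  assumes "f \<in> borel_measurable borel" "0 \<le> c"
    and "(\<integral>\<^sup>+x. ennreal (cmod (f x) powr 2) \<partial>lborel) \<le> ennreal (c powr 2)"
  shows "norm (to_L2 f) \<le> c"
  using assms by (intro norm_to_L2_le_nn) (auto simp: powr_numeral)

lemma norm_mul_indicator_le: "norm (mul (indicator (cball 0 r)) v) \<le> norm (v :: 'a::euclidean_space L2)"
proof -
  have "norm (mul (indicator (cball 0 r)) v) \<le> 1 * norm v"
    by (rule norm_mul_le) (auto simp: indicator_def intro!: borel_measurable_indicator)
  then show ?thesis by simp
qed

context damped_wave
begin

subsection \<open>Decay of the linear evolution\<close>

text \<open>\<open>fourier_ball_Lm\<close> supplies the ball bound with
  \<open>\<beta> / 2 = n * (1/\<mu> - 1/2)\<close>, and \<open>gap'\<close> is the condition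
  \<open>2 * \<kappa> < \<beta>\<close> of \<open>decaying_mul_ball\<close> for the singular kernel,
  \<open>\<kappa> = 2 * \<sigma>\<^sub>1\<close>.\<close>

lemma K1_decay:
  assumes \<mu>: "1 \<le> \<mu>" "\<mu> < 2" and gap': "2 * \<sigma>\<^sub>1 < n * (1/\<mu> - 1/2)"
  shows "\<exists>C>0. \<forall>(f :: 'a L2) t M. 0 \<le> t \<longrightarrow> 0 < M \<longrightarrow> norm f \<le> M \<longrightarrow>
    (\<integral>\<^sup>+x. ennreal (cmod (rep_L2 f x) powr \<mu>) \<partial>lborel) \<le> ennreal (M powr \<mu>) \<longrightarrow>
    norm (mul (K\<^sub>1 t) (fourier f)) \<le> C * (M * (1 + t) powr ((2 * \<sigma>\<^sub>1 - n * (1/\<mu> - 1/2)) / \<alpha>)) \<and>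
    norm (mul (\<lambda>\<xi>. complex_of_real (norm \<xi> powr \<sigma>) * K\<^sub>1 t \<xi>) (fourier f))
      \<le> C * (M * (1 + t) powr ((2 * \<sigma>\<^sub>1 - \<sigma> - n * (1/\<mu> - 1/2)) / \<alpha>))"
proof -
  define \<beta> where "\<beta> = 2 * (n * (1/\<mu> - 1/2))"
  have \<beta>: "0 < \<beta>" "2 * (2 * \<sigma>\<^sub>1) < \<beta>" "2 * (2 * \<sigma>\<^sub>1 - \<sigma>) < \<beta>" using gap' sigma by (auto simp: \<beta>_def)
  have \<beta>2: "\<beta> / 2 = n * (1/\<mu> - 1/2)" by (simp add: \<beta>_def)
  obtain C1 where C1: "0 < C1" "\<And>(k :: 'a \<Rightarrow> complex) c t v M. 0 \<le> c \<Longrightarrow> 0 \<le> t \<Longrightarrow> 0 \<le> M \<Longrightarrow> decaying \<alpha> (2 * \<sigma>\<^sub>1) c t k \<Longrightarrow>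
    norm v \<le> M \<Longrightarrow> (\<forall>r>0. norm (mul (indicator (cball 0 r)) v) \<le> M * r powr (\<beta> / 2)) \<Longrightarrow>
    norm (mul k v) \<le> C1 * (c * ((1 + t) powr ((2 * \<sigma>\<^sub>1 - \<beta> / 2) / \<alpha>) * M))"
    using decaying_mul_ball[OF alpha_pos \<beta>(1,2)] by blast
  obtain C2 where C2: "0 < C2" "\<And>(k :: 'a \<Rightarrow> complex) c t v M. 0 \<le> c \<Longrightarrow> 0 \<le> t \<Longrightarrow> 0 \<le> M \<Longrightarrow> decaying \<alpha> (2 * \<sigma>\<^sub>1 - \<sigma>) c t k \<Longrightarrow>
    norm v \<le> M \<Longrightarrow> (\<forall>r>0. norm (mul (indicator (cball 0 r)) v) \<le> M * r powr (\<beta> / 2)) \<Longrightarrow>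
    norm (mul k v) \<le> C2 * (c * ((1 + t) powr ((2 * \<sigma>\<^sub>1 - \<sigma> - \<beta> / 2) / \<alpha>) * M))"
    using decaying_mul_ball[OF alpha_pos \<beta>(1,3)] by blast
  define Q where "Q = sqrt (unit_ball_vol (real DIM('a))) + sqrt_pi_const TYPE('a)"
  have Q: "0 < Q" "sqrt_pi_const TYPE('a) \<le> Q"
    unfolding Q_def using sqrt_pi_const_pos[where 'a='a] by (auto intro: add_nonneg_pos)
  have "norm (mul (K\<^sub>1 t) (fourier f)) \<le> (C1 + C2) * ck * Q * (M * (1 + t) powr ((2 * \<sigma>\<^sub>1 - n * (1/\<mu> - 1/2)) / \<alpha>)) \<and>
    norm (mul (\<lambda>\<xi>. complex_of_real (norm \<xi> powr \<sigma>) * K\<^sub>1 t \<xi>) (fourier f))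
      \<le> (C1 + C2) * ck * Q * (M * (1 + t) powr ((2 * \<sigma>\<^sub>1 - \<sigma> - n * (1/\<mu> - 1/2)) / \<alpha>))"
    if t: "0 \<le> t" and M: "0 < M" and f: "norm f \<le> M" "(\<integral>\<^sup>+x. ennreal (cmod (rep_L2 f x) powr \<mu>) \<partial>lborel) \<le> ennreal (M powr \<mu>)"
    for f :: "'a L2" and t M
  proof -
    have nf: "norm (fourier f) \<le> Q * M"
      unfolding norm_fourier using Q f M sqrt_pi_const_pos[where 'a='a] by (intro mult_mono) auto
    have bf: "\<forall>r>0. norm (mul (indicator (cball 0 r)) (fourier f)) \<le> Q * M * r powr (\<beta> / 2)"
    proof (intro allI impI)
      fix r :: real assume "0 < r"
      from fourier_ball_Lm[OF \<mu>(1) less_imp_le[OF \<mu>(2)] this M f(2)]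
      show "norm (mul (indicator (cball 0 r)) (fourier f)) \<le> Q * M * r powr (\<beta> / 2)"
        unfolding \<beta>2 Q_def[symmetric] n_eq by (simp only: mult_ac)
    qed
    have QM: "0 \<le> Q * M" using Q M by simp
    have "norm (mul (K\<^sub>1 t) (fourier f)) \<le> C1 * (ck * ((1 + t) powr ((2 * \<sigma>\<^sub>1 - \<beta> / 2) / \<alpha>) * (Q * M)))"
      by (rule C1(2)[OF less_imp_le[OF ck(1)] t QM decaying_K1[OF t] nf bf])
    also have "\<dots> = C1 * (ck * Q * (M * (1 + t) powr ((2 * \<sigma>\<^sub>1 - n * (1/\<mu> - 1/2)) / \<alpha>)))"
      unfolding \<beta>2 by (simp only: mult_ac)
    also have "\<dots> \<le> (C1 + C2) * (ck * Q * (M * (1 + t) powr ((2 * \<sigma>\<^sub>1 - n * (1/\<mu> - 1/2)) / \<alpha>)))"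
      using C2(1) Q M ck by (intro mult_right_mono) auto
    finally have 1: "norm (mul (K\<^sub>1 t) (fourier f)) \<le> (C1 + C2) * (ck * Q * (M * (1 + t) powr ((2 * \<sigma>\<^sub>1 - n * (1/\<mu> - 1/2)) / \<alpha>)))" .
    have "norm (mul (\<lambda>\<xi>. complex_of_real (norm \<xi> powr \<sigma>) * K\<^sub>1 t \<xi>) (fourier f)) \<le> C2 * (ck * ((1 + t) powr ((2 * \<sigma>\<^sub>1 - \<sigma> - \<beta> / 2) / \<alpha>) * (Q * M)))"
      by (rule C2(2)[OF less_imp_le[OF ck(1)] t QM decaying_DK1[OF t] nf bf])
    also have "\<dots> = C2 * (ck * Q * (M * (1 + t) powr ((2 * \<sigma>\<^sub>1 - \<sigma> - n * (1/\<mu> - 1/2)) / \<alpha>)))"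
      unfolding \<beta>2 by (simp only: mult_ac)
    also have "\<dots> \<le> (C1 + C2) * (ck * Q * (M * (1 + t) powr ((2 * \<sigma>\<^sub>1 - \<sigma> - n * (1/\<mu> - 1/2)) / \<alpha>)))"
      using C1(1) Q M ck by (intro mult_right_mono) auto
    finally show ?thesis using 1 by (simp only: mult.assoc)
  qed
  moreover have "0 < (C1 + C2) * ck * Q" using C1(1) C2(1) ck Q by simp
  ultimately show ?thesis by blast
qed

text \<open>A pure L2 estimate for the second half of the Duhamel integral: its rate
  \<open>(\<sigma> - 2 * \<sigma>\<^sub>1) / \<alpha>\<close> is below \<open>1\<close>, as
  \<open>norm_integral_second_half\<close> asks.\<close>

lemma K1_flat:
  shows "\<exists>C>0. \<forall>v t. 0 \<le> t \<longrightarrow>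
    norm (mul (\<lambda>\<xi>. complex_of_real (norm \<xi> powr \<sigma>) * K\<^sub>1 t \<xi>) v) \<le> C * ((1 + t) powr ((2 * \<sigma>\<^sub>1 - \<sigma>) / \<alpha>) * norm v)"
proof -
  have "2 * \<sigma>\<^sub>1 - \<sigma> \<le> 0" using sigma by simp
  then obtain C where C: "0 < C" "\<And>(k :: 'a \<Rightarrow> complex) c t v. 0 \<le> c \<Longrightarrow> 0 \<le> t \<Longrightarrow> decaying \<alpha> (2 * \<sigma>\<^sub>1 - \<sigma>) c t k \<Longrightarrow>
    norm (mul k v) \<le> C * (c * ((1 + t) powr ((2 * \<sigma>\<^sub>1 - \<sigma>) / \<alpha>) * norm v))"
    using decaying_mul_flat[OF alpha_pos] by blast
  have "norm (mul (\<lambda>\<xi>. complex_of_real (norm \<xi> powr \<sigma>) * K\<^sub>1 t \<xi>) v) \<le> C * ck * ((1 + t) powr ((2 * \<sigma>\<^sub>1 - \<sigma>) / \<alpha>) * norm v)" if "0 \<le> t" for v t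
    using C(2)[OF less_imp_le[OF ck(1)] that decaying_DK1[OF that], of v] by (simp only: mult.assoc)
  moreover have "0 < C * ck" using C(1) ck by simp
  ultimately show ?thesis by blast
qed

subsection \<open>The nonlinearity along decaying functions\<close>

lemma sigma_alpha: "\<alpha> = 2 * \<sigma> - 2 * \<sigma>\<^sub>1" by (simp add: \<alpha>_def)

lemma alpha_a: "\<alpha> * a = n * (1/m - 1/2) - 2 * \<sigma>\<^sub>1" using alpha_pos by (simp add: a_def)

text \<open>At time \<open>x\<close> the rates \<open>a\<close> and \<open>b\<close> describe a
  function at scale \<open>\<rho> = (1 + x) powr (- 1 / \<alpha>)\<close>, so
  \<open>nonlin_difference\<close> yields the decay exponent
  \<open>a * p + s * p / \<alpha>\<close>. The lower bound on \<open>p\<close> says that this is at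
  least the exponent claimed, with equality at the critical \<open>p\<close>.\<close>

lemma nonlin_bound:
  assumes \<mu>: "0 < \<mu>" "\<mu> \<le> 2" "2 \<le> \<mu> * p"
  shows "\<exists>C>0. \<forall>(W :: 'a L2) W' r d x. 0 < r \<longrightarrow> 0 < d \<longrightarrow> 0 \<le> x \<longrightarrow>
    norm (opA \<sigma> W) \<le> r * (1 + x) powr - a \<longrightarrow> norm (opB \<sigma> W) \<le> r * (1 + x) powr - b \<longrightarrow>
    norm (opA \<sigma> W') \<le> r * (1 + x) powr - a \<longrightarrow> norm (opB \<sigma> W') \<le> r * (1 + x) powr - b \<longrightarrow>
    norm (opA \<sigma> (W - W')) \<le> d * (1 + x) powr - a \<longrightarrow> norm (opB \<sigma> (W - W')) \<le> d * (1 + x) powr - b \<longrightarrow>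
    (\<integral>\<^sup>+y. ennreal (cmod (abs_power p (rep_L2 (inv_fourier (opA \<sigma> W))) y - abs_power p (rep_L2 (inv_fourier (opA \<sigma> W'))) y) powr \<mu>) \<partial>lborel)
      \<le> ennreal ((C * (d * r powr (p - 1) * (1 + x) powr - (1 + n * (1/m - 1/\<mu>) / \<alpha>))) powr \<mu>)"
proof -
  define s where "s = n * (1/2 - 1/(\<mu> * p))"
  have s: "s \<le> \<sigma>" unfolding s_def by (rule exponent_embed[OF \<mu>(1,2)])
  obtain C where C: "0 < C" "\<And>(W :: 'a L2) W' r d \<rho>. 0 < r \<Longrightarrow> 0 < d \<Longrightarrow> 0 < \<rho> \<Longrightarrow>
    norm (opA \<sigma> W) \<le> r \<Longrightarrow> norm (opB \<sigma> W) \<le> \<rho> powr \<sigma> * r \<Longrightarrow>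
    norm (opA \<sigma> W') \<le> r \<Longrightarrow> norm (opB \<sigma> W') \<le> \<rho> powr \<sigma> * r \<Longrightarrow>
    norm (opA \<sigma> (W - W')) \<le> d \<Longrightarrow> norm (opB \<sigma> (W - W')) \<le> \<rho> powr \<sigma> * d \<Longrightarrow>
    (\<integral>\<^sup>+x. ennreal (cmod (abs_power p (rep_L2 (inv_fourier (opA \<sigma> W))) x - abs_power p (rep_L2 (inv_fourier (opA \<sigma> W'))) x) powr \<mu>) \<partial>lborel)
      \<le> ennreal ((C * (d * r powr (p - 1) * \<rho> powr (s * p))) powr \<mu>)"
    using nonlin_difference[OF sigma_nonneg p(1) \<mu>(1,3) s_def[unfolded n_eq] s] by blast
  have ex: "1 + n * (1/m - 1/\<mu>) / \<alpha> \<le> a * p + s * p / \<alpha>"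
  proof -
    have sp: "s * p = n * (p / 2 - 1 / \<mu>)" using p \<mu> by (simp add: s_def field_simps)
    \<comment> \<open>The terms with \<open>n / 2\<close> cancel, and \<open>p\<close> remains only
      in \<open>(p - 1) * (n / m - 2 * \<sigma>\<^sub>1)\<close>, which \<open>p(2)\<close> bounds
      below.\<close>
    have "\<alpha> * (a * p + s * p / \<alpha>) = (n * (1/m - 1/2) - 2 * \<sigma>\<^sub>1) * p + s * p"
      using alpha_pos alpha_a by (simp add: distrib_left)
    also have "\<dots> = (p - 1) * (n / m - 2 * \<sigma>\<^sub>1) + (n / m - 2 * \<sigma>\<^sub>1) - n / \<mu>" unfolding sp by (simp add: algebra_simps diff_divide_distrib add_divide_distrib)
    also have "\<dots> \<ge> 2 * \<sigma> + (n / m - 2 * \<sigma>\<^sub>1) - n / \<mu>" using p(2) by simp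
    also have "2 * \<sigma> + (n / m - 2 * \<sigma>\<^sub>1) - n / \<mu> = \<alpha> * (1 + n * (1/m - 1/\<mu>) / \<alpha>)"
    proof -
      have "\<alpha> * (1 + n * (1/m - 1/\<mu>) / \<alpha>) = \<alpha> + n * (1/m - 1/\<mu>)"
        using alpha_pos by (simp add: distrib_left)
      then show ?thesis by (simp add: sigma_alpha algebra_simps)
    qed
    finally show ?thesis using alpha_pos by (simp only: mult_le_cancel_left_pos)
  qed
  have "(\<integral>\<^sup>+y. ennreal (cmod (abs_power p (rep_L2 (inv_fourier (opA \<sigma> W))) y - abs_power p (rep_L2 (inv_fourier (opA \<sigma> W'))) y) powr \<mu>) \<partial>lborel)
      \<le> ennreal ((C * (d * r powr (p - 1) * (1 + x) powr - (1 + n * (1/m - 1/\<mu>) / \<alpha>))) powr \<mu>)"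
    if r: "0 < r" and d: "0 < d" and x: "0 \<le> x"
    and W: "norm (opA \<sigma> W) \<le> r * (1 + x) powr - a" "norm (opB \<sigma> W) \<le> r * (1 + x) powr - b"
    and W': "norm (opA \<sigma> W') \<le> r * (1 + x) powr - a" "norm (opB \<sigma> W') \<le> r * (1 + x) powr - b"
    and D: "norm (opA \<sigma> (W - W')) \<le> d * (1 + x) powr - a" "norm (opB \<sigma> (W - W')) \<le> d * (1 + x) powr - b"
    for W W' :: "'a L2" and r d x
  proof -
    define \<rho> where "\<rho> = (1 + x) powr (- 1 / \<alpha>)"
    have \<rho>: "0 < \<rho>" using x by (simp add: \<rho>_def)
    have rb: "z * (1 + x) powr - b = \<rho> powr \<sigma> * (z * (1 + x) powr - a)" for z
    proof -
      have "\<rho> powr \<sigma> * (1 + x) powr - a = (1 + x) powr - b"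
        unfolding \<rho>_def powr_powr powr_add[symmetric] by (simp add: b_def algebra_simps)
      then show ?thesis by (simp add: mult_ac)
    qed
    have x1: "0 < (1 + x) powr - a" using x by simp
    have "(\<integral>\<^sup>+y. ennreal (cmod (abs_power p (rep_L2 (inv_fourier (opA \<sigma> W))) y - abs_power p (rep_L2 (inv_fourier (opA \<sigma> W'))) y) powr \<mu>) \<partial>lborel)
      \<le> ennreal ((C * (d * (1 + x) powr - a * (r * (1 + x) powr - a) powr (p - 1) * \<rho> powr (s * p))) powr \<mu>)"
      by (rule C(2)[OF mult_pos_pos[OF r x1] mult_pos_pos[OF d x1] \<rho> W(1) W(2)[unfolded rb] W'(1) W'(2)[unfolded rb] D(1) D(2)[unfolded rb]])
    also have "\<dots> \<le> ennreal ((C * (d * r powr (p - 1) * (1 + x) powr - (1 + n * (1/m - 1/\<mu>) / \<alpha>))) powr \<mu>)"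
    proof (intro ennreal_leI powr_mono2 mult_left_mono)
      have e: "(1 + x) powr - a * ((1 + x) powr - a) powr (p - 1) * \<rho> powr (s * p) = (1 + x) powr - (a * p + s * p / \<alpha>)"
        unfolding \<rho>_def powr_powr powr_add[symmetric] by (simp add: algebra_simps)
      have "d * (1 + x) powr - a * (r * (1 + x) powr - a) powr (p - 1) * \<rho> powr (s * p) =
          d * r powr (p - 1) * ((1 + x) powr - a * ((1 + x) powr - a) powr (p - 1) * \<rho> powr (s * p))"
        using r by (simp add: powr_mult)
      also have "\<dots> = d * r powr (p - 1) * (1 + x) powr - (a * p + s * p / \<alpha>)" unfolding e ..
      also have "\<dots> \<le> d * r powr (p - 1) * (1 + x) powr - (1 + n * (1/m - 1/\<mu>) / \<alpha>)"
        using ex x d by (intro mult_left_mono powr_mono) auto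
      finally show "d * (1 + x) powr - a * (r * (1 + x) powr - a) powr (p - 1) * \<rho> powr (s * p) \<le> d * r powr (p - 1) * (1 + x) powr - (1 + n * (1/m - 1/\<mu>) / \<alpha>)" .
    qed (use \<mu> C(1) d in auto)
    finally show ?thesis .
  qed
  then show ?thesis using C(1) by blast
qed

text \<open>At scale \<open>1\<close> both norms are bounded by that of the argument. Equal
  arguments are a separate case because \<open>nonlin_difference\<close> takes a positive
  \<open>d\<close>.\<close>

lemma nonlin_lipschitz:
  assumes R: "0 < R"
  shows "\<exists>l. \<forall>W W' :: 'a L2. norm W \<le> R \<longrightarrow> norm W' \<le> R \<longrightarrow> norm (nonlin \<sigma> p W - nonlin \<sigma> p W') \<le> l * norm (W - W')"
proof -
  obtain C where C: "0 < C" "\<And>(W :: 'a L2) W' r d \<rho>. 0 < r \<Longrightarrow> 0 < d \<Longrightarrow> 0 < \<rho> \<Longrightarrow>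
    norm (opA \<sigma> W) \<le> r \<Longrightarrow> norm (opB \<sigma> W) \<le> \<rho> powr \<sigma> * r \<Longrightarrow>
    norm (opA \<sigma> W') \<le> r \<Longrightarrow> norm (opB \<sigma> W') \<le> \<rho> powr \<sigma> * r \<Longrightarrow>
    norm (opA \<sigma> (W - W')) \<le> d \<Longrightarrow> norm (opB \<sigma> (W - W')) \<le> \<rho> powr \<sigma> * d \<Longrightarrow>
    (\<integral>\<^sup>+x. ennreal (cmod (abs_power p (rep_L2 (inv_fourier (opA \<sigma> W))) x - abs_power p (rep_L2 (inv_fourier (opA \<sigma> W'))) x) powr 2) \<partial>lborel)
      \<le> ennreal ((C * (d * r powr (p - 1) * \<rho> powr (n * (1/2 - 1/(2 * p)) * p))) powr 2)"
    using nonlin_difference[OF sigma_nonneg p(1) _ two_le_2p refl embed[unfolded n_eq]] unfolding n_eq by auto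
  have "norm (nonlin \<sigma> p W - nonlin \<sigma> p W') \<le> (sqrt_pi_const TYPE('a) * (C * R powr (p - 1))) * norm (W - W')"
    if W: "norm W \<le> R" "norm W' \<le> R" for W W' :: "'a L2"
  proof (cases "W = W'")
    case False
    then have d: "0 < norm (W - W')" by simp
    let ?F = "\<lambda>x. abs_power p (rep_L2 (inv_fourier (opA \<sigma> W))) x - abs_power p (rep_L2 (inv_fourier (opA \<sigma> W'))) x"
    have "(\<integral>\<^sup>+x. ennreal (cmod (?F x) powr 2) \<partial>lborel) \<le> ennreal ((C * (norm (W - W') * R powr (p - 1) * 1 powr (n * (1/2 - 1/(2 * p)) * p))) powr 2)"
      by (rule C(2)[OF R d]) (use W norm_opA_le[OF sigma_nonneg, of W] norm_opA_le[OF sigma_nonneg, of W'] norm_opB_le[OF sigma_nonneg, of W]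
        norm_opB_le[OF sigma_nonneg, of W'] norm_opA_le[OF sigma_nonneg, of "W - W'"] norm_opB_le[OF sigma_nonneg, of "W - W'"] in auto)
    then have "norm (to_L2 ?F) \<le> C * (norm (W - W') * R powr (p - 1))"
      using C(1) by (intro norm_to_L2_le_powr) auto
    then have "sqrt_pi_const TYPE('a) * norm (to_L2 ?F) \<le> sqrt_pi_const TYPE('a) * (C * (norm (W - W') * R powr (p - 1)))"
      using sqrt_pi_const_pos[where 'a='a] by (intro mult_left_mono) auto
    then show ?thesis unfolding nonlin_diff_eq norm_fourier by (simp only: mult_ac)
  qed simp
  then show ?thesis by blast
qed

text \<open>At the critical exponent \<open>|u|\<^sup>p\<close> decays only like \<open>(1 + t)\<^sup>-\<^sup>1\<close> in \<open>L\<^sup>m\<close>, which is not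
  integrable. In \<open>L\<^sup>\<mu>\<close> with \<open>\<mu>\<close> slightly below \<open>m\<close> its decay is worse by \<open>\<delta>\<close>, but the linear evolution
  gains the same \<open>\<delta>\<close>, and the Duhamel integral converges without a logarithm.\<close>

lemma auxiliary_exponent:
  obtains \<mu> where "1 < \<mu>" "\<mu> < m" "2 \<le> \<mu> * p" "n * (1/\<mu> - 1/2) < 2 * \<sigma>" "2 * \<sigma>\<^sub>1 < n * (1/\<mu> - 1/2)"
proof -
  \<comment> \<open>The lower bounds on \<open>\<mu>\<close>: \<open>1\<close>, then
    \<open>2 / p\<close> for \<open>\<mu> * p \<ge> 2\<close>, then the solution of
    \<open>n * (1/\<mu> - 1/2) = 2 * \<sigma>\<close>. Each is below \<open>m\<close>, and
    \<open>\<mu>\<close> is taken halfway.\<close>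
  define l where "l = max 1 (max (2 / p) (2 * n / (n + 4 * \<sigma>)))"
  have nn: "0 < n + 4 * \<sigma>" using n_pos sigma by simp
  have "2 / p < m" using m(3) p by (simp add: field_simps)
  moreover have "2 * n / (n + 4 * \<sigma>) < m"
  proof -
    have "m * (n * (1/m - 1/2)) < m * (2 * \<sigma>)" using slow m by (intro mult_strict_left_mono) auto
    then have "2 * n < m * (n + 4 * \<sigma>)" using m by (simp add: algebra_simps)
    then show ?thesis using nn by (simp add: pos_divide_less_eq)
  qed
  ultimately have lm: "l < m" using m by (simp add: l_def)
  define \<mu> where "\<mu> = (l + m) / 2"
  have \<mu>: "l < \<mu>" "\<mu> < m" using lm by (auto simp: \<mu>_def)
  have l: "1 \<le> l" "2 / p \<le> l" "2 * n / (n + 4 * \<sigma>) \<le> l" by (auto simp: l_def)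
  have \<mu>1: "1 < \<mu>" using \<mu> l by simp
  have 2: "2 \<le> \<mu> * p" using \<mu> l p by (simp add: pos_divide_le_eq[symmetric])
  have "2 * n < \<mu> * (n + 4 * \<sigma>)" using \<mu> l nn by (simp add: pos_divide_less_eq[symmetric])
  then have 3: "n * (1/\<mu> - 1/2) < 2 * \<sigma>" using \<mu>1 by (simp add: field_simps)
  have "1 / m < 1 / \<mu>" using \<mu> \<mu>1 by (intro divide_strict_left_mono) auto
  then have "n * (1/m - 1/2) < n * (1/\<mu> - 1/2)" using n_pos by (intro mult_strict_left_mono) auto
  moreover have "2 * \<sigma>\<^sub>1 \<le> n * (1/m - 1/2)" using gap by auto
  ultimately show ?thesis using that[of \<mu>] \<mu>1 \<mu> 2 3 by simp
qed

text \<open>\<open>\<delta>\<close> is the rate exchanged between nonlinearity and evolution when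
  L^m is replaced by L^\<mu>. \<open>\<eta>\<close> is the extra decay of the nonlinearity in L2
  compared with L^m; it is spent where only the L2 estimate of the evolution is used.\<close>

lemma duhamel_instance:
  obtains \<delta> \<eta> K where "duhamel (opA \<sigma>) (opB \<sigma>) opS (nonlin \<sigma> p) a b (2 powr (\<sigma> / 2)) \<delta> \<eta> K p (8 * 2 powr (\<sigma> / 2))"
proof -
  obtain \<mu> where \<mu>: "1 < \<mu>" "\<mu> < m" "2 \<le> \<mu> * p" "n * (1/\<mu> - 1/2) < 2 * \<sigma>" "2 * \<sigma>\<^sub>1 < n * (1/\<mu> - 1/2)"
    by (rule auxiliary_exponent)
  have \<mu>2: "\<mu> < 2" using \<mu> m by simp
  define \<delta> where "\<delta> = n * (1/\<mu> - 1/m) / \<alpha>"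
  define \<eta> where "\<eta> = n * (1/m - 1/2) / \<alpha>"
  have \<delta>: "0 < \<delta>"
  proof -
    have "1 / m < 1 / \<mu>" using \<mu> by (intro divide_strict_left_mono) auto
    then show ?thesis using n_pos alpha_pos by (simp add: \<delta>_def)
  qed
  have \<eta>: "0 \<le> \<eta>"
  proof -
    have "1 / 2 \<le> 1 / m" using m by (intro divide_left_mono) auto
    then show ?thesis using n_pos alpha_pos by (simp add: \<eta>_def)
  qed
  have ad: "- (a + \<delta>) = (2 * \<sigma>\<^sub>1 - n * (1/\<mu> - 1/2)) / \<alpha>"
    unfolding a_def \<delta>_def minus_divide_left add_divide_distrib[symmetric] by (simp add: algebra_simps)
  have bd: "- (b + \<delta>) = (2 * \<sigma>\<^sub>1 - \<sigma> - n * (1/\<mu> - 1/2)) / \<alpha>"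
    unfolding b_def a_def \<delta>_def minus_divide_left add_divide_distrib[symmetric] by (simp add: algebra_simps)
  have be: "- (b - \<eta>) = (2 * \<sigma>\<^sub>1 - \<sigma>) / \<alpha>"
    unfolding b_def a_def \<eta>_def minus_divide_left add_divide_distrib[symmetric] diff_divide_distrib[symmetric] by (simp add: algebra_simps)
  have ad1: "a + \<delta> < 1"
  proof -
    have "a + \<delta> = (n * (1/\<mu> - 1/2) - 2 * \<sigma>\<^sub>1) / \<alpha>"
      unfolding a_def \<delta>_def add_divide_distrib[symmetric] by (simp add: algebra_simps)
    also have "\<dots> < 1" using \<mu>(4) alpha_pos by (simp add: pos_divide_less_eq sigma_alpha)
    finally show ?thesis .
  qed
  have be1: "b - \<eta> < 1"
  proof -
    have "b - \<eta> = (\<sigma> - 2 * \<sigma>\<^sub>1) / \<alpha>"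
      unfolding b_def a_def \<eta>_def add_divide_distrib[symmetric] diff_divide_distrib[symmetric] by (simp add: algebra_simps)
    also have "\<dots> < 1" using sigma alpha_pos by (simp add: pos_divide_less_eq sigma_alpha)
    finally show ?thesis .
  qed
  have b0: "0 \<le> b" using a_nonneg sigma_nonneg alpha_pos by (simp add: b_def)
  obtain D1 where D1: "0 < D1" "\<And>(f :: 'a L2) t M. 0 \<le> t \<Longrightarrow> 0 < M \<Longrightarrow> norm f \<le> M \<Longrightarrow>
    (\<integral>\<^sup>+x. ennreal (cmod (rep_L2 f x) powr \<mu>) \<partial>lborel) \<le> ennreal (M powr \<mu>) \<Longrightarrow>
    norm (mul (K\<^sub>1 t) (fourier f)) \<le> D1 * (M * (1 + t) powr ((2 * \<sigma>\<^sub>1 - n * (1/\<mu> - 1/2)) / \<alpha>)) \<and>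
    norm (mul (\<lambda>\<xi>. complex_of_real (norm \<xi> powr \<sigma>) * K\<^sub>1 t \<xi>) (fourier f))
      \<le> D1 * (M * (1 + t) powr ((2 * \<sigma>\<^sub>1 - \<sigma> - n * (1/\<mu> - 1/2)) / \<alpha>))"
    using K1_decay[OF less_imp_le[OF \<mu>(1)] \<mu>2 \<mu>(5)] by blast
  obtain D2 where D2: "0 < D2" "\<And>v t. 0 \<le> t \<Longrightarrow>
    norm (mul (\<lambda>\<xi>. complex_of_real (norm \<xi> powr \<sigma>) * K\<^sub>1 t \<xi>) v) \<le> D2 * ((1 + t) powr ((2 * \<sigma>\<^sub>1 - \<sigma>) / \<alpha>) * norm v)"
    using K1_flat by blast
  have \<mu>0: "0 < \<mu>" using \<mu> by simp
  obtain C1 where C1: "0 < C1" "\<And>(W :: 'a L2) W' r d x. 0 < r \<Longrightarrow> 0 < d \<Longrightarrow> 0 \<le> x \<Longrightarrow>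
    norm (opA \<sigma> W) \<le> r * (1 + x) powr - a \<Longrightarrow> norm (opB \<sigma> W) \<le> r * (1 + x) powr - b \<Longrightarrow>
    norm (opA \<sigma> W') \<le> r * (1 + x) powr - a \<Longrightarrow> norm (opB \<sigma> W') \<le> r * (1 + x) powr - b \<Longrightarrow>
    norm (opA \<sigma> (W - W')) \<le> d * (1 + x) powr - a \<Longrightarrow> norm (opB \<sigma> (W - W')) \<le> d * (1 + x) powr - b \<Longrightarrow>
    (\<integral>\<^sup>+y. ennreal (cmod (abs_power p (rep_L2 (inv_fourier (opA \<sigma> W))) y - abs_power p (rep_L2 (inv_fourier (opA \<sigma> W'))) y) powr \<mu>) \<partial>lborel)
      \<le> ennreal ((C1 * (d * r powr (p - 1) * (1 + x) powr - (1 + n * (1/m - 1/\<mu>) / \<alpha>))) powr \<mu>)"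
    using nonlin_bound[OF \<mu>0 less_imp_le[OF \<mu>2] \<mu>(3)] by blast
  obtain C2 where C2: "0 < C2" "\<And>(W :: 'a L2) W' r d x. 0 < r \<Longrightarrow> 0 < d \<Longrightarrow> 0 \<le> x \<Longrightarrow>
    norm (opA \<sigma> W) \<le> r * (1 + x) powr - a \<Longrightarrow> norm (opB \<sigma> W) \<le> r * (1 + x) powr - b \<Longrightarrow>
    norm (opA \<sigma> W') \<le> r * (1 + x) powr - a \<Longrightarrow> norm (opB \<sigma> W') \<le> r * (1 + x) powr - b \<Longrightarrow>
    norm (opA \<sigma> (W - W')) \<le> d * (1 + x) powr - a \<Longrightarrow> norm (opB \<sigma> (W - W')) \<le> d * (1 + x) powr - b \<Longrightarrow>
    (\<integral>\<^sup>+y. ennreal (cmod (abs_power p (rep_L2 (inv_fourier (opA \<sigma> W))) y - abs_power p (rep_L2 (inv_fourier (opA \<sigma> W'))) y) powr 2) \<partial>lborel)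
      \<le> ennreal ((C2 * (d * r powr (p - 1) * (1 + x) powr - (1 + n * (1/m - 1/2) / \<alpha>))) powr 2)"
    using nonlin_bound[OF _ order_refl two_le_2p] by auto
  define sp where "sp = sqrt_pi_const TYPE('a)"
  have sp: "0 < sp" unfolding sp_def by (rule sqrt_pi_const_pos)
  define K where "K = D1 * (C1 + C2) + D2 * (sp * C2)"
  have K: "0 < K" using D1 D2 C1 C2 sp by (simp add: K_def add_pos_pos)
  have em: "- (1 + n * (1/m - 1/\<mu>) / \<alpha>) = \<delta> - 1" unfolding \<delta>_def by (simp add: right_diff_distrib diff_divide_distrib)
  have e2: "- (1 + n * (1/m - 1/2) / \<alpha>) = - (1 + \<eta>)" by (simp add: \<eta>_def)
  show ?thesis
  proof (rule that[of \<delta> \<eta> K], rule duhamel.intro)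
    show "bounded_linear (opA \<sigma> :: 'a L2 \<Rightarrow> 'a L2)" by (rule bounded_linear_opA[OF sigma_nonneg])
    show "bounded_linear (opB \<sigma> :: 'a L2 \<Rightarrow> 'a L2)" by (rule bounded_linear_opB[OF sigma_nonneg])
    show "norm W \<le> 2 powr (\<sigma> / 2) * (norm (opA \<sigma> W) + norm (opB \<sigma> W))" for W :: "'a L2"
      by (rule norm_le_opA_opB[OF sigma_nonneg])
    show "bounded_linear (opS t)" if "0 \<le> t" for t
      using that by (rule bounded_linear_opS)
    show "norm (opS t x) \<le> 8 * 2 powr (\<sigma> / 2) * (1 + t) * norm x" if "0 \<le> t" for t x
      using that by (rule norm_opS_le)
    show "continuous_on {0..} (\<lambda>t. opS t x)" for x
      by (rule opS_continuous)
    show "opS 0 x = 0" for x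
      by (rule opS_0)
    show "nonlin \<sigma> p (0 :: 'a L2) = 0" by (rule nonlin_0)
    show "\<exists>l. \<forall>W W' :: 'a L2. norm W \<le> R \<longrightarrow> norm W' \<le> R \<longrightarrow> norm (nonlin \<sigma> p W - nonlin \<sigma> p W') \<le> l * norm (W - W')" if "0 < R" for R
      by (rule nonlin_lipschitz[OF that])
    show "0 \<le> (2::real) powr (\<sigma> / 2)" "1 < p" "0 < K" "0 \<le> a" "0 \<le> b" "0 < \<delta>" "a + \<delta> < 1" "0 \<le> \<eta>" "b - \<eta> < 1" "0 \<le> 8 * (2::real) powr (\<sigma> / 2)"
      using p K a_nonneg b0 \<delta> ad1 \<eta> be1 by auto
    fix W W' :: "'a L2" and r d x s :: real
    assume r: "0 < r" and d: "0 < d" and x: "0 \<le> x" and s: "0 \<le> s"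
      and h: "norm (opA \<sigma> W) \<le> r * (1 + x) powr - a" "norm (opB \<sigma> W) \<le> r * (1 + x) powr - b"
      "norm (opA \<sigma> W') \<le> r * (1 + x) powr - a" "norm (opB \<sigma> W') \<le> r * (1 + x) powr - b"
      "norm (opA \<sigma> (W - W')) \<le> d * (1 + x) powr - a" "norm (opB \<sigma> (W - W')) \<le> d * (1 + x) powr - b"
    define F where "F y = abs_power p (rep_L2 (inv_fourier (opA \<sigma> W))) y - abs_power p (rep_L2 (inv_fourier (opA \<sigma> W'))) y" for y
    have sF: "square_integrable F" unfolding F_def[abs_def]
      by (rule square_integrable_diff[OF square_integrable_abs_power square_integrable_abs_power])
    have Fm: "F \<in> borel_measurable borel" using sF by (simp add: square_integrable_def)
    have N: "nonlin \<sigma> p W - nonlin \<sigma> p W' = fourier (to_L2 F)" unfolding nonlin_diff_eq F_def[abs_def] ..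
    define P where "P = d * r powr (p - 1)"
    have P: "0 < P" using r d by (simp add: P_def)
    have i1: "(\<integral>\<^sup>+y. ennreal (cmod (F y) powr \<mu>) \<partial>lborel) \<le> ennreal ((C1 * (P * (1 + x) powr (\<delta> - 1))) powr \<mu>)"
      using C1(2)[OF r d x h] unfolding em F_def P_def .
    have "(\<integral>\<^sup>+y. ennreal (cmod (F y) powr 2) \<partial>lborel) \<le> ennreal ((C2 * (P * (1 + x) powr - (1 + \<eta>))) powr 2)"
      using C2(2)[OF r d x h] unfolding e2 F_def P_def .
    then have i2: "norm (to_L2 F) \<le> C2 * (P * (1 + x) powr - (1 + \<eta>))"
      using C2(1) P by (intro norm_to_L2_le_powr[OF Fm]) auto
    \<comment> \<open>One bound for both the L2 and the L^\<mu> norm, as \<open>K1_decay\<close>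
      takes it; the L2 norm decays faster because
      \<open>- (1 + \<eta>) \<le> \<delta> - 1\<close>.\<close>
    define M where "M = (C1 + C2) * (P * (1 + x) powr (\<delta> - 1))"
    have M: "0 < M" using C1(1) C2(1) P x by (simp add: M_def)
    have M2: "norm (to_L2 F) \<le> M"
    proof -
      have "(1 + x) powr - (1 + \<eta>) \<le> (1 + x) powr (\<delta> - 1)" using x \<delta> \<eta> by (intro powr_mono) auto
      then have "C2 * (P * (1 + x) powr - (1 + \<eta>)) \<le> (C1 + C2) * (P * (1 + x) powr (\<delta> - 1))"
        using C1(1) C2(1) P by (intro mult_mono) auto
      then show ?thesis using i2 by (simp add: M_def)
    qed
    have M1: "(\<integral>\<^sup>+y. ennreal (cmod (rep_L2 (to_L2 F) y) powr \<mu>) \<partial>lborel) \<le> ennreal (M powr \<mu>)"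
    proof -
      have "(\<integral>\<^sup>+y. ennreal (cmod (rep_L2 (to_L2 F) y) powr \<mu>) \<partial>lborel) = (\<integral>\<^sup>+y. ennreal (cmod (F y) powr \<mu>) \<partial>lborel)"
        by (rule nn_integral_cong_AE) (use rep_to_L2[OF sF] in \<open>eventually_elim, simp\<close>)
      also note i1
      also have "ennreal ((C1 * (P * (1 + x) powr (\<delta> - 1))) powr \<mu>) \<le> ennreal (M powr \<mu>)"
        unfolding M_def using C1(1) C2(1) P \<mu>0 by (intro ennreal_leI powr_mono2 mult_right_mono) auto
      finally show ?thesis .
    qed
    note dec = D1(2)[OF s M M2 M1, folded ad bd]
    have DK: "D1 * (C1 + C2) \<le> K" "D2 * (sp * C2) \<le> K" using D1 D2 C1 C2 sp by (auto simp: K_def)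
    have big: "D1 * (M * (1 + s) powr e) \<le> K * r powr (p - 1) * d * ((1 + s) powr e * (1 + x) powr (\<delta> - 1))" for e
    proof -
      have "D1 * (M * (1 + s) powr e) = (D1 * (C1 + C2)) * (P * ((1 + s) powr e * (1 + x) powr (\<delta> - 1)))" by (simp only: M_def mult_ac)
      also have "\<dots> \<le> K * (P * ((1 + s) powr e * (1 + x) powr (\<delta> - 1)))" using DK P by (intro mult_right_mono) auto
      finally show ?thesis by (simp only: P_def mult_ac)
    qed
    have "norm (opB \<sigma> (opS s (nonlin \<sigma> p W - nonlin \<sigma> p W'))) \<le> D2 * ((1 + s) powr - (b - \<eta>) * (sp * norm (to_L2 F)))"
      using D2(2)[OF s, of "fourier (to_L2 F)"] unfolding be opB_opS[OF s] N norm_fourier sp_def .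
    also have "\<dots> \<le> D2 * ((1 + s) powr - (b - \<eta>) * (sp * (C2 * (P * (1 + x) powr - (1 + \<eta>)))))"
      using D2(1) sp i2 by (intro mult_left_mono) auto
    also have "\<dots> = (D2 * (sp * C2)) * (P * ((1 + s) powr - (b - \<eta>) * (1 + x) powr - (1 + \<eta>)))" by (simp only: mult_ac)
    also have "\<dots> \<le> K * (P * ((1 + s) powr - (b - \<eta>) * (1 + x) powr - (1 + \<eta>)))" using DK P by (intro mult_right_mono) auto
    finally have 3: "norm (opB \<sigma> (opS s (nonlin \<sigma> p W - nonlin \<sigma> p W'))) \<le> K * r powr (p - 1) * d * ((1 + s) powr - (b - \<eta>) * (1 + x) powr - (1 + \<eta>))"
      by (simp only: P_def mult_ac)
    show "norm (opA \<sigma> (opS s (nonlin \<sigma> p W - nonlin \<sigma> p W'))) \<le> K * r powr (p - 1) * d * ((1 + s) powr - (a + \<delta>) * (1 + x) powr (\<delta> - 1)) \<and>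
      norm (opB \<sigma> (opS s (nonlin \<sigma> p W - nonlin \<sigma> p W'))) \<le> K * r powr (p - 1) * d * ((1 + s) powr - (b + \<delta>) * (1 + x) powr (\<delta> - 1)) \<and>
      norm (opB \<sigma> (opS s (nonlin \<sigma> p W - nonlin \<sigma> p W'))) \<le> K * r powr (p - 1) * d * ((1 + s) powr - (b - \<eta>) * (1 + x) powr - (1 + \<eta>))"
      using dec big 3 unfolding opA_opS[OF s] opB_opS[OF s] N by (meson order_trans)
  qed
qed

end

lemma fourier_multiplier_eq: "fourier_multiplier k u = inv_fourier (mul k (fourier u))"
  by (simp add: fourier_multiplier_def mul_def)

lemma nn_lebesgue_norm:
  assumes m: "0 < m" and u: "u \<in> lebesgue_space m" "lebesgue_norm m u \<le> D"
  shows "(\<integral>\<^sup>+x. ennreal (cmod (rep_L2 u x) powr m) \<partial>lborel) \<le> ennreal (D powr m)"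
proof -
  let ?I = "\<integral>x. cmod (rep_L2 u x) powr m \<partial>lborel"
  have i: "integrable lborel (\<lambda>x. cmod (rep_L2 u x) powr m)" using u by (simp add: lebesgue_space_def)
  have I0: "0 \<le> ?I" by simp
  have "?I = (?I powr (1 / m)) powr m" using m I0 by (simp add: powr_powr)
  also have "\<dots> \<le> D powr m" using u(2) m by (intro powr_mono2) (auto simp: lebesgue_norm_def)
  finally show ?thesis using nn_integral_eq_integral[OF i] by (simp add: ennreal_leI)
qed

context damped_wave
begin

text \<open>For \<open>m = 2\<close> the exponent \<open>n * (1/m - 1/2)\<close> vanishes and balls
  bring no gain; but then \<open>\<sigma>\<^sub>1 = 0\<close>, the symbol is not singular, and the
  flat estimate has the right rate. For \<open>m < 2\<close> the condition \<open>gap\<close> makes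
  the ball estimate applicable.\<close>

lemma data_decay:
  assumes \<kappa>: "\<kappa> \<le> 2 * \<sigma>\<^sub>1"
  shows "\<exists>C>0. \<forall>(k :: 'a \<Rightarrow> complex) c t v M. 0 \<le> c \<longrightarrow> 0 \<le> t \<longrightarrow> 0 \<le> M \<longrightarrow> decaying \<alpha> \<kappa> c t k \<longrightarrow>
    norm v \<le> M \<longrightarrow> (\<forall>r>0. norm (mul (indicator (cball 0 r)) v) \<le> M * r powr (n * (1/m - 1/2))) \<longrightarrow>
    norm (mul k v) \<le> C * (c * ((1 + t) powr ((\<kappa> - n * (1/m - 1/2)) / \<alpha>) * M))"
proof (cases "m = 2")
  case True
  then have "\<sigma>\<^sub>1 = 0" using gap by auto
  then have "\<kappa> \<le> 0" using \<kappa> by simp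
  then obtain C where C: "0 < C" "\<And>(k :: 'a \<Rightarrow> complex) c t v. 0 \<le> c \<Longrightarrow> 0 \<le> t \<Longrightarrow> decaying \<alpha> \<kappa> c t k \<Longrightarrow>
    norm (mul k v) \<le> C * (c * ((1 + t) powr (\<kappa> / \<alpha>) * norm v))"
    using decaying_mul_flat[OF alpha_pos] by blast
  have "norm (mul k v) \<le> C * (c * ((1 + t) powr ((\<kappa> - n * (1/m - 1/2)) / \<alpha>) * M))"
    if "0 \<le> c" "0 \<le> t" "decaying \<alpha> \<kappa> c t k" "norm v \<le> M" for k :: "'a \<Rightarrow> complex" and c t v M
  proof -
    have "norm (mul k v) \<le> C * (c * ((1 + t) powr (\<kappa> / \<alpha>) * norm v))" by (rule C(2)[OF that(1-3)])
    also have "\<dots> \<le> C * (c * ((1 + t) powr (\<kappa> / \<alpha>) * M))" using C(1) that by (intro mult_left_mono) auto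
    finally show ?thesis using True by simp
  qed
  then show ?thesis using C(1) by blast
next
  case False
  define \<beta> where "\<beta> = 2 * (n * (1/m - 1/2))"
  have \<beta>: "0 < \<beta>" "2 * \<kappa> < \<beta>" using gap False sigma \<kappa> by (auto simp: \<beta>_def)
  have \<beta>2: "\<beta> / 2 = n * (1/m - 1/2)" by (simp add: \<beta>_def)
  show ?thesis using decaying_mul_ball[OF alpha_pos \<beta>] unfolding \<beta>2 .
qed

text \<open>The weight is put on \<open>u\<^sub>0\<close> before the kernel is applied, since the
  bound on \<open>K\<^sub>0\<close> offers no smoothing, whereas \<open>opS\<close> carries the
  weight inside its symbol.\<close>

definition source :: "'a L2 \<Rightarrow> 'a L2 \<Rightarrow> real \<Rightarrow> 'a L2" where
  "source u\<^sub>0 u\<^sub>1 t = mul (K\<^sub>0 t) (mul (bessel_symbol \<sigma>) (fourier u\<^sub>0)) + opS t (fourier u\<^sub>1)"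

lemma opA_mul_K0: "0 \<le> t \<Longrightarrow> opA \<sigma> (mul (K\<^sub>0 t) w) = mul (\<lambda>\<xi>. bessel_symbol (- \<sigma>) \<xi> * K\<^sub>0 t \<xi>) w"
  unfolding opA_def by (rule mul_mul[OF square_integrable_K0]) auto

lemma opB_mul_K0: "0 \<le> t \<Longrightarrow> opB \<sigma> (mul (K\<^sub>0 t) w) = mul (\<lambda>\<xi>. complex_of_real (norm \<xi> powr \<sigma>) * bessel_symbol (- \<sigma>) \<xi> * K\<^sub>0 t \<xi>) w"
  unfolding opB_def by (rule mul_mul[OF square_integrable_K0]) auto

lemma source_continuous: "continuous_on {0..} (source u\<^sub>0 u\<^sub>1)"
  unfolding source_def[abs_def] by (intro continuous_intros mul_K0_continuous opS_continuous)

text \<open>\<open>D\<close> is any positive bound on the data norm: the norm itself may be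
  \<open>0\<close>, while \<open>fourier_ball_Lm\<close> takes a positive constant.\<close>

lemma source_decay:
  "\<exists>C>0. \<forall>u\<^sub>0 u\<^sub>1 D t. (u\<^sub>0, u\<^sub>1) \<in> data_space \<sigma> m \<longrightarrow> data_norm \<sigma> m (u\<^sub>0, u\<^sub>1) \<le> D \<longrightarrow> 0 < D \<longrightarrow> 0 \<le> t \<longrightarrow>
    norm (opA \<sigma> (source u\<^sub>0 u\<^sub>1 t)) \<le> C * D * (1 + t) powr - a \<and>
    norm (opB \<sigma> (source u\<^sub>0 u\<^sub>1 t)) \<le> C * D * (1 + t) powr - b"
proof -
  define g where "g = n * (1/m - 1/2)"
  have ea: "(2 * \<sigma>\<^sub>1 - g) / \<alpha> = - a" unfolding a_def g_def minus_divide_left by simp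
  have eb: "(2 * \<sigma>\<^sub>1 - \<sigma> - g) / \<alpha> = - b"
    unfolding b_def a_def g_def minus_divide_left add_divide_distrib[symmetric] by (simp add: algebra_simps)
  obtain C1 where C1: "0 < C1" "\<And>(k :: 'a \<Rightarrow> complex) c t v M. 0 \<le> c \<Longrightarrow> 0 \<le> t \<Longrightarrow> 0 \<le> M \<Longrightarrow> decaying \<alpha> (2 * \<sigma>\<^sub>1) c t k \<Longrightarrow>
    norm v \<le> M \<Longrightarrow> (\<forall>r>0. norm (mul (indicator (cball 0 r)) v) \<le> M * r powr g) \<Longrightarrow>
    norm (mul k v) \<le> C1 * (c * ((1 + t) powr - a * M))"
    using data_decay[OF order_refl] unfolding g_def[symmetric] ea by blast
  have "2 * \<sigma>\<^sub>1 - \<sigma> \<le> 2 * \<sigma>\<^sub>1" using sigma by simp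
  from data_decay[OF this] obtain C2 where C2: "0 < C2" "\<And>(k :: 'a \<Rightarrow> complex) c t v M. 0 \<le> c \<Longrightarrow> 0 \<le> t \<Longrightarrow> 0 \<le> M \<Longrightarrow> decaying \<alpha> (2 * \<sigma>\<^sub>1 - \<sigma>) c t k \<Longrightarrow>
    norm v \<le> M \<Longrightarrow> (\<forall>r>0. norm (mul (indicator (cball 0 r)) v) \<le> M * r powr g) \<Longrightarrow>
    norm (mul k v) \<le> C2 * (c * ((1 + t) powr - b * M))"
    unfolding g_def[symmetric] eb by blast
  have g0: "0 \<le> g" using gap sigma by (auto simp: g_def)
  define sp where "sp = sqrt_pi_const TYPE('a)"
  have sp: "0 < sp" unfolding sp_def by (rule sqrt_pi_const_pos)
  define Q where "Q = sqrt (unit_ball_vol (real DIM('a))) + sqrt_pi_const TYPE('a)"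
  have Qn: "Q = sqrt (unit_ball_vol n) + sqrt_pi_const TYPE('a)" by (simp add: Q_def n_eq)
  have Q: "0 < Q" unfolding Q_def using sqrt_pi_const_pos[where 'a='a] by (auto intro: add_nonneg_pos)
  define Z where "Z = 2 powr (\<sigma> / 2) * Q + sp"
  have one: "1 \<le> 2 powr (\<sigma> / 2)" using sigma by (intro ge_one_powr_ge_zero) auto
  have "Q \<le> 2 powr (\<sigma> / 2) * Q" using mult_right_mono[OF one less_imp_le[OF Q]] by simp
  then have Z: "0 < Z" "Q \<le> Z" "2 powr (\<sigma> / 2) * Q \<le> Z" "sp \<le> Z"
    unfolding Z_def using sp Q by linarith+
  have "norm (opA \<sigma> (source u\<^sub>0 u\<^sub>1 t)) \<le> (2 * (C1 + C2) * ck * Z) * D * (1 + t) powr - a \<and>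
    norm (opB \<sigma> (source u\<^sub>0 u\<^sub>1 t)) \<le> (2 * (C1 + C2) * ck * Z) * D * (1 + t) powr - b"
    if data: "(u\<^sub>0, u\<^sub>1) \<in> data_space \<sigma> m" and D: "data_norm \<sigma> m (u\<^sub>0, u\<^sub>1) \<le> D" "0 < D" and t: "0 \<le> t" for u\<^sub>0 u\<^sub>1 D t
  proof -
    let ?w = "mul (bessel_symbol \<sigma>) (fourier u\<^sub>0)" and ?v = "fourier u\<^sub>1"
    have ln0: "0 \<le> lebesgue_norm m u" for u :: "'a L2" by (simp add: lebesgue_norm_def)
    have sn0: "0 \<le> sobolev_norm \<sigma> u" for u :: "'a L2" by (simp add: sobolev_norm_def)
    have le: "sobolev_norm \<sigma> u\<^sub>0 \<le> D" "lebesgue_norm m u\<^sub>0 \<le> D" "norm u\<^sub>1 \<le> D" "lebesgue_norm m u\<^sub>1 \<le> D"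
      using D(1)[unfolded data_norm_def prod.case] ln0[of u\<^sub>0] ln0[of u\<^sub>1] sn0[of u\<^sub>0] norm_ge_zero[of u\<^sub>1] by linarith+
    have sq: "square_integrable (\<lambda>\<xi>. bessel_symbol \<sigma> \<xi> * rep_L2 (fourier u\<^sub>0) \<xi>)"
      using data by (simp add: data_space_def sobolev_space_def in_multiplier_domain_def)
    have m0: "0 < m" using m by simp
    have L0: "(\<integral>\<^sup>+x. ennreal (cmod (rep_L2 u\<^sub>0 x) powr m) \<partial>lborel) \<le> ennreal (D powr m)"
      by (rule nn_lebesgue_norm[OF m0 _ le(2)]) (use data in \<open>simp add: data_space_def\<close>)
    have L1: "(\<integral>\<^sup>+x. ennreal (cmod (rep_L2 u\<^sub>1 x) powr m) \<partial>lborel) \<le> ennreal (D powr m)"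
      by (rule nn_lebesgue_norm[OF m0 _ le(4)]) (use data in \<open>simp add: data_space_def\<close>)
    have ZD: "0 \<le> Z * D" using Z D by simp
    have ball: "norm (mul (indicator (cball 0 r)) (fourier u)) \<le> Q * (D * r powr g)"
      if "0 < r" "(\<integral>\<^sup>+x. ennreal (cmod (rep_L2 u x) powr m) \<partial>lborel) \<le> ennreal (D powr m)" for r and u :: "'a L2"
      using fourier_ball_Lm[OF less_imp_le[OF m(1)] m(2) that(1) D(2) that(2)]
      unfolding n_eq[symmetric] g_def[symmetric] Qn[symmetric] by (simp only: mult_ac)
    have nv: "norm ?v \<le> Z * D"
      unfolding norm_fourier sp_def[symmetric] using Z sp le D by (intro mult_mono) auto
    have bv: "\<forall>r>0. norm (mul (indicator (cball 0 r)) ?v) \<le> Z * D * r powr g"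
    proof (intro allI impI)
      fix r :: real assume "0 < r"
      note ball[OF this L1]
      also have "Q * (D * r powr g) \<le> Z * (D * r powr g)" using Z D by (intro mult_right_mono) auto
      finally show "norm (mul (indicator (cball 0 r)) ?v) \<le> Z * D * r powr g" by (simp only: mult.assoc)
    qed
    have nw: "norm ?w \<le> sp * D"
    proof -
      have "sobolev_norm \<sigma> u\<^sub>0 = norm ?w / sp" by (simp add: sobolev_norm_def fourier_multiplier_eq norm_inv_fourier sp_def)
      then show ?thesis using le(1) sp by (simp add: pos_divide_le_eq mult.commute)
    qed
    have spZ: "sp * D \<le> Z * D" using Z D by (intro mult_right_mono) auto
    \<comment> \<open>The weighted transform of \<open>u\<^sub>0\<close> obeys the same ball bound:
      for \<open>r \<le> 1\<close> the weight is at most \<open>2 powr (\<sigma> / 2)\<close> and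
      the L^m norm is used, for larger \<open>r\<close> the full norm is enough because
      \<open>r powr g \<ge> 1\<close>.\<close>
    have bw: "\<forall>r>0. norm (mul (indicator (cball 0 r)) ?w) \<le> Z * D * r powr g"
    proof (intro allI impI)
      fix r :: real assume r: "0 < r"
      show "norm (mul (indicator (cball 0 r)) ?w) \<le> Z * D * r powr g"
      proof (cases "r \<le> 1")
        case True
        have i: "square_integrable (\<lambda>\<xi>. indicator (cball 0 r) \<xi> * rep_L2 v \<xi>)" for v :: "'a L2"
          by (rule square_integrable_mul[where C=1]) (auto simp: indicator_def intro!: borel_measurable_indicator)
        have "norm (mul (indicator (cball 0 r)) ?w) \<le> 2 powr (\<sigma> / 2) * norm (mul (indicator (cball 0 r)) (fourier u\<^sub>0))"
        proof (rule norm_L2_mono)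
          show "AE \<xi> in lborel. cmod (rep_L2 (mul (indicator (cball 0 r)) ?w) \<xi>) \<le> 2 powr (\<sigma> / 2) * cmod (rep_L2 (mul (indicator (cball 0 r)) (fourier u\<^sub>0)) \<xi>)"
            using rep_mul[OF i[of ?w]] rep_mul[OF i[of "fourier u\<^sub>0"]] rep_mul[OF sq]
          proof eventually_elim
            case (elim \<xi>)
            show ?case
            proof (cases "norm \<xi> \<le> r")
              case True
              then have "cmod (bessel_symbol \<sigma> \<xi>) \<le> 2 powr (\<sigma> / 2)"
                using \<open>r \<le> 1\<close> by (intro bessel_pos_le(1)[OF sigma_nonneg]) simp
              moreover have "indicator (cball 0 r) \<xi> = (1 :: complex)" using True by simp
              ultimately show ?thesis unfolding elim by (simp add: norm_mult mult_right_mono)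
            next
              case False
              then show ?thesis unfolding elim by (simp add: indicator_def)
            qed
          qed
        qed simp
        also have "\<dots> \<le> 2 powr (\<sigma> / 2) * (Q * (D * r powr g))" by (intro mult_left_mono ball[OF r L0]) simp
        also have "\<dots> = (2 powr (\<sigma> / 2) * Q) * (D * r powr g)" by (simp only: mult.assoc)
        also have "\<dots> \<le> Z * (D * r powr g)" using Z D by (intro mult_right_mono) auto
        finally show ?thesis by (simp only: mult.assoc)
      next
        case False
        have "1 \<le> r powr g" using False g0 by (intro ge_one_powr_ge_zero) auto
        then have "Z * D * 1 \<le> Z * D * r powr g" using ZD by (intro mult_left_mono)
        then show ?thesis using norm_mul_indicator_le[of r ?w] nw spZ by simp
      qed
    qed
    have nw': "norm ?w \<le> Z * D" using nw spZ by simp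
    note c = less_imp_le[OF ck(1)]
    have C12: "C1 * x \<le> (C1 + C2) * x" "C2 * x \<le> (C1 + C2) * x" if "0 \<le> x" for x
      using C1(1) C2(1) that by (auto intro: mult_right_mono)
    have pa: "0 \<le> ck * ((1 + t) powr e * (Z * D))" for e using c ZD by simp
    have linA: "opA \<sigma> (source u\<^sub>0 u\<^sub>1 t) = mul (\<lambda>\<xi>. bessel_symbol (- \<sigma>) \<xi> * K\<^sub>0 t \<xi>) ?w + mul (K\<^sub>1 t) ?v"
      unfolding source_def linear_add[OF bounded_linear.linear[OF bounded_linear_opA[OF sigma_nonneg]]] opA_mul_K0[OF t] opA_opS[OF t] ..
    have linB: "opB \<sigma> (source u\<^sub>0 u\<^sub>1 t) = mul (\<lambda>\<xi>. complex_of_real (norm \<xi> powr \<sigma>) * bessel_symbol (- \<sigma>) \<xi> * K\<^sub>0 t \<xi>) ?w + mul (\<lambda>\<xi>. complex_of_real (norm \<xi> powr \<sigma>) * K\<^sub>1 t \<xi>) ?v"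
      unfolding source_def linear_add[OF bounded_linear.linear[OF bounded_linear_opB[OF sigma_nonneg]]] opB_mul_K0[OF t] opB_opS[OF t] ..
    have two: "x + y \<le> (2 * (C1 + C2) * ck * Z) * D * (1 + t) powr e"
      if "x \<le> (C1 + C2) * (ck * ((1 + t) powr e * (Z * D)))" "y \<le> (C1 + C2) * (ck * ((1 + t) powr e * (Z * D)))" for x y e
      using add_mono[OF that] by (simp add: algebra_simps)
    have "norm (opA \<sigma> (source u\<^sub>0 u\<^sub>1 t)) \<le> (2 * (C1 + C2) * ck * Z) * D * (1 + t) powr - a"
      unfolding linA
      by (rule order_trans[OF norm_triangle_ineq two])
         (rule order_trans[OF C1(2)[OF c t ZD decaying_AK0[OF t] nw' bw] C12(1)[OF pa]],
          rule order_trans[OF C1(2)[OF c t ZD decaying_K1[OF t] nv bv] C12(1)[OF pa]])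
    moreover have "norm (opB \<sigma> (source u\<^sub>0 u\<^sub>1 t)) \<le> (2 * (C1 + C2) * ck * Z) * D * (1 + t) powr - b"
      unfolding linB
      by (rule order_trans[OF norm_triangle_ineq two])
         (rule order_trans[OF C2(2)[OF c t ZD decaying_BK0[OF t] nw' bw] C12(2)[OF pa]],
          rule order_trans[OF C2(2)[OF c t ZD decaying_DK1[OF t] nv bv] C12(2)[OF pa]])
    ultimately show ?thesis by blast
  qed
  moreover have "0 < 2 * (C1 + C2) * ck * Z" using C1(1) C2(1) ck Z by simp
  ultimately show ?thesis by blast
qed

subsection \<open>Solutions in frequency space\<close>

lemma K1_multiplier_nonlin:
  assumes "0 \<le> s"
  shows "fourier_multiplier (K\<^sub>1 s) (to_L2 (abs_power p (rep_L2 (inv_fourier (opA \<sigma> W))))) = inv_fourier (opA \<sigma> (opS s (nonlin \<sigma> p W)))"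
  unfolding fourier_multiplier_eq opA_opS[OF assms] nonlin_def ..

lemma bounded_linear_inv_opA: "bounded_linear (\<lambda>W :: 'a L2. inv_fourier (opA \<sigma> W))"
  by (rule bounded_linear_compose[OF bounded_linear_inv_fourier bounded_linear_opA[OF sigma_nonneg]])

lemma inv_opA_source:
  assumes t: "0 \<le> t" and u0: "u\<^sub>0 \<in> sobolev_space \<sigma>"
  shows "inv_fourier (opA \<sigma> (source u\<^sub>0 u\<^sub>1 t)) = fourier_multiplier (K\<^sub>0 t) u\<^sub>0 + fourier_multiplier (K\<^sub>1 t) u\<^sub>1"
proof -
  have sq: "square_integrable (\<lambda>\<xi>. bessel_symbol \<sigma> \<xi> * rep_L2 (fourier u\<^sub>0) \<xi>)"
    using u0 by (simp add: sobolev_space_def in_multiplier_domain_def)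
  have "bessel_symbol (- \<sigma>) x * K\<^sub>0 t x * bessel_symbol \<sigma> x = K\<^sub>0 t x" for x
    using bessel_inverse[of \<sigma> x] by (metis mult.assoc mult.commute mult.right_neutral)
  then have "opA \<sigma> (mul (K\<^sub>0 t) (mul (bessel_symbol \<sigma>) (fourier u\<^sub>0))) = mul (K\<^sub>0 t) (fourier u\<^sub>0)"
    unfolding opA_mul_K0[OF t] by (subst mul_mul[OF sq]) (auto simp only: borel_measurable_times bessel_measurable K_hat_measurable)
  then show ?thesis
    unfolding source_def fourier_multiplier_eq
    by (simp add: linear_add[OF bounded_linear.linear[OF bounded_linear_opA[OF sigma_nonneg]]] opA_opS[OF t]
        linear_add[OF bounded_linear.linear[OF bounded_linear_inv_fourier]])
qed

lemma global_solution_of_frequency: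
  assumes duh: "duhamel (opA \<sigma>) (opB \<sigma>) opS (nonlin \<sigma> p) a b c \<delta> \<eta> K p L"
    and W: "continuous_on {0..} W" "\<And>t. 0 \<le> t \<Longrightarrow> W t = \<epsilon> *\<^sub>R source u\<^sub>0 u\<^sub>1 t + duhamel.duh opS (nonlin \<sigma> p) W t"
    and u0: "u\<^sub>0 \<in> sobolev_space \<sigma>"
  shows "global_solution \<sigma> \<sigma>\<^sub>1 \<sigma>\<^sub>2 p \<epsilon> u\<^sub>0 u\<^sub>1 (\<lambda>t. inv_fourier (opA \<sigma> (W t)))"
proof -
  interpret duhamel "opA \<sigma>" "opB \<sigma>" opS "nonlin \<sigma> p" a b c \<delta> \<eta> K p L by (rule duh)
  note lin = bounded_linear.linear[OF bounded_linear_inv_opA]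
  have "continuous_into_sobolev \<sigma> (\<lambda>t. inv_fourier (opA \<sigma> (W t)))"
    unfolding continuous_into_sobolev_def
  proof (intro allI impI conjI)
    fix t :: real assume t: "0 \<le> t"
    have "square_integrable (\<lambda>\<xi>. bessel_symbol \<sigma> \<xi> * rep_L2 (opA \<sigma> (W t)) \<xi>)"
    proof (rule square_integrable_cong_AE[OF square_integrable_rep[of "W t"]])
      show "AE \<xi> in lborel. rep_L2 (W t) \<xi> = bessel_symbol \<sigma> \<xi> * rep_L2 (opA \<sigma> (W t)) \<xi>"
        using rep_mul[OF square_integrable_opA[OF sigma_nonneg, of "W t"]] unfolding opA_def[symmetric]
        by eventually_elim (simp add: mult.assoc[symmetric] bessel_inverse)
    qed measurable
    then show "inv_fourier (opA \<sigma> (W t)) \<in> sobolev_space \<sigma>"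
      by (simp add: sobolev_space_def in_multiplier_domain_def)
    have "sobolev_norm \<sigma> (inv_fourier (opA \<sigma> (W x)) - inv_fourier (opA \<sigma> (W t))) = norm (W x - W t) / sqrt_pi_const TYPE('a)" for x
      unfolding linear_diff[OF lin, symmetric] sobolev_norm_def fourier_multiplier_eq fourier_inv_fourier
        bessel_opA[OF sigma_nonneg] norm_inv_fourier ..
    moreover have "((\<lambda>x. norm (W x - W t) / sqrt_pi_const TYPE('a)) \<longlongrightarrow> norm (W t - W t) / sqrt_pi_const TYPE('a)) (at t within {0..})"
      using W(1) t sqrt_pi_const_pos[where 'a='a] by (intro tendsto_intros) (auto simp: continuous_on_def)
    ultimately show "((\<lambda>x. sobolev_norm \<sigma> (inv_fourier (opA \<sigma> (W x)) - inv_fourier (opA \<sigma> (W t)))) \<longlongrightarrow> 0) (at t within {0..})"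
      by simp
  qed
  moreover have "\<exists>I. ((\<lambda>x. fourier_multiplier (K\<^sub>1 (t - x)) (to_L2 (abs_power p (rep_L2 (inv_fourier (opA \<sigma> (W x))))))) has_integral I) {0..t} \<and>
      inv_fourier (opA \<sigma> (W t)) = \<epsilon> *\<^sub>R fourier_multiplier (K\<^sub>0 t) u\<^sub>0 + \<epsilon> *\<^sub>R fourier_multiplier (K\<^sub>1 t) u\<^sub>1 + I" if t: "0 \<le> t" for t
  proof (intro exI conjI)
    have "((\<lambda>x. inv_fourier (opA \<sigma> (opS (t - x) (nonlin \<sigma> p (W x))))) has_integral inv_fourier (opA \<sigma> (duh W t))) {0..t}"
      using has_integral_linear[OF duh_integral[OF W(1)] bounded_linear_inv_opA] by (simp add: o_def)
    then show "((\<lambda>x. fourier_multiplier (K\<^sub>1 (t - x)) (to_L2 (abs_power p (rep_L2 (inv_fourier (opA \<sigma> (W x))))))) has_integral inv_fourier (opA \<sigma> (duh W t))) {0..t}"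
      by (rule has_integral_eq[rotated]) (simp add: K1_multiplier_nonlin)
    show "inv_fourier (opA \<sigma> (W t)) = \<epsilon> *\<^sub>R fourier_multiplier (K\<^sub>0 t) u\<^sub>0 + \<epsilon> *\<^sub>R fourier_multiplier (K\<^sub>1 t) u\<^sub>1 + inv_fourier (opA \<sigma> (duh W t))"
      unfolding W(2)[OF t] linear_add[OF lin] linear_scale[OF lin] inv_opA_source[OF t u0] by (simp add: scaleR_add_right)
  qed
  ultimately show ?thesis unfolding global_solution_def using square_integrable_abs_power by blast
qed

text \<open>Brings an arbitrary solution, which need not decay, into the setting of
  \<open>solution_unique\<close>. Norms of differences of \<open>V\<close> are multiples of Sobolev
  norms of those of \<open>v\<close>, which carries over continuity; injectivity of
  \<open>W \<mapsto> inv_fourier (opA \<sigma> W)\<close> carries over the equation.\<close>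

lemma frequency_of_global_solution:
  assumes duh: "duhamel (opA \<sigma>) (opB \<sigma>) opS (nonlin \<sigma> p) a b c \<delta> \<eta> K p L"
    and v: "global_solution \<sigma> \<sigma>\<^sub>1 \<sigma>\<^sub>2 p \<epsilon> u\<^sub>0 u\<^sub>1 v" and u0: "u\<^sub>0 \<in> sobolev_space \<sigma>"
  obtains V where "continuous_on {0..} V" "\<And>t. 0 \<le> t \<Longrightarrow> V t = \<epsilon> *\<^sub>R source u\<^sub>0 u\<^sub>1 t + duhamel.duh opS (nonlin \<sigma> p) V t"
    "\<And>t. 0 \<le> t \<Longrightarrow> v t = inv_fourier (opA \<sigma> (V t))"
proof -
  interpret duhamel "opA \<sigma>" "opB \<sigma>" opS "nonlin \<sigma> p" a b c \<delta> \<eta> K p L by (rule duh)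
  note lin = bounded_linear.linear[OF bounded_linear_inv_opA]
  have cs: "continuous_into_sobolev \<sigma> v" using v by (simp add: global_solution_def)
  define V where "V t = mul (bessel_symbol \<sigma>) (fourier (v t))" for t
  have sq: "square_integrable (\<lambda>\<xi>. bessel_symbol \<sigma> \<xi> * rep_L2 (fourier (v t)) \<xi>)" if "0 \<le> t" for t
    using cs that by (simp add: continuous_into_sobolev_def sobolev_space_def in_multiplier_domain_def)
  have vV: "v t = inv_fourier (opA \<sigma> (V t))" if "0 \<le> t" for t
    unfolding V_def opA_bessel[OF sq[OF that]] by simp
  have Vc: "continuous_on {0..} V"
    unfolding continuous_on_def
  proof
    fix t :: real assume "t \<in> {0..}"
    then have t: "0 \<le> t" by simp
    have eq: "norm (V x - V t) = sqrt_pi_const TYPE('a) * sobolev_norm \<sigma> (v x - v t)" if "0 \<le> x" for x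
    proof -
      have "sobolev_norm \<sigma> (v x - v t) = norm (V x - V t) / sqrt_pi_const TYPE('a)"
        unfolding vV[OF that] vV[OF t] linear_diff[OF lin, symmetric] sobolev_norm_def fourier_multiplier_eq fourier_inv_fourier
          bessel_opA[OF sigma_nonneg] norm_inv_fourier ..
      then show ?thesis using sqrt_pi_const_pos[where 'a='a] by simp
    qed
    have "((\<lambda>x. sqrt_pi_const TYPE('a) * sobolev_norm \<sigma> (v x - v t)) \<longlongrightarrow> sqrt_pi_const TYPE('a) * 0) (at t within {0..})"
      using cs t by (intro tendsto_intros) (auto simp: continuous_into_sobolev_def)
    moreover have "\<forall>\<^sub>F x in at t within {0..}. sqrt_pi_const TYPE('a) * sobolev_norm \<sigma> (v x - v t) = norm (V x - V t)"
      by (auto simp: eventually_at_filter eq)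
    ultimately have "((\<lambda>x. norm (V x - V t)) \<longlongrightarrow> sqrt_pi_const TYPE('a) * 0) (at t within {0..})"
      by (rule Lim_transform_eventually)
    then show "(V \<longlongrightarrow> V t) (at t within {0..})" by (simp add: tendsto_norm_zero_iff LIM_zero_iff)
  qed
  have "V t = \<epsilon> *\<^sub>R source u\<^sub>0 u\<^sub>1 t + duh V t" if t: "0 \<le> t" for t
  proof -
    obtain I where I: "((\<lambda>x. fourier_multiplier (K\<^sub>1 (t - x)) (to_L2 (abs_power p (rep_L2 (v x))))) has_integral I) {0..t}"
      "v t = \<epsilon> *\<^sub>R fourier_multiplier (K\<^sub>0 t) u\<^sub>0 + \<epsilon> *\<^sub>R fourier_multiplier (K\<^sub>1 t) u\<^sub>1 + I"
      using v t unfolding global_solution_def by blast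
    have "((\<lambda>x. inv_fourier (opA \<sigma> (opS (t - x) (nonlin \<sigma> p (V x))))) has_integral inv_fourier (opA \<sigma> (duh V t))) {0..t}"
      using has_integral_linear[OF duh_integral[OF Vc] bounded_linear_inv_opA] by (simp add: o_def)
    then have "((\<lambda>x. fourier_multiplier (K\<^sub>1 (t - x)) (to_L2 (abs_power p (rep_L2 (v x))))) has_integral inv_fourier (opA \<sigma> (duh V t))) {0..t}"
      by (rule has_integral_eq[rotated]) (simp add: K1_multiplier_nonlin vV)
    then have "I = inv_fourier (opA \<sigma> (duh V t))" using I(1) by (rule has_integral_unique[rotated])
    then have "inv_fourier (opA \<sigma> (V t)) = inv_fourier (opA \<sigma> (\<epsilon> *\<^sub>R source u\<^sub>0 u\<^sub>1 t + duh V t))"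
      unfolding vV[OF t, symmetric] I(2) linear_add[OF lin] linear_scale[OF lin] inv_opA_source[OF t u0] by (simp add: scaleR_add_right)
    then have "mul (bessel_symbol \<sigma>) (fourier (inv_fourier (opA \<sigma> (V t)))) = mul (bessel_symbol \<sigma>) (fourier (inv_fourier (opA \<sigma> (\<epsilon> *\<^sub>R source u\<^sub>0 u\<^sub>1 t + duh V t))))"
      by (rule arg_cong)
    then show ?thesis by (simp only: fourier_inv_fourier bessel_opA[OF sigma_nonneg])
  qed
  then show ?thesis using that Vc vV by blast
qed

text \<open>\<open>C\<close> is fixed before the data, while the threshold for
  \<open>\<epsilon>\<close> depends on their norm. That norm may be \<open>0\<close> and
  \<open>small_data_solution\<close> takes a positive constant, so solutions are built for bounds
  \<open>D'\<close> slightly above it, and the estimate with the norm itself is a limit.\<close>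

theorem global_existence:
  "\<exists>C>0. \<forall>u\<^sub>0 u\<^sub>1 :: 'a L2. (u\<^sub>0, u\<^sub>1) \<in> data_space \<sigma> m \<longrightarrow>
    (\<exists>\<epsilon>\<^sub>0>0. \<forall>\<epsilon>. 0 < \<epsilon> \<and> \<epsilon> \<le> \<epsilon>\<^sub>0 \<longrightarrow>
      (\<exists>u. global_solution \<sigma> \<sigma>\<^sub>1 \<sigma>\<^sub>2 p \<epsilon> u\<^sub>0 u\<^sub>1 u \<and>
        (\<forall>v. global_solution \<sigma> \<sigma>\<^sub>1 \<sigma>\<^sub>2 p \<epsilon> u\<^sub>0 u\<^sub>1 v \<longrightarrow> (\<forall>t\<ge>0. v t = u t)) \<and>
        (\<forall>t\<ge>0. norm (u t) \<le> C * (1 + t) powr - a * data_norm \<sigma> m (u\<^sub>0, u\<^sub>1) \<and>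
          norm (abs_D \<sigma> (u t)) \<le> C * (1 + t) powr - b * data_norm \<sigma> m (u\<^sub>0, u\<^sub>1))))"
proof -
  obtain \<delta> \<eta> K where duh: "duhamel (opA \<sigma>) (opB \<sigma>) opS (nonlin \<sigma> p) a b (2 powr (\<sigma> / 2)) \<delta> \<eta> K p (8 * 2 powr (\<sigma> / 2))"
    by (rule duhamel_instance)
  interpret duhamel "opA \<sigma>" "opB \<sigma>" opS "nonlin \<sigma> p" a b "2 powr (\<sigma> / 2)" \<delta> \<eta> K p "8 * 2 powr (\<sigma> / 2)" by (rule duh)
  obtain g\<^sub>0 where g0: "0 < g\<^sub>0" "\<And>G g. \<lbrakk>continuous_on {0..} G; 0 < g; g \<le> g\<^sub>0; decays g G\<rbrakk> \<Longrightarrow>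
    \<exists>W. continuous_on {0..} W \<and> decays (2 * g) W \<and> (\<forall>t\<ge>0. W t = G t + duh W t)"
    using small_data_solution by blast
  obtain CG where CG: "0 < CG" "\<And>u\<^sub>0 u\<^sub>1 D t. (u\<^sub>0, u\<^sub>1) \<in> data_space \<sigma> m \<Longrightarrow> data_norm \<sigma> m (u\<^sub>0, u\<^sub>1) \<le> D \<Longrightarrow> 0 < D \<Longrightarrow> 0 \<le> t \<Longrightarrow>
    norm (opA \<sigma> (source u\<^sub>0 u\<^sub>1 t)) \<le> CG * D * (1 + t) powr - a \<and>
    norm (opB \<sigma> (source u\<^sub>0 u\<^sub>1 t)) \<le> CG * D * (1 + t) powr - b"
    using source_decay by blast
  define sp where "sp = sqrt_pi_const TYPE('a)"
  have sp: "0 < sp" unfolding sp_def by (rule sqrt_pi_const_pos)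
  define C where "C = 2 * CG / sp"
  have C: "0 < C" using CG sp by (simp add: C_def)
  have "\<exists>\<epsilon>\<^sub>0>0. \<forall>\<epsilon>. 0 < \<epsilon> \<and> \<epsilon> \<le> \<epsilon>\<^sub>0 \<longrightarrow>
      (\<exists>u. global_solution \<sigma> \<sigma>\<^sub>1 \<sigma>\<^sub>2 p \<epsilon> u\<^sub>0 u\<^sub>1 u \<and>
        (\<forall>v. global_solution \<sigma> \<sigma>\<^sub>1 \<sigma>\<^sub>2 p \<epsilon> u\<^sub>0 u\<^sub>1 v \<longrightarrow> (\<forall>t\<ge>0. v t = u t)) \<and>
        (\<forall>t\<ge>0. norm (u t) \<le> C * (1 + t) powr - a * data_norm \<sigma> m (u\<^sub>0, u\<^sub>1) \<and>
          norm (abs_D \<sigma> (u t)) \<le> C * (1 + t) powr - b * data_norm \<sigma> m (u\<^sub>0, u\<^sub>1)))"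
    if data: "(u\<^sub>0, u\<^sub>1) \<in> data_space \<sigma> m" for u\<^sub>0 u\<^sub>1 :: "'a L2"
  proof -
    define D where "D = data_norm \<sigma> m (u\<^sub>0, u\<^sub>1)"
    have D: "0 \<le> D" by (simp add: D_def data_norm_def sobolev_norm_def lebesgue_norm_def)
    have u0: "u\<^sub>0 \<in> sobolev_space \<sigma>" using data by (simp add: data_space_def)
    \<comment> \<open>\<open>D + 1\<close> leaves room for every bound \<open>D'\<close> between
      \<open>D\<close> and \<open>D + 1\<close>; the minimum with \<open>1\<close> lets
      \<open>\<epsilon>\<close> be dropped from the final estimates.\<close>
    define \<epsilon>\<^sub>0 where "\<epsilon>\<^sub>0 = min 1 (g\<^sub>0 / (CG * (D + 1)))"
    have e0: "0 < \<epsilon>\<^sub>0" using g0 CG D by (simp add: \<epsilon>\<^sub>0_def)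
    have "\<exists>u. global_solution \<sigma> \<sigma>\<^sub>1 \<sigma>\<^sub>2 p \<epsilon> u\<^sub>0 u\<^sub>1 u \<and>
        (\<forall>v. global_solution \<sigma> \<sigma>\<^sub>1 \<sigma>\<^sub>2 p \<epsilon> u\<^sub>0 u\<^sub>1 v \<longrightarrow> (\<forall>t\<ge>0. v t = u t)) \<and>
        (\<forall>t\<ge>0. norm (u t) \<le> C * (1 + t) powr - a * D \<and> norm (abs_D \<sigma> (u t)) \<le> C * (1 + t) powr - b * D)"
      if e: "0 < \<epsilon>" "\<epsilon> \<le> \<epsilon>\<^sub>0" for \<epsilon>
    proof -
      let ?G = "\<lambda>t. \<epsilon> *\<^sub>R source u\<^sub>0 u\<^sub>1 t"
      have e1: "\<epsilon> \<le> 1" "\<epsilon> * (CG * (D + 1)) \<le> g\<^sub>0"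
        using e CG D by (auto simp: \<epsilon>\<^sub>0_def pos_le_divide_eq)
      have Gc: "continuous_on {0..} ?G" by (intro continuous_intros source_continuous)
      have Gd: "decays (\<epsilon> * (CG * D')) ?G" if "D \<le> D'" "0 < D'" for D'
        unfolding decays_def
      proof (intro allI impI)
        fix t :: real assume t: "0 \<le> t"
        have h: "norm (opA \<sigma> (source u\<^sub>0 u\<^sub>1 t)) \<le> CG * D' * (1 + t) powr - a" "norm (opB \<sigma> (source u\<^sub>0 u\<^sub>1 t)) \<le> CG * D' * (1 + t) powr - b"
          using CG(2)[OF data _ that(2) t] that(1) unfolding D_def by auto
        show "norm (opA \<sigma> (?G t)) \<le> \<epsilon> * (CG * D') * (1 + t) powr - a \<and> norm (opB \<sigma> (?G t)) \<le> \<epsilon> * (CG * D') * (1 + t) powr - b"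
          using mult_left_mono[OF h(1), of \<epsilon>] mult_left_mono[OF h(2), of \<epsilon>] e
          unfolding linear_scale[OF bounded_linear.linear[OF A]] linear_scale[OF bounded_linear.linear[OF B]]
          by (simp add: mult.assoc)
      qed
      have sol: "\<exists>W. continuous_on {0..} W \<and> decays (2 * (\<epsilon> * (CG * D'))) W \<and> (\<forall>t\<ge>0. W t = ?G t + duh W t)"
        if D': "D \<le> D'" "0 < D'" "D' \<le> D + 1" for D'
      proof (rule g0(2)[OF Gc _ _ Gd[OF D'(1,2)]])
        show "0 < \<epsilon> * (CG * D')" using e CG D' by simp
        have "\<epsilon> * (CG * D') \<le> \<epsilon> * (CG * (D + 1))" using e CG D' by (intro mult_left_mono) auto
        then show "\<epsilon> * (CG * D') \<le> g\<^sub>0" using e1 by simp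
      qed
      obtain W where W: "continuous_on {0..} W" "\<And>t. 0 \<le> t \<Longrightarrow> W t = ?G t + duh W t"
        using sol[of "D + 1"] D by auto
      \<comment> \<open>By uniqueness the solutions built for different \<open>D'\<close> coincide,
        so the one \<open>W\<close> has all these decay bounds at once.\<close>
      have Wd: "decays (2 * (\<epsilon> * (CG * D'))) W" if D': "D \<le> D'" "0 < D'" "D' \<le> D + 1" for D'
      proof -
        obtain W' where W': "continuous_on {0..} W'" "decays (2 * (\<epsilon> * (CG * D'))) W'" "\<And>t. 0 \<le> t \<Longrightarrow> W' t = ?G t + duh W' t"
          using sol[OF D'] by blast
        have "W t = W' t" if "0 \<le> t" for t
          by (rule solution_unique[OF W W'(1,3) that]) auto
        then show ?thesis using W'(2) by (simp add: decays_def)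
      qed
      have bound: "norm (opA \<sigma> (W t)) \<le> 2 * CG * (1 + t) powr - a * D \<and> norm (opB \<sigma> (W t)) \<le> 2 * CG * (1 + t) powr - b * D" if t: "0 \<le> t" for t
      proof -
        \<comment> \<open>The bounds with \<open>D' = D + h\<close> pass to the limit as
          \<open>h\<close> decreases to \<open>0\<close>; this includes
          \<open>D = 0\<close>.\<close>
        have lim: "x \<le> 2 * CG * y * D" if y: "0 \<le> y" and x: "\<And>D'. D \<le> D' \<Longrightarrow> 0 < D' \<Longrightarrow> D' \<le> D + 1 \<Longrightarrow> x \<le> 2 * (\<epsilon> * (CG * D')) * y" for x y
        proof (rule tendsto_lowerbound)
          show "((\<lambda>h. 2 * CG * y * (D + h)) \<longlongrightarrow> 2 * CG * y * D) (at_right 0)"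
            by (auto intro!: tendsto_eq_intros)
          have "x \<le> 2 * CG * y * (D + h)" if h: "0 < h" "h < 1" for h
          proof -
            have "x \<le> 2 * (\<epsilon> * (CG * (D + h))) * y" using h D by (intro x) auto
            also have "\<dots> = \<epsilon> * (2 * CG * y * (D + h))" by (simp add: mult_ac)
            also have "\<dots> \<le> 1 * (2 * CG * y * (D + h))" using e1 CG y D h by (intro mult_right_mono) auto
            finally show ?thesis by simp
          qed
          then show "\<forall>\<^sub>F h in at_right 0. x \<le> 2 * CG * y * (D + h)"
            unfolding eventually_at_right_field by (intro exI[of _ 1]) auto
        qed simp
        show ?thesis using Wd t unfolding decays_def by (intro conjI lim) auto
      qed
      let ?u = "\<lambda>t. inv_fourier (opA \<sigma> (W t))"
      have "global_solution \<sigma> \<sigma>\<^sub>1 \<sigma>\<^sub>2 p \<epsilon> u\<^sub>0 u\<^sub>1 ?u"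
        by (rule global_solution_of_frequency[OF duh W u0])
      moreover have "v t = ?u t" if v: "global_solution \<sigma> \<sigma>\<^sub>1 \<sigma>\<^sub>2 p \<epsilon> u\<^sub>0 u\<^sub>1 v" and t: "0 \<le> t" for v t
      proof -
        obtain V where V: "continuous_on {0..} V" "\<And>t. 0 \<le> t \<Longrightarrow> V t = ?G t + duh V t" "\<And>t. 0 \<le> t \<Longrightarrow> v t = inv_fourier (opA \<sigma> (V t))"
          by (rule frequency_of_global_solution[OF duh v u0]) (rule that; blast)
        have "V t = W t" by (rule solution_unique[OF V(1,2) W t]) auto
        then show ?thesis using V(3)[OF t] by simp
      qed
      moreover have "norm (?u t) \<le> C * (1 + t) powr - a * D" if "0 \<le> t" for t
        using divide_right_mono[OF conjunct1[OF bound[OF that]], of sp] sp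
        unfolding norm_inv_fourier sp_def[symmetric] C_def by simp
      moreover have "norm (abs_D \<sigma> (?u t)) \<le> C * (1 + t) powr - b * D" if "0 \<le> t" for t
      proof -
        have "mul (\<lambda>\<xi>. complex_of_real (norm \<xi> powr \<sigma>)) (opA \<sigma> (W t)) = opB \<sigma> (W t)"
          unfolding opA_def opB_def by (rule mul_mul[OF square_integrable_opA[OF sigma_nonneg]]) auto
        then have "norm (abs_D \<sigma> (?u t)) = norm (opB \<sigma> (W t)) / sp"
          by (simp add: abs_D_def fourier_multiplier_eq norm_inv_fourier sp_def)
        then show ?thesis
          using divide_right_mono[OF conjunct2[OF bound[OF that]], of sp] sp unfolding C_def by simp
      qed
      ultimately show ?thesis by blast
    qed
    then show ?thesis using e0 unfolding D_def by blast
  qed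
  then show ?thesis using C by blast
qed

end

section \<open>From the hypotheses of the theorem to the conditions used\<close>

lemma sqrt_less_imp_square: "sqrt x < y \<Longrightarrow> x < y\<^sup>2" for x y :: real
  by (metis not_le real_le_rsqrt)

text \<open>The lower bound on \<open>m\<close> other than \<open>1\<close> is the positive root of
  \<open>2 * (\<sigma> - \<sigma>\<^sub>1) * m\<^sup>2 + (n + 4 * \<sigma>\<^sub>1) * m = 2 *
  n\<close>, an equation that says \<open>m * p = 2\<close> at the critical \<open>p\<close>. For
  positive \<open>\<sigma>\<^sub>1\<close> the upper bound on \<open>m\<close> is
  \<open>gap\<close>, and \<open>p \<le> n / (n - 2 * \<sigma>)\<close> is the Sobolev condition
  \<open>embed\<close>.\<close>

lemma main_parameters:
  fixes \<sigma> \<sigma>\<^sub>1 \<sigma>\<^sub>2 m p n :: real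
  assumes n: "n = real DIM('a::euclidean_space)"
    and s: "1 \<le> \<sigma>" "0 \<le> \<sigma>\<^sub>1" "\<sigma>\<^sub>1 < \<sigma> / 2" "\<sigma> / 2 < \<sigma>\<^sub>2" "\<sigma>\<^sub>2 \<le> \<sigma>"
    and m: "m > max 1 ((sqrt ((n + 4 * \<sigma>\<^sub>1)\<^sup>2 + 16 * n * (\<sigma> - \<sigma>\<^sub>1)) - n - 4 * \<sigma>\<^sub>1) / (4 * (\<sigma> - \<sigma>\<^sub>1)))"
    and m0: "\<sigma>\<^sub>1 = 0 \<Longrightarrow> m \<le> 2" and m1: "\<sigma>\<^sub>1 > 0 \<Longrightarrow> m < 2 * n / (n + 4 * \<sigma>\<^sub>1)"
    and cases: "(n \<le> 2 * \<sigma> \<and> 1 + 2 * m * \<sigma> / (n - 2 * m * \<sigma>\<^sub>1) \<le> p) \<or>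
         (2 * \<sigma> < n \<and> (m = 2 \<or> n < 4 * \<sigma> / (2 - m)) \<and>
          1 + 2 * m * \<sigma> / (n - 2 * m * \<sigma>\<^sub>1) \<le> p \<and> p \<le> n / (n - 2 * \<sigma>))"
  shows "damped_wave TYPE('a) \<sigma> \<sigma>\<^sub>1 \<sigma>\<^sub>2 m p n"
proof -
  have n0: "0 < n" by (simp add: n)
  have m1': "1 < m" using m by simp
  have A: "0 < \<sigma> - \<sigma>\<^sub>1" using s by simp
  have root: "2 * n < 2 * (\<sigma> - \<sigma>\<^sub>1) * m\<^sup>2 + (n + 4 * \<sigma>\<^sub>1) * m"
  proof -
    have "(sqrt ((n + 4 * \<sigma>\<^sub>1)\<^sup>2 + 16 * n * (\<sigma> - \<sigma>\<^sub>1)) - n - 4 * \<sigma>\<^sub>1) / (4 * (\<sigma> - \<sigma>\<^sub>1)) < m" using m by simp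
    then have "sqrt ((n + 4 * \<sigma>\<^sub>1)\<^sup>2 + 16 * n * (\<sigma> - \<sigma>\<^sub>1)) < m * (4 * (\<sigma> - \<sigma>\<^sub>1)) + (n + 4 * \<sigma>\<^sub>1)"
      using A by (simp add: pos_divide_less_eq)
    then have "(n + 4 * \<sigma>\<^sub>1)\<^sup>2 + 16 * n * (\<sigma> - \<sigma>\<^sub>1) < (m * (4 * (\<sigma> - \<sigma>\<^sub>1)) + (n + 4 * \<sigma>\<^sub>1))\<^sup>2"
      by (rule sqrt_less_imp_square)
    \<comment> \<open>After expansion the squares of \<open>n + 4 * \<sigma>\<^sub>1\<close> cancel
      and the factor \<open>8 * (\<sigma> - \<sigma>\<^sub>1)\<close> is common to the rest.\<close>
    then have "(8 * (\<sigma> - \<sigma>\<^sub>1)) * (2 * n) < (8 * (\<sigma> - \<sigma>\<^sub>1)) * (2 * (\<sigma> - \<sigma>\<^sub>1) * m\<^sup>2 + (n + 4 * \<sigma>\<^sub>1) * m)"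
      by (simp add: power2_eq_square algebra_simps)
    then show ?thesis using A by (simp only: mult_less_cancel_left_pos mult_pos_pos zero_less_numeral)
  qed
  have pos1: "m * (n + 4 * \<sigma>\<^sub>1) < 2 * n" if "\<sigma>\<^sub>1 > 0"
    using m1[OF that] n0 s by (simp add: pos_less_divide_eq add_pos_nonneg)
  have m2: "m < 2" if "\<sigma>\<^sub>1 > 0"
  proof -
    have "m * n < m * (n + 4 * \<sigma>\<^sub>1)" using that m1' by simp
    then have "m * n < 2 * n" using pos1[OF that] by simp
    then show ?thesis using n0 by simp
  qed
  have mle: "m \<le> 2" using m0 m2 s(2) by (cases "\<sigma>\<^sub>1 = 0") auto
  have gap: "m = 2 \<and> \<sigma>\<^sub>1 = 0 \<or> m < 2 \<and> 2 * \<sigma>\<^sub>1 < n * (1/m - 1/2)"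
  proof (cases "\<sigma>\<^sub>1 = 0")
    case True
    show ?thesis
    proof (cases "m = 2")
      case False
      then have "m < 2" using mle by simp
      then have "0 < n * (1/m - 1/2)" using n0 m1' by (intro mult_pos_pos) (auto simp: field_simps)
      then show ?thesis using True \<open>m < 2\<close> by simp
    qed (use True in simp)
  next
    case False
    then have s1: "0 < \<sigma>\<^sub>1" using s by simp
    have "2 * \<sigma>\<^sub>1 < n * (1/m - 1/2)" using pos1[OF s1] m1' by (simp add: field_simps)
    then show ?thesis using m2[OF s1] by simp
  qed
  \<comment> \<open>The denominator of the critical exponent; for
    \<open>\<sigma>\<^sub>1 > 0\<close> its positivity is weaker than the upper bound on
    \<open>m\<close>.\<close>
  have nm: "0 < n - 2 * m * \<sigma>\<^sub>1"
  proof (cases "\<sigma>\<^sub>1 = 0")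
    case False
    then have "m * (n + 4 * \<sigma>\<^sub>1) < 2 * n" using s by (intro pos1) simp
    moreover have "0 < m * n" using m1' n0 by simp
    ultimately show ?thesis by (simp add: algebra_simps)
  qed (use n0 in simp)
  have pc: "1 + 2 * m * \<sigma> / (n - 2 * m * \<sigma>\<^sub>1) \<le> p" using cases by auto
  have "2 * m * \<sigma> / (n - 2 * m * \<sigma>\<^sub>1) \<le> p - 1" using pc by linarith
  then have pp: "2 * m * \<sigma> \<le> (p - 1) * (n - 2 * m * \<sigma>\<^sub>1)" using nm by (simp add: pos_divide_le_eq)
  have "0 < 2 * m * \<sigma> / (n - 2 * m * \<sigma>\<^sub>1)" using m1' s nm by simp
  then have p1: "1 < p" using pc by linarith
  have crit: "2 * \<sigma> \<le> (p - 1) * (n / m - 2 * \<sigma>\<^sub>1)"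
  proof -
    have "m * (n / m - 2 * \<sigma>\<^sub>1) = n - 2 * m * \<sigma>\<^sub>1" using m1' by (simp add: right_diff_distrib)
    then have "m * (2 * \<sigma>) \<le> m * ((p - 1) * (n / m - 2 * \<sigma>\<^sub>1))"
      using pp by (metis mult.assoc mult.left_commute mult.commute)
    then show ?thesis using m1' by simp
  qed
  have mp: "2 < m * p"
  proof -
    \<comment> \<open>Multiplied by the positive denominator and evaluated at the critical
      \<open>p\<close>, the claim is \<open>root\<close>.\<close>
    have "m * (2 * m * \<sigma>) \<le> m * ((p - 1) * (n - 2 * m * \<sigma>\<^sub>1))" using pp m1' by (intro mult_left_mono) auto
    then have "2 * (n - 2 * m * \<sigma>\<^sub>1) < m * p * (n - 2 * m * \<sigma>\<^sub>1)"
      using root by (simp add: algebra_simps power2_eq_square)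
    then show ?thesis by (rule mult_right_less_imp_less[OF _ less_imp_le[OF nm]])
  qed
  have slow: "n * (1/m - 1/2) < 2 * \<sigma>"
  proof -
    \<comment> \<open>In every case \<open>n * (2 - m) \<le> 4 * \<sigma>\<close>; strictness comes
      from \<open>m > 1\<close>.\<close>
    have "n * (2 - m) < 4 * \<sigma> * m"
    proof (cases "n \<le> 2 * \<sigma>")
      case True
      have "n * (2 - m) \<le> n * 1" using n0 m1' by (intro mult_left_mono) auto
      moreover have "4 * \<sigma> * 1 < 4 * \<sigma> * m" using s m1' by (intro mult_strict_left_mono) auto
      ultimately show ?thesis using True s by linarith
    next
      case False
      have "n * (2 - m) \<le> 4 * \<sigma>"
      proof (cases "m = 2")
        case False
        then have "n < 4 * \<sigma> / (2 - m)" "0 < 2 - m" using cases \<open>\<not> n \<le> 2 * \<sigma>\<close> mle by auto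
        then show ?thesis by (simp add: pos_less_divide_eq)
      qed (use s in simp)
      moreover have "4 * \<sigma> * 1 < 4 * \<sigma> * m" using s m1' by (intro mult_strict_left_mono) auto
      ultimately show ?thesis by linarith
    qed
    then show ?thesis using m1' by (simp add: field_simps)
  qed
  have embed: "n * (1/2 - 1/(2 * p)) \<le> \<sigma>"
  proof -
    have "n * (p - 1) \<le> 2 * \<sigma> * p"
    proof (cases "n \<le> 2 * \<sigma>")
      case True
      then have "n * (p - 1) \<le> 2 * \<sigma> * (p - 1)" using p1 by (intro mult_right_mono) auto
      also have "\<dots> \<le> 2 * \<sigma> * p" using s by (intro mult_left_mono) auto
      finally show ?thesis .
    next
      case False
      then have "p \<le> n / (n - 2 * \<sigma>)" "0 < n - 2 * \<sigma>" using cases by auto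
      then have "p * (n - 2 * \<sigma>) \<le> n" by (simp add: pos_le_divide_eq)
      then show ?thesis by (simp add: algebra_simps)
    qed
    then show ?thesis using p1 by (simp add: field_simps)
  qed
  show ?thesis
    by (rule damped_wave.intro[OF n s m1' mle mp gap slow p1 crit embed])
qed

theorem theorem1p2:
  fixes \<sigma> \<sigma>\<^sub>1 \<sigma>\<^sub>2 m p n :: real
  defines "n \<equiv> real CARD('n::finite)"
  assumes "1 \<le> \<sigma>"
    and "0 \<le> \<sigma>\<^sub>1" and "\<sigma>\<^sub>1 < \<sigma> / 2" and "\<sigma> / 2 < \<sigma>\<^sub>2" and "\<sigma>\<^sub>2 \<le> \<sigma>"
    and "m > max 1 ((sqrt ((n + 4 * \<sigma>\<^sub>1)\<^sup>2 + 16 * n * (\<sigma> - \<sigma>\<^sub>1)) - n - 4 * \<sigma>\<^sub>1) / (4 * (\<sigma> - \<sigma>\<^sub>1)))"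
    and "\<sigma>\<^sub>1 = 0 \<Longrightarrow> m \<le> 2"
    and "\<sigma>\<^sub>1 > 0 \<Longrightarrow> m < 2 * n / (n + 4 * \<sigma>\<^sub>1)"
    and "(n \<le> 2 * \<sigma> \<and> 1 + 2 * m * \<sigma> / (n - 2 * m * \<sigma>\<^sub>1) \<le> p) \<or>
         (2 * \<sigma> < n \<and> (m = 2 \<or> n < 4 * \<sigma> / (2 - m)) \<and>
          1 + 2 * m * \<sigma> / (n - 2 * m * \<sigma>\<^sub>1) \<le> p \<and> p \<le> n / (n - 2 * \<sigma>))"
  shows "\<exists>C>0. \<forall>(u\<^sub>0 :: (real ^ 'n) L2) u\<^sub>1. (u\<^sub>0, u\<^sub>1) \<in> data_space \<sigma> m \<longrightarrow>
    (\<exists>\<epsilon>\<^sub>0>0. \<forall>\<epsilon>. 0 < \<epsilon> \<and> \<epsilon> \<le> \<epsilon>\<^sub>0 \<longrightarrow>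
      (\<exists>u. global_solution \<sigma> \<sigma>\<^sub>1 \<sigma>\<^sub>2 p \<epsilon> u\<^sub>0 u\<^sub>1 u \<and>
        (\<forall>v. global_solution \<sigma> \<sigma>\<^sub>1 \<sigma>\<^sub>2 p \<epsilon> u\<^sub>0 u\<^sub>1 v \<longrightarrow> (\<forall>t\<ge>0. v t = u t)) \<and>
        (\<forall>t\<ge>0.
          norm (u t) \<le> C *
            (1 + t) powr (- n / (2 * (\<sigma> - \<sigma>\<^sub>1)) * (1 / m - 1 / 2) + \<sigma>\<^sub>1 / (\<sigma> - \<sigma>\<^sub>1)) *
            data_norm \<sigma> m (u\<^sub>0, u\<^sub>1) \<and>
          norm (abs_D \<sigma> (u t)) \<le> C *
            (1 + t) powr (- n / (2 * (\<sigma> - \<sigma>\<^sub>1)) * (1 / m - 1 / 2)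
                          - (\<sigma> - 2 * \<sigma>\<^sub>1) / (2 * (\<sigma> - \<sigma>\<^sub>1))) *
            data_norm \<sigma> m (u\<^sub>0, u\<^sub>1))))"
proof -
  have n: "n = real DIM(real ^ 'n)" by (simp add: n_def)
  interpret damped_wave \<sigma> \<sigma>\<^sub>1 \<sigma>\<^sub>2 m p n "TYPE(real ^ 'n)"
    by (rule main_parameters[OF n assms(2-10)])
  have d: "0 < \<sigma> - \<sigma>\<^sub>1" using assms by simp
  \<comment> \<open>With \<open>d\<close> for \<open>\<sigma> - \<sigma>\<^sub>1\<close>, these
    identities recognise the exponents of the statement as \<open>- a\<close> and
    \<open>- b\<close>.\<close>
  have "- n / (2 * d) * x + s / d = - ((n * x - 2 * s) / (2 * d))"
    "- n / (2 * d) * x - (r - 2 * s) / (2 * d) = - ((n * x - 2 * s) / (2 * d) + r / (2 * d))"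
    if "0 < d" for d x r s :: real
  proof -
    have "s / d = (2 * s) / (2 * d)" using that by simp
    then show "- n / (2 * d) * x + s / d = - ((n * x - 2 * s) / (2 * d))" by (simp add: diff_divide_distrib)
    show "- n / (2 * d) * x - (r - 2 * s) / (2 * d) = - ((n * x - 2 * s) / (2 * d) + r / (2 * d))"
      by (simp add: diff_divide_distrib)
  qed
  note e = this[OF d]
  have ea: "- n / (2 * (\<sigma> - \<sigma>\<^sub>1)) * (1 / m - 1 / 2) + \<sigma>\<^sub>1 / (\<sigma> - \<sigma>\<^sub>1) = - a"
    unfolding a_def \<alpha>_def by (rule e(1))
  have eb: "- n / (2 * (\<sigma> - \<sigma>\<^sub>1)) * (1 / m - 1 / 2) - (\<sigma> - 2 * \<sigma>\<^sub>1) / (2 * (\<sigma> - \<sigma>\<^sub>1)) = - b"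
    unfolding b_def a_def \<alpha>_def by (rule e(2))
  show ?thesis unfolding ea eb by (rule global_existence)
qed

end
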